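(* Let $(M,\omega)$ be a $2n$-dimensional symplectic manifold. Set $L_{-i}=\Omega^{i+1}(M)$ for $i\in\{0,\dots,2n-1\}$, let $l_1=\delta$ on the truncated canonical homology complex $$\Omega^{2n}(M)\xrightarrow{\delta}\Omega^{2n-1}(M)\xrightarrow{\delta}\cdots\xrightarrow{\delta}\Omega^1(M)$$ (with $l_1=0$ on $L_0=\Omega^1(M)$), and for $k\in\{2,\dots,2n+1\}$ and $\alpha_1,\dots,\alpha_k\in L_0=\Omega^1(M)$ set $$l_k(\alpha_1,\dots,\alpha_k)=(-1)^k\Big(\sum_{0\le j\le (k-1)/2}\frac{(k-j-1)!}{(k-1)!\,j!}\,L^j\Lambda^j\Big)\,\mathrm{Alt}(m_k)(\delta\alpha_1,\dots,\delta\alpha_k)\in\Omega^{k-1}(M)=L_{2-k},$$ with $l_k$ ($k\ge2$) equal to zero whenever some argument has nonzero degree, and $l_k=0$ for $k>2n+1$. Then $(\bigoplus_i L_{-i},(l_k)_{k\ge 1})$ is a grounded $L_\infty$-algebra. Moreover, the quotient map $L_0=\Omega^1(M)\to\Omega^1(M)/\delta\Omega^2(M)$ defines an $L_\infty$-morphism from this $L_\infty$-algebra to the Lie algebra $\Omega^1(M)/\delta\Omega^2(M)$.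
   Context: Conventions on symplectic manifolds: $X_f$ is defined by $\iota_{X_f}\omega=-df$, the Poisson bracket is $\{f,g\}=\omega(X_f,X_g)$, and $\pi=\omega^{-1}$ is the Poisson bivector, normalized by $\iota_\pi(df\wedge dg)=\{f,g\}$. Operators on $\Omega^\bullet(M)$: $L\alpha=\omega\wedge\alpha$, $\Lambda=\iota_\pi$, and the Koszul differential $\delta=\Lambda d-d\Lambda$, which lowers form degree by one and satisfies $\delta^2=0$; in particular $\delta(f\,dg)=\{f,g\}$. The space $\Omega^1(M)/\delta\Omega^2(M)$ is a Lie algebra with bracket $[[\alpha],[\beta]]=[\delta\alpha\cdot d\delta\beta]$. For functions $f_1,\dots,f_k\in C^\infty(M)$, $$\mathrm{Alt}(m_k)(f_1,\dots,f_k)=\frac1k\sum_{i=1}^k(-1)^{i+1}f_i\,df_1\wedge\cdots\widehat{df_i}\cdots\wedge df_k\in\Omega^{k-1}(M),$$ i.e. the antisymmetrization of $m_k(f_1,\dots,f_k)=f_1\,df_2\wedge\cdots\wedge df_k$. An $L_\infty$-algebra is a $\mathbb Z$-graded vector space $L$ with graded skew-symmetric multilinear maps $l_k:\bigwedge^kL\to L$ of degree $2-k$ ($k\ge1$) such that for all $n\geq 1$ and homogeneous $x_1,\dots,x_n$ $$\sum_{i+j=n+1}(-1)^{i(j+1)}\sum_{\sigma\in \mathrm{ush}(i,n-i)}\mathrm{sgn}(\sigma)\,\epsilon(\sigma;x_1,\dots,x_n)\,l_j(l_i(x_{\sigma(1)},\dots,x_{\sigma(i)}),x_{\sigma(i+1)},\dots,x_{\sigma(n)})=0,$$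 where $\epsilon$ is the Koszul sign and $\mathrm{ush}(i,n-i)\subset S_n$ is the set of $(i,n-i)$-unshuffles. It is grounded if it is non-positively graded, $L=\bigoplus_{i\ge0}L_{-i}$; $l_k(x_1,\dots,x_k)=0$ whenever $k>1$ and $\sum_i|x_i|\ne0$; and, for $k>1$, $l_k(x_1,\dots,x_k)=0$ whenever $x_1=l_1(\alpha)$ for some $\alpha\in L_{-1}$. An $L_\infty$-morphism from a grounded $L_\infty$-algebra $(L,l_k)$ to a Lie algebra $(\mathfrak g,[\cdot,\cdot])$ (placed in degree $0$) amounts to a linear map $f_1:L_0\to\mathfrak g$ with $f_1\circ l_1=0$ on $L_{-1}$ and $f_1(l_2(x,y))=[f_1(x),f_1(y)]$ for all $x,y\in L_0$. *)

theory Defs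
  imports "HOL-Analysis.Analysis" "HOL-Library.Function_Algebras"
begin

section \<open>Pointwise real vector space structure on functions\<close>

instantiation "fun" :: (type, real_vector) real_vector
begin

definition scaleR_fun :: "real \<Rightarrow> ('a \<Rightarrow> 'b) \<Rightarrow> 'a \<Rightarrow> 'b"
  where "scaleR_fun a f = (\<lambda>x. a *\<^sub>R f x)"

instance
  by standard (simp_all add: scaleR_fun_def plus_fun_def fun_eq_iff scaleR_add_right scaleR_add_left)

end

section \<open>Unshuffles and \<open>L\<^sub>\<infinity>\<close>-algebras\<close>

text \<open>Positions in a sequence of length \<open>n\<close> are numbered \<open>0, \<dots>, n - 1\<close>, so the symmetric
  group \<open>S\<^sub>n\<close> consists of the permutations of \<open>{..<n}\<close>, and
  \<open>permute_list \<sigma> [x\<^sub>0, \<dots>]\<close> is \<open>[x (\<sigma> 0), x (\<sigma> 1), \<dots>]\<close>.\<close>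

definition unshuffles :: "nat \<Rightarrow> nat \<Rightarrow> (nat \<Rightarrow> nat) set"
  where "unshuffles i m =
    {\<sigma>. \<sigma> permutes {..<i + m} \<and> strict_mono_on {..<i} \<sigma> \<and> strict_mono_on {i..<i + m} \<sigma>}"

text \<open>The Koszul sign of \<open>\<sigma>\<close> on homogeneous elements of degrees \<open>ds\<close>: a factor \<open>-1\<close> for each
  pair of odd elements whose order is reversed.\<close>

definition koszul_sign :: "(nat \<Rightarrow> nat) \<Rightarrow> int list \<Rightarrow> int"
  where "koszul_sign \<sigma> ds =
    (\<Prod>(r, s) \<in> {(r, s). r < s \<and> s < length ds \<and> \<sigma> s < \<sigma> r}.
       if odd (ds ! \<sigma> r) \<and> odd (ds ! \<sigma> s) then - 1 else 1)"

text \<open>A graded vector space is given by its homogeneous components \<open>V d\<close>, which are linearly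
  independent subspaces of an ambient real vector space; the graded space itself is
  \<open>total_space V\<close>, their internal direct sum.\<close>

definition total_space :: "(int \<Rightarrow> 'v::real_vector set) \<Rightarrow> 'v set"
  where "total_space V = span (\<Union>d. V d)"

definition graded_vector_space :: "(int \<Rightarrow> 'v::real_vector set) \<Rightarrow> bool"
  where "graded_vector_space V \<longleftrightarrow>
    (\<forall>d. subspace (V d)) \<and>
    (\<forall>D x. finite D \<and> (\<forall>d\<in>D. x d \<in> V d) \<and> (\<Sum>d\<in>D. x d) = 0 \<longrightarrow> (\<forall>d\<in>D. x d = 0))"

definition homogeneous_list :: "(int \<Rightarrow> 'v set) \<Rightarrow> int list \<Rightarrow> 'v list \<Rightarrow> bool"
  where "homogeneous_list V ds xs \<longleftrightarrow> list_all2 (\<lambda>d x. x \<in> V d) ds xs"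

text \<open>The operation \<open>l\<^sub>k\<close> on \<open>(x\<^sub>1, \<dots>, x\<^sub>k)\<close> is \<open>l k [x\<^sub>1, \<dots>, x\<^sub>k]\<close>.\<close>

definition multilinear_on :: "'v::real_vector set \<Rightarrow> nat \<Rightarrow> ('v list \<Rightarrow> 'v) \<Rightarrow> bool"
  where "multilinear_on T k f \<longleftrightarrow>
    (\<forall>xs i x y a b. length xs = k \<and> set xs \<subseteq> T \<and> i < k \<and> x \<in> T \<and> y \<in> T \<longrightarrow>
       f (xs[i := a *\<^sub>R x + b *\<^sub>R y]) = a *\<^sub>R f (xs[i := x]) + b *\<^sub>R f (xs[i := y]))"

definition graded_skew_symmetric ::
    "(int \<Rightarrow> 'v::real_vector set) \<Rightarrow> nat \<Rightarrow> ('v list \<Rightarrow> 'v) \<Rightarrow> bool"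
  where "graded_skew_symmetric V k f \<longleftrightarrow>
    (\<forall>ds xs \<sigma>. length xs = k \<and> homogeneous_list V ds xs \<and> \<sigma> permutes {..<k} \<longrightarrow>
       f (permute_list \<sigma> xs) = of_int (sign \<sigma> * koszul_sign \<sigma> ds) *\<^sub>R f xs)"

definition L_infinity_algebra ::
    "(int \<Rightarrow> 'v::real_vector set) \<Rightarrow> (nat \<Rightarrow> 'v list \<Rightarrow> 'v) \<Rightarrow> bool"
  where "L_infinity_algebra V l \<longleftrightarrow>
    graded_vector_space V \<and>
    (\<forall>k\<ge>1. multilinear_on (total_space V) k (l k) \<and>
       graded_skew_symmetric V k (l k) \<and>
       (\<forall>ds xs. length xs = k \<and> homogeneous_list V ds xs \<longrightarrow>
          l k xs \<in> V (sum_list ds + 2 - int k))) \<and>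
    (\<forall>n\<ge>1. \<forall>ds xs. length xs = n \<and> homogeneous_list V ds xs \<longrightarrow>
       (\<Sum>i = 1..n. let j = n + 1 - i in
          (- 1) ^ (i * (j + 1)) *\<^sub>R
          (\<Sum>\<sigma> \<in> unshuffles i (n - i).
             of_int (sign \<sigma> * koszul_sign \<sigma> ds) *\<^sub>R
             l j (l i (take i (permute_list \<sigma> xs)) # drop i (permute_list \<sigma> xs)))) = 0)"

definition grounded_L_infinity_algebra ::
    "(int \<Rightarrow> 'v::real_vector set) \<Rightarrow> (nat \<Rightarrow> 'v list \<Rightarrow> 'v) \<Rightarrow> bool"
  where "grounded_L_infinity_algebra V l \<longleftrightarrow>
    L_infinity_algebra V l \<and>
    (\<forall>d>0. V d = {0}) \<and>
    (\<forall>k>1. \<forall>ds xs. length xs = k \<and> homogeneous_list V ds xs \<and> sum_list ds \<noteq> 0 \<longrightarrow>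
       l k xs = 0) \<and>
    (\<forall>k>1. \<forall>ds xs. length xs = k \<and> homogeneous_list V ds xs \<and>
       (\<exists>\<alpha> \<in> V (- 1). xs ! 0 = l 1 [\<alpha>]) \<longrightarrow> l k xs = 0)"

section \<open>Real Lie algebras with explicit carrier\<close>

record 'g lie_structure =
  lie_carrier :: "'g set"
  lie_add :: "'g \<Rightarrow> 'g \<Rightarrow> 'g"
  lie_zero :: 'g
  lie_scale :: "real \<Rightarrow> 'g \<Rightarrow> 'g"
  lie_bracket :: "'g \<Rightarrow> 'g \<Rightarrow> 'g"

definition real_lie_algebra :: "'g lie_structure \<Rightarrow> bool"
  where "real_lie_algebra g \<longleftrightarrow>
    (let G = lie_carrier g; add = lie_add g; z = lie_zero g; sc = lie_scale g; br = lie_bracket g in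
      z \<in> G \<and>
      (\<forall>x\<in>G. \<forall>y\<in>G. add x y \<in> G \<and> br x y \<in> G) \<and>
      (\<forall>a. \<forall>x\<in>G. sc a x \<in> G) \<and>
      (\<forall>x\<in>G. \<forall>y\<in>G. \<forall>w\<in>G. add (add x y) w = add x (add y w)) \<and>
      (\<forall>x\<in>G. \<forall>y\<in>G. add x y = add y x) \<and>
      (\<forall>x\<in>G. add z x = x) \<and>
      (\<forall>x\<in>G. \<exists>y\<in>G. add y x = z) \<and>
      (\<forall>a. \<forall>x\<in>G. \<forall>y\<in>G. sc a (add x y) = add (sc a x) (sc a y)) \<and>
      (\<forall>a b. \<forall>x\<in>G. sc (a + b) x = add (sc a x) (sc b x)) \<and>
      (\<forall>a b. \<forall>x\<in>G. sc (a * b) x = sc a (sc b x)) \<and>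
      (\<forall>x\<in>G. sc 1 x = x) \<and>
      (\<forall>a b. \<forall>x\<in>G. \<forall>y\<in>G. \<forall>w\<in>G.
         br (add (sc a x) (sc b y)) w = add (sc a (br x w)) (sc b (br y w)) \<and>
         br w (add (sc a x) (sc b y)) = add (sc a (br w x)) (sc b (br w y))) \<and>
      (\<forall>x\<in>G. br x x = z) \<and>
      (\<forall>x\<in>G. \<forall>y\<in>G. \<forall>w\<in>G.
         add (add (br x (br y w)) (br y (br w x))) (br w (br x y)) = z))"

text \<open>An \<open>L\<^sub>\<infinity>\<close>-morphism from a grounded \<open>L\<^sub>\<infinity>\<close>-algebra to a Lie algebra in degree \<open>0\<close> is determined
  by its linear component on degree \<open>0\<close>.\<close>

definition L_infinity_morphism_to_lie ::
    "(int \<Rightarrow> 'v::real_vector set) \<Rightarrow> (nat \<Rightarrow> 'v list \<Rightarrow> 'v) \<Rightarrow> 'g lie_structure \<Rightarrow> ('v \<Rightarrow> 'g) \<Rightarrow> bool"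
  where "L_infinity_morphism_to_lie V l g f \<longleftrightarrow>
    grounded_L_infinity_algebra V l \<and> real_lie_algebra g \<and>
    (\<forall>x \<in> V 0. f x \<in> lie_carrier g) \<and>
    (\<forall>a b. \<forall>x \<in> V 0. \<forall>y \<in> V 0.
       f (a *\<^sub>R x + b *\<^sub>R y) = lie_add g (lie_scale g a (f x)) (lie_scale g b (f y))) \<and>
    (\<forall>\<alpha> \<in> V (- 1). f (l 1 [\<alpha>]) = lie_zero g) \<and>
    (\<forall>x \<in> V 0. \<forall>y \<in> V 0. f (l 2 [x, y]) = lie_bracket g (f x) (f y))"

section \<open>Smooth manifolds\<close>

primrec Ck_on :: "nat \<Rightarrow> 'b::real_normed_vector set \<Rightarrow> ('b \<Rightarrow> 'c::real_normed_vector) \<Rightarrow> bool"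
  where
    "Ck_on 0 S f \<longleftrightarrow> continuous_on S f"
  | "Ck_on (Suc k) S f \<longleftrightarrow> (\<forall>x\<in>S. f differentiable (at x)) \<and>
       (\<forall>v. Ck_on k S (\<lambda>x. frechet_derivative f (at x) v))"

text \<open>Meaningful for open \<open>S\<close>, which is the only use below.\<close>

definition smooth_on :: "'b::real_normed_vector set \<Rightarrow> ('b \<Rightarrow> 'c::real_normed_vector) \<Rightarrow> bool"
  where "smooth_on S f \<longleftrightarrow> (\<forall>k. Ck_on k S f)"

text \<open>A chart \<open>(U, \<phi>)\<close>; only the values of \<open>\<phi>\<close> on \<open>U\<close> matter.\<close>

type_synonym ('a, 'b) chart = "'a set \<times> ('a \<Rightarrow> 'b)"

definition chart_image :: "('a, 'b) chart \<Rightarrow> 'b set"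
  where "chart_image c = snd c ` fst c"

definition is_chart :: "'a topology \<Rightarrow> ('a, 'b::euclidean_space) chart \<Rightarrow> bool"
  where "is_chart X c \<longleftrightarrow> openin X (fst c) \<and> open (chart_image c) \<and>
    homeomorphic_map (subtopology X (fst c)) (top_of_set (chart_image c)) (snd c)"

text \<open>The coordinates of the points of \<open>fst c \<inter> fst c'\<close> in the chart \<open>c\<close>.\<close>

definition overlap :: "('a, 'b) chart \<Rightarrow> ('a, 'b) chart \<Rightarrow> 'b set"
  where "overlap c c' = snd c ` (fst c \<inter> fst c')"

definition transition :: "('a, 'b) chart \<Rightarrow> ('a, 'b) chart \<Rightarrow> 'b \<Rightarrow> 'b"
  where "transition c c' = snd c' \<circ> inv_into (fst c) (snd c)"

text \<open>The atlas need not be maximal; the dimension is \<open>DIM('b)\<close>.\<close>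

definition smooth_manifold :: "'a topology \<Rightarrow> ('a, 'b::euclidean_space) chart set \<Rightarrow> bool"
  where "smooth_manifold X A \<longleftrightarrow>
    Hausdorff_space X \<and> second_countable X \<and>
    (\<forall>c\<in>A. is_chart X c) \<and> (\<Union>c\<in>A. fst c) = topspace X \<and>
    (\<forall>c\<in>A. \<forall>c'\<in>A. smooth_on (overlap c c') (transition c c'))"

section \<open>Differential forms\<close>

text \<open>A differential form is a family of forms on the coordinate domains of the charts of the atlas
  that agree under pullback along the transition maps. The value \<open>\<alpha> c x [v\<^sub>1, \<dots>, v\<^sub>k]\<close> is
  \<open>\<alpha>\<^sub>x(v\<^sub>1, \<dots>, v\<^sub>k)\<close> in the coordinates of the chart \<open>c\<close>. A \<open>k\<close>-form vanishes on lists of any length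
  other than \<open>k\<close>, so the spaces of \<open>k\<close>-forms for varying \<open>k\<close> are independent and an element of
  their direct sum is again of this type. To make equality of forms equality of functions,
  the value is \<open>0\<close> off the atlas and off the coordinate domain. Functions are the \<open>0\<close>-forms:
  \<open>f c x []\<close> is the value of \<open>f\<close> at the point with coordinates \<open>x\<close>.\<close>

type_synonym ('a, 'b) form = "('a, 'b) chart \<Rightarrow> 'b \<Rightarrow> 'b list \<Rightarrow> real"

definition alternating_form :: "nat \<Rightarrow> ('b::real_vector list \<Rightarrow> real) \<Rightarrow> bool"
  where "alternating_form k f \<longleftrightarrow>
    (\<forall>vs i. length vs = k \<and> i < k \<longrightarrow> linear (\<lambda>v. f (vs[i := v]))) \<and>
    (\<forall>vs i j. length vs = k \<and> i < j \<and> j < k \<and> vs ! i = vs ! j \<longrightarrow> f vs = 0)"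

definition forms :: "('a, 'b::euclidean_space) chart set \<Rightarrow> nat \<Rightarrow> ('a, 'b) form set"
  where "forms A k = {\<alpha>.
    (\<forall>c x vs. c \<notin> A \<or> x \<notin> chart_image c \<or> length vs \<noteq> k \<longrightarrow> \<alpha> c x vs = 0) \<and>
    (\<forall>c\<in>A. \<forall>x\<in>chart_image c. alternating_form k (\<alpha> c x)) \<and>
    (\<forall>c\<in>A. \<forall>vs. length vs = k \<longrightarrow> smooth_on (chart_image c) (\<lambda>x. \<alpha> c x vs)) \<and>
    (\<forall>c\<in>A. \<forall>c'\<in>A. \<forall>x\<in>overlap c c'. \<forall>vs. length vs = k \<longrightarrow>
       \<alpha> c x vs = \<alpha> c' (transition c c' x) (map (frechet_derivative (transition c c') (at x)) vs))}"

definition degree_part :: "nat \<Rightarrow> ('a, 'b) form \<Rightarrow> ('a, 'b) form"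
  where "degree_part k \<alpha> = (\<lambda>c x vs. if length vs = k then \<alpha> c x vs else 0)"

text \<open>The normalization without factorials: \<open>(\<alpha> \<and> \<beta>)(u, v) = \<alpha>(u) \<beta>(v) - \<alpha>(v) \<beta>(u)\<close> for \<open>1\<close>-forms.
  Only the term with \<open>p = deg \<alpha>\<close> contributes when \<open>\<alpha>\<close> is homogeneous.\<close>

definition wedge :: "('a, 'b) form \<Rightarrow> ('a, 'b) form \<Rightarrow> ('a, 'b) form"
  where "wedge \<alpha> \<beta> = (\<lambda>c x vs.
    \<Sum>p\<le>length vs. \<Sum>\<sigma>\<in>unshuffles p (length vs - p).
      of_int (sign \<sigma>) * \<alpha> c x (take p (permute_list \<sigma> vs)) * \<beta> c x (drop p (permute_list \<sigma> vs)))"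

definition omit :: "nat \<Rightarrow> 'x list \<Rightarrow> 'x list"
  where "omit i xs = take i xs @ drop (Suc i) xs"

text \<open>The exterior derivative in coordinates, for constant vector fields \<open>vs\<close>.\<close>

definition ext_d :: "('a, 'b::euclidean_space) chart set \<Rightarrow> ('a, 'b) form \<Rightarrow> ('a, 'b) form"
  where "ext_d A \<alpha> = (\<lambda>c x vs.
    if c \<in> A \<and> x \<in> chart_image c then
      \<Sum>i<length vs. (- 1) ^ i *
        frechet_derivative (\<lambda>y. \<alpha> c y (omit i vs)) (at x) (vs ! i)
    else 0)"

section \<open>Symplectic manifolds and the Koszul differential\<close>

definition symplectic_form :: "('a, 'b::euclidean_space) chart set \<Rightarrow> ('a, 'b) form \<Rightarrow> bool"
  where "symplectic_form A \<omega> \<longleftrightarrow> \<omega> \<in> forms A 2 \<and> ext_d A \<omega> = 0 \<and>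
    (\<forall>c\<in>A. \<forall>x\<in>chart_image c. \<forall>u. u \<noteq> 0 \<longrightarrow> (\<exists>v. \<omega> c x [u, v] \<noteq> 0))"

definition symplectic_manifold ::
    "'a topology \<Rightarrow> ('a, 'b::euclidean_space) chart set \<Rightarrow> ('a, 'b) form \<Rightarrow> bool"
  where "symplectic_manifold X A \<omega> \<longleftrightarrow> smooth_manifold X A \<and> symplectic_form A \<omega>"

text \<open>For a covector \<open>\<xi>\<close>, the vector \<open>u\<close> with \<open>\<iota>\<^sub>u \<omega> = - \<xi>\<close>; for \<open>\<xi> = df\<close> it is the Hamiltonian
  vector of \<open>f\<close>.\<close>

definition ham_vector ::
    "('a, 'b::euclidean_space) form \<Rightarrow> ('a, 'b) chart \<Rightarrow> 'b \<Rightarrow> ('b \<Rightarrow> real) \<Rightarrow> 'b"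
  where "ham_vector \<omega> c x \<xi> = (THE u. \<forall>v. \<omega> c x [u, v] = - \<xi> v)"

text \<open>\<open>\<pi>(\<xi>, \<eta>)\<close>; for \<open>\<xi> = df\<close> and \<open>\<eta> = dg\<close> it is \<open>\<omega>(X\<^sub>f, X\<^sub>g) = {f, g}\<close>.\<close>

definition poisson_bivector ::
    "('a, 'b::euclidean_space) form \<Rightarrow> ('a, 'b) chart \<Rightarrow> 'b \<Rightarrow> ('b \<Rightarrow> real) \<Rightarrow> ('b \<Rightarrow> real) \<Rightarrow> real"
  where "poisson_bivector \<omega> c x \<xi> \<eta> = \<omega> c x [ham_vector \<omega> c x \<xi>, ham_vector \<omega> c x \<eta>]"

definition lefschetz_L :: "('a, 'b::euclidean_space) form \<Rightarrow> ('a, 'b) form \<Rightarrow> ('a, 'b) form"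
  where "lefschetz_L \<omega> \<alpha> = wedge \<omega> \<alpha>"

text \<open>The contraction with \<open>\<pi> = 1/2 \<Sum> \<pi>(e\<^sup>i, e\<^sup>j) e\<^sub>i \<and> e\<^sub>j\<close>, where \<open>e\<^sub>i\<close> runs over the standard basis and
  \<open>e\<^sup>i = dx\<^sup>i\<close> over the dual basis, so the coefficients are the brackets of the coordinate
  functions. The order of the arguments and the factor \<open>1/2\<close> give \<open>\<iota>\<^sub>\<pi>(df \<and> dg) = {f, g}\<close>.\<close>

definition lefschetz_Lambda :: "('a, 'b::euclidean_space) form \<Rightarrow> ('a, 'b) form \<Rightarrow> ('a, 'b) form"
  where "lefschetz_Lambda \<omega> \<alpha> = (\<lambda>c x vs.
    1 / 2 * (\<Sum>e\<in>Basis. \<Sum>e'\<in>Basis.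
      poisson_bivector \<omega> c x (\<lambda>v. v \<bullet> e) (\<lambda>v. v \<bullet> e') * \<alpha> c x (e # e' # vs)))"

lemma unshuffles_1_1: "unshuffles 1 1 = {id, Transposition.transpose 0 1}"
proof -
  have "\<sigma> = id \<or> \<sigma> = Transposition.transpose 0 1" if "\<sigma> permutes {..<2}" for \<sigma> :: "nat \<Rightarrow> nat"
  proof -
    have "{..<2::nat} = {0, 1}" by auto
    with that show ?thesis using permutes_doubleton_iff[of \<sigma> 0 1] by simp
  qed
  moreover have "id permutes {..<2::nat}" "Transposition.transpose 0 1 permutes {..<2::nat}"
    by (auto intro: permutes_id permutes_swap_id)
  ultimately show ?thesis
    by (auto simp: unshuffles_def strict_mono_on_def numeral_2_eq_2)
qed

lemma wedge_one_forms:
  assumes "\<And>vs. length vs \<noteq> 1 \<Longrightarrow> \<alpha> c x vs = 0" "\<And>vs. length vs \<noteq> 1 \<Longrightarrow> \<beta> c x vs = 0"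
  shows "wedge \<alpha> \<beta> c x [u, v] = \<alpha> c x [u] * \<beta> c x [v] - \<alpha> c x [v] * \<beta> c x [u]"
proof -
  have ne: "id \<noteq> (Transposition.transpose 0 1 :: nat \<Rightarrow> nat)"
    by (metis id_apply transpose_apply_first zero_neq_one)
  have "wedge \<alpha> \<beta> c x [u, v] = (\<Sum>\<sigma>\<in>unshuffles 1 1.
      of_int (sign \<sigma>) * \<alpha> c x (take 1 (permute_list \<sigma> [u, v])) * \<beta> c x (drop 1 (permute_list \<sigma> [u, v])))"
    by (simp add: wedge_def assms numeral_2_eq_2)
  also have "\<dots> = \<alpha> c x [u] * \<beta> c x [v] - \<alpha> c x [v] * \<beta> c x [u]"
    using ne by (simp only: unshuffles_1_1) (simp add: permute_list_def sign_swap_id sign_id)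
  finally show ?thesis .
qed

text \<open>Nondegeneracy makes the description in \<open>ham_vector\<close> proper.\<close>

lemma ham_vector:
  fixes \<omega> :: "('a, 'b::euclidean_space) form"
  assumes "symplectic_form A \<omega>" "c \<in> A" "x \<in> chart_image c" "linear \<xi>"
  shows "\<omega> c x [ham_vector \<omega> c x \<xi>, v] = - \<xi> v"
proof -
  have alt: "alternating_form 2 (\<omega> c x)"
    and nd: "\<And>u. u \<noteq> 0 \<Longrightarrow> \<exists>v. \<omega> c x [u, v] \<noteq> 0"
    using assms by (auto simp: symplectic_form_def forms_def)
  have lin1: "linear (\<lambda>u. \<omega> c x [u, w])" for w
    using alt[unfolded alternating_form_def, THEN conjunct1, rule_format, of "[w, w]" 0] by simp
  have lin2: "linear (\<lambda>u. \<omega> c x [w, u])" for w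
    using alt[unfolded alternating_form_def, THEN conjunct1, rule_format, of "[w, w]" 1] by simp
  define T where "T u = (\<Sum>e\<in>Basis. \<omega> c x [u, e] *\<^sub>R e)" for u
  have Tin: "T u \<bullet> v = \<omega> c x [u, v]" for u v
  proof -
    have "\<omega> c x [u, v] = \<omega> c x [u, \<Sum>e\<in>Basis. (v \<bullet> e) *\<^sub>R e]" by (simp add: euclidean_representation)
    also have "\<dots> = (\<Sum>e\<in>Basis. (v \<bullet> e) * \<omega> c x [u, e])"
      by (simp only: linear_sum[OF lin2] linear_scale[OF lin2] real_scaleR_def)
    finally show ?thesis by (simp add: T_def inner_sum_left inner_commute[of v] mult.commute)
  qed
  have "linear T"
    unfolding T_def
    by (intro linearI) (simp_all add: linear_add[OF lin1] linear_scale[OF lin1] scaleR_add_left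
        sum.distrib scaleR_sum_right)
  moreover have "inj T"
    using nd Tin by (subst linear_injective_0[OF \<open>linear T\<close>]) (metis inner_zero_left)
  ultimately have "surj T" "inj T" using linear_injective_imp_surjective by blast+
  obtain u where u: "T u = - (\<Sum>e\<in>Basis. \<xi> e *\<^sub>R e)" using \<open>surj T\<close> by (metis surjD)
  have ex: "\<forall>w. \<omega> c x [u, w] = - \<xi> w"
  proof
    fix w
    have "\<xi> w = \<xi> (\<Sum>e\<in>Basis. (w \<bullet> e) *\<^sub>R e)" by (simp add: euclidean_representation)
    also have "\<dots> = (\<Sum>e\<in>Basis. (w \<bullet> e) * \<xi> e)"
      by (simp only: linear_sum[OF assms(4)] linear_scale[OF assms(4)] real_scaleR_def)
    also have "\<dots> = - (T u \<bullet> w)"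
      unfolding u by (simp add: inner_sum_left inner_commute[of w] mult.commute)
    finally show "\<omega> c x [u, w] = - \<xi> w" by (simp add: Tin)
  qed
  moreover have "u' = u" if "\<forall>v. \<omega> c x [u', v] = - \<xi> v" for u'
  proof -
    have "T u' \<bullet> v = T u \<bullet> v" for v using that ex Tin by simp
    then have "T u' = T u" by (metis vector_eq_rdot)
    then show ?thesis using \<open>inj T\<close> by (simp add: inj_eq)
  qed
  ultimately have "\<forall>v. \<omega> c x [ham_vector \<omega> c x \<xi>, v] = - \<xi> v"
    unfolding ham_vector_def by (rule theI)
  then show ?thesis by simp
qed

text \<open>The normalization \<open>\<iota>\<^sub>\<pi>(df \<and> dg) = {f, g}\<close>, for arbitrary \<open>1\<close>-forms.\<close>

lemma Lambda_wedge_one_forms: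
  fixes \<omega> :: "('a, 'b::euclidean_space) form"
  assumes S: "symplectic_form A \<omega>" "c \<in> A" "x \<in> chart_image c"
    and f: "\<alpha> \<in> forms A 1" "\<beta> \<in> forms A 1"
  shows "lefschetz_Lambda \<omega> (wedge \<alpha> \<beta>) c x [] =
    poisson_bivector \<omega> c x (\<lambda>v. \<alpha> c x [v]) (\<lambda>v. \<beta> c x [v])"
proof -
  have lin: "linear (\<lambda>v. \<gamma> c x [v])" if "\<gamma> \<in> forms A 1" for \<gamma>
  proof -
    have "alternating_form 1 (\<gamma> c x)" using that S by (auto simp: forms_def)
    from this[unfolded alternating_form_def, THEN conjunct1, rule_format, of "[0]" 0]
    show ?thesis by simp
  qed
  have alt: "alternating_form 2 (\<omega> c x)" using S by (auto simp: symplectic_form_def forms_def)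
  have lin1: "linear (\<lambda>u. \<omega> c x [u, w])" for w
    using alt[unfolded alternating_form_def, THEN conjunct1, rule_format, of "[w, w]" 0] by simp
  have lin2: "linear (\<lambda>u. \<omega> c x [w, u])" for w
    using alt[unfolded alternating_form_def, THEN conjunct1, rule_format, of "[w, w]" 1] by simp
  have diag: "\<omega> c x [w, w] = 0" for w
    using alt[unfolded alternating_form_def, THEN conjunct2, rule_format, of "[w, w]" 0 1] by simp
  have anti: "\<omega> c x [u, v] = - \<omega> c x [v, u]" for u v
    using diag[of "u + v"] diag[of u] diag[of v]
    by (simp add: linear_add[OF lin1] linear_add[OF lin2])
  let ?H = "ham_vector \<omega> c x" and ?P = "poisson_bivector \<omega> c x"
  have linb: "linear (\<lambda>v::'b. v \<bullet> e)" for e by (simp add: linear_iff inner_add_left)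
  have P: "?P \<xi> \<eta> = - \<xi> (?H \<eta>)" if "linear \<xi>" for \<xi> \<eta>
    using ham_vector[OF S that] by (simp add: poisson_bivector_def)
  have Pa: "?P \<xi> \<eta> = - ?P \<eta> \<xi>" for \<xi> \<eta>
    unfolding poisson_bivector_def by (rule anti)
  have expand: "\<xi> v = (\<Sum>e\<in>Basis. (v \<bullet> e) * \<xi> e)" if "linear \<xi>" for v :: 'b and \<xi> :: "'b \<Rightarrow> real"
  proof -
    have "\<xi> v = \<xi> (\<Sum>e\<in>Basis. (v \<bullet> e) *\<^sub>R e)" by (simp add: euclidean_representation)
    then show ?thesis by (simp only: linear_sum[OF that] linear_scale[OF that] real_scaleR_def)
  qed
  have L: "?P \<xi> \<eta> = (\<Sum>e\<in>Basis. \<xi> e * ?P (\<lambda>v. v \<bullet> e) \<eta>)" if "linear \<xi>" for \<xi> \<eta>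
    unfolding P[OF that] P[OF linb]
    by (subst expand[OF that]) (simp add: sum_negf mult.commute)
  have PP: "?P \<xi> \<eta> = (\<Sum>e\<in>Basis. \<Sum>e'\<in>Basis. ?P (\<lambda>v. v \<bullet> e) (\<lambda>v. v \<bullet> e') * (\<xi> e * \<eta> e'))"
    if "linear \<xi>" "linear \<eta>" for \<xi> \<eta>
  proof -
    have "?P (\<lambda>v. v \<bullet> e) \<eta> = (\<Sum>e'\<in>Basis. \<eta> e' * ?P (\<lambda>v. v \<bullet> e) (\<lambda>v. v \<bullet> e'))" for e
      unfolding Pa[of "\<lambda>v. v \<bullet> e"] L[OF that(2), of "\<lambda>v. v \<bullet> e"] by (simp add: sum_negf)
    then show ?thesis
      by (subst L[OF that(1)]) (simp add: sum_distrib_left mult_ac)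
  qed
  let ?a = "\<lambda>v. \<alpha> c x [v]" and ?b = "\<lambda>v. \<beta> c x [v]"
  have vanish: "\<gamma> c x vs = 0" if "\<gamma> \<in> forms A 1" "length vs \<noteq> 1" for \<gamma> vs
    using that unfolding forms_def by blast
  have w: "wedge \<alpha> \<beta> c x [u, v] = ?a u * ?b v - ?b u * ?a v" for u v
    by (subst wedge_one_forms) (rule vanish[OF f(1)], assumption, rule vanish[OF f(2)], assumption, simp only: mult.commute)
  have "lefschetz_Lambda \<omega> (wedge \<alpha> \<beta>) c x [] = 1 / 2 * (?P ?a ?b - ?P ?b ?a)"
    unfolding lefschetz_Lambda_def w PP[OF lin[OF f(1)] lin[OF f(2)]] PP[OF lin[OF f(2)] lin[OF f(1)]]
    by (simp only: sum_subtractf right_diff_distrib)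
  also have "?P ?b ?a = - ?P ?a ?b" by (rule Pa)
  finally show ?thesis by simp
qed

definition koszul_delta ::
    "('a, 'b::euclidean_space) chart set \<Rightarrow> ('a, 'b) form \<Rightarrow> ('a, 'b) form \<Rightarrow> ('a, 'b) form"
  where "koszul_delta A \<omega> \<alpha> =
    lefschetz_Lambda \<omega> (ext_d A \<alpha>) - ext_d A (lefschetz_Lambda \<omega> \<alpha>)"

section \<open>The \<open>L\<^sub>\<infinity>\<close>-algebra of a symplectic manifold\<close>

text \<open>\<open>f\<^sub>i df\<^sub>1 \<and> \<dots> \<and> df\<^sub>k\<close> (with \<open>df\<^sub>i\<close> omitted) is formed by wedging \<open>f\<^sub>i\<close> on the right with the \<open>df\<^sub>j\<close>
  in order; the index \<open>i\<close> starts at \<open>0\<close>.\<close>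

definition alt_m :: "('a, 'b::euclidean_space) chart set \<Rightarrow> ('a, 'b) form list \<Rightarrow> ('a, 'b) form"
  where "alt_m A fs = (1 / real (length fs)) *\<^sub>R
    (\<Sum>i<length fs. (- 1) ^ i *\<^sub>R foldl wedge (fs ! i) (map (ext_d A) (omit i fs)))"

definition symp_higher_bracket ::
    "('a, 'b::euclidean_space) chart set \<Rightarrow> ('a, 'b) form \<Rightarrow> ('a, 'b) form list \<Rightarrow> ('a, 'b) form"
  where "symp_higher_bracket A \<omega> \<alpha>s = (let k = length \<alpha>s in
    (- 1) ^ k *\<^sub>R
    (\<Sum>j = 0..(k - 1) div 2. (fact (k - j - 1) / (fact (k - 1) * fact j)) *\<^sub>R
       (lefschetz_L \<omega> ^^ j) ((lefschetz_Lambda \<omega> ^^ j) (alt_m A (map (koszul_delta A \<omega>) \<alpha>s)))))"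

definition symp_grading ::
    "('a, 'b::euclidean_space) chart set \<Rightarrow> nat \<Rightarrow> int \<Rightarrow> ('a, 'b) form set"
  where "symp_grading A n d =
    (if - int (2 * n) < d \<and> d \<le> 0 then forms A (nat (1 - d)) else {0})"

text \<open>The operations on the total space. Degree \<open>0\<close> consists of the \<open>1\<close>-forms: \<open>l\<^sub>1\<close> is \<open>\<delta>\<close> on forms of
  degree at least \<open>2\<close> and zero on \<open>1\<close>-forms, and for \<open>k \<ge> 2\<close> the multilinear map that is given by
  the formula on \<open>1\<close>-forms and vanishes if some argument is homogeneous of another form degree
  takes the \<open>1\<close>-form parts of its arguments.\<close>

definition symp_ops ::
    "('a, 'b::euclidean_space) chart set \<Rightarrow> ('a, 'b) form \<Rightarrow> nat \<Rightarrow>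
     nat \<Rightarrow> ('a, 'b) form list \<Rightarrow> ('a, 'b) form"
  where "symp_ops A \<omega> n k \<alpha>s =
    (if k = 1 then koszul_delta A \<omega> (hd \<alpha>s - degree_part 1 (hd \<alpha>s))
     else if 2 \<le> k \<and> k \<le> 2 * n + 1 then symp_higher_bracket A \<omega> (map (degree_part 1) \<alpha>s)
     else 0)"

text \<open>The quotient of \<open>1\<close>-forms by \<open>\<delta>\<close> of \<open>2\<close>-forms, as a set of equivalence classes with the induced
  operations. Each union over representatives consists of a single class exactly if the operation
  is independent of the representatives.\<close>

definition delta_rel ::
    "('a, 'b::euclidean_space) chart set \<Rightarrow> ('a, 'b) form \<Rightarrow> (('a, 'b) form \<times> ('a, 'b) form) set"
  where "delta_rel A \<omega> = {(\<alpha>, \<beta>). \<alpha> \<in> forms A 1 \<and> \<beta> \<in> forms A 1 \<and>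
    \<alpha> - \<beta> \<in> koszul_delta A \<omega> ` forms A 2}"

definition delta_class ::
    "('a, 'b::euclidean_space) chart set \<Rightarrow> ('a, 'b) form \<Rightarrow> ('a, 'b) form \<Rightarrow> ('a, 'b) form set"
  where "delta_class A \<omega> \<alpha> = delta_rel A \<omega> `` {\<alpha>}"

definition symp_lie ::
    "('a, 'b::euclidean_space) chart set \<Rightarrow> ('a, 'b) form \<Rightarrow> ('a, 'b) form set lie_structure"
  where "symp_lie A \<omega> = \<lparr>
    lie_carrier = forms A 1 // delta_rel A \<omega>,
    lie_add = (\<lambda>P Q. \<Union>\<alpha>\<in>P. \<Union>\<beta>\<in>Q. delta_class A \<omega> (\<alpha> + \<beta>)),
    lie_zero = delta_class A \<omega> 0,
    lie_scale = (\<lambda>a P. \<Union>\<alpha>\<in>P. delta_class A \<omega> (a *\<^sub>R \<alpha>)),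
    lie_bracket = (\<lambda>P Q. \<Union>\<alpha>\<in>P. \<Union>\<beta>\<in>Q.
      delta_class A \<omega> (wedge (koszul_delta A \<omega> \<alpha>) (ext_d A (koszul_delta A \<omega> \<beta>))))\<rparr>"

end

theory Submission
  imports Defs
begin

text \<open>The operators \<open>d\<close>, \<open>L\<close>, \<open>\<Lambda>\<close> and \<open>\<delta>\<close> act on the space \<open>T\<close> of forms of mixed degree. The theorem follows from
four operator identities and from the effect of \<open>\<Lambda>\<close> on products of exact one-forms.

\<^emph>\<open>Operator identities.\<close> Linear algebra at a point shows that \<open>[\<Lambda>, L]\<close> multiplies \<open>k\<close>-forms by \<open>n - k\<close>
(\<open>\<Lambda>_L\<close>), and \<open>d\<omega> = 0\<close> means \<open>[L, d] = 0\<close> (\<open>d_L\<close>). So \<open>L\<close>, \<open>\<Lambda>\<close> and \<open>H = [\<Lambda>, L]\<close> form an \<open>sl\<^sub>2\<close>-triple, and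
in its adjoint action \<open>d\<close> is a lowest weight vector with \<open>[H, d] = - d\<close>. As \<open>(ad \<Lambda>)\<^sup>m d\<close> lowers the degree
of forms by \<open>2m - 1\<close>, it vanishes for large \<open>m\<close>, so \<open>d\<close> generates the two-dimensional representation
spanned by \<open>d\<close> and \<open>\<delta> = [\<Lambda>, d]\<close>. This gives \<open>[L, \<delta>] = d\<close> (\<open>L_\<delta>\<close>) and \<open>[\<Lambda>, \<delta>] = 0\<close> (\<open>\<Lambda>_\<delta>\<close>), and the
latter implies \<open>\<delta>\<^sup>2 = 0\<close> (\<open>\<delta>_\<delta>\<close>). In coordinates, \<open>[\<Lambda>, \<delta>] = 0\<close> is the Jacobi identity of \<open>\<pi>\<close>.

\<^emph>\<open>Higher brackets.\<close> Let \<open>f\<^sub>i = \<delta>\<alpha>\<^sub>i\<close>, let \<open>D = df\<^sub>1 \<and> \<dots> \<and> df\<^sub>k\<close> (\<open>d_prod\<close>) and \<open>a = k Alt(m\<^sub>k)(f\<^sub>1, \<dots>, f\<^sub>k)\<close>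
(\<open>alt_sum\<close>). Then \<open>da = k D\<close>. Contraction with a Hamiltonian vector field is an antiderivation, so \<open>\<Lambda>\<close>
maps \<open>D\<close> and \<open>a\<close> to signed sums over the pairs \<open>i < j\<close>, with \<open>f\<^sub>i\<close> and \<open>f\<^sub>j\<close> removed and the factor
\<open>{f\<^sub>i, f\<^sub>j}\<close> in front (\<open>\<Lambda>_d_prod\<close>, \<open>\<Lambda>_alt_sum\<close>). It follows that \<open>\<delta>a = R + S\<close>, where \<open>R = \<Lambda>D\<close> and \<open>S\<close> is the
signed sum of the antisymmetrized products of \<open>{f\<^sub>i, f\<^sub>j}\<close> and the remaining functions
(\<open>\<delta>_alt_sum\<close>). In \<open>\<delta> (\<Sum>\<^sub>j c\<^sub>k\<^sub>,\<^sub>j L\<^sup>j \<Lambda>\<^sup>j a)\<close> the operator identities move \<open>\<delta>\<close> to the right. Since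
\<open>c\<^sub>k\<^sub>,\<^sub>j = (j + 1) (k - j - 1) c\<^sub>k\<^sub>,\<^sub>j\<^sub>+\<^sub>1\<close>, all terms with \<open>R\<close> cancel and \<open>S\<close> remains with coefficients
proportional to \<open>c\<^sub>k\<^sub>-\<^sub>1\<^sub>,\<^sub>j\<close> (\<open>\<delta>_lefschetz_poly_alt_sum\<close>). So \<open>\<delta> l\<^sub>k\<close> is minus the signed sum of the values
of \<open>l\<^sub>k\<^sub>-\<^sub>1\<close> with a pair of arguments replaced by its \<open>l\<^sub>2\<close> (\<open>\<delta>_bracket\<close>). In the Jacobi relation of
arity \<open>k \<ge> 3\<close> these are the terms with \<open>i = 2\<close> and \<open>i = k\<close>. In all others some \<open>l\<^sub>j\<close> with \<open>j \<ge> 2\<close> has an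
argument in the image of \<open>\<delta>\<close> or of nonzero degree, so they vanish (\<open>jacobi_l\<close>).

\<^emph>\<open>The quotient map.\<close> From \<open>[L, \<delta>] = d\<close> one obtains \<open>df = - \<delta>(f \<omega>)\<close> for functions \<open>f\<close>, so exact one-forms
lie in \<open>\<delta>\<Omega>\<^sup>2\<close> (\<open>d_F0_\<delta>_exact\<close>). Hence \<open>l\<^sub>2(\<alpha>, \<beta>) = (\<delta>\<alpha> d\<delta>\<beta> - \<delta>\<beta> d\<delta>\<alpha>) / 2\<close> has the class of \<open>\<delta>\<alpha> d\<delta>\<beta>\<close>
(\<open>bracket_2_mod_\<delta>_exact\<close>), and the Jacobi identity of the quotient is the relation of arity three
(\<open>jacobi_mod_\<delta>_exact\<close>).

\<^emph>\<open>Forms at a point\<close> are functions on lists of vectors. The interior product with \<open>v\<close> prepends \<open>v\<close> to the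
list, and a formula for the interior product of a wedge product or of an exterior derivative is a
recursion over the list, so the algebraic identities are proved by list induction. The geometry of
the manifold enters in showing that the operators preserve forms: \<open>d\<close> commutes with pullback
(\<open>pullback_local_d\<close>), the components of \<open>\<pi>\<close> are smooth (\<open>smooth_ham\<close>), and contraction with \<open>\<pi>\<close> is
compatible with the transition maps (\<open>bivector_contraction_pullback\<close>, \<open>ham_transition\<close>).\<close>

section \<open>Sums over unshuffles\<close>

definition lift_perm :: "(nat \<Rightarrow> nat) \<Rightarrow> nat \<Rightarrow> nat"
  where "lift_perm \<tau> = case_nat 0 (\<lambda>j. Suc (\<tau> j))"

lemma lift_perm_simps [simp]: "lift_perm \<tau> 0 = 0" "lift_perm \<tau> (Suc j) = Suc (\<tau> j)"
  by (simp_all add: lift_perm_def)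

lemma lift_perm_inj: "lift_perm \<sigma> = lift_perm \<tau> \<Longrightarrow> \<sigma> = \<tau>"
  by (metis ext lift_perm_simps(2) nat.inject)

lemma lift_perm_transpose:
  "lift_perm (Transposition.transpose a b \<circ> p) = Transposition.transpose (Suc a) (Suc b) \<circ> lift_perm p"
  by (auto simp: fun_eq_iff lift_perm_def Transposition.transpose_def split: nat.split)

lemma lift_perm_permutes_sign:
  assumes "\<tau> permutes {..<n}"
  shows "lift_perm \<tau> permutes {..<Suc n} \<and> sign (lift_perm \<tau>) = sign \<tau>"
  using assms finite_lessThan
proof (induction rule: permutes_induct)
  case id
  have "lift_perm id = id" by (auto simp: fun_eq_iff lift_perm_def split: nat.split)
  then show ?case by (simp only: permutes_id sign_id simp_thms)
next
  case (swap a b p)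
  have t: "Transposition.transpose (Suc a) (Suc b) permutes {..<Suc n}"
    using swap by (intro permutes_swap_id) auto
  have "sign (Transposition.transpose (Suc a) (Suc b) \<circ> lift_perm p) = - sign (lift_perm p)"
    using swap permutes_imp_permutation[OF _ t] permutes_imp_permutation[of "{..<Suc n}" "lift_perm p"]
    by (simp add: sign_compose sign_swap_id)
  moreover have "sign (Transposition.transpose a b \<circ> p) = - sign p"
    using swap permutes_imp_permutation[of "{..<n}" p] permutation_swap_id[of a b]
    by (simp add: sign_compose sign_swap_id)
  ultimately show ?case
    unfolding lift_perm_transpose
    using swap.IH permutes_compose[OF _ t, of "lift_perm p"] by metis
qed

lemmas lift_perm_permutes = lift_perm_permutes_sign[THEN conjunct1]
  and sign_lift_perm = lift_perm_permutes_sign[THEN conjunct2]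

lemma permutes_fix_0_imp_lift:
  assumes "\<sigma> permutes {..<Suc n}" "\<sigma> 0 = 0"
  shows "\<exists>\<tau>. \<tau> permutes {..<n} \<and> \<sigma> = lift_perm \<tau>"
proof -
  define \<tau> where "\<tau> j = \<sigma> (Suc j) - 1" for j
  have pos: "\<sigma> (Suc j) > 0" for j
    using assms by (metis gr0I nat.distinct(1) permutes_inj injD)
  have eq: "\<sigma> = lift_perm \<tau>"
    using pos assms(2) by (auto simp: fun_eq_iff lift_perm_def \<tau>_def split: nat.split)
  have "\<tau> permutes {..<n}"
    unfolding permutes_def
  proof (intro conjI allI impI)
    fix x assume "x \<notin> {..<n}"
    then have "\<sigma> (Suc x) = Suc x" using assms(1) by (simp add: permutes_def)
    then show "\<tau> x = x" by (simp add: \<tau>_def)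
  next
    fix y
    have "\<exists>!x. \<sigma> x = Suc y" using assms(1) by (simp add: permutes_def)
    moreover have "\<sigma> x = Suc y \<longleftrightarrow> (\<exists>z. x = Suc z \<and> \<tau> z = y)" for x
      by (subst eq) (auto simp: lift_perm_def split: nat.split)
    ultimately show "\<exists>!x. \<tau> x = y" by (metis nat.inject)
  qed
  with eq show ?thesis by blast
qed

text \<open>As a permutation of list positions, \<open>front_cycle m\<close> moves the head of a list behind the \<open>m\<close> entries
that follow it (\<open>permute_list_front_cycle\<close>). Its sign is the sign in the shuffle recursion.\<close>

definition front_cycle :: "nat \<Rightarrow> nat \<Rightarrow> nat"
  where "front_cycle m = (\<lambda>i. if i < m then Suc i else if i = m then 0 else i)"

lemma front_cycle_Suc:
  "front_cycle (Suc m) = Transposition.transpose 0 (Suc m) \<circ> front_cycle m"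
  by (auto simp: fun_eq_iff front_cycle_def Transposition.transpose_def)

lemma front_cycle_permutes_sign:
  "front_cycle m permutes {..m} \<and> sign (front_cycle m) = (- 1) ^ m"
proof (induction m)
  case 0
  have "front_cycle 0 = id" by (auto simp: fun_eq_iff front_cycle_def)
  then show ?case by (simp only: permutes_id sign_id power_0 simp_thms)
next
  case (Suc m)
  have t: "Transposition.transpose 0 (Suc m) permutes {..Suc m}"
    by (intro permutes_swap_id) auto
  have c: "front_cycle m permutes {..Suc m}" using Suc by (auto intro: permutes_subset)
  have "sign (Transposition.transpose 0 (Suc m) \<circ> front_cycle m) = (- 1) ^ Suc m"
    using Suc permutes_imp_permutation[OF _ c] permutes_imp_permutation[OF _ t]
    by (simp add: sign_compose sign_swap_id)
  with permutes_compose[OF c t] show ?case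
    unfolding front_cycle_Suc by blast
qed

lemma front_cycle_permutes: "m \<le> n \<Longrightarrow> front_cycle m permutes {..<Suc n}"
  using front_cycle_permutes_sign[of m] by (auto intro: permutes_subset)

lemma permute_list_lift:
  assumes "\<tau> permutes {..<length xs}"
  shows "permute_list (lift_perm \<tau>) (v # xs) = v # permute_list \<tau> xs"
proof -
  have "[0..<Suc (length xs)] = 0 # map Suc [0..<length xs]"
    by (simp add: upt_conv_Cons map_Suc_upt del: upt_Suc)
  then show ?thesis by (simp add: permute_list_def comp_def del: upt_Suc)
qed

lemma permute_list_front_cycle:
  assumes "m \<le> length xs"
  shows "permute_list (front_cycle m) (v # xs) = take m xs @ v # drop m xs"
  using assms
  by (intro nth_equalityI) (auto simp: permute_list_def front_cycle_def nth_append nth_Cons' min_def simp del: upt_Suc)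

lemma unshuffles_0_left: "unshuffles 0 q = {id}"
proof -
  have "\<sigma> = id" if "\<sigma> permutes {..<q}" "strict_mono_on {..<q} \<sigma>" for \<sigma>
  proof -
    have "\<sigma> j = j" if "j < q" for j
      using that
    proof (induction j rule: less_induct)
      case (less j)
      have s: "bij_betw \<sigma> {..<q} {..<q}" using \<open>\<sigma> permutes {..<q}\<close> by (rule permutes_imp_bij)
      have "\<sigma> j \<ge> j"
      proof (rule ccontr)
        assume "\<not> j \<le> \<sigma> j"
        then have "\<sigma> (\<sigma> j) = \<sigma> j" using less by auto
        then have "\<sigma> j = j" using \<open>\<sigma> permutes {..<q}\<close> by (metis permutes_inj injD)
        with \<open>\<not> j \<le> \<sigma> j\<close> show False by simp
      qed
      moreover have "\<sigma> j \<le> j"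
      proof -
        obtain i where i: "i < q" "\<sigma> i = j" using s less.prems by (metis bij_betw_def imageE lessThan_iff)
        have "\<not> i < j"
          using less i by (metis nat_neq_iff)
        then have "\<sigma> j \<le> \<sigma> i"
          using \<open>strict_mono_on {..<q} \<sigma>\<close> i less.prems
          by (metis lessThan_iff linorder_not_less nat_less_le strict_mono_onD order_refl)
        then show ?thesis using i by simp
      qed
      ultimately show ?case by simp
    qed
    then show ?thesis using that(1) by (auto simp: fun_eq_iff permutes_def)
  qed
  then show ?thesis
    by (auto simp: unshuffles_def permutes_id strict_mono_on_def atLeast0LessThan)
qed

lemma unshuffles_0_right: "unshuffles p 0 = {id}"
  using unshuffles_0_left[of p] by (auto simp: unshuffles_def strict_mono_on_def atLeast0LessThan)

lemma finite_unshuffles: "finite (unshuffles p q)"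
  by (rule finite_subset[OF _ finite_permutations[of "{..<p + q}"]]) (auto simp: unshuffles_def)

text \<open>An unshuffle is increasing on both blocks, so the position that it sends to \<open>0\<close> is the first one
of a block: position \<open>0\<close> or position \<open>p + 1\<close>. Removing this position leaves an unshuffle in which the
first or the second block is shorter.\<close>

lemma unshuffles_Suc:
  "unshuffles (Suc p) (Suc q) =
    lift_perm ` unshuffles p (Suc q) \<union>
    (\<lambda>\<tau>. lift_perm \<tau> \<circ> front_cycle (Suc p)) ` unshuffles (Suc p) q" (is "?U = ?A \<union> ?B")
proof (intro equalityI subsetI)
  fix \<sigma> assume "\<sigma> \<in> ?A \<union> ?B"
  then show "\<sigma> \<in> ?U"
  proof
    assume "\<sigma> \<in> ?A"
    then obtain \<tau> where t: "\<tau> \<in> unshuffles p (Suc q)" "\<sigma> = lift_perm \<tau>" by auto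
    have "\<sigma> permutes {..<Suc p + Suc q}"
      using t lift_perm_permutes[of \<tau> "p + Suc q"] by (auto simp: unshuffles_def)
    moreover have "strict_mono_on {..<Suc p} \<sigma>" "strict_mono_on {Suc p..<Suc p + Suc q} \<sigma>"
      using t by (auto simp: unshuffles_def strict_mono_on_def lift_perm_def split: nat.split)
    ultimately show ?thesis by (simp add: unshuffles_def)
  next
    assume "\<sigma> \<in> ?B"
    then obtain \<tau> where t: "\<tau> \<in> unshuffles (Suc p) q" "\<sigma> = lift_perm \<tau> \<circ> front_cycle (Suc p)" by auto
    have "\<sigma> permutes {..<Suc p + Suc q}"
      using t lift_perm_permutes[of \<tau> "Suc p + q"] front_cycle_permutes[of "Suc p" "Suc p + q"]
        permutes_compose[of "front_cycle (Suc p)" _ "lift_perm \<tau>"] by (auto simp: unshuffles_def)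
    moreover have "strict_mono_on {..<Suc p} \<sigma>" "strict_mono_on {Suc p..<Suc p + Suc q} \<sigma>"
      using t by (auto simp: unshuffles_def strict_mono_on_def lift_perm_def front_cycle_def split: nat.split)
    ultimately show ?thesis by (simp add: unshuffles_def)
  qed
next
  fix \<sigma> assume s: "\<sigma> \<in> ?U"
  let ?n = "p + Suc q"
  have perm: "\<sigma> permutes {..<Suc ?n}" and m1: "strict_mono_on {..<Suc p} \<sigma>"
    and m2: "strict_mono_on {Suc p..<Suc ?n} \<sigma>"
    using s by (auto simp: unshuffles_def)
  obtain i where i: "\<sigma> i = 0" using perm by (metis permutes_surj surjD)
  have "i < Suc ?n"
  proof (rule ccontr)
    assume "\<not> i < Suc ?n"
    then have "\<sigma> i = i" using perm by (simp add: permutes_def)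
    with i \<open>\<not> i < Suc ?n\<close> show False by simp
  qed
  then consider "i = 0" | "i = Suc p"
    using m1 m2 i unfolding strict_mono_on_def
    by (metis atLeastLessThan_iff lessThan_iff less_zeroE linorder_neqE_nat linorder_not_less
        zero_less_Suc less_Suc_eq_le not_less_eq_eq le_add1 add_Suc_right)
  then show "\<sigma> \<in> ?A \<union> ?B"
  proof cases
    case 1
    then obtain \<tau> where t: "\<tau> permutes {..<?n}" "\<sigma> = lift_perm \<tau>"
      using permutes_fix_0_imp_lift[OF perm] i by blast
    have "strict_mono_on {..<p} \<tau>"
      using m1 t by (fastforce simp: strict_mono_on_def)
    moreover have "strict_mono_on {p..<?n} \<tau>"
      unfolding strict_mono_on_def
    proof (intro allI impI)
      fix r s assume "r \<in> {p..<?n} \<and> s \<in> {p..<?n} \<and> r < s"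
      then have "\<sigma> (Suc r) < \<sigma> (Suc s)" using m2 unfolding strict_mono_on_def by auto
      then show "\<tau> r < \<tau> s" using t by simp
    qed
    ultimately show ?thesis using t by (auto simp: unshuffles_def)
  next
    case 2
    let ?\<rho> = "front_cycle (Suc p)"
    have r: "?\<rho> permutes {..<Suc ?n}" by (rule front_cycle_permutes) simp
    define \<sigma>' where "\<sigma>' = \<sigma> \<circ> inv ?\<rho>"
    have s': "\<sigma> = \<sigma>' \<circ> ?\<rho>" unfolding \<sigma>'_def comp_assoc
      using permutes_inv_o(2)[OF r] by simp
    have "?\<rho> (Suc p) = 0" by (simp add: front_cycle_def)
    then have "\<sigma>' 0 = 0" using s' i 2 by (metis comp_apply)
    moreover have "\<sigma>' permutes {..<Suc ?n}"
      unfolding \<sigma>'_def using permutes_compose[OF permutes_inv[OF r] perm] .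
    ultimately obtain \<tau> where t: "\<tau> permutes {..<?n}" "\<sigma>' = lift_perm \<tau>"
      using permutes_fix_0_imp_lift by blast
    have a: "\<sigma> j = Suc (\<tau> j)" if "j < Suc p" for j
      using that by (simp add: s' t front_cycle_def)
    have b: "\<sigma> (Suc j) = Suc (\<tau> j)" if "Suc p \<le> j" for j
      using that by (simp add: s' t front_cycle_def)
    have "strict_mono_on {..<Suc p} \<tau>"
      using m1 a by (auto simp: strict_mono_on_def)
    moreover have "strict_mono_on {Suc p..<?n} \<tau>"
      unfolding strict_mono_on_def
    proof (intro allI impI)
      fix r s assume "r \<in> {Suc p..<?n} \<and> s \<in> {Suc p..<?n} \<and> r < s"
      then have "\<sigma> (Suc r) < \<sigma> (Suc s)" "Suc p \<le> r" "Suc p \<le> s"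
        using m2 unfolding strict_mono_on_def by auto
      then show "\<tau> r < \<tau> s" using b by simp
    qed
    ultimately show ?thesis using t s' by (auto simp: unshuffles_def)
  qed
qed

text \<open>Wedge products are sums of such sums over \<open>p\<close>, and the Jacobi relations contain one with \<open>p = 2\<close>. Only
the recursion \<open>shuffle_sum_Cons\<close> is used to evaluate them.\<close>

definition shuffle_sum :: "nat \<Rightarrow> nat \<Rightarrow> ('x list \<Rightarrow> 'x list \<Rightarrow> 'v::real_vector) \<Rightarrow> 'x list \<Rightarrow> 'v"
  where "shuffle_sum p q G xs = (\<Sum>\<sigma>\<in>unshuffles p q. real_of_int (sign \<sigma>) *\<^sub>R
    G (take p (permute_list \<sigma> xs)) (drop p (permute_list \<sigma> xs)))"

lemma shuffle_sum_0_left: "shuffle_sum 0 q G xs = G [] xs"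
  by (simp add: shuffle_sum_def unshuffles_0_left)

lemma shuffle_sum_0_right: "length xs = p \<Longrightarrow> shuffle_sum p 0 G xs = G xs []"
  by (simp add: shuffle_sum_def unshuffles_0_right)

text \<open>The head \<open>v\<close> goes to the front of the first or of the second list; in the latter case it passes the
\<open>p + 1\<close> entries of the first list.\<close>

lemma shuffle_sum_Cons:
  assumes len: "length xs = Suc (p + q)"
  shows "shuffle_sum (Suc p) (Suc q) G (v # xs) =
    shuffle_sum p (Suc q) (\<lambda>a b. G (v # a) b) xs +
    (- 1) ^ Suc p *\<^sub>R shuffle_sum (Suc p) q (\<lambda>a b. G a (v # b)) xs"
proof -
  let ?F = "\<lambda>\<sigma>. real_of_int (sign \<sigma>) *\<^sub>R
    G (take (Suc p) (permute_list \<sigma> (v # xs))) (drop (Suc p) (permute_list \<sigma> (v # xs)))"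
  let ?A = "lift_perm ` unshuffles p (Suc q)"
  let ?h = "\<lambda>\<tau>. lift_perm \<tau> \<circ> front_cycle (Suc p)"
  let ?B = "?h ` unshuffles (Suc p) q"
  have pn: "\<tau> permutes {..<length xs}" if "\<tau> \<in> unshuffles p (Suc q) \<or> \<tau> \<in> unshuffles (Suc p) q" for \<tau>
    using that len by (auto simp: unshuffles_def)
  have fp: "front_cycle (Suc p) permutes {..<Suc (length xs)}"
    using len by (intro front_cycle_permutes) auto
  have disj: "?A \<inter> ?B = {}"
  proof -
    have "lift_perm \<tau> \<noteq> ?h \<tau>'" for \<tau> \<tau>'
    proof
      assume "lift_perm \<tau> = ?h \<tau>'"
      then have "lift_perm \<tau> 0 = ?h \<tau>' 0" by (rule fun_cong)
      then show False by (simp add: front_cycle_def)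
    qed
    then show ?thesis by auto
  qed
  have injh: "inj_on ?h (unshuffles (Suc p) q)"
  proof (rule inj_onI)
    fix \<tau> \<tau>' assume h: "?h \<tau> = ?h \<tau>'"
    have "lift_perm \<tau> = ?h \<tau> \<circ> inv (front_cycle (Suc p))" for \<tau>
      unfolding comp_assoc using permutes_inv_o(1)[OF fp] by simp
    with h have "lift_perm \<tau> = lift_perm \<tau>'" by metis
    then show "\<tau> = \<tau>'" by (rule lift_perm_inj)
  qed
  have "shuffle_sum (Suc p) (Suc q) G (v # xs) = sum ?F ?A + sum ?F ?B"
    unfolding shuffle_sum_def unshuffles_Suc
    by (intro sum.union_disjoint disj finite_imageI finite_unshuffles)
  also have "sum ?F ?A = shuffle_sum p (Suc q) (\<lambda>a b. G (v # a) b) xs"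
    unfolding shuffle_sum_def
    by (subst sum.reindex)
      (auto intro!: inj_onI lift_perm_inj sum.cong
        simp: pn permute_list_lift sign_lift_perm[OF pn])
  also have "sum ?F ?B = (- 1) ^ Suc p *\<^sub>R shuffle_sum (Suc p) q (\<lambda>a b. G a (v # b)) xs"
    unfolding shuffle_sum_def sum.reindex[OF injh] scaleR_sum_right
  proof (rule sum.cong, rule refl)
    fix \<tau> assume t: "\<tau> \<in> unshuffles (Suc p) q"
    note l = lift_perm_permutes[OF pn[OF disjI2[OF t]]]
    have "sign (?h \<tau>) = (- 1) ^ Suc p * sign \<tau>"
      using sign_compose[OF permutes_imp_permutation[OF _ l] permutes_imp_permutation[OF _ fp]]
        front_cycle_permutes_sign[of "Suc p"] sign_lift_perm[OF pn[OF disjI2[OF t]]]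
      by simp
    moreover have "permute_list (?h \<tau>) (v # xs) =
        take (Suc p) (permute_list \<tau> xs) @ v # drop (Suc p) (permute_list \<tau> xs)"
      using fp len
      by (subst permute_list_compose)
        (simp_all add: permute_list_lift[OF pn[OF disjI2[OF t]]] permute_list_front_cycle)
    ultimately show "(?F \<circ> ?h) \<tau> = (- 1) ^ Suc p *\<^sub>R real_of_int (sign \<tau>) *\<^sub>R
        G (take (Suc p) (permute_list \<tau> xs)) (v # drop (Suc p) (permute_list \<tau> xs))"
      using len by simp
  qed
  finally show ?thesis .
qed

section \<open>Smooth functions on open sets\<close>

lemma has_frechet_derivative:
  "f differentiable at x \<Longrightarrow> (f has_derivative frechet_derivative f (at x)) (at x)"
  by (simp flip: frechet_derivative_works)

lemma frechet_derivative_add: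
  "f differentiable at x \<Longrightarrow> g differentiable at x \<Longrightarrow>
    frechet_derivative (\<lambda>y. f y + g y) (at x) v = frechet_derivative f (at x) v + frechet_derivative g (at x) v"
  by (rule fun_cong[OF frechet_derivative_at[symmetric], THEN trans], rule has_derivative_add)
    (auto simp flip: frechet_derivative_works)

lemma frechet_derivative_bounded_linear:
  "bounded_linear h \<Longrightarrow> f differentiable at x \<Longrightarrow>
    frechet_derivative (\<lambda>y. h (f y)) (at x) v = h (frechet_derivative f (at x) v)"
  by (rule fun_cong[OF frechet_derivative_at[symmetric], THEN trans], erule bounded_linear.has_derivative)
    (auto simp flip: frechet_derivative_works)

lemma frechet_derivative_mult:
  fixes f g :: "'a::real_normed_vector \<Rightarrow> real"
  shows "f differentiable at x \<Longrightarrow> g differentiable at x \<Longrightarrow>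
    frechet_derivative (\<lambda>y. f y * g y) (at x) v =
      f x * frechet_derivative g (at x) v + frechet_derivative f (at x) v * g x"
  by (rule fun_cong[OF frechet_derivative_at[symmetric], THEN trans], rule has_derivative_mult)
    (auto simp flip: frechet_derivative_works)

lemma frechet_derivative_cong_open:
  assumes "open S" "x \<in> S" "\<And>y. y \<in> S \<Longrightarrow> f y = g y"
  shows "frechet_derivative f (at x) = frechet_derivative g (at x)"
proof -
  have "(f has_derivative D) (at x) \<longleftrightarrow> (g has_derivative D) (at x)" for D
    using assms by (metis has_derivative_transform_within_open)
  then show ?thesis by (simp add: frechet_derivative_def)
qed

lemma differentiable_cong_open:
  assumes "open S" "x \<in> S" "\<And>y. y \<in> S \<Longrightarrow> f y = g y"
  shows "f differentiable at x \<longleftrightarrow> g differentiable at x"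
  unfolding differentiable_def using assms by (metis has_derivative_transform_within_open)

lemma Ck_on_cong:
  assumes "open S" "\<And>y. y \<in> S \<Longrightarrow> f y = g y"
  shows "Ck_on k S f \<longleftrightarrow> Ck_on k S g"
  using assms(2)
proof (induction k arbitrary: f g)
  case 0
  then show ?case by (simp cong: continuous_on_cong)
next
  case (Suc k)
  have "frechet_derivative f (at x) = frechet_derivative g (at x)" if "x \<in> S" for x
    using frechet_derivative_cong_open[OF assms(1) that] Suc.prems by blast
  then have "Ck_on k S (\<lambda>x. frechet_derivative f (at x) v) \<longleftrightarrow> Ck_on k S (\<lambda>x. frechet_derivative g (at x) v)" for v
    by (intro Suc.IH) simp
  moreover have "f differentiable at x \<longleftrightarrow> g differentiable at x" if "x \<in> S" for x
    using differentiable_cong_open[OF assms(1) that] Suc.prems by blast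
  ultimately show ?case by simp
qed

lemma Ck_on_const: "Ck_on k S (\<lambda>x. c)"
  by (induction k arbitrary: c) simp_all

lemma Ck_on_SucD: "Ck_on (Suc k) S f \<Longrightarrow> Ck_on k S f"
proof (induction k arbitrary: f)
  case 0
  then show ?case
    by (auto simp: continuous_on_eq_continuous_at intro!: continuous_at_imp_continuous_on differentiable_imp_continuous_within)
next
  case (Suc k)
  then show ?case by (metis Ck_on.simps(2))
qed

lemma Ck_on_add:
  assumes "open S"
  shows "Ck_on k S f \<Longrightarrow> Ck_on k S g \<Longrightarrow> Ck_on k S (\<lambda>x. f x + g x)"
proof (induction k arbitrary: f g)
  case 0
  then show ?case by (auto intro: continuous_intros)
next
  case (Suc k)
  have "Ck_on k S (\<lambda>x. frechet_derivative (\<lambda>x. f x + g x) (at x) v)" for v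
  proof (rule iffD1[OF Ck_on_cong[OF assms]])
    show "Ck_on k S (\<lambda>x. frechet_derivative f (at x) v + frechet_derivative g (at x) v)"
      using Suc by auto
  qed (use Suc.prems in \<open>simp add: frechet_derivative_add\<close>)
  with Suc.prems show ?case by (auto intro: differentiable_add)
qed

lemma Ck_on_bounded_linear:
  assumes "open S" "bounded_linear h"
  shows "Ck_on k S f \<Longrightarrow> Ck_on k S (\<lambda>x. h (f x))"
proof (induction k arbitrary: f)
  case 0
  then show ?case by (auto intro: bounded_linear.continuous_on[OF assms(2)])
next
  case (Suc k)
  have "Ck_on k S (\<lambda>x. frechet_derivative (\<lambda>x. h (f x)) (at x) v)" for v
  proof (rule iffD1[OF Ck_on_cong[OF assms(1)]])
    show "Ck_on k S (\<lambda>x. h (frechet_derivative f (at x) v))"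
      using Suc by auto
  qed (use Suc.prems in \<open>simp add: frechet_derivative_bounded_linear[OF assms(2)]\<close>)
  moreover have "(\<lambda>x. h (f x)) differentiable at x" if "x \<in> S" for x
    using Suc.prems that bounded_linear.has_derivative[OF assms(2) has_frechet_derivative[of f x]]
    by (auto simp: differentiable_def)
  ultimately show ?case by simp
qed

lemma Ck_on_mult:
  fixes f g :: "'a::real_normed_vector \<Rightarrow> real"
  assumes "open S"
  shows "Ck_on k S f \<Longrightarrow> Ck_on k S g \<Longrightarrow> Ck_on k S (\<lambda>x. f x * g x)"
proof (induction k arbitrary: f g)
  case 0
  then show ?case by (auto intro: continuous_intros)
next
  case (Suc k)
  have "Ck_on k S (\<lambda>x. frechet_derivative (\<lambda>x. f x * g x) (at x) v)" for v
  proof (rule iffD1[OF Ck_on_cong[OF assms]])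
    show "Ck_on k S (\<lambda>x. f x * frechet_derivative g (at x) v + frechet_derivative f (at x) v * g x)"
      using Suc Suc.prems[THEN Ck_on_SucD] by (intro Ck_on_add[OF assms] Suc.IH) auto
  qed (use Suc.prems in \<open>simp add: frechet_derivative_mult\<close>)
  with Suc.prems show ?case by (auto intro: differentiable_mult)
qed

lemma Ck_on_sum:
  assumes "open S" "\<And>i. i \<in> I \<Longrightarrow> Ck_on k S (f i)"
  shows "Ck_on k S (\<lambda>x. \<Sum>i\<in>I. f i x)"
  using assms(2)
  by (induction I rule: infinite_finite_induct) (auto simp: Ck_on_const intro: Ck_on_add[OF assms(1)])

lemma Ck_on_compose:
  fixes f :: "'b::euclidean_space \<Rightarrow> real" and g :: "'a::real_normed_vector \<Rightarrow> 'b"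
  assumes "open S" "g ` S \<subseteq> T"
  shows "Ck_on k S g \<Longrightarrow> Ck_on k T f \<Longrightarrow> Ck_on k S (\<lambda>x. f (g x))"
proof (induction k arbitrary: f)
  case 0
  then show ?case using assms(2) by (auto intro: continuous_on_compose2)
next
  case (Suc k)
  have d: "((\<lambda>x. f (g x)) has_derivative (\<lambda>v. frechet_derivative f (at (g x)) (frechet_derivative g (at x) v))) (at x)"
    if "x \<in> S" for x
    using Suc.prems that assms(2)
    by (intro has_derivative_compose[of g _ x UNIV f] has_frechet_derivative) auto
  have "Ck_on k S (\<lambda>x. frechet_derivative (\<lambda>x. f (g x)) (at x) v)" for v
  proof (rule iffD1[OF Ck_on_cong[OF assms(1)]])
    show "Ck_on k S (\<lambda>x. \<Sum>e\<in>Basis. (frechet_derivative g (at x) v \<bullet> e) * frechet_derivative f (at (g x)) e)"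
    proof (intro Ck_on_sum assms Ck_on_mult)
      fix e :: 'b
      show "Ck_on k S (\<lambda>x. frechet_derivative g (at x) v \<bullet> e)"
        using Suc.prems by (intro Ck_on_bounded_linear[OF assms(1) bounded_linear_inner_left]) simp
      show "Ck_on k S (\<lambda>x. frechet_derivative f (at (g x)) e)"
        using Suc.prems Ck_on_SucD[OF Suc.prems(1)] by (intro Suc.IH) auto
    qed
    fix x assume x: "x \<in> S"
    have "linear (frechet_derivative f (at (g x)))"
      using Suc.prems x assms(2) by (intro linear_frechet_derivative) auto
    from linear_sum[OF this, of "\<lambda>e. (frechet_derivative g (at x) v \<bullet> e) *\<^sub>R e" Basis] linear_scale[OF this]
    show "(\<Sum>e\<in>Basis. (frechet_derivative g (at x) v \<bullet> e) * frechet_derivative f (at (g x)) e) =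
        frechet_derivative (\<lambda>x. f (g x)) (at x) v"
      unfolding frechet_derivative_at[OF d[OF x], symmetric]
      by (simp add: euclidean_representation)
  qed
  then show ?case using d by (auto simp: differentiable_def)
qed

lemma smooth_on_const: "smooth_on S (\<lambda>x. c)"
  and smooth_on_add: "open S \<Longrightarrow> smooth_on S f \<Longrightarrow> smooth_on S g \<Longrightarrow> smooth_on S (\<lambda>x. f x + g x)"
  and smooth_on_bounded_linear: "open S \<Longrightarrow> bounded_linear h \<Longrightarrow> smooth_on S f \<Longrightarrow> smooth_on S (\<lambda>x. h (f x))"
  and smooth_on_sum: "open S \<Longrightarrow> (\<And>i. i \<in> I \<Longrightarrow> smooth_on S (p i)) \<Longrightarrow> smooth_on S (\<lambda>x. \<Sum>i\<in>I. p i x)"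
  by (auto simp: smooth_on_def Ck_on_const intro: Ck_on_add Ck_on_bounded_linear Ck_on_sum)

lemma smooth_on_mult:
  fixes f g :: "'a::real_normed_vector \<Rightarrow> real"
  shows "open S \<Longrightarrow> smooth_on S f \<Longrightarrow> smooth_on S g \<Longrightarrow> smooth_on S (\<lambda>x. f x * g x)"
  by (simp add: smooth_on_def Ck_on_mult)

lemma smooth_on_compose:
  fixes f :: "'b::euclidean_space \<Rightarrow> real"
  shows "open S \<Longrightarrow> g ` S \<subseteq> T \<Longrightarrow> smooth_on S g \<Longrightarrow> smooth_on T f \<Longrightarrow> smooth_on S (\<lambda>x. f (g x))"
  by (simp add: smooth_on_def Ck_on_compose)

lemma smooth_on_cmult:
  fixes f :: "'a::real_normed_vector \<Rightarrow> real"
  shows "open S \<Longrightarrow> smooth_on S f \<Longrightarrow> smooth_on S (\<lambda>x. c * f x)"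
  by (rule smooth_on_bounded_linear[OF _ bounded_linear_mult_right])

lemma smooth_on_minus:
  fixes f :: "'a::real_normed_vector \<Rightarrow> real"
  shows "open S \<Longrightarrow> smooth_on S f \<Longrightarrow> smooth_on S (\<lambda>x. - f x)"
  using smooth_on_cmult[of S f "- 1"] by simp

lemma smooth_on_diff:
  fixes f g :: "'a::real_normed_vector \<Rightarrow> real"
  shows "open S \<Longrightarrow> smooth_on S f \<Longrightarrow> smooth_on S g \<Longrightarrow> smooth_on S (\<lambda>x. f x - g x)"
  using smooth_on_add[of S f "\<lambda>x. - g x"] smooth_on_minus[of S g] by simp

lemma smooth_on_cong:
  assumes "open S" "\<And>x. x \<in> S \<Longrightarrow> f x = g x"
  shows "smooth_on S f \<longleftrightarrow> smooth_on S g"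
  unfolding smooth_on_def using Ck_on_cong[of S f g] assms by simp

lemma smooth_on_imp_differentiable: "smooth_on S f \<Longrightarrow> x \<in> S \<Longrightarrow> f differentiable at x"
  unfolding smooth_on_def by (metis Ck_on.simps(2))

lemma smooth_on_frechet_derivative:
  "smooth_on S f \<Longrightarrow> smooth_on S (\<lambda>x. frechet_derivative f (at x) v)"
  unfolding smooth_on_def by (metis Ck_on.simps(2))

lemma smooth_on_imp_continuous: "smooth_on S f \<Longrightarrow> continuous_on S f"
  unfolding smooth_on_def by (metis Ck_on.simps(1))

section \<open>Symmetry of second derivatives\<close>

lemma DERIV_along_line:
  fixes f :: "'a::real_normed_vector \<Rightarrow> real"
  assumes "f differentiable at (p + s *\<^sub>R u)"
  shows "DERIV (\<lambda>s. f (p + s *\<^sub>R u)) s :> frechet_derivative f (at (p + s *\<^sub>R u)) u"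
proof -
  have "((\<lambda>s. p + s *\<^sub>R u) has_derivative (\<lambda>h. h *\<^sub>R u)) (at s)"
    by (auto intro!: derivative_eq_intros)
  from has_derivative_compose[OF this has_frechet_derivative[OF assms]]
  have "((\<lambda>s. f (p + s *\<^sub>R u)) has_derivative (\<lambda>h. frechet_derivative f (at (p + s *\<^sub>R u)) (h *\<^sub>R u))) (at s)" .
  then show ?thesis
    unfolding has_field_derivative_def
    by (rule has_derivative_eq_rhs)
      (simp add: fun_eq_iff linear_scale[OF linear_frechet_derivative[OF assms]])
qed

text \<open>The mean value theorem, applied first in the direction \<open>u\<close> and then in the direction \<open>v\<close>, expresses the
second difference of \<open>f\<close> over a parallelogram by a second derivative at one of its points.\<close>

lemma second_difference_mean_value:
  fixes f :: "'a::real_normed_vector \<Rightarrow> real"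
  assumes f: "smooth_on S f" and t: "t > 0" and b: "cball x (t * (norm u + norm v)) \<subseteq> S"
  shows "\<exists>y \<in> cball x (t * (norm u + norm v)).
    f (x + t *\<^sub>R u + t *\<^sub>R v) - f (x + t *\<^sub>R u) - f (x + t *\<^sub>R v) + f x =
    t * t * frechet_derivative (\<lambda>z. frechet_derivative f (at z) u) (at y) v"
proof -
  have inb: "x + a *\<^sub>R u + c *\<^sub>R v \<in> cball x (t * (norm u + norm v))"
    if "0 \<le> a" "a \<le> t" "0 \<le> c" "c \<le> t" for a c
  proof -
    have "norm (a *\<^sub>R u + c *\<^sub>R v) \<le> a * norm u + c * norm v"
      using that by (metis abs_of_nonneg norm_scaleR norm_triangle_ineq)
    also have "\<dots> \<le> t * norm u + t * norm v"
      using that by (intro add_mono mult_right_mono) auto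
    finally have "norm (a *\<^sub>R u + c *\<^sub>R v) \<le> t * (norm u + norm v)" by (simp add: distrib_left)
    moreover have "dist x (x + a *\<^sub>R u + c *\<^sub>R v) = norm (a *\<^sub>R u + c *\<^sub>R v)"
      using norm_minus_cancel[of "a *\<^sub>R u + c *\<^sub>R v"] by (simp add: dist_norm add.assoc del: norm_minus_cancel)
    ultimately show ?thesis by simp
  qed
  let ?fu = "\<lambda>z. frechet_derivative f (at z) u"
  have d: "f differentiable at (x + a *\<^sub>R u + c *\<^sub>R v)" "?fu differentiable at (x + a *\<^sub>R u + c *\<^sub>R v)"
    if "0 \<le> a" "a \<le> t" "0 \<le> c" "c \<le> t" for a c
    using inb[OF that] b smooth_on_imp_differentiable[OF f]
      smooth_on_imp_differentiable[OF smooth_on_frechet_derivative[OF f]] by blast+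
  have "\<exists>s. 0 < s \<and> s < t \<and>
    (f ((x + t *\<^sub>R v) + t *\<^sub>R u) - f (x + t *\<^sub>R u)) - (f ((x + t *\<^sub>R v) + 0 *\<^sub>R u) - f (x + 0 *\<^sub>R u))
     = (t - 0) * (?fu ((x + t *\<^sub>R v) + s *\<^sub>R u) - ?fu (x + s *\<^sub>R u))"
  proof (rule MVT2[OF t])
    fix s assume s: "0 \<le> s" "s \<le> t"
    have "f differentiable at (x + t *\<^sub>R v + s *\<^sub>R u)" "f differentiable at (x + s *\<^sub>R u)"
      using d(1)[OF s, of t] d(1)[OF s, of 0] t by (simp_all add: add_ac)
    then show "DERIV (\<lambda>s. f (x + t *\<^sub>R v + s *\<^sub>R u) - f (x + s *\<^sub>R u)) s :>
        ?fu (x + t *\<^sub>R v + s *\<^sub>R u) - ?fu (x + s *\<^sub>R u)"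
      by (intro DERIV_diff DERIV_along_line)
  qed
  then obtain s where s: "0 < s" "s < t"
    and 1: "f (x + t *\<^sub>R u + t *\<^sub>R v) - f (x + t *\<^sub>R u) - f (x + t *\<^sub>R v) + f x
     = t * (?fu (x + s *\<^sub>R u + t *\<^sub>R v) - ?fu (x + s *\<^sub>R u))"
    by (auto simp: algebra_simps)
  have "\<exists>r. 0 < r \<and> r < t \<and> ?fu (x + s *\<^sub>R u + t *\<^sub>R v) - ?fu (x + s *\<^sub>R u + 0 *\<^sub>R v)
     = (t - 0) * frechet_derivative ?fu (at (x + s *\<^sub>R u + r *\<^sub>R v)) v"
    by (rule MVT2[OF t], rule DERIV_along_line, rule d) (use s in auto)
  then obtain r where r: "0 < r" "r < t"
    and 2: "?fu (x + s *\<^sub>R u + t *\<^sub>R v) - ?fu (x + s *\<^sub>R u)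
     = t * frechet_derivative ?fu (at (x + s *\<^sub>R u + r *\<^sub>R v)) v"
    by auto
  show ?thesis
    using 1 2 inb[of s r] s r by (intro bexI[of _ "x + s *\<^sub>R u + r *\<^sub>R v"]) auto
qed

text \<open>The second difference is symmetric in \<open>u\<close> and \<open>v\<close>. So the two mixed derivatives agree at suitable points
arbitrarily close to \<open>x\<close>, and they are continuous.\<close>

lemma second_derivative_symmetric:
  fixes f :: "'a::real_normed_vector \<Rightarrow> real"
  assumes f: "smooth_on S f" and S: "open S" "x \<in> S"
  shows "frechet_derivative (\<lambda>z. frechet_derivative f (at z) u) (at x) v =
    frechet_derivative (\<lambda>z. frechet_derivative f (at z) v) (at x) u" (is "?F x = ?G x")
proof (rule ccontr)
  assume ne: "?F x \<noteq> ?G x"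
  define e where "e = \<bar>?F x - ?G x\<bar> / 2"
  have e: "e > 0" using ne by (simp add: e_def)
  have cont: "isCont ?F x" "isCont ?G x"
    using S smooth_on_imp_continuous[OF smooth_on_frechet_derivative[OF smooth_on_frechet_derivative[OF f]]]
    by (simp_all add: continuous_on_eq_continuous_at)
  obtain d1 where d1: "d1 > 0" "\<And>y. dist y x < d1 \<Longrightarrow> dist (?F y) (?F x) < e"
    using cont(1) e unfolding continuous_at_eps_delta by blast
  obtain d2 where d2: "d2 > 0" "\<And>y. dist y x < d2 \<Longrightarrow> dist (?G y) (?G x) < e"
    using cont(2) e unfolding continuous_at_eps_delta by blast
  obtain d3 where d3: "d3 > 0" "ball x d3 \<subseteq> S" using S openE by blast
  define d where "d = min d1 (min d2 d3)"
  \<comment> \<open>The step is small enough for the parallelogram to lie in the ball of radius \<open>d\<close>.\<close>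
  define t where "t = d / (2 * (norm u + norm v + 1))"
  have dpos: "d > 0" using d1 d2 d3 by (simp add: d_def)
  have n: "norm u + norm v + 1 > 0" by (simp add: add_nonneg_pos)
  have t: "t > 0" unfolding t_def using dpos n by (intro divide_pos_pos) auto
  have "t * (norm u + norm v) \<le> t * (norm u + norm v + 1)" using t by simp
  also have "\<dots> = d / 2" unfolding t_def using n by (simp add: field_simps)
  finally have small: "t * (norm u + norm v) < d" using dpos by simp
  then have sub: "cball x (t * (norm u + norm v)) \<subseteq> S"
    using d3 by (auto simp: d_def subset_iff)
  obtain y where y: "y \<in> cball x (t * (norm u + norm v))"
    "f (x + t *\<^sub>R u + t *\<^sub>R v) - f (x + t *\<^sub>R u) - f (x + t *\<^sub>R v) + f x = t * t * ?F y"
    using second_difference_mean_value[OF f t sub] by blast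
  have sub': "cball x (t * (norm v + norm u)) \<subseteq> S" using sub by (simp add: add.commute)
  obtain z where z: "z \<in> cball x (t * (norm v + norm u))"
    "f (x + t *\<^sub>R v + t *\<^sub>R u) - f (x + t *\<^sub>R v) - f (x + t *\<^sub>R u) + f x = t * t * ?G z"
    using second_difference_mean_value[OF f t sub'] by blast
  have "t * t * ?F y = t * t * ?G z" using y z by (simp add: algebra_simps)
  then have "?F y = ?G z" using t by simp
  moreover have "dist (?F y) (?F x) < e" using y small by (intro d1) (auto simp: d_def dist_commute)
  moreover have "dist (?G z) (?G x) < e" using z small by (intro d2) (auto simp: d_def dist_commute add.commute)
  ultimately have "\<bar>?F x - ?G x\<bar> < e + e" by (simp add: dist_real_def)
  then show False by (simp add: e_def)
qed

section \<open>Smoothness of the inverse matrix\<close>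

text \<open>Because \<open>g\<close> vanishes at \<open>x\<close>, the product is differentiable as soon as \<open>f\<close> is continuous: the error
\<open>(f y - f x) * g y\<close> is a term of first order times a factor that tends to \<open>0\<close>. For the entries of an inverse matrix,
continuity is what is known before differentiability.\<close>

lemma has_derivative_mult_vanishing:
  fixes f g :: "'a::real_normed_vector \<Rightarrow> real"
  assumes f: "isCont f x" and g: "(g has_derivative g') (at x)" "g x = 0"
  shows "((\<lambda>y. f y * g y) has_derivative (\<lambda>h. f x * g' h)) (at x)"
proof -
  have "((\<lambda>y. (f y - f x) * g y) has_derivative (\<lambda>h. 0)) (at x)"
  proof (rule has_derivativeI)
    show "bounded_linear (\<lambda>h::'a. 0::real)" by simp
    have lim: "((\<lambda>y. (g y - g x - g' (y - x)) /\<^sub>R norm (y - x)) \<longlongrightarrow> 0) (at x)"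
      using g(1) by (simp add: has_derivative_at_within divide_inverse_commute has_derivative_within)
    obtain B where B: "\<And>h. norm (g' h) \<le> norm h * B" using bounded_linear.bounded[OF has_derivative_bounded_linear[OF g(1)]] by blast
    have f0: "((\<lambda>y. f y - f x) \<longlongrightarrow> 0) (at x)" using f by (simp add: isCont_def LIM_zero)
    have b: "((\<lambda>y. (f y - f x) * (g' (y - x) /\<^sub>R norm (y - x))) \<longlongrightarrow> 0) (at x)"
    proof (rule Lim_null_comparison)
      show "((\<lambda>y. norm (f y - f x) * \<bar>B\<bar>) \<longlongrightarrow> 0) (at x)"
        by (intro tendsto_mult_left_zero tendsto_norm_zero f0)
      show "\<forall>\<^sub>F y in at x. norm ((f y - f x) * (g' (y - x) /\<^sub>R norm (y - x))) \<le> norm (f y - f x) * \<bar>B\<bar>"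
      proof (rule eventuallyI)
        fix y
        have "norm (g' (y - x)) \<le> norm (y - x) * \<bar>B\<bar>" using B[of "y - x"]
          by (meson abs_ge_self mult_left_mono norm_ge_zero order_trans)
        then have "norm (g' (y - x)) / norm (y - x) \<le> \<bar>B\<bar>"
          by (cases "y = x") (auto simp: divide_simps mult.commute)
        then have "norm (g' (y - x) /\<^sub>R norm (y - x)) \<le> \<bar>B\<bar>"
          by (simp add: divide_inverse_commute abs_mult)
        then show "norm ((f y - f x) * (g' (y - x) /\<^sub>R norm (y - x))) \<le> norm (f y - f x) * \<bar>B\<bar>"
          unfolding norm_mult by (intro mult_left_mono) auto
      qed
    qed
    have "((\<lambda>y. (f y - f x) * ((g y - g x - g' (y - x)) /\<^sub>R norm (y - x)) + (f y - f x) * (g' (y - x) /\<^sub>R norm (y - x))) \<longlongrightarrow> 0 * 0 + 0) (at x)"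
      by (intro tendsto_add tendsto_mult f0 lim b)
    then show "((\<lambda>y. ((f y - f x) * g y - (f x - f x) * g x - 0) /\<^sub>R norm (y - x)) \<longlongrightarrow> 0) (at x)"
      using g(2) by (simp add: algebra_simps)
  qed
  from has_derivative_add[OF this has_derivative_mult_right[OF g(1), of "f x"]]
  show ?thesis by (simp add: algebra_simps)
qed

text \<open>The hypothesis on differences is the entrywise form of \<open>p(y) - p(x) = p(y) (w(x) - w(y)) p(x)\<close>. If \<open>P\<close>
denotes the sum of the absolute entries of \<open>p\<close> and \<open>W y\<close> that of \<open>w(x) - w(y)\<close>, it bounds \<open>P y\<close> by
\<open>P x\<close> plus a small multiple of \<open>P y\<close> near \<open>x\<close>, so \<open>P\<close> is locally bounded, and a second application gives
continuity.\<close>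

lemma inverse_matrix_continuous:
  fixes p w :: "'a::real_normed_vector \<Rightarrow> 'i \<Rightarrow> 'i \<Rightarrow> real"
  assumes S: "open S" "x \<in> S" and I: "finite I" "i \<in> I" "j \<in> I"
    and diff: "\<And>x y i j. x \<in> S \<Longrightarrow> y \<in> S \<Longrightarrow> i \<in> I \<Longrightarrow> j \<in> I \<Longrightarrow>
      p y i j - p x i j = (\<Sum>a\<in>I. \<Sum>b\<in>I. p y i a * ((w x a b - w y a b) * p x b j))"
    and w: "\<And>i j. i \<in> I \<Longrightarrow> j \<in> I \<Longrightarrow> isCont (\<lambda>x. w x i j) x"
  shows "isCont (\<lambda>x. p x i j) x"
proof -
  define P where "P y = (\<Sum>i\<in>I. \<Sum>j\<in>I. \<bar>p y i j\<bar>)" for y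
  define W where "W y = (\<Sum>a\<in>I. \<Sum>b\<in>I. \<bar>w x a b - w y a b\<bar>)" for y
  define N where "N = real (card I)"
  have P0: "P y \<ge> 0" and W0: "W y \<ge> 0" for y by (auto simp: P_def W_def intro!: sum_nonneg)
  have entry: "\<bar>p y i j\<bar> \<le> P y" if "i \<in> I" "j \<in> I" for y i j
  proof -
    have "\<bar>p y i j\<bar> \<le> (\<Sum>j\<in>I. \<bar>p y i j\<bar>)" using that I by (intro member_le_sum) auto
    also have "\<dots> \<le> P y" unfolding P_def
      by (rule member_le_sum[OF that(1), where f="\<lambda>i. \<Sum>j\<in>I. \<bar>p y i j\<bar>"]) (auto intro: sum_nonneg I)
    finally show ?thesis .
  qed
  have est: "\<bar>p y i j - p x i j\<bar> \<le> P y * W y * P x" if "y \<in> S" "i \<in> I" "j \<in> I" for y i j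
  proof -
    have "\<bar>p y i j - p x i j\<bar> \<le> (\<Sum>a\<in>I. \<Sum>b\<in>I. \<bar>p y i a * ((w x a b - w y a b) * p x b j)\<bar>)"
      unfolding diff[OF S(2) that] by (rule order_trans[OF sum_abs sum_mono]) (rule sum_abs)
    also have "\<dots> \<le> (\<Sum>a\<in>I. \<Sum>b\<in>I. P y * (\<bar>w x a b - w y a b\<bar> * P x))"
      unfolding abs_mult using that P0 by (intro sum_mono mult_mono entry) auto
    also have "\<dots> = P y * W y * P x"
      by (simp add: W_def sum_distrib_left sum_distrib_right mult_ac)
    finally show ?thesis .
  qed
  have bound: "P y \<le> P x + N * N * (P y * W y * P x)" if "y \<in> S" for y
  proof -
    have "P y = (\<Sum>i\<in>I. \<Sum>j\<in>I. \<bar>p y i j\<bar>)" by (rule P_def)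
    also have "\<dots> \<le> (\<Sum>i\<in>I. \<Sum>j\<in>I. \<bar>p x i j\<bar> + P y * W y * P x)"
    proof (intro sum_mono)
      fix i j assume "i \<in> I" "j \<in> I"
      from est[OF that this] show "\<bar>p y i j\<bar> \<le> \<bar>p x i j\<bar> + P y * W y * P x" by linarith
    qed
    also have "\<dots> = P x + N * N * (P y * W y * P x)"
      by (simp add: sum.distrib P_def N_def mult.assoc)
    finally show ?thesis .
  qed
  have W_lim: "(W \<longlongrightarrow> 0) (at x)"
  proof -
    have "(W \<longlongrightarrow> (\<Sum>a\<in>I. \<Sum>b\<in>I. \<bar>w x a b - w x a b\<bar>)) (at x)"
      unfolding W_def using w by (intro tendsto_intros) (auto simp: isCont_def)
    then show ?thesis by simp
  qed
  \<comment> \<open>The bound on \<open>W\<close> makes the factor of \<open>P y\<close> in \<open>bound\<close> at most \<open>1 / 2\<close>.\<close>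
  have "\<forall>\<^sub>F y in at x. W y < 1 / (2 * (N * N * P x + 1))"
    using W_lim P0[of x] by (intro order_tendstoD(2)) (auto simp: N_def intro!: add_nonneg_pos)
  moreover have "\<forall>\<^sub>F y in at x. y \<in> S" using S eventually_at_in_open' by blast
  ultimately have "\<forall>\<^sub>F y in at x. norm (p y i j - p x i j) \<le> 2 * P x * W y * P x"
  proof eventually_elim
    case (elim y)
    have "W y * (2 * (N * N * P x + 1)) < 1"
      using elim(1) P0[of x] by (simp add: pos_less_divide_eq N_def add_nonneg_pos)
    then have "N * N * P x * W y \<le> 1 / 2"
      using W0[of y] by (simp add: algebra_simps)
    then have "(N * N * P x * W y) * P y \<le> 1 / 2 * P y"
      by (rule mult_right_mono) (rule P0)
    with bound[OF elim(2)] have "P y \<le> 2 * P x" by (simp add: mult_ac)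
    then have "P y * (W y * P x) \<le> 2 * P x * (W y * P x)"
      using W0 P0 by (intro mult_right_mono mult_nonneg_nonneg)
    with est[OF elim(2) I(2,3)] show ?case by (simp add: mult.assoc)
  qed
  then have "((\<lambda>y. p y i j - p x i j) \<longlongrightarrow> 0) (at x)"
    by (rule Lim_null_comparison) (intro tendsto_mult_left_zero tendsto_mult_right_zero W_lim)
  then show ?thesis by (simp add: isCont_def LIM_zero_iff)
qed

text \<open>The same formula shows that the derivative of \<open>p\<close> is \<open>- p w' p\<close>, a polynomial in the entries of \<open>p\<close> and
of \<open>w'\<close>. So \<open>p\<close> is \<open>C\<^sup>k\<^sup>+\<^sup>1\<close> if it is \<open>C\<^sup>k\<close>.\<close>

lemma smooth_on_inverse_matrix:
  fixes p w :: "'a::real_normed_vector \<Rightarrow> 'i \<Rightarrow> 'i \<Rightarrow> real"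
  assumes S: "open S" and I: "finite I" 
    and pw: "\<And>x i j. x \<in> S \<Longrightarrow> i \<in> I \<Longrightarrow> j \<in> I \<Longrightarrow> (\<Sum>k\<in>I. p x i k * w x k j) = (if i = j then 1 else 0)"
    and wp: "\<And>x i j. x \<in> S \<Longrightarrow> i \<in> I \<Longrightarrow> j \<in> I \<Longrightarrow> (\<Sum>k\<in>I. w x i k * p x k j) = (if i = j then 1 else 0)"
    and w: "\<And>i j. i \<in> I \<Longrightarrow> j \<in> I \<Longrightarrow> smooth_on S (\<lambda>x. w x i j)"
    and ij: "i \<in> I" "j \<in> I"
  shows "smooth_on S (\<lambda>x. p x i j)"
proof -
  have diff: "p y i j - p x i j = (\<Sum>a\<in>I. \<Sum>b\<in>I. p y i a * ((w x a b - w y a b) * p x b j))"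
    if "x \<in> S" "y \<in> S" "i \<in> I" "j \<in> I" for x y i j
  proof -
    have "(\<Sum>a\<in>I. \<Sum>b\<in>I. p y i a * ((w x a b - w y a b) * p x b j)) =
        (\<Sum>a\<in>I. p y i a * (\<Sum>b\<in>I. w x a b * p x b j)) - (\<Sum>b\<in>I. (\<Sum>a\<in>I. p y i a * w y a b) * p x b j)"
      by (subst sum.swap[of _ I I, where g="\<lambda>b a. p y i a * w y a b * p x b j" for b, simplified sum_distrib_right[symmetric]])?
        (simp add: sum_distrib_left sum_distrib_right sum_subtractf left_diff_distrib right_diff_distrib mult.assoc
          sum.swap[of "\<lambda>a b. p y i a * (w y a b * p x b j)" I I])
    also have "\<dots> = p y i j - p x i j"
      using that I by (simp add: pw wp if_distrib if_distribR cong: if_cong)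
    finally show ?thesis by simp
  qed
  have cont: "isCont (\<lambda>x. p x i j) x" if "x \<in> S" "i \<in> I" "j \<in> I" for x i j
  proof (rule inverse_matrix_continuous[where w = w, OF S that(1) I that(2,3)])
    show "isCont (\<lambda>x. w x i j) x" if "i \<in> I" "j \<in> I" for i j
      using smooth_on_imp_differentiable[OF w[OF that] \<open>x \<in> S\<close>] by (rule differentiable_imp_continuous_within)
  qed (rule diff)
  let ?D = "\<lambda>x i j v. \<Sum>a\<in>I. \<Sum>b\<in>I. p x i a * (- frechet_derivative (\<lambda>y. w y a b) (at x) v * p x b j)"
  have deriv: "((\<lambda>y. p y i j) has_derivative ?D x i j) (at x)" if "x \<in> S" "i \<in> I" "j \<in> I" for x i j
  proof -
    have "((\<lambda>y. p x i j + (\<Sum>a\<in>I. \<Sum>b\<in>I. p y i a * ((w x a b - w y a b) * p x b j)))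
        has_derivative (\<lambda>v. 0 + ?D x i j v)) (at x)"
    proof (intro has_derivative_add has_derivative_const has_derivative_sum has_derivative_mult_vanishing cont that)
      fix a b assume ab: "a \<in> I" "b \<in> I"
      have "((\<lambda>y. w y a b) has_derivative frechet_derivative (\<lambda>y. w y a b) (at x)) (at x)"
        using smooth_on_imp_differentiable[OF w[OF ab] that(1)] by (rule has_frechet_derivative)
      from has_derivative_mult_left[OF has_derivative_diff[OF has_derivative_const this]]
      show "((\<lambda>y. (w x a b - w y a b) * p x b j) has_derivative
          (\<lambda>v. - frechet_derivative (\<lambda>y. w y a b) (at x) v * p x b j)) (at x)" by simp
    qed simp_all
    then show ?thesis
      by (rule has_derivative_transform_within_open[OF _ S that(1), THEN has_derivative_eq_rhs])
        (use diff[OF that(1) _ that(2,3)] in \<open>auto simp: algebra_simps\<close>)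
  qed
  have "\<forall>i\<in>I. \<forall>j\<in>I. Ck_on k S (\<lambda>x. p x i j)" for k
  proof (induction k)
    case 0
    then show ?case using cont by (simp add: continuous_at_imp_continuous_on)
  next
    case (Suc k)
    have "Ck_on k S (\<lambda>x. frechet_derivative (\<lambda>x. p x i j) (at x) v)" if ij: "i \<in> I" "j \<in> I" for i j v
    proof (rule iffD1[OF Ck_on_cong[OF S]])
      show "Ck_on k S (\<lambda>x. ?D x i j v)"
      proof (intro Ck_on_sum Ck_on_mult S)
        fix a b assume ab: "a \<in> I" "b \<in> I"
        show "Ck_on k S (\<lambda>x. p x i a)" "Ck_on k S (\<lambda>x. p x b j)" using Suc ij ab by auto
        show "Ck_on k S (\<lambda>x. - frechet_derivative (\<lambda>y. w y a b) (at x) v)"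
          using smooth_on_minus[OF S smooth_on_frechet_derivative[OF w[OF ab]]] by (simp add: smooth_on_def)
      qed
      show "?D x i j v = frechet_derivative (\<lambda>x. p x i j) (at x) v" if "x \<in> S" for x
        by (rule fun_cong[OF frechet_derivative_at[OF deriv[OF that ij]]])
    qed
    with deriv show ?case by (auto simp: differentiable_def)
  qed
  with ij show ?thesis by (simp add: smooth_on_def)
qed

section \<open>The exterior product at a point\<close>

text \<open>Forms are functions, but they are treated as elements of a vector space. Sums and multiples of them
are evaluated at arguments only on request, by \<open>fun_apply\<close>.\<close>

declare plus_fun_apply zero_fun_apply times_fun_apply one_fun_apply minus_apply uminus_apply [simp del]

lemma scaleR_fun_apply: "(r *\<^sub>R f) x = r *\<^sub>R f x"
  by (simp add: scaleR_fun_def)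

lemmas fun_apply = plus_fun_apply zero_fun_apply minus_apply uminus_apply scaleR_fun_apply

lemma sum_fun_apply: "(\<Sum>i\<in>I. f i) x = (\<Sum>i\<in>I. f i x)"
  by (induction I rule: infinite_finite_induct) (simp_all add: fun_apply)

definition interior_prod :: "'b \<Rightarrow> ('b list \<Rightarrow> real) \<Rightarrow> 'b list \<Rightarrow> real"
  where "interior_prod v a = (\<lambda>vs. a (v # vs))"

definition grade_sign :: "('b list \<Rightarrow> real) \<Rightarrow> 'b list \<Rightarrow> real"
  where "grade_sign a = (\<lambda>vs. (- 1) ^ length vs * a vs)"

text \<open>The pointwise wedge product (\<open>wedge_eq_ext_prod\<close>) is the signed shuffle product, an associative product
on all functions on lists, alternating or not.\<close>

definition ext_prod :: "('b list \<Rightarrow> real) \<Rightarrow> ('b list \<Rightarrow> real) \<Rightarrow> 'b list \<Rightarrow> real"  (infixl \<open>\<odot>\<close> 70)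
  where "a \<odot> b = (\<lambda>vs. \<Sum>p\<le>length vs. shuffle_sum p (length vs - p) (\<lambda>x y. a x * b y) vs)"

lemma wedge_eq_ext_prod: "wedge \<alpha> \<beta> c x = \<alpha> c x \<odot> \<beta> c x"
  by (simp add: wedge_def ext_prod_def shuffle_sum_def mult.assoc)

lemma interior_prod_linear [simp]:
  "interior_prod v (a + b) = interior_prod v a + interior_prod v b"
  "interior_prod v (a - b) = interior_prod v a - interior_prod v b"
  "interior_prod v (- a) = - interior_prod v a"
  "interior_prod v (r *\<^sub>R a) = r *\<^sub>R interior_prod v a"
  "interior_prod v 0 = 0"
  by (auto simp: interior_prod_def fun_eq_iff fun_apply scaleR_fun_apply)

lemma grade_sign_linear [simp]:
  "grade_sign (a + b) = grade_sign a + grade_sign b"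
  "grade_sign (a - b) = grade_sign a - grade_sign b"
  "grade_sign (- a) = - grade_sign a"
  "grade_sign (r *\<^sub>R a) = r *\<^sub>R grade_sign a"
  "grade_sign 0 = 0"
  "grade_sign (grade_sign a) = a"
  by (auto simp: grade_sign_def fun_eq_iff fun_apply scaleR_fun_apply algebra_simps power_mult_distrib[symmetric] simp flip: mult.assoc)

lemma interior_prod_grade_sign [simp]: "interior_prod v (grade_sign a) = - grade_sign (interior_prod v a)"
  by (auto simp: interior_prod_def grade_sign_def fun_eq_iff fun_apply)

lemma ext_prod_Nil [simp]: "(a \<odot> b) [] = a [] * b []"
  by (simp add: ext_prod_def shuffle_sum_0_left)

text \<open>This is the shuffle recursion: the head of the list is an argument of \<open>a\<close>, or it passes all arguments
of \<open>a\<close> and is one of \<open>b\<close>. Together with the value on the empty list it determines the product, and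
bilinearity, associativity and compatibility with pullback follow by induction on the list.\<close>

lemma interior_prod_ext_prod:
  fixes a b :: "'b list \<Rightarrow> real"
  shows
  "interior_prod v (a \<odot> b) = interior_prod v a \<odot> b + grade_sign a \<odot> interior_prod v b"
proof
  fix vs :: "'b list"
  let ?m = "length vs"
  let ?G = "\<lambda>x y. a x * b y :: real"
  let ?F = "\<lambda>p. shuffle_sum p (?m - p) (\<lambda>x y. a (v # x) * b y) vs"
  let ?H = "\<lambda>p. (- 1) ^ p * shuffle_sum p (?m - p) (\<lambda>x y. a x * b (v # y)) vs"
  have mid: "shuffle_sum (Suc p) (Suc ?m - Suc p) ?G (v # vs) = ?F p + ?H (Suc p)" if "p < ?m" for p
  proof -
    obtain q where q: "?m - p = Suc q" using \<open>p < ?m\<close> by (metis Suc_diff_Suc)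
    then have "?m = Suc (p + q)" "?m - Suc p = q" by auto
    then show ?thesis using shuffle_sum_Cons[of vs p q ?G v] q by simp
  qed
  have "interior_prod v (a \<odot> b) vs =
      shuffle_sum 0 (Suc ?m) ?G (v # vs) + (\<Sum>p\<le>?m. shuffle_sum (Suc p) (Suc ?m - Suc p) ?G (v # vs))"
    by (simp only: ext_prod_def interior_prod_def list.size sum.atMost_Suc_shift diff_zero add_0_right add_Suc_right)
  also have "(\<Sum>p\<le>?m. shuffle_sum (Suc p) (Suc ?m - Suc p) ?G (v # vs)) =
      (\<Sum>p<?m. ?F p + ?H (Suc p)) + shuffle_sum (Suc ?m) 0 ?G (v # vs)"
    by (simp add: sum.lessThan_Suc[of _ ?m, unfolded lessThan_Suc_atMost] mid[simplified])
  also have "shuffle_sum (Suc ?m) 0 ?G (v # vs) = ?F ?m" by (simp add: shuffle_sum_0_right)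
  also have "shuffle_sum 0 (Suc ?m) ?G (v # vs) = ?H 0" by (simp add: shuffle_sum_0_left)
  also have "?H 0 + ((\<Sum>p<?m. ?F p + ?H (Suc p)) + ?F ?m) = (\<Sum>p\<le>?m. ?F p) + (\<Sum>p\<le>?m. ?H p)"
    unfolding sum.distrib sum.lessThan_Suc_shift[of ?H ?m, unfolded lessThan_Suc_atMost]
      sum.lessThan_Suc[of ?F ?m, unfolded lessThan_Suc_atMost] by simp
  also have "(\<Sum>p\<le>?m. ?H p) = (grade_sign a \<odot> interior_prod v b) vs"
    unfolding ext_prod_def
  proof (rule sum.cong, rule refl)
    fix p assume "p \<in> {..?m}"
    then show "?H p = shuffle_sum p (?m - p) (\<lambda>x y. grade_sign a x * interior_prod v b y) vs"
      by (simp add: shuffle_sum_def grade_sign_def interior_prod_def sum_distrib_left min_def mult_ac)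
  qed
  finally show "interior_prod v (a \<odot> b) vs = (interior_prod v a \<odot> b + grade_sign a \<odot> interior_prod v b) vs"
    by (simp add: ext_prod_def interior_prod_def fun_apply)
qed

lemma ext_prod_Cons: "(a \<odot> b) (v # vs) = (interior_prod v a \<odot> b) vs + (grade_sign a \<odot> interior_prod v b) vs"
  using interior_prod_ext_prod[of v a b] by (metis interior_prod_def plus_fun_apply)

lemma eq_by_interior_prod:
  assumes "a [] = b []" "\<And>v. interior_prod v a = interior_prod v b"
  shows "a = b"
proof
  fix vs show "a vs = b vs"
    using assms by (cases vs) (auto simp: interior_prod_def fun_eq_iff fun_apply)
qed

lemma ext_prod_add_left: "(a + b) \<odot> c = a \<odot> c + b \<odot> c"
proof
  fix vs show "((a + b) \<odot> c) vs = (a \<odot> c + b \<odot> c) vs"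
    by (induction vs arbitrary: a b c) (simp_all add: ext_prod_Cons fun_apply algebra_simps)
qed

lemma ext_prod_add_right: "c \<odot> (a + b) = c \<odot> a + c \<odot> b"
proof
  fix vs show "(c \<odot> (a + b)) vs = (c \<odot> a + c \<odot> b) vs"
    by (induction vs arbitrary: a b c) (simp_all add: ext_prod_Cons fun_apply algebra_simps)
qed

lemma ext_prod_scaleR_left: "(r *\<^sub>R a) \<odot> c = r *\<^sub>R (a \<odot> c)"
proof
  fix vs show "((r *\<^sub>R a) \<odot> c) vs = (r *\<^sub>R (a \<odot> c)) vs"
    by (induction vs arbitrary: a c) (simp_all add: ext_prod_Cons fun_apply algebra_simps scaleR_fun_apply)
qed

lemma ext_prod_scaleR_right: "c \<odot> (r *\<^sub>R a) = r *\<^sub>R (c \<odot> a)"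
proof
  fix vs show "(c \<odot> (r *\<^sub>R a)) vs = (r *\<^sub>R (c \<odot> a)) vs"
    by (induction vs arbitrary: a c) (simp_all add: ext_prod_Cons fun_apply algebra_simps scaleR_fun_apply)
qed

lemma bilinear_ext_prod: "bilinear (\<odot>)"
  by (auto simp: bilinear_def intro!: linearI ext_prod_add_left ext_prod_add_right ext_prod_scaleR_left ext_prod_scaleR_right)

lemmas ext_prod_zero_left [simp] = bilinear_lzero[OF bilinear_ext_prod]
  and ext_prod_zero_right [simp] = bilinear_rzero[OF bilinear_ext_prod]
  and ext_prod_minus_left = bilinear_lneg[OF bilinear_ext_prod]
  and ext_prod_minus_right = bilinear_rneg[OF bilinear_ext_prod]
  and ext_prod_diff_left = bilinear_lsub[OF bilinear_ext_prod]
  and ext_prod_diff_right = bilinear_rsub[OF bilinear_ext_prod]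

lemma ext_prod_sum_right: "c \<odot> (\<Sum>i\<in>I. f i) = (\<Sum>i\<in>I. c \<odot> f i)"
  by (rule linear_sum[OF bilinear_ext_prod[unfolded bilinear_def, THEN conjunct1, rule_format]])

lemma interior_prod_sum: "interior_prod v (\<Sum>i\<in>I. f i) = (\<Sum>i\<in>I. interior_prod v (f i))"
  using linear_sum[of "interior_prod v" f I] by (simp add: linear_iff)

lemma grade_sign_ext_prod [simp]: "grade_sign (a \<odot> b) = grade_sign a \<odot> grade_sign b"
proof
  fix vs show "grade_sign (a \<odot> b) vs = (grade_sign a \<odot> grade_sign b) vs"
  proof (induction vs arbitrary: a b)
    case Nil
    then show ?case by (simp add: grade_sign_def)
  next
    case (Cons v vs)
    have "grade_sign (a \<odot> b) (v # vs) = - (grade_sign (interior_prod v (a \<odot> b)) vs)"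
      by (simp add: grade_sign_def interior_prod_def)
    also have "\<dots> = (grade_sign a \<odot> grade_sign b) (v # vs)"
      by (simp add: interior_prod_ext_prod ext_prod_Cons Cons.IH ext_prod_minus_left ext_prod_minus_right fun_apply)
    finally show ?case .
  qed
qed

lemma ext_prod_assoc: "(a \<odot> b) \<odot> c = a \<odot> (b \<odot> c)"
proof
  fix vs show "((a \<odot> b) \<odot> c) vs = (a \<odot> (b \<odot> c)) vs"
    by (induction vs arbitrary: a b c)
      (simp_all add: ext_prod_Cons fun_apply interior_prod_ext_prod ext_prod_add_left ext_prod_add_right)
qed

section \<open>Elements of a given degree\<close>

definition has_grade :: "nat \<Rightarrow> ('b list \<Rightarrow> real) \<Rightarrow> bool"
  where "has_grade k a \<longleftrightarrow> (\<forall>vs. length vs \<noteq> k \<longrightarrow> a vs = 0)"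

lemma has_grade_interior_prod: "has_grade (Suc k) a \<Longrightarrow> has_grade k (interior_prod v a)"
  by (simp add: has_grade_def interior_prod_def)

lemma grade_sign_has_grade: "has_grade k a \<Longrightarrow> grade_sign a = (- 1) ^ k *\<^sub>R a"
  by (auto simp: has_grade_def grade_sign_def fun_eq_iff scaleR_fun_apply)

lemma interior_prod_scalar: "has_grade 0 a \<Longrightarrow> interior_prod v a = 0"
  by (simp add: has_grade_def interior_prod_def fun_eq_iff fun_apply)

lemma ext_prod_scalar_left: "has_grade 0 a \<Longrightarrow> a \<odot> b = a [] *\<^sub>R b"
proof
  fix vs assume a: "has_grade 0 a"
  show "(a \<odot> b) vs = (a [] *\<^sub>R b) vs"
    using a
    by (induction vs arbitrary: b)
      (simp_all add: ext_prod_Cons fun_apply interior_prod_scalar grade_sign_has_grade scaleR_fun_apply, simp add: interior_prod_def)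
qed

lemma ext_prod_scalar_right: "has_grade 0 a \<Longrightarrow> b \<odot> a = a [] *\<^sub>R b"
proof
  fix vs assume a: "has_grade 0 a"
  show "(b \<odot> a) vs = (a [] *\<^sub>R b) vs"
    using a
    by (induction vs arbitrary: b)
      (simp_all add: ext_prod_Cons fun_apply interior_prod_scalar scaleR_fun_apply, simp add: interior_prod_def)
qed

lemma interior_prod_covector_ext_prod:
  assumes "has_grade 1 \<theta>"
  shows "interior_prod v (\<theta> \<odot> b) = \<theta> [v] *\<^sub>R b - \<theta> \<odot> interior_prod v b"
  using has_grade_interior_prod[of 0 \<theta> v] assms
  by (simp add: interior_prod_ext_prod grade_sign_has_grade[OF assms] ext_prod_scalar_left ext_prod_minus_left)
    (simp add: interior_prod_def)

lemma covector_ext_prod_commute: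
  assumes "has_grade 1 \<theta>" "has_grade 1 \<eta>"
  shows "\<theta> \<odot> \<eta> = - (\<eta> \<odot> \<theta>)"
proof (rule eq_by_interior_prod)
  show "(\<theta> \<odot> \<eta>) [] = (- (\<eta> \<odot> \<theta>)) []" using assms by (simp add: has_grade_def fun_apply)
  fix v
  have "has_grade 0 (interior_prod v \<theta>)" "has_grade 0 (interior_prod v \<eta>)"
    using assms by (simp_all add: has_grade_interior_prod)
  then show "interior_prod v (\<theta> \<odot> \<eta>) = interior_prod v (- (\<eta> \<odot> \<theta>))"
    using assms
    by (simp add: interior_prod_covector_ext_prod ext_prod_scalar_right) (simp add: interior_prod_def)
qed

section \<open>Alternating elements\<close>

definition alternating :: "('b::real_vector list \<Rightarrow> real) \<Rightarrow> bool"
  where "alternating a \<longleftrightarrow> (\<forall>k. alternating_form k a)"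

lemma alternating_linear: "alternating a \<Longrightarrow> linear (\<lambda>v. a (v # vs))"
  unfolding alternating_def alternating_form_def
  by (drule spec[of _ "Suc (length vs)"], drule conjunct1, drule spec[of _ "0 # vs"], drule spec[of _ 0]) simp

lemma alternating_same: "alternating a \<Longrightarrow> a (v # v # vs) = 0"
  unfolding alternating_def alternating_form_def
  by (drule spec[of _ "Suc (Suc (length vs))"], drule conjunct2, drule spec[of _ "v # v # vs"],
      drule spec[of _ 0], drule spec[of _ 1]) simp

lemma alternating_interior_prod: "alternating a \<Longrightarrow> alternating (interior_prod v a)"
  unfolding alternating_def
proof
  fix k assume a: "\<forall>k. alternating_form k a"
  show "alternating_form k (interior_prod v a)"
    unfolding alternating_form_def interior_prod_def
  proof (intro conjI allI impI)
    fix vs :: "'a list" and i assume "length vs = k \<and> i < k"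
    then show "linear (\<lambda>u. a (v # vs[i := u]))"
      using a[unfolded alternating_form_def, rule_format, of "Suc k", THEN conjunct1, rule_format, of "v # vs" "Suc i"] by simp
  next
    fix vs :: "'a list" and i j assume "length vs = k \<and> i < j \<and> j < k \<and> vs ! i = vs ! j"
    then show "a (v # vs) = 0"
      using a[unfolded alternating_form_def, rule_format, of "Suc k", THEN conjunct2, rule_format, of "v # vs" "Suc i" "Suc j"] by simp
  qed
qed

lemma skew_if_diagonal_zero:
  fixes f :: "'b::real_vector \<Rightarrow> 'b \<Rightarrow> real"
  assumes "\<And>w. linear (\<lambda>u. f u w)" "\<And>w. linear (f w)" "\<And>u. f u u = 0"
  shows "f u v = - f v u"
  using assms(3)[of "u + v"] assms(3)[of u] assms(3)[of v]
    linear_add[OF assms(1)[of "u + v"], of u v] linear_add[OF assms(2)[of u], of u v] linear_add[OF assms(2)[of v], of u v]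
  by simp

text \<open>Alternation in general position reduces to the first two positions and to the contractions of \<open>a\<close>:
if the first argument equals a later one, exchanging the first two arguments moves the equal pair into
a contraction.\<close>

lemma alternating_form_SucI:
  assumes lin: "\<And>vs. length vs = k \<Longrightarrow> linear (\<lambda>v. a (v # vs))"
    and same: "\<And>v vs. Suc (length vs) = k \<Longrightarrow> a (v # v # vs) = 0"
    and tail: "\<And>v. alternating_form k (interior_prod v a)"
  shows "alternating_form (Suc k) a"
  unfolding alternating_form_def
proof (intro conjI allI impI)
  fix vs :: "'a list" and i assume i: "length vs = Suc k \<and> i < Suc k"
  then obtain u us where vs: "vs = u # us" "length us = k" by (cases vs) auto
  show "linear (\<lambda>v. a (vs[i := v]))"
  proof (cases i)
    case 0
    then show ?thesis using lin vs by simp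
  next
    case (Suc i')
    then show ?thesis
      using tail[of u, unfolded alternating_form_def, THEN conjunct1, rule_format, of us i'] i vs
      by (simp add: interior_prod_def)
  qed
next
  fix vs :: "'a list" and i j assume ij: "length vs = Suc k \<and> i < j \<and> j < Suc k \<and> vs ! i = vs ! j"
  then obtain u us j' where vs: "vs = u # us" "length us = k" "j = Suc j'"
    by (cases vs; cases j) auto
  have tail0: "a (v # us') = 0" if "length us' = k" "i' < j'" "j' < k" "us' ! i' = us' ! j'" for v us' i' j'
    using tail[of v, unfolded alternating_form_def, THEN conjunct2, rule_format, of us' i' j'] that
    by (simp add: interior_prod_def)
  show "a vs = 0"
  proof (cases i)
    case (Suc i')
    then show ?thesis using tail0[of us i' j' u] ij vs by simp
  next
    case 0
    then obtain w ws where us: "us = w # ws" using ij vs by (cases us) auto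
    have len: "Suc (length ws) = k" using us vs by simp
    have lin2: "linear (\<lambda>v. a (x # v # ws))" for x
      using tail[of x, unfolded alternating_form_def, THEN conjunct1, rule_format, of us 0] vs us len
      by (simp add: interior_prod_def)
    have sk: "a (x # y # ws) = - a (y # x # ws)" for x y
      by (rule skew_if_diagonal_zero[where f = "\<lambda>x y. a (x # y # ws)"]) (use lin lin2 same len in auto)
    show ?thesis
    proof (cases j')
      case 0
      have "w = u" using ij unfolding \<open>i = 0\<close> vs us 0 by simp
      then show ?thesis using vs us same[of ws w] len by simp
    next
      case (Suc j'')
      then have "a (w # u # ws) = 0"
        using tail0[of "u # ws" 0 j' w] \<open>i = 0\<close> ij vs us len by simp
      then show ?thesis using sk[of u w] vs us by simp
    qed
  qed
qed

lemma alternating_form_0: "alternating_form 0 a"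
  by (simp add: alternating_form_def)

lemma alternatingI:
  assumes "\<And>vs. linear (\<lambda>v. a (v # vs))" "\<And>v vs. a (v # v # vs) = 0" "\<And>v. alternating (interior_prod v a)"
  shows "alternating a"
  unfolding alternating_def
proof
  fix k show "alternating_form k a"
    using assms by (cases k) (auto simp: alternating_form_0 alternating_def intro: alternating_form_SucI)
qed

lemma alternating_swap: "alternating a \<Longrightarrow> a (u # v # vs) = - a (v # u # vs)"
  using alternating_linear alternating_same alternating_linear[OF alternating_interior_prod]
  by (intro skew_if_diagonal_zero[where f = "\<lambda>x y. a (x # y # vs)"]) (auto simp: interior_prod_def)

lemma interior_prod_swap: "alternating a \<Longrightarrow> interior_prod u (interior_prod v a) = - interior_prod v (interior_prod u a)"
  using alternating_swap[of a v u] by (auto simp: interior_prod_def fun_eq_iff fun_apply)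

lemma alternating_zero [simp]: "alternating 0"
  by (auto simp: alternating_def alternating_form_def zero_fun_apply intro!: linearI)

lemma alternating_form_linear_combination:
  assumes "alternating_form k a" "alternating_form k b"
  shows "alternating_form k (r *\<^sub>R a + b)"
  unfolding alternating_form_def
proof (intro conjI allI impI)
  fix vs :: "'a list" and i assume "length vs = k \<and> i < k"
  then have "linear (\<lambda>v. a (vs[i := v]))" "linear (\<lambda>v. b (vs[i := v]))"
    using assms by (auto simp: alternating_form_def)
  then show "linear (\<lambda>v. (r *\<^sub>R a + b) (vs[i := v]))"
    unfolding fun_apply by (intro linear_compose_add linear_compose_scale_right)
next
  fix vs :: "'a list" and i j assume "length vs = k \<and> i < j \<and> j < k \<and> vs ! i = vs ! j"
  then have "a vs = 0" "b vs = 0" using assms unfolding alternating_form_def by blast+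
  then show "(r *\<^sub>R a + b) vs = 0" by (simp add: fun_apply)
qed

lemma alternating_add: "alternating a \<Longrightarrow> alternating b \<Longrightarrow> alternating (a + b)"
  using alternating_form_linear_combination[of _ a b 1] by (simp add: alternating_def)

lemma alternating_scaleR: "alternating a \<Longrightarrow> alternating (r *\<^sub>R a)"
  using alternating_form_linear_combination[of _ a 0 r] alternating_zero[unfolded alternating_def]
  by (auto simp: alternating_def)

lemma alternating_sum: "(\<And>i. i \<in> I \<Longrightarrow> alternating (f i)) \<Longrightarrow> alternating (\<Sum>i\<in>I. f i)"
  by (induction I rule: infinite_finite_induct) (auto intro: alternating_add)

lemma alternating_grade_sign:
  assumes "alternating a" shows "alternating (grade_sign a)"
proof -
  have "alternating_form k (grade_sign a) = alternating_form k ((- 1) ^ k *\<^sub>R a)" for k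
    by (auto simp: alternating_form_def grade_sign_def scaleR_fun_apply)
  with alternating_scaleR[OF assms] show ?thesis by (simp add: alternating_def)
qed

lemma linear_interior_prod:
  assumes "alternating a"
  shows "interior_prod (u + v) a = interior_prod u a + interior_prod v a"
    and "interior_prod (r *\<^sub>R v) a = r *\<^sub>R interior_prod v a"
  using linear_add[OF alternating_linear[OF assms]] linear_scale[OF alternating_linear[OF assms]]
  by (auto simp: interior_prod_def fun_eq_iff fun_apply scaleR_fun_apply)

lemma alternating_ext_prod:
  assumes "alternating a" "alternating b"
  shows "alternating (a \<odot> b)"
  unfolding alternating_def
proof
  fix k show "alternating_form k (a \<odot> b)"
    using assms
  proof (induction k arbitrary: a b)
    case 0
    then show ?case by (simp add: alternating_form_0)
  next
    case (Suc k)
    note al = alternating_interior_prod alternating_grade_sign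
    show ?case
    proof (rule alternating_form_SucI)
      fix vs :: "'a list"
      show "linear (\<lambda>v. (a \<odot> b) (v # vs))"
        by (rule linearI)
          (simp_all add: ext_prod_Cons fun_apply linear_interior_prod Suc.prems ext_prod_add_left ext_prod_add_right
            ext_prod_scaleR_left ext_prod_scaleR_right fun_apply algebra_simps)
      have i0: "interior_prod v (interior_prod v c) = 0" if "alternating c" for v :: 'a and c
        using alternating_same[OF that] by (simp add: interior_prod_def fun_eq_iff fun_apply)
      have "interior_prod v (interior_prod v (a \<odot> b)) = 0" for v
        by (simp add: interior_prod_ext_prod i0 Suc.prems ext_prod_minus_left)
      then show "(a \<odot> b) (v # v # vs) = 0" for v
        by (simp add: interior_prod_def fun_eq_iff fun_apply)
      show "alternating_form k (interior_prod v (a \<odot> b))" for v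
        using alternating_form_linear_combination[of k _ _ 1] Suc.IH[of "interior_prod v a" b]
          Suc.IH[of "grade_sign a" "interior_prod v b"] al Suc.prems
        unfolding interior_prod_ext_prod by fastforce
    qed
  qed
qed

lemma linear_interior_prod_vector: "alternating a \<Longrightarrow> linear (\<lambda>v. interior_prod v a)"
  by (rule linearI) (simp_all add: linear_interior_prod)

lemma sum_Basis_linear: "linear f \<Longrightarrow> (\<Sum>e\<in>Basis. (v \<bullet> e) *\<^sub>R f e) = f v"
  for f :: "'b::euclidean_space \<Rightarrow> 'v::real_vector"
  using linear_sum[of f "\<lambda>e. (v \<bullet> e) *\<^sub>R e" Basis] by (simp add: linear_scale euclidean_representation)

definition dual_covector :: "'b::euclidean_space \<Rightarrow> 'b list \<Rightarrow> real"
  where "dual_covector e vs = (case vs of [v] \<Rightarrow> v \<bullet> e | _ \<Rightarrow> 0)"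

lemma has_grade_dual_covector: "has_grade 1 (dual_covector e)"
  by (auto simp: has_grade_def dual_covector_def split: list.split)

text \<open>Euler's identity \<open>\<Sum>\<^sub>e e\<^sup>* \<and> \<iota>\<^sub>e a = (deg a) a\<close>. It serves twice: it produces the degree in the commutator
of \<open>\<Lambda>\<close> and \<open>L\<close>, and it writes a \<open>k\<close>-form as a sum of products of one-forms with \<open>(k - 1)\<close>-forms.\<close>

lemma sum_dual_covector_interior_prod:
  fixes a :: "'b::euclidean_space list \<Rightarrow> real"
  assumes "alternating a"
  shows "(\<Sum>e\<in>Basis. dual_covector e \<odot> interior_prod e a) = (\<lambda>vs. real (length vs) * a vs)"
proof
  fix vs show "(\<Sum>e\<in>Basis. dual_covector e \<odot> interior_prod e a) vs = real (length vs) * a vs"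
    using assms
  proof (induction vs arbitrary: a)
    case Nil
    then show ?case by (simp add: sum_fun_apply dual_covector_def)
  next
    case (Cons v vs)
    let ?S = "\<lambda>a. \<Sum>e\<in>Basis. dual_covector e \<odot> interior_prod e a"
    have "interior_prod v (?S a) =
        (\<Sum>e\<in>Basis. (v \<bullet> e) *\<^sub>R interior_prod e a - dual_covector e \<odot> interior_prod v (interior_prod e a))"
      unfolding interior_prod_sum interior_prod_covector_ext_prod[OF has_grade_dual_covector]
      by (simp add: dual_covector_def)
    also have "\<dots> = interior_prod v a + ?S (interior_prod v a)"
      unfolding sum_subtractf sum_Basis_linear[OF linear_interior_prod_vector[OF Cons.prems]]
      by (simp add: interior_prod_swap[OF Cons.prems, of v] ext_prod_minus_right sum_negf)
    finally have "?S a (v # vs) = (interior_prod v a + ?S (interior_prod v a)) vs"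
      by (metis interior_prod_def)
    also have "\<dots> = real (length (v # vs)) * a (v # vs)"
      using Cons.IH[OF alternating_interior_prod[OF Cons.prems], of v]
      by (simp add: fun_apply interior_prod_def algebra_simps)
    finally show ?case .
  qed
qed

section \<open>Contraction with a bivector\<close>

text \<open>Contraction with the bivector that has the components \<open>h e \<bullet> e'\<close>, where \<open>e\<close> and \<open>e'\<close> run through the
standard basis.\<close>

definition bivector_contraction :: "('b::euclidean_space \<Rightarrow> 'b) \<Rightarrow> ('b list \<Rightarrow> real) \<Rightarrow> 'b list \<Rightarrow> real"
  where "bivector_contraction h a = (1 / 2) *\<^sub>R (\<Sum>e\<in>Basis. interior_prod (h e) (interior_prod e a))"

definition skew_map :: "('b::euclidean_space \<Rightarrow> 'b) \<Rightarrow> bool"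
  where "skew_map h \<longleftrightarrow> linear h \<and> (\<forall>u v. h u \<bullet> v = - (h v \<bullet> u))"

text \<open>Expanding \<open>h e\<close> in the basis, the two sides differ by a transposition of the matrix of \<open>h\<close>.\<close>

lemma skew_map_trace:
  fixes \<Phi> :: "'b::euclidean_space \<Rightarrow> 'b \<Rightarrow> 'v::real_vector"
  assumes "skew_map h" "bilinear \<Phi>"
  shows "(\<Sum>e\<in>Basis. \<Phi> e (h e)) = - (\<Sum>e\<in>Basis. \<Phi> (h e) e)"
proof -
  have l: "linear (\<Phi> u)" "linear (\<lambda>u. \<Phi> u v)" for u v using assms(2) by (auto simp: bilinear_def)
  have "(\<Sum>e\<in>Basis. \<Phi> e (h e)) = (\<Sum>e\<in>Basis. \<Sum>f\<in>Basis. (h e \<bullet> f) *\<^sub>R \<Phi> e f)"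
    by (simp add: sum_Basis_linear[OF l(1)])
  also have "\<dots> = (\<Sum>f\<in>Basis. \<Sum>e\<in>Basis. (h e \<bullet> f) *\<^sub>R \<Phi> e f)"
    by (rule sum.swap)
  also have "\<dots> = (\<Sum>f\<in>Basis. - (\<Sum>e\<in>Basis. (h f \<bullet> e) *\<^sub>R \<Phi> e f))"
  proof -
    have "h e \<bullet> f = - (h f \<bullet> e)" for e f using assms(1) unfolding skew_map_def by blast
    then have "(h e \<bullet> f) *\<^sub>R \<Phi> e f = - ((h f \<bullet> e) *\<^sub>R \<Phi> e f)" for e f
      by (metis scaleR_minus_left)
    then show ?thesis by (simp only: sum_negf)
  qed
  also have "\<dots> = - (\<Sum>f\<in>Basis. \<Phi> (h f) f)"
    by (simp only: sum_Basis_linear[OF l(2)] sum_negf)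
  finally show ?thesis .
qed

text \<open>Both interior products are antiderivations. Of the resulting terms, the two in which one contraction
hits \<open>\<theta>\<close> and the other one \<open>a\<close> are equal by \<open>skew_map_trace\<close>, which absorbs the factor \<open>1 / 2\<close>.\<close>

lemma bivector_contraction_covector:
  fixes a \<theta> :: "'b::euclidean_space list \<Rightarrow> real"
  assumes h: "skew_map h" and a: "alternating a" and \<theta>: "alternating \<theta>" "has_grade 1 \<theta>"
  shows "bivector_contraction h (\<theta> \<odot> a) =
    \<theta> \<odot> bivector_contraction h a + interior_prod (\<Sum>e\<in>Basis. \<theta> [e] *\<^sub>R h e) a"
proof -
  note la = linear_interior_prod_vector[OF a] and lt = alternating_linear[OF \<theta>(1), of "[]"]
  have "bilinear (\<lambda>u v. \<theta> [v] *\<^sub>R interior_prod u a)"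
    by (auto simp: bilinear_def linear_add[OF la] linear_scale[OF la] linear_add[OF lt] linear_scale[OF lt]
        algebra_simps intro!: linearI)
  from skew_map_trace[OF h this]
  have tr: "(\<Sum>e\<in>Basis. \<theta> [h e] *\<^sub>R interior_prod e a) = - (\<Sum>e\<in>Basis. \<theta> [e] *\<^sub>R interior_prod (h e) a)" .
  have X: "interior_prod (\<Sum>e\<in>Basis. \<theta> [e] *\<^sub>R h e) a = (\<Sum>e\<in>Basis. \<theta> [e] *\<^sub>R interior_prod (h e) a)"
    by (simp add: linear_sum[OF la] linear_scale[OF la])
  have "interior_prod (h e) (interior_prod e (\<theta> \<odot> a)) =
      (\<theta> [e] *\<^sub>R interior_prod (h e) a - \<theta> [h e] *\<^sub>R interior_prod e a) + \<theta> \<odot> interior_prod (h e) (interior_prod e a)" for e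
    by (simp add: interior_prod_covector_ext_prod[OF \<theta>(2)])
  then show ?thesis
    unfolding bivector_contraction_def X
    by (simp add: sum.distrib sum_subtractf tr ext_prod_sum_right ext_prod_scaleR_right scaleR_add_right)
      (simp add: fun_eq_iff fun_apply)
qed

text \<open>By hypothesis \<open>\<iota>\<^sub>h\<^sub>e w = - e\<^sup>*\<close>. When \<open>\<iota>\<^sub>h\<^sub>e \<iota>\<^sub>e\<close> is applied to \<open>w \<and> a\<close> and summed over \<open>e\<close>, the term with both
contractions on \<open>w\<close> gives the dimension, and each of the two mixed terms gives minus the degree by
Euler's identity.\<close>

lemma bivector_contraction_symplectic:
  fixes a w :: "'b::euclidean_space list \<Rightarrow> real"
  assumes h: "skew_map h" and a: "alternating a" and w: "alternating w" "has_grade 2 w"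
    and wh: "\<And>u v. w [h u, v] = - (v \<bullet> u)"
  shows "bivector_contraction h (w \<odot> a) = w \<odot> bivector_contraction h a +
    (\<lambda>vs. (real DIM('b) / 2 - real (length vs)) * a vs)"
proof -
  note la = linear_interior_prod_vector[OF a] and lw = linear_interior_prod_vector[OF w(1)]
  have g1: "has_grade 1 (interior_prod e w)" for e
    using has_grade_interior_prod[of 1 w] w(2) by (simp add: numeral_2_eq_2)
  have iw: "interior_prod (h e) w = - dual_covector e" for e
  proof
    fix vs :: "'b list"
    show "interior_prod (h e) w vs = (- dual_covector e) vs"
      using w(2) wh[of e]
      by (cases vs; cases "tl vs") (auto simp: interior_prod_def dual_covector_def has_grade_def fun_apply)
  qed
  have one: "interior_prod (h e) (interior_prod e w) \<odot> a = a" if "e \<in> Basis" for e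
  proof -
    have "has_grade 0 (interior_prod (h e) (interior_prod e w))"
      using has_grade_interior_prod[of 0 "interior_prod e w"] g1 by simp
    moreover have "interior_prod (h e) (interior_prod e w) [] = 1"
      using alternating_swap[OF w(1), of e "h e" "[]"] wh[of e e] that
      by (simp add: interior_prod_def)
    ultimately show ?thesis by (simp add: ext_prod_scalar_left)
  qed
  have expand: "interior_prod (h e) (interior_prod e (w \<odot> a)) =
      a - interior_prod e w \<odot> interior_prod (h e) a - dual_covector e \<odot> interior_prod e a
      + w \<odot> interior_prod (h e) (interior_prod e a)" if "e \<in> Basis" for e
  proof -
    have ww: "grade_sign w = w" using grade_sign_has_grade[OF w(2)] by simp
    have ew: "grade_sign (interior_prod e w) = - interior_prod e w" using grade_sign_has_grade[OF g1] by simp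
    show ?thesis
      by (simp add: interior_prod_ext_prod ww ew one[OF that] iw ext_prod_minus_left)
  qed
  have "bilinear (\<lambda>u v. interior_prod u w \<odot> interior_prod v a)"
    by (auto simp: bilinear_def linear_add[OF la] linear_scale[OF la] linear_add[OF lw] linear_scale[OF lw]
        ext_prod_add_left ext_prod_add_right ext_prod_scaleR_left ext_prod_scaleR_right intro!: linearI)
  from skew_map_trace[OF h this]
  have tr: "(\<Sum>e\<in>Basis. interior_prod e w \<odot> interior_prod (h e) a) = (\<Sum>e\<in>Basis. dual_covector e \<odot> interior_prod e a)"
    by (simp add: iw ext_prod_minus_left sum_negf)
  let ?E = "\<lambda>vs. real (length vs) * a vs"
  have "(\<Sum>e\<in>Basis. interior_prod (h e) (interior_prod e (w \<odot> a))) =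
      (\<Sum>e\<in>Basis. a - interior_prod e w \<odot> interior_prod (h e) a - dual_covector e \<odot> interior_prod e a
      + w \<odot> interior_prod (h e) (interior_prod e a))"
    by (rule sum.cong[OF refl expand])
  also have "\<dots> = real DIM('b) *\<^sub>R a - ?E - ?E + (\<Sum>e\<in>Basis. w \<odot> interior_prod (h e) (interior_prod e a))"
    unfolding sum.distrib sum_subtractf tr sum_dual_covector_interior_prod[OF a] sum_constant_scaleR ..
  finally have total: "(\<Sum>e\<in>Basis. interior_prod (h e) (interior_prod e (w \<odot> a))) =
      real DIM('b) *\<^sub>R a - ?E - ?E + (\<Sum>e\<in>Basis. w \<odot> interior_prod (h e) (interior_prod e a))" .
  show ?thesis
    unfolding bivector_contraction_def total ext_prod_scaleR_right ext_prod_sum_right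
    by (auto simp: fun_eq_iff fun_apply field_simps)
qed

lemma alternating_bivector_contraction: "alternating a \<Longrightarrow> alternating (bivector_contraction h a)"
  unfolding bivector_contraction_def
  by (intro alternating_scaleR alternating_sum alternating_interior_prod)

section \<open>Pullback along a linear map\<close>

definition pullback :: "('b \<Rightarrow> 'c) \<Rightarrow> ('c list \<Rightarrow> real) \<Rightarrow> 'b list \<Rightarrow> real"
  where "pullback T a = (\<lambda>vs. a (map T vs))"

lemma interior_prod_pullback: "interior_prod v (pullback T a) = pullback T (interior_prod (T v) a)"
  by (simp add: interior_prod_def pullback_def)

lemma pullback_linear: "pullback T (a + b) = pullback T a + pullback T b" "pullback T (r *\<^sub>R a) = r *\<^sub>R pullback T a"
  by (auto simp: pullback_def fun_eq_iff fun_apply)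

lemma pullback_sum: "pullback T (\<Sum>i\<in>I. f i) = (\<Sum>i\<in>I. pullback T (f i))"
  by (simp add: pullback_def fun_eq_iff sum_fun_apply)

lemma grade_sign_pullback: "grade_sign (pullback T a) = pullback T (grade_sign a)"
  by (simp add: pullback_def grade_sign_def)

lemma pullback_ext_prod: "pullback T (a \<odot> b) = pullback T a \<odot> pullback T b"
proof
  fix vs show "pullback T (a \<odot> b) vs = (pullback T a \<odot> pullback T b) vs"
  proof (induction vs arbitrary: a b)
    case Nil
    then show ?case by (simp add: pullback_def)
  next
    case (Cons v vs)
    show ?case
      unfolding ext_prod_Cons interior_prod_pullback grade_sign_pullback Cons.IH[symmetric]
      by (simp add: pullback_def ext_prod_Cons)
  qed
qed

text \<open>The map \<open>h'\<close> describes the push-forward of the bivector of \<open>h\<close> along \<open>T\<close>.\<close>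

lemma bivector_contraction_pullback:
  fixes T :: "'b::euclidean_space \<Rightarrow> 'c::euclidean_space"
  assumes T: "linear T" and h: "linear h" and a: "alternating a"
    and h': "\<And>u. h' u = T (h (adjoint T u))"
  shows "bivector_contraction h (pullback T a) = pullback T (bivector_contraction h' a)"
proof -
  let ?\<Phi> = "\<lambda>u v. interior_prod v (interior_prod u a)"
  have la: "linear (\<lambda>u. ?\<Phi> u v)" for v
    using linear_interior_prod_vector[OF a] by (simp add: linear_iff)
  have lv: "linear (\<lambda>v. ?\<Phi> u (T (h v)))" for u
    using linear_interior_prod_vector[OF alternating_interior_prod[OF a]] T h
    by (simp add: linear_iff)
  have "(\<Sum>e\<in>Basis. ?\<Phi> (T e) (T (h e))) = (\<Sum>e\<in>Basis. \<Sum>f\<in>Basis. (T e \<bullet> f) *\<^sub>R ?\<Phi> f (T (h e)))"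
    by (simp add: sum_Basis_linear[OF la])
  also have "\<dots> = (\<Sum>f\<in>Basis. \<Sum>e\<in>Basis. (adjoint T f \<bullet> e) *\<^sub>R ?\<Phi> f (T (h e)))"
    by (subst sum.swap) (simp add: adjoint_works[OF T] inner_commute)
  also have "\<dots> = (\<Sum>f\<in>Basis. ?\<Phi> f (h' f))"
    by (simp add: sum_Basis_linear[OF lv] h')
  finally show ?thesis
    unfolding bivector_contraction_def interior_prod_pullback
    by (simp add: pullback_sum[symmetric] pullback_linear[symmetric])
qed

section \<open>The exterior derivative in a chart\<close>

lemma frechet_derivative_scaleR:
  fixes f :: "'a::real_normed_vector \<Rightarrow> real"
  shows "f differentiable at x \<Longrightarrow> frechet_derivative (\<lambda>y. r * f y) (at x) v = r * frechet_derivative f (at x) v"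
  by (rule frechet_derivative_bounded_linear[OF bounded_linear_mult_right])

lemma frechet_derivative_sum:
  fixes f :: "'i \<Rightarrow> 'a::real_normed_vector \<Rightarrow> real"
  assumes "\<And>i. i \<in> I \<Longrightarrow> f i differentiable at x"
  shows "frechet_derivative (\<lambda>y. \<Sum>i\<in>I. f i y) (at x) v = (\<Sum>i\<in>I. frechet_derivative (f i) (at x) v)"
  by (rule fun_cong[OF frechet_derivative_at[symmetric, OF has_derivative_sum[OF has_frechet_derivative[OF assms]]]])

text \<open>A form on a subset of Euclidean space is a family of functions on lists, and its coefficients are the
values on constant vector fields.\<close>

definition smooth_coeffs :: "'b::euclidean_space set \<Rightarrow> ('b \<Rightarrow> 'b list \<Rightarrow> real) \<Rightarrow> bool"
  where "smooth_coeffs S a \<longleftrightarrow> (\<forall>vs. smooth_on S (\<lambda>x. a x vs))"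

definition dir_deriv :: "'b::euclidean_space \<Rightarrow> ('b \<Rightarrow> 'b list \<Rightarrow> real) \<Rightarrow> 'b \<Rightarrow> 'b list \<Rightarrow> real"
  where "dir_deriv v a = (\<lambda>x vs. frechet_derivative (\<lambda>y. a y vs) (at x) v)"

definition local_d :: "('b::euclidean_space \<Rightarrow> 'b list \<Rightarrow> real) \<Rightarrow> 'b \<Rightarrow> 'b list \<Rightarrow> real"
  where "local_d a = (\<lambda>x vs. \<Sum>i<length vs. (- 1) ^ i *
    frechet_derivative (\<lambda>y. a y (omit i vs)) (at x) (vs ! i))"

lemma local_d_Nil [simp]: "local_d a x [] = 0"
  by (simp add: local_d_def)

text \<open>Cartan's formula for the constant vector field \<open>v\<close>. It is the list recursion that determines \<open>d\<close>.\<close>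

lemma interior_prod_local_d:
  "interior_prod v (local_d a x) = dir_deriv v a x - local_d (\<lambda>y. interior_prod v (a y)) x"
proof
  fix vs
  show "interior_prod v (local_d a x) vs = (dir_deriv v a x - local_d (\<lambda>y. interior_prod v (a y)) x) vs"
    by (simp add: interior_prod_def local_d_def dir_deriv_def omit_def fun_apply sum.lessThan_Suc_shift
        flip: sum_negf del: sum.lessThan_Suc)
qed

lemma local_d_Cons: "local_d a x (v # vs) = dir_deriv v a x vs - local_d (\<lambda>y. interior_prod v (a y)) x vs"
  using interior_prod_local_d[of v a x] by (metis interior_prod_def minus_apply)

lemma smooth_coeffs_differentiable: "smooth_coeffs S a \<Longrightarrow> x \<in> S \<Longrightarrow> (\<lambda>y. a y vs) differentiable at x"
  by (auto simp: smooth_coeffs_def intro: smooth_on_imp_differentiable)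

lemma smooth_coeffs_interior_prod: "smooth_coeffs S a \<Longrightarrow> smooth_coeffs S (\<lambda>x. interior_prod v (a x))"
  by (simp add: smooth_coeffs_def interior_prod_def)

lemma smooth_coeffs_dir_deriv: "smooth_coeffs S a \<Longrightarrow> smooth_coeffs S (dir_deriv v a)"
  by (simp add: smooth_coeffs_def dir_deriv_def smooth_on_frechet_derivative)

lemma smooth_coeffs_zero: "smooth_coeffs S (\<lambda>x. 0)"
  by (simp add: smooth_coeffs_def fun_apply smooth_on_const)

lemma smooth_coeffs_cong: "open S \<Longrightarrow> (\<And>x. x \<in> S \<Longrightarrow> a x = b x) \<Longrightarrow> smooth_coeffs S a \<longleftrightarrow> smooth_coeffs S b"
  unfolding smooth_coeffs_def by (intro all_cong1 smooth_on_cong) auto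

lemma local_d_cong:
  assumes "open S" "x \<in> S" "\<And>y. y \<in> S \<Longrightarrow> a y = b y"
  shows "local_d a x = local_d b x" "dir_deriv v a x = dir_deriv v b x"
proof -
  have "frechet_derivative (\<lambda>y. a y vs) (at x) = frechet_derivative (\<lambda>y. b y vs) (at x)" for vs
    by (rule frechet_derivative_cong_open[OF assms(1,2)]) (simp add: assms(3))
  then show "local_d a x = local_d b x" "dir_deriv v a x = dir_deriv v b x"
    by (simp_all add: local_d_def dir_deriv_def)
qed

context
  fixes S :: "'b::euclidean_space set"
  assumes S: "open S"
begin

lemma smooth_coeffs_add: "smooth_coeffs S a \<Longrightarrow> smooth_coeffs S b \<Longrightarrow> smooth_coeffs S (\<lambda>x. a x + b x)"
  by (simp add: smooth_coeffs_def fun_apply smooth_on_add[OF S])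

lemma smooth_coeffs_scaleR: "smooth_coeffs S a \<Longrightarrow> smooth_coeffs S (\<lambda>x. r *\<^sub>R a x)"
  by (simp add: smooth_coeffs_def fun_apply smooth_on_cmult[OF S])

lemma smooth_coeffs_sum: "(\<And>i. i \<in> I \<Longrightarrow> smooth_coeffs S (f i)) \<Longrightarrow> smooth_coeffs S (\<lambda>x. \<Sum>i\<in>I. f i x)"
  by (simp add: smooth_coeffs_def sum_fun_apply smooth_on_sum[OF S])

lemma smooth_coeffs_grade_sign: "smooth_coeffs S a \<Longrightarrow> smooth_coeffs S (\<lambda>x. grade_sign (a x))"
  by (simp add: smooth_coeffs_def grade_sign_def smooth_on_cmult[OF S])

lemma smooth_coeffs_ext_prod:
  assumes "smooth_coeffs S a" "smooth_coeffs S b"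
  shows "smooth_coeffs S (\<lambda>x. a x \<odot> b x)"
  unfolding smooth_coeffs_def
proof
  fix vs show "smooth_on S (\<lambda>x. (a x \<odot> b x) vs)"
    using assms
  proof (induction vs arbitrary: a b)
    case Nil
    then show ?case by (simp add: smooth_coeffs_def smooth_on_mult[OF S])
  next
    case (Cons v vs)
    then show ?case
      unfolding ext_prod_Cons
      by (intro smooth_on_add[OF S] Cons.IH smooth_coeffs_interior_prod smooth_coeffs_grade_sign)
  qed
qed

lemma smooth_coeffs_local_d:
  assumes "smooth_coeffs S a"
  shows "smooth_coeffs S (local_d a)"
  using assms unfolding smooth_coeffs_def local_d_def
  by (auto intro!: smooth_on_sum[OF S] smooth_on_cmult[OF S] smooth_on_frechet_derivative)

lemma local_d_linear:
  assumes "smooth_coeffs S a" "smooth_coeffs S b" "x \<in> S"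
  shows "local_d (\<lambda>y. a y + b y) x = local_d a x + local_d b x"
    and "local_d (\<lambda>y. a y - b y) x = local_d a x - local_d b x"
    and "local_d (\<lambda>y. r *\<^sub>R a y) x = r *\<^sub>R local_d a x"
    and "dir_deriv v (\<lambda>y. a y + b y) x = dir_deriv v a x + dir_deriv v b x"
    and "dir_deriv v (\<lambda>y. r *\<^sub>R a y) x = r *\<^sub>R dir_deriv v a x"
proof -
  note d = smooth_coeffs_differentiable[OF assms(1,3)] smooth_coeffs_differentiable[OF assms(2,3)]
  have add: "frechet_derivative (\<lambda>y. (a y + b y) vs) (at x) v =
      frechet_derivative (\<lambda>y. a y vs) (at x) v + frechet_derivative (\<lambda>y. b y vs) (at x) v" for vs v
    unfolding fun_apply by (rule frechet_derivative_add[OF d])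
  have scale: "frechet_derivative (\<lambda>y. (r *\<^sub>R a y) vs) (at x) v = r * frechet_derivative (\<lambda>y. a y vs) (at x) v" for vs v r
    unfolding fun_apply real_scaleR_def by (rule frechet_derivative_scaleR[OF d(1)])
  have scaleb: "frechet_derivative (\<lambda>y. - (b y vs)) (at x) v = - frechet_derivative (\<lambda>y. b y vs) (at x) v" for vs v
    using frechet_derivative_scaleR[OF d(2), of "- 1"] by simp
  have diff: "frechet_derivative (\<lambda>y. (a y - b y) vs) (at x) v =
      frechet_derivative (\<lambda>y. a y vs) (at x) v - frechet_derivative (\<lambda>y. b y vs) (at x) v" for vs v
    using frechet_derivative_add[OF d(1), of "\<lambda>y. - (b y vs)" vs v] d(2) 
    by (simp add: fun_apply differentiable_minus scaleb)
  show "local_d (\<lambda>y. a y + b y) x = local_d a x + local_d b x"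
    "local_d (\<lambda>y. a y - b y) x = local_d a x - local_d b x"
    "local_d (\<lambda>y. r *\<^sub>R a y) x = r *\<^sub>R local_d a x"
    "dir_deriv v (\<lambda>y. a y + b y) x = dir_deriv v a x + dir_deriv v b x"
    "dir_deriv v (\<lambda>y. r *\<^sub>R a y) x = r *\<^sub>R dir_deriv v a x"
    unfolding local_d_def dir_deriv_def add scale diff
    by (simp_all add: fun_eq_iff fun_apply sum.distrib sum_subtractf sum_distrib_left distrib_left right_diff_distrib mult.left_commute)
qed

lemma local_d_sum:
  assumes "\<And>i. i \<in> I \<Longrightarrow> smooth_coeffs S (f i)" "x \<in> S"
  shows "local_d (\<lambda>y. \<Sum>i\<in>I. f i y) x = (\<Sum>i\<in>I. local_d (f i) x)"
  using assms(1)
proof (induction I rule: infinite_finite_induct)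
  case (insert i I)
  have "local_d (\<lambda>y. f i y + (\<Sum>i\<in>I. f i y)) x = local_d (f i) x + local_d (\<lambda>y. \<Sum>i\<in>I. f i y) x"
    using insert.prems by (intro local_d_linear(1) smooth_coeffs_sum assms(2)) auto
  moreover have "local_d (\<lambda>y. \<Sum>i\<in>I. f i y) x = (\<Sum>i\<in>I. local_d (f i) x)"
    using insert by blast
  ultimately show ?case unfolding sum.insert[OF insert(1,2)] by argo
qed (simp_all add: local_d_def fun_eq_iff fun_apply)

lemma grade_sign_local_d:
  assumes "smooth_coeffs S a" "x \<in> S"
  shows "local_d (\<lambda>y. grade_sign (a y)) x = - grade_sign (local_d a x)"
proof
  fix vs :: "'b list"
  have len: "length (omit i vs) = length vs - 1" if "i < length vs" for i
    using that by (auto simp: omit_def)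
  have "frechet_derivative (\<lambda>y. grade_sign (a y) (omit i vs)) (at x) v =
      (- 1) ^ (length vs - 1) * frechet_derivative (\<lambda>y. a y (omit i vs)) (at x) v" if "i < length vs" for i v
    unfolding grade_sign_def len[OF that]
    by (rule frechet_derivative_scaleR[OF smooth_coeffs_differentiable[OF assms]])
  then show "local_d (\<lambda>y. grade_sign (a y)) x vs = (- grade_sign (local_d a x)) vs"
    by (cases "length vs")
      (auto simp: local_d_def grade_sign_def fun_apply sum_distrib_left sum_negf[symmetric] mult_ac intro!: sum.cong)
qed

lemma dir_deriv_ext_prod:
  assumes "smooth_coeffs S a" "smooth_coeffs S b" "x \<in> S"
  shows "dir_deriv v (\<lambda>y. a y \<odot> b y) x = dir_deriv v a x \<odot> b x + a x \<odot> dir_deriv v b x"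
proof
  fix vs show "dir_deriv v (\<lambda>y. a y \<odot> b y) x vs = (dir_deriv v a x \<odot> b x + a x \<odot> dir_deriv v b x) vs"
    using assms(1,2)
  proof (induction vs arbitrary: a b)
    case Nil
    then show ?case
      by (simp add: dir_deriv_def fun_apply frechet_derivative_mult[OF smooth_coeffs_differentiable[OF Nil(1) assms(3)]
          smooth_coeffs_differentiable[OF Nil(2) assms(3)]])
  next
    case (Cons u vs)
    note sm = smooth_coeffs_interior_prod[OF Cons.prems(1), of u] Cons.prems(2)
      smooth_coeffs_grade_sign[OF Cons.prems(1)] smooth_coeffs_interior_prod[OF Cons.prems(2), of u]
    have comm: "dir_deriv v (\<lambda>y. interior_prod u (a y)) x = interior_prod u (dir_deriv v a x)" for a
      by (simp add: dir_deriv_def interior_prod_def)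
    have gs: "dir_deriv v (\<lambda>y. grade_sign (a y)) x = grade_sign (dir_deriv v a x)"
      unfolding dir_deriv_def grade_sign_def
      using frechet_derivative_scaleR[OF smooth_coeffs_differentiable[OF Cons.prems(1) assms(3)]] by simp
    have "dir_deriv v (\<lambda>y. a y \<odot> b y) x (u # vs) = interior_prod u (dir_deriv v (\<lambda>y. a y \<odot> b y) x) vs"
      by (simp add: interior_prod_def)
    also have "\<dots> = dir_deriv v (\<lambda>y. interior_prod u (a y) \<odot> b y + grade_sign (a y) \<odot> interior_prod u (b y)) x vs"
      unfolding comm[symmetric] interior_prod_ext_prod ..
    also have "\<dots> = (dir_deriv v (\<lambda>y. interior_prod u (a y) \<odot> b y) x +
        dir_deriv v (\<lambda>y. grade_sign (a y) \<odot> interior_prod u (b y)) x) vs"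
      by (subst local_d_linear(4)[OF smooth_coeffs_ext_prod smooth_coeffs_ext_prod assms(3)]) (use sm in auto)
    also have "\<dots> = (dir_deriv v a x \<odot> b x + a x \<odot> dir_deriv v b x) (u # vs)"
      unfolding fun_apply ext_prod_Cons Cons.IH[OF sm(1,2)] Cons.IH[OF sm(3,4)] comm gs by simp
    finally show ?case .
  qed
qed

text \<open>Induction on the list: after contraction with \<open>v\<close>, Cartan's formula and the product rule for the
directional derivative reduce the claim to the products of \<open>\<iota>\<^sub>v a\<close> with \<open>b\<close> and of \<open>a\<close> with \<open>\<iota>\<^sub>v b\<close>.\<close>

lemma local_d_ext_prod:
  assumes "smooth_coeffs S a" "smooth_coeffs S b" "x \<in> S"
  shows "local_d (\<lambda>y. a y \<odot> b y) x = local_d a x \<odot> b x + grade_sign (a x) \<odot> local_d b x"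
proof
  fix vs show "local_d (\<lambda>y. a y \<odot> b y) x vs = (local_d a x \<odot> b x + grade_sign (a x) \<odot> local_d b x) vs"
    using assms(1,2)
  proof (induction vs arbitrary: a b)
    case Nil
    then show ?case by (simp add: fun_apply)
  next
    case (Cons v vs)
    note sm = smooth_coeffs_interior_prod[OF Cons.prems(1), of v] Cons.prems(2)
      smooth_coeffs_grade_sign[OF Cons.prems(1)] smooth_coeffs_interior_prod[OF Cons.prems(2), of v]
    have "local_d (\<lambda>y. a y \<odot> b y) x (v # vs) =
        (dir_deriv v (\<lambda>y. a y \<odot> b y) x - (local_d (\<lambda>y. interior_prod v (a y) \<odot> b y) x +
         local_d (\<lambda>y. grade_sign (a y) \<odot> interior_prod v (b y)) x)) vs"
    proof -
      have "local_d (\<lambda>y. interior_prod v (a y \<odot> b y)) x =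
          local_d (\<lambda>y. interior_prod v (a y) \<odot> b y) x + local_d (\<lambda>y. grade_sign (a y) \<odot> interior_prod v (b y)) x"
        unfolding interior_prod_ext_prod
        by (rule local_d_linear(1)[OF smooth_coeffs_ext_prod smooth_coeffs_ext_prod assms(3)]) (use sm in auto)
      then show ?thesis unfolding local_d_Cons by (simp only: fun_apply)
    qed
    also have "\<dots> = (local_d a x \<odot> b x + grade_sign (a x) \<odot> local_d b x) (v # vs)"
      unfolding plus_fun_apply[of _ _ vs] plus_fun_apply[of _ _ "v # vs"] minus_apply[of _ _ vs]
        ext_prod_Cons Cons.IH[OF sm(1,2)] Cons.IH[OF sm(3,4)]
        dir_deriv_ext_prod[OF Cons.prems assms(3)] interior_prod_local_d
        grade_sign_local_d[OF Cons.prems(1) assms(3)] ext_prod_diff_left ext_prod_diff_right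
        grade_sign_linear ext_prod_minus_left
      by (simp add: fun_apply ext_prod_minus_left)
    finally show ?case .
  qed
qed

text \<open>Second derivatives are symmetric.\<close>

lemma dir_deriv_local_d:
  assumes "smooth_coeffs S a" "x \<in> S"
  shows "dir_deriv v (local_d a) x = local_d (dir_deriv v a) x"
proof
  fix vs
  have d: "(\<lambda>y. frechet_derivative (\<lambda>y. a y us) (at y) u) differentiable at x" for us u
    using assms by (auto simp: smooth_coeffs_def intro: smooth_on_imp_differentiable[OF smooth_on_frechet_derivative])
  have "dir_deriv v (local_d a) x vs = (\<Sum>i<length vs. (- 1) ^ i *
      frechet_derivative (\<lambda>y. frechet_derivative (\<lambda>y. a y (omit i vs)) (at y) (vs ! i)) (at x) v)"
    unfolding local_d_def dir_deriv_def
    by (subst frechet_derivative_sum) (auto intro!: differentiable_mult d differentiable_const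
        simp: frechet_derivative_scaleR[OF d])
  also have "\<dots> = local_d (dir_deriv v a) x vs"
    unfolding local_d_def dir_deriv_def
    using assms by (subst second_derivative_symmetric[of S]) (auto simp: smooth_coeffs_def S)
  finally show "dir_deriv v (local_d a) x vs = local_d (dir_deriv v a) x vs" .
qed

text \<open>By Cartan's formula \<open>\<iota>\<^sub>v d d a = D\<^sub>v d a - d D\<^sub>v a + d d \<iota>\<^sub>v a\<close>, and \<open>D\<^sub>v\<close> commutes with \<open>d\<close>.\<close>

lemma local_d_local_d:
  assumes "smooth_coeffs S a" "x \<in> S"
  shows "local_d (local_d a) x = 0"
proof
  fix vs show "local_d (local_d a) x vs = 0 vs"
    using assms(1)
  proof (induction vs arbitrary: a)
    case Nil
    then show ?case by (simp add: fun_apply)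
  next
    case (Cons v vs)
    note i = smooth_coeffs_interior_prod[OF Cons.prems, of v]
    have "local_d (local_d a) x (v # vs) = (dir_deriv v (local_d a) x -
        (local_d (dir_deriv v a) x - local_d (local_d (\<lambda>y. interior_prod v (a y))) x)) vs"
    proof -
      have "local_d (\<lambda>y. interior_prod v (local_d a y)) x =
          local_d (dir_deriv v a) x - local_d (local_d (\<lambda>y. interior_prod v (a y))) x"
        unfolding interior_prod_local_d
        by (rule local_d_linear(2)[OF smooth_coeffs_dir_deriv smooth_coeffs_local_d assms(2)]) (use i Cons.prems in auto)
      then show ?thesis unfolding local_d_Cons by (simp only: fun_apply)
    qed
    then show ?case
      using Cons.IH[OF i] by (simp add: fun_apply dir_deriv_local_d[OF Cons.prems assms(2)])
  qed
qed

lemma alternating_dir_deriv: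
  assumes a: "smooth_coeffs S a" "\<And>y. y \<in> S \<Longrightarrow> alternating (a y)" and x: "x \<in> S"
  shows "alternating (dir_deriv v a x)"
  unfolding alternating_def alternating_form_def
proof (intro allI conjI impI)
  fix vs :: "'b list" and i k assume i: "length vs = k \<and> i < k"
  have lin: "linear (\<lambda>u. a y (vs[i := u]))" if "y \<in> S" for y
    using a(2)[OF that] i by (auto simp: alternating_def alternating_form_def)
  note d = smooth_coeffs_differentiable[OF a(1) x]
  show "linear (\<lambda>u. dir_deriv v a x (vs[i := u]))"
  proof (rule linearI)
    fix u w :: 'b and r :: real
    have "frechet_derivative (\<lambda>y. a y (vs[i := u + w])) (at x) =
        frechet_derivative (\<lambda>y. a y (vs[i := u]) + a y (vs[i := w])) (at x)"
      by (rule frechet_derivative_cong_open[OF S x]) (simp add: linear_add[OF lin])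
    then show "dir_deriv v a x (vs[i := u + w]) = dir_deriv v a x (vs[i := u]) + dir_deriv v a x (vs[i := w])"
      by (simp add: dir_deriv_def frechet_derivative_add d)
    have "frechet_derivative (\<lambda>y. a y (vs[i := r *\<^sub>R u])) (at x) =
        frechet_derivative (\<lambda>y. r * a y (vs[i := u])) (at x)"
      by (rule frechet_derivative_cong_open[OF S x]) (simp add: linear_scale[OF lin])
    then show "dir_deriv v a x (vs[i := r *\<^sub>R u]) = r *\<^sub>R dir_deriv v a x (vs[i := u])"
      by (simp add: dir_deriv_def frechet_derivative_scaleR d)
  qed
next
  fix vs :: "'b list" and i j k assume "length vs = k \<and> i < j \<and> j < k \<and> vs ! i = vs ! j"
  then have "a y vs = 0" if "y \<in> S" for y
    using a(2)[OF that] unfolding alternating_def alternating_form_def by blast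
  then have "frechet_derivative (\<lambda>y. a y vs) (at x) = frechet_derivative (\<lambda>y. 0) (at x)"
    by (intro frechet_derivative_cong_open[OF S x]) simp
  then show "dir_deriv v a x vs = 0" by (simp add: dir_deriv_def)
qed

lemma local_d_zero: "local_d (\<lambda>y. 0) x = 0"
  by (simp add: local_d_def fun_eq_iff fun_apply)

text \<open>Applying Cartan's formula twice, \<open>\<iota>\<^sub>v \<iota>\<^sub>v d a = \<iota>\<^sub>v D\<^sub>v a - D\<^sub>v \<iota>\<^sub>v a + d \<iota>\<^sub>v \<iota>\<^sub>v a = 0\<close>.\<close>

lemma alternating_local_d:
  assumes "smooth_coeffs S a" "\<And>y. y \<in> S \<Longrightarrow> alternating (a y)" "x \<in> S"
  shows "alternating (local_d a x)"
  unfolding alternating_def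
proof
  fix k show "alternating_form k (local_d a x)"
    using assms(1,2)
  proof (induction k arbitrary: a)
    case 0
    then show ?case by (simp add: alternating_form_0)
  next
    case (Suc k)
    note sm = smooth_coeffs_interior_prod[OF Suc.prems(1)]
    show ?case
    proof (rule alternating_form_SucI)
      fix vs :: "'b list"
      have l: "linear (\<lambda>v. local_d (\<lambda>y. interior_prod v (a y)) x vs)"
      proof (rule linearI)
        fix u w :: 'b and r :: real
        have "local_d (\<lambda>y. interior_prod (u + w) (a y)) x = local_d (\<lambda>y. interior_prod u (a y) + interior_prod w (a y)) x"
          by (rule local_d_cong[OF S assms(3)]) (simp add: linear_interior_prod Suc.prems)
        then show "local_d (\<lambda>y. interior_prod (u + w) (a y)) x vs =
            local_d (\<lambda>y. interior_prod u (a y)) x vs + local_d (\<lambda>y. interior_prod w (a y)) x vs"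
          using local_d_linear(1)[OF sm sm assms(3)] by (simp add: fun_apply)
        have "local_d (\<lambda>y. interior_prod (r *\<^sub>R u) (a y)) x = local_d (\<lambda>y. r *\<^sub>R interior_prod u (a y)) x"
          by (rule local_d_cong[OF S assms(3)]) (simp add: linear_interior_prod Suc.prems)
        then show "local_d (\<lambda>y. interior_prod (r *\<^sub>R u) (a y)) x vs = r *\<^sub>R local_d (\<lambda>y. interior_prod u (a y)) x vs"
          using local_d_linear(3)[OF sm sm assms(3)] by (simp add: fun_apply)
      qed
      have "linear (\<lambda>v. dir_deriv v a x vs)"
        unfolding dir_deriv_def
        using linear_frechet_derivative[OF smooth_coeffs_differentiable[OF Suc.prems(1) assms(3)]] by simp
      from linear_compose_sub[OF this l]
      show "linear (\<lambda>v. local_d a x (v # vs))" unfolding local_d_Cons .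
    next
      fix v :: 'b and vs :: "'b list"
      have "local_d (\<lambda>y. interior_prod v (interior_prod v (a y))) x = local_d (\<lambda>y. 0) x"
        by (rule local_d_cong[OF S assms(3)])
          (use alternating_same[OF Suc.prems(2)] in \<open>simp add: interior_prod_def fun_eq_iff fun_apply\<close>)
      then show "local_d a x (v # v # vs) = 0"
        unfolding local_d_Cons local_d_zero
        by (simp add: dir_deriv_def interior_prod_def fun_apply)
    next
      fix v :: 'b
      have "alternating_form k (local_d (\<lambda>y. interior_prod v (a y)) x)"
        by (rule Suc.IH[OF sm alternating_interior_prod[OF Suc.prems(2)]])
      moreover have "alternating_form k (dir_deriv v a x)"
        using alternating_dir_deriv[OF Suc.prems assms(3)] by (simp add: alternating_def)
      ultimately show "alternating_form k (interior_prod v (local_d a x))"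
        unfolding interior_prod_local_d
        using alternating_form_linear_combination[of k _ "dir_deriv v a x" "- 1"] by fastforce
    qed
  qed
qed

end

section \<open>Naturality of the exterior derivative\<close>

definition grade_part :: "nat \<Rightarrow> ('b list \<Rightarrow> real) \<Rightarrow> 'b list \<Rightarrow> real"
  where "grade_part k a = (\<lambda>vs. if length vs = k then a vs else 0)"

lemma has_grade_grade_part: "has_grade k (grade_part k a)"
  by (simp add: has_grade_def grade_part_def)

lemma alternating_grade_part: "alternating a \<Longrightarrow> alternating (grade_part k a)"
  unfolding alternating_def
proof
  fix j assume a: "\<forall>k. alternating_form k a"
  have z: "alternating_form j (0 :: 'a list \<Rightarrow> real)"
    by (rule alternating_zero[unfolded alternating_def, rule_format])
  have "alternating_form j (grade_part k a) = alternating_form j (if j = k then a else 0)"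
    by (auto simp: alternating_form_def grade_part_def fun_apply)
  with a z show "alternating_form j (grade_part k a)" by (simp split: if_splits)
qed

lemma smooth_coeffs_grade_part: "smooth_coeffs S a \<Longrightarrow> smooth_coeffs S (\<lambda>x. grade_part k (a x))"
  unfolding smooth_coeffs_def
proof
  fix vs assume "\<forall>vs. smooth_on S (\<lambda>x. a x vs)"
  then show "smooth_on S (\<lambda>x. grade_part k (a x) vs)"
    by (cases "length vs = k") (simp_all add: grade_part_def smooth_on_const)
qed

lemma local_d_grade_part: "local_d a x vs = local_d (\<lambda>y. grade_part (length vs - 1) (a y)) x vs"
  unfolding local_d_def grade_part_def by (intro sum.cong) (auto simp: omit_def)

lemma has_grade_local_d:
  assumes "\<And>y. has_grade k (a y)"
  shows "has_grade (Suc k) (local_d a x)"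
  unfolding has_grade_def
proof (intro allI impI)
  fix vs :: "'a list" assume "length vs \<noteq> Suc k"
  then have "a y (omit i vs) = 0" if "i < length vs" for i y
    using assms[of y] that by (auto simp: has_grade_def omit_def)
  then show "local_d a x vs = 0" by (simp add: local_d_def)
qed

lemma grade_part_pullback: "grade_part k (pullback T a) = pullback T (grade_part k a)"
  by (simp add: grade_part_def pullback_def)

lemma has_grade_pullback: "has_grade k a \<Longrightarrow> has_grade k (pullback T a)"
  by (simp add: has_grade_def pullback_def)

text \<open>Induction on the degree \<open>k\<close>. For functions this is the chain rule. For \<open>k > 0\<close>, Euler's identity writes
\<open>\<beta>\<close> as a multiple of \<open>\<Sum>\<^sub>e dy\<^sub>e \<and> \<iota>\<^sub>e \<beta>\<close>, where pulling back \<open>dy\<^sub>e\<close> gives the exact form \<open>d (y\<^sub>e \<circ> g)\<close>, and the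
Leibniz rule reduces the claim to \<open>\<iota>\<^sub>e \<beta>\<close>. Smoothness of the pullback is part of the induction, because
the Leibniz rule is applied to pullbacks.\<close>

lemma pullback_local_d_graded:
  fixes g :: "'b::euclidean_space \<Rightarrow> 'b"
  assumes U: "open U" and V: "open V" and gUV: "g ` U \<subseteq> V" and g: "smooth_on U g"
  assumes "smooth_coeffs V \<beta>" "\<And>y. y \<in> V \<Longrightarrow> alternating (\<beta> y)" "\<And>y. has_grade k (\<beta> y)"
  shows "smooth_coeffs U (\<lambda>x. pullback (frechet_derivative g (at x)) (\<beta> (g x))) \<and>
    (\<forall>x\<in>U. local_d (\<lambda>x. pullback (frechet_derivative g (at x)) (\<beta> (g x))) x =
      pullback (frechet_derivative g (at x)) (local_d \<beta> (g x)))"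
  using assms(5-)
proof (induction k arbitrary: \<beta>)
  case 0
  let ?p = "\<lambda>x. pullback (frechet_derivative g (at x)) (\<beta> (g x))"
  have p: "?p x vs = (if vs = [] then \<beta> (g x) [] else 0)" for x vs
    using 0(3)[of "g x"] by (auto simp: pullback_def has_grade_def)
  have b: "smooth_on V (\<lambda>y. \<beta> y [])" using 0 by (simp add: smooth_coeffs_def)
  have "smooth_on U (\<lambda>x. \<beta> (g x) [])" by (rule smooth_on_compose[OF U gUV g b])
  then have "smooth_coeffs U ?p"
    unfolding smooth_coeffs_def p by (intro allI, case_tac "vs = []") (simp_all add: smooth_on_const)
  moreover have "local_d ?p x = pullback (frechet_derivative g (at x)) (local_d \<beta> (g x))" if x: "x \<in> U" for x
  proof
    fix vs
    show "local_d ?p x vs = pullback (frechet_derivative g (at x)) (local_d \<beta> (g x)) vs"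
    proof (cases "length vs = 1")
      case False
      have "has_grade 1 (local_d ?p x)" "has_grade 1 (local_d \<beta> (g x))"
        using has_grade_local_d[of 0 ?p, OF has_grade_pullback[OF 0(3)]] has_grade_local_d[of 0 \<beta>, OF 0(3)]
        by simp_all
      then show ?thesis using False by (auto simp: has_grade_def pullback_def)
    next
      case True
      then obtain v where vs: "vs = [v]" by (auto simp: length_Suc_conv)
      have gx: "g x \<in> V" using gUV x by auto
      have "((\<lambda>x. \<beta> (g x) []) has_derivative
          (\<lambda>v. frechet_derivative (\<lambda>y. \<beta> y []) (at (g x)) (frechet_derivative g (at x) v))) (at x)"
        using smooth_on_imp_differentiable[OF b gx] smooth_on_imp_differentiable[OF g x]
        by (intro has_derivative_compose[of g _ x UNIV "\<lambda>y. \<beta> y []"] has_frechet_derivative) auto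
      from frechet_derivative_at[OF this] show ?thesis
        by (simp add: vs local_d_def omit_def pullback_def fun_eq_iff)
    qed
  qed
  ultimately show ?case by blast
next
  case (Suc k)
  let ?P = "\<lambda>x. pullback (frechet_derivative g (at x))"
  let ?i = "\<lambda>e y. interior_prod e (\<beta> y)"
  define r where "r = 1 / real (Suc k)"
  have r: "r * real (Suc k) = 1" by (simp add: r_def)
  \<comment> \<open>\<open>G e\<close> is the coordinate \<open>y\<^sub>e \<circ> g\<close> as a form of degree \<open>0\<close>.\<close>
  define G where "G e x vs = (if vs = [] then g x \<bullet> e else 0)" for e x and vs :: "'b list"
  have IH: "smooth_coeffs U (\<lambda>x. ?P x (?i e (g x)))"
    "\<And>x. x \<in> U \<Longrightarrow> local_d (\<lambda>x. ?P x (?i e (g x))) x = ?P x (local_d (?i e) (g x))" for e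
    using Suc.IH[OF smooth_coeffs_interior_prod[OF Suc.prems(1)] alternating_interior_prod[OF Suc.prems(2)]
        has_grade_interior_prod[OF Suc.prems(3)], of e] by blast+
  have smG: "smooth_coeffs U (G e)" for e
    unfolding smooth_coeffs_def G_def
    by (intro allI, case_tac "vs = []")
      (simp_all add: smooth_on_const smooth_on_bounded_linear[OF U bounded_linear_inner_left g])
  have dG: "local_d (G e) x = ?P x (dual_covector e)" if "x \<in> U" for e x
  proof
    fix vs :: "'b list"
    show "local_d (G e) x vs = ?P x (dual_covector e) vs"
    proof (cases "length vs = 1")
      case False
      have "has_grade 1 (local_d (G e) x)"
        using has_grade_local_d[of 0 "G e"] by (auto simp: has_grade_def G_def)
      then show ?thesis using False has_grade_pullback[OF has_grade_dual_covector]
        unfolding has_grade_def by metis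
    next
      case True
      then obtain v where vs: "vs = [v]" by (auto simp: length_Suc_conv)
      show ?thesis
        using frechet_derivative_bounded_linear[OF bounded_linear_inner_left smooth_on_imp_differentiable[OF g that], of e v]
        by (simp add: vs local_d_def omit_def pullback_def dual_covector_def G_def)
    qed
  qed
  have euler: "\<beta> y = r *\<^sub>R (\<Sum>e\<in>Basis. dual_covector e \<odot> ?i e y)" if "y \<in> V" for y
  proof
    fix vs
    show "\<beta> y vs = (r *\<^sub>R (\<Sum>e\<in>Basis. dual_covector e \<odot> ?i e y)) vs"
      using Suc.prems(3)[of y] r unfolding sum_dual_covector_interior_prod[OF Suc.prems(2)[OF that]]
      by (cases "length vs = Suc k") (auto simp: has_grade_def fun_apply)
  qed
  have pull: "?P x (\<beta> (g x)) = r *\<^sub>R (\<Sum>e\<in>Basis. local_d (G e) x \<odot> ?P x (?i e (g x)))" if "x \<in> U" for x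
  proof -
    have "g x \<in> V" using gUV that by auto
    then show ?thesis
      by (subst euler) (simp_all only: pullback_linear pullback_sum pullback_ext_prod dG[OF that])
  qed
  have smprod: "smooth_coeffs U (\<lambda>x. local_d (G e) x \<odot> ?P x (?i e (g x)))" for e
    by (intro smooth_coeffs_ext_prod[OF U] smooth_coeffs_local_d[OF U] smG IH)
  have "smooth_coeffs U (\<lambda>x. r *\<^sub>R (\<Sum>e\<in>Basis. local_d (G e) x \<odot> ?P x (?i e (g x))))"
    by (intro smooth_coeffs_scaleR[OF U] smooth_coeffs_sum[OF U] smprod)
  then have 1: "smooth_coeffs U (\<lambda>x. ?P x (\<beta> (g x)))"
    by (subst smooth_coeffs_cong[OF U pull])
  have minus: "grade_sign (dual_covector e) = - dual_covector e" for e :: 'b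
    using grade_sign_has_grade[OF has_grade_dual_covector[of e]] by simp
  have 2: "local_d (\<lambda>x. ?P x (\<beta> (g x))) x = ?P x (local_d \<beta> (g x))" if x: "x \<in> U" for x
  proof -
    have gx: "g x \<in> V" using gUV x by auto
    have "local_d (\<lambda>x. ?P x (\<beta> (g x))) x =
        local_d (\<lambda>x. r *\<^sub>R (\<Sum>e\<in>Basis. local_d (G e) x \<odot> ?P x (?i e (g x)))) x"
      by (rule local_d_cong[OF U x pull])
    also have "\<dots> = r *\<^sub>R (\<Sum>e\<in>Basis. local_d (\<lambda>x. local_d (G e) x \<odot> ?P x (?i e (g x))) x)"
      by (simp only: local_d_linear(3)[OF U smooth_coeffs_sum[OF U smprod] smooth_coeffs_zero x] local_d_sum[OF U smprod x])
    also have "\<dots> = r *\<^sub>R (\<Sum>e\<in>Basis. ?P x (- dual_covector e \<odot> local_d (?i e) (g x)))"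
    proof -
      have "local_d (\<lambda>x. local_d (G e) x \<odot> ?P x (?i e (g x))) x = ?P x (- dual_covector e \<odot> local_d (?i e) (g x))" for e
        unfolding local_d_ext_prod[OF U smooth_coeffs_local_d[OF U smG] IH(1) x]
          local_d_local_d[OF U smG x] IH(2)[OF x] dG[OF x] grade_sign_pullback minus pullback_ext_prod
        by simp
      then show ?thesis by simp
    qed
    also have "\<dots> = ?P x (r *\<^sub>R (\<Sum>e\<in>Basis. - dual_covector e \<odot> local_d (?i e) (g x)))"
      by (simp only: pullback_linear pullback_sum)
    also have "r *\<^sub>R (\<Sum>e\<in>Basis. - dual_covector e \<odot> local_d (?i e) (g x)) = local_d \<beta> (g x)"
    proof -
      have smd: "smooth_coeffs V (\<lambda>y. dual_covector e)" for e :: 'b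
        by (simp add: smooth_coeffs_def smooth_on_const)
      have smi: "smooth_coeffs V (?i e)" for e
        by (rule smooth_coeffs_interior_prod[OF Suc.prems(1)])
      note sp = smooth_coeffs_ext_prod[OF V smd smi]
      have z: "local_d (\<lambda>y. dual_covector e) (g x) = 0" for e :: 'b
        by (simp add: local_d_def fun_eq_iff fun_apply)
      have "local_d \<beta> (g x) = local_d (\<lambda>y. r *\<^sub>R (\<Sum>e\<in>Basis. dual_covector e \<odot> ?i e y)) (g x)"
        by (rule local_d_cong[OF V gx euler])
      also have "\<dots> = r *\<^sub>R (\<Sum>e\<in>Basis. local_d (\<lambda>y. dual_covector e \<odot> ?i e y) (g x))"
        by (simp only: local_d_linear(3)[OF V smooth_coeffs_sum[OF V sp] smooth_coeffs_zero gx] local_d_sum[OF V sp gx])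
      also have "\<dots> = r *\<^sub>R (\<Sum>e\<in>Basis. - dual_covector e \<odot> local_d (?i e) (g x))"
        unfolding local_d_ext_prod[OF V smd smi gx] z minus by simp
      finally show ?thesis by simp
    qed
    finally show ?thesis .
  qed
  from 1 2 show ?case by blast
qed

text \<open>A value of \<open>d \<alpha>\<close> on a list of length \<open>k + 1\<close> depends only on the degree \<open>k\<close> part of \<open>\<alpha>\<close>.\<close>

lemma pullback_local_d:
  fixes g :: "'b::euclidean_space \<Rightarrow> 'b"
  assumes U: "open U" and V: "open V" and gUV: "g ` U \<subseteq> V" and g: "smooth_on U g"
    and b: "smooth_coeffs V \<beta>" "\<And>y. y \<in> V \<Longrightarrow> alternating (\<beta> y)"
    and x: "x \<in> U"
    and a: "\<And>x. x \<in> U \<Longrightarrow> \<alpha> x = pullback (frechet_derivative g (at x)) (\<beta> (g x))"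
  shows "local_d \<alpha> x = pullback (frechet_derivative g (at x)) (local_d \<beta> (g x))"
proof
  fix vs :: "'b list"
  define k where "k = length vs - 1"
  have "local_d \<alpha> x vs = local_d (\<lambda>y. grade_part k (\<alpha> y)) x vs"
    unfolding k_def by (rule local_d_grade_part)
  also have "local_d (\<lambda>y. grade_part k (\<alpha> y)) x =
      local_d (\<lambda>x. pullback (frechet_derivative g (at x)) (grade_part k (\<beta> (g x)))) x"
    by (rule local_d_cong[OF U x]) (simp add: a grade_part_pullback)
  also have "\<dots> = pullback (frechet_derivative g (at x)) (local_d (\<lambda>y. grade_part k (\<beta> y)) (g x))"
    using pullback_local_d_graded[OF U V gUV g smooth_coeffs_grade_part[OF b(1)]
        alternating_grade_part[OF b(2)] has_grade_grade_part] x by blast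
  also have "\<dots> vs = pullback (frechet_derivative g (at x)) (local_d \<beta> (g x)) vs"
    unfolding pullback_def k_def using local_d_grade_part[of \<beta> "g x" "map (frechet_derivative g (at x)) vs"] by simp
  finally show "local_d \<alpha> x vs = pullback (frechet_derivative g (at x)) (local_d \<beta> (g x)) vs" .
qed

section \<open>Forms of mixed degree\<close>

text \<open>Finite sums of forms of different degrees. All operators are defined on this space, so that their
commutator relations can be stated without reference to degrees.\<close>

definition mixed_forms :: "('a, 'b::euclidean_space) chart set \<Rightarrow> ('a, 'b) form set"
  where "mixed_forms A = {\<alpha>.
    (\<forall>c x. c \<notin> A \<or> x \<notin> chart_image c \<longrightarrow> \<alpha> c x = 0) \<and>
    (\<forall>c\<in>A. smooth_coeffs (chart_image c) (\<alpha> c)) \<and>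
    (\<forall>c\<in>A. \<forall>x\<in>chart_image c. alternating (\<alpha> c x)) \<and>
    (\<forall>c\<in>A. \<forall>c'\<in>A. \<forall>x\<in>overlap c c'.
       \<alpha> c x = pullback (frechet_derivative (transition c c') (at x)) (\<alpha> c' (transition c c' x)))}"

definition homogeneous :: "nat \<Rightarrow> ('a, 'b) form \<Rightarrow> bool"
  where "homogeneous k \<alpha> \<longleftrightarrow> (\<forall>c x. has_grade k (\<alpha> c x))"

lemma mixed_formsD:
  assumes "\<alpha> \<in> mixed_forms A"
  shows "c \<notin> A \<or> x \<notin> chart_image c \<Longrightarrow> \<alpha> c x = 0"
    and "c \<in> A \<Longrightarrow> smooth_coeffs (chart_image c) (\<alpha> c)"
    and "c \<in> A \<Longrightarrow> x \<in> chart_image c \<Longrightarrow> alternating (\<alpha> c x)"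
    and "c \<in> A \<Longrightarrow> c' \<in> A \<Longrightarrow> x \<in> overlap c c' \<Longrightarrow>
       \<alpha> c x = pullback (frechet_derivative (transition c c') (at x)) (\<alpha> c' (transition c c' x))"
  using assms unfolding mixed_forms_def by blast+

lemma mixed_forms_alternating: "\<alpha> \<in> mixed_forms A \<Longrightarrow> alternating (\<alpha> c x)"
  using mixed_formsD(1,3)[of \<alpha> A] by (metis alternating_zero)

lemma forms_iff:
  fixes \<alpha> :: "('a, 'b::euclidean_space) form"
  shows "\<alpha> \<in> forms A k \<longleftrightarrow> \<alpha> \<in> mixed_forms A \<and> homogeneous k \<alpha>"
proof
  assume f: "\<alpha> \<in> forms A k"
  then have z: "\<alpha> c x vs = 0" if "c \<notin> A \<or> x \<notin> chart_image c \<or> length vs \<noteq> k" for c x vs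
    using that unfolding forms_def by blast
  have alt: "alternating (\<alpha> c x)" if "c \<in> A" "x \<in> chart_image c" for c x
    unfolding alternating_def
  proof
    fix j
    have "alternating_form k (\<alpha> c x)" using f that by (auto simp: forms_def)
    moreover have "alternating_form j (\<alpha> c x)" if "j \<noteq> k"
      using z that by (auto simp: alternating_form_def intro!: linearI)
    ultimately show "alternating_form j (\<alpha> c x)" by (cases "j = k") auto
  qed
  have sm: "smooth_coeffs (chart_image c) (\<alpha> c)" if "c \<in> A" for c
    unfolding smooth_coeffs_def
  proof
    fix vs :: "'b list" show "smooth_on (chart_image c) (\<lambda>x. \<alpha> c x vs)"
    proof (cases "length vs = k")
      case True
      then show ?thesis using f that by (simp add: forms_def)
    next
      case False
      then have "(\<lambda>x. \<alpha> c x vs) = (\<lambda>x. 0)" using z by auto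
      then show ?thesis by (simp add: smooth_on_const)
    qed
  qed
  have comp: "\<alpha> c x = pullback (frechet_derivative (transition c c') (at x)) (\<alpha> c' (transition c c' x))"
    if "c \<in> A" "c' \<in> A" "x \<in> overlap c c'" for c c' x
  proof
    fix vs :: "'b list" show "\<alpha> c x vs = pullback (frechet_derivative (transition c c') (at x)) (\<alpha> c' (transition c c' x)) vs"
      using f that z[of c x vs] z[of c' "transition c c' x" "map (frechet_derivative (transition c c') (at x)) vs"]
      by (cases "length vs = k") (auto simp: forms_def pullback_def)
  qed
  show "\<alpha> \<in> mixed_forms A \<and> homogeneous k \<alpha>"
    using z alt sm comp by (auto simp: mixed_forms_def homogeneous_def has_grade_def fun_eq_iff fun_apply)
next
  assume m: "\<alpha> \<in> mixed_forms A \<and> homogeneous k \<alpha>"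
  then have m1: "\<alpha> \<in> mixed_forms A" and m2: "\<And>c x vs. length vs \<noteq> k \<Longrightarrow> \<alpha> c x vs = 0"
    by (auto simp: homogeneous_def has_grade_def)
  show "\<alpha> \<in> forms A k"
    unfolding forms_def mem_Collect_eq
  proof (intro conjI allI ballI impI)
    fix c x and vs :: "'b list" assume "c \<notin> A \<or> x \<notin> chart_image c \<or> length vs \<noteq> k"
    then show "\<alpha> c x vs = 0" using mixed_formsD(1)[OF m1, of c x] m2[of vs c x] by (auto simp: fun_apply)
  next
    fix c x assume "c \<in> A" "x \<in> chart_image c"
    then show "alternating_form k (\<alpha> c x)" using mixed_formsD(3)[OF m1] by (auto simp: alternating_def)
  next
    fix c and vs :: "'b list" assume "c \<in> A"
    then show "smooth_on (chart_image c) (\<lambda>x. \<alpha> c x vs)" using mixed_formsD(2)[OF m1] by (auto simp: smooth_coeffs_def)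
  next
    fix c c' x and vs :: "'b list" assume "c \<in> A" "c' \<in> A" "x \<in> overlap c c'"
    from mixed_formsD(4)[OF m1 this]
    show "\<alpha> c x vs = \<alpha> c' (transition c c' x) (map (frechet_derivative (transition c c') (at x)) vs)"
      by (simp add: pullback_def fun_eq_iff)
  qed
qed

lemma ext_d_eq_local_d: "c \<in> A \<Longrightarrow> x \<in> chart_image c \<Longrightarrow> ext_d A \<alpha> c x = local_d (\<alpha> c) x"
  by (simp add: ext_d_def local_d_def)

lemma ext_d_outside: "c \<notin> A \<or> x \<notin> chart_image c \<Longrightarrow> ext_d A \<alpha> c x = 0"
  by (auto simp: ext_d_def fun_eq_iff fun_apply)

locale symplectic_atlas =
  fixes X :: "'a topology" and A :: "('a, 'b::euclidean_space) chart set" and \<omega> :: "('a, 'b) form"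
  assumes symplectic: "symplectic_manifold X A \<omega>"
begin

lemma symplectic_form: "symplectic_form A \<omega>"
  using symplectic by (simp add: symplectic_manifold_def)

lemma chart: "c \<in> A \<Longrightarrow> is_chart X c"
  using symplectic by (simp add: symplectic_manifold_def smooth_manifold_def)

lemma open_chart_image: "c \<in> A \<Longrightarrow> open (chart_image c)"
  using chart by (simp add: is_chart_def)

lemma overlap_subset: "overlap c c' \<subseteq> chart_image c"
  by (auto simp: overlap_def chart_image_def)

lemma inj_chart: "c \<in> A \<Longrightarrow> inj_on (snd c) (fst c)"
  using chart[of c] homeomorphic_imp_injective_map[of "subtopology X (fst c)" "top_of_set (chart_image c)" "snd c"]
    openin_subset[of X "fst c"]
  by (simp add: is_chart_def Int_absorb1)

lemma open_overlap:
  assumes "c \<in> A" "c' \<in> A"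
  shows "open (overlap c c')"
proof -
  have o: "openin X (fst c)" "openin X (fst c')" using chart assms by (auto simp: is_chart_def)
  have "openin (subtopology X (fst c)) (fst c \<inter> fst c')"
    using o by (metis inf_le1 openin_Int openin_open_subtopology)
  moreover have "open_map (subtopology X (fst c)) (top_of_set (chart_image c)) (snd c)"
    using chart[OF assms(1)] by (auto simp: is_chart_def intro: homeomorphic_imp_open_map)
  ultimately have "openin (top_of_set (chart_image c)) (overlap c c')"
    unfolding overlap_def open_map_def by blast
  then show ?thesis using open_chart_image[OF assms(1)] openin_open_trans by blast
qed

lemma transition_image:
  assumes "c \<in> A" "x \<in> overlap c c'"
  shows "transition c c' x \<in> overlap c' c"
    and "c' \<in> A \<Longrightarrow> transition c' c (transition c c' x) = x"
proof -
  obtain p where p: "p \<in> fst c" "p \<in> fst c'" "x = snd c p" using assms(2) unfolding overlap_def by blast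
  have "inv_into (fst c) (snd c) x = p" using inv_into_f_f[OF inj_chart[OF assms(1)] p(1)] p(3) by metis
  then have t: "transition c c' x = snd c' p" by (simp add: transition_def)
  with p show "transition c c' x \<in> overlap c' c" unfolding overlap_def by blast
  assume "c' \<in> A"
  then have "inv_into (fst c') (snd c') (snd c' p) = p" using inv_into_f_f[OF inj_chart p(2)] by metis
  then show "transition c' c (transition c c' x) = x" using t p(3) by (simp add: transition_def)
qed

lemma smooth_transition: "c \<in> A \<Longrightarrow> c' \<in> A \<Longrightarrow> smooth_on (overlap c c') (transition c c')"
  using symplectic by (simp add: symplectic_manifold_def smooth_manifold_def)

lemma transition_subset: "c \<in> A \<Longrightarrow> transition c c' ` overlap c c' \<subseteq> chart_image c'"
  using transition_image(1)[of c _ c'] subsetD[OF overlap_subset[of c' c]] by (simp add: image_subset_iff)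

lemma linear_transition:
  "c \<in> A \<Longrightarrow> c' \<in> A \<Longrightarrow> x \<in> overlap c c' \<Longrightarrow> linear (frechet_derivative (transition c c') (at x))"
  by (intro linear_frechet_derivative smooth_on_imp_differentiable[OF smooth_transition])

lemma surj_transition:
  assumes "c \<in> A" "c' \<in> A" "x \<in> overlap c c'"
  shows "surj (frechet_derivative (transition c c') (at x))"
proof -
  let ?y = "transition c c' x"
  let ?T = "frechet_derivative (transition c c') (at x)"
  let ?T' = "frechet_derivative (transition c' c) (at ?y)"
  have y: "?y \<in> overlap c' c" using transition_image(1)[OF assms(1,3)] .
  have x: "transition c' c ?y = x" using transition_image(2)[OF assms(1,3,2)] .
  have "(transition c' c has_derivative ?T') (at ?y)"
    by (intro has_frechet_derivative smooth_on_imp_differentiable[OF smooth_transition[OF assms(2,1)] y])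
  moreover have "(transition c c' has_derivative ?T) (at (transition c' c ?y))"
    unfolding x by (intro has_frechet_derivative smooth_on_imp_differentiable[OF smooth_transition[OF assms(1,2)] assms(3)])
  ultimately have "((\<lambda>z. transition c c' (transition c' c z)) has_derivative (\<lambda>v. ?T (?T' v))) (at ?y)"
    by (rule has_derivative_compose)
  moreover have "((\<lambda>z. transition c c' (transition c' c z)) has_derivative (\<lambda>v. v)) (at ?y)"
    by (rule has_derivative_transform_within_open[OF has_derivative_ident open_overlap[OF assms(2,1)] y])
      (use transition_image(2)[OF assms(2) _ assms(1)] in simp)
  ultimately have "(\<lambda>v. ?T (?T' v)) = (\<lambda>v. v)" by (rule has_derivative_unique)
  then show ?thesis by (metis surjI)
qed

lemma mixed_formsI:
  assumes "\<And>c x. c \<notin> A \<or> x \<notin> chart_image c \<Longrightarrow> \<alpha> c x = 0"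
    and "\<And>c. c \<in> A \<Longrightarrow> smooth_coeffs (chart_image c) (\<alpha> c)"
    and "\<And>c x. c \<in> A \<Longrightarrow> x \<in> chart_image c \<Longrightarrow> alternating (\<alpha> c x)"
    and "\<And>c c' x. c \<in> A \<Longrightarrow> c' \<in> A \<Longrightarrow> x \<in> overlap c c' \<Longrightarrow> x \<in> chart_image c \<Longrightarrow>
       transition c c' x \<in> chart_image c' \<Longrightarrow>
       \<alpha> c x = pullback (frechet_derivative (transition c c') (at x)) (\<alpha> c' (transition c c' x))"
  shows "\<alpha> \<in> mixed_forms A"
proof -
  have "transition c c' x \<in> chart_image c'" if "c \<in> A" "x \<in> overlap c c'" for c c' x
    by (rule subsetD[OF transition_subset[OF that(1)] imageI[OF that(2)]])
  moreover have "x \<in> chart_image c" if "x \<in> overlap c c'" for c c' x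
    by (rule subsetD[OF overlap_subset that])
  ultimately show ?thesis
    unfolding mixed_forms_def mem_Collect_eq by (intro conjI allI ballI impI assms)
qed

lemma mixed_forms_zero: "0 \<in> mixed_forms A"
proof (rule mixed_formsI)
  show "smooth_coeffs (chart_image c) (0 c)" for c :: "('a, 'b) chart"
    using smooth_coeffs_zero[of "chart_image c"] by (simp add: zero_fun_def)
qed (auto simp: fun_apply pullback_def fun_eq_iff)

lemma mixed_forms_add:
  assumes "\<alpha> \<in> mixed_forms A" "\<beta> \<in> mixed_forms A"
  shows "\<alpha> + \<beta> \<in> mixed_forms A"
proof (rule mixed_formsI)
  fix c assume c: "c \<in> A"
  show "smooth_coeffs (chart_image c) ((\<alpha> + \<beta>) c)"
    using smooth_coeffs_add[OF open_chart_image[OF c] mixed_formsD(2)[OF assms(1) c] mixed_formsD(2)[OF assms(2) c]]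
    by (simp add: plus_fun_def)
qed (use mixed_formsD[OF assms(1)] mixed_formsD[OF assms(2)] in
    \<open>simp_all add: plus_fun_apply[of \<alpha>] plus_fun_apply[of "\<alpha> _"] alternating_add pullback_linear\<close>)

lemma mixed_forms_scaleR:
  assumes "\<alpha> \<in> mixed_forms A"
  shows "r *\<^sub>R \<alpha> \<in> mixed_forms A"
proof (rule mixed_formsI)
  fix c assume c: "c \<in> A"
  show "smooth_coeffs (chart_image c) ((r *\<^sub>R \<alpha>) c)"
    using smooth_coeffs_scaleR[OF open_chart_image[OF c] mixed_formsD(2)[OF assms c]]
    by (simp add: scaleR_fun_def)
qed (use mixed_formsD[OF assms] in
    \<open>simp_all add: scaleR_fun_apply[of _ \<alpha>] scaleR_fun_apply[of _ "\<alpha> _"] alternating_scaleR pullback_linear\<close>)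

lemma mixed_forms_minus: "\<alpha> \<in> mixed_forms A \<Longrightarrow> - \<alpha> \<in> mixed_forms A"
  using mixed_forms_scaleR[of \<alpha> "- 1"] by simp

lemma mixed_forms_diff: "\<alpha> \<in> mixed_forms A \<Longrightarrow> \<beta> \<in> mixed_forms A \<Longrightarrow> \<alpha> - \<beta> \<in> mixed_forms A"
  using mixed_forms_add[of \<alpha> "- \<beta>"] mixed_forms_minus[of \<beta>] by simp

lemma mixed_forms_sum: "(\<And>i. i \<in> I \<Longrightarrow> f i \<in> mixed_forms A) \<Longrightarrow> (\<Sum>i\<in>I. f i) \<in> mixed_forms A"
  by (induction I rule: infinite_finite_induct) (auto intro: mixed_forms_zero mixed_forms_add)

lemma mixed_forms_wedge:
  assumes "\<alpha> \<in> mixed_forms A" "\<beta> \<in> mixed_forms A"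
  shows "wedge \<alpha> \<beta> \<in> mixed_forms A"
proof (rule mixed_formsI)
  fix c assume "c \<in> A"
  then have "smooth_coeffs (chart_image c) (\<lambda>x. \<alpha> c x \<odot> \<beta> c x)"
    by (intro smooth_coeffs_ext_prod open_chart_image mixed_formsD(2)[OF assms(1)] mixed_formsD(2)[OF assms(2)])
  then show "smooth_coeffs (chart_image c) (wedge \<alpha> \<beta> c)"
    by (simp add: wedge_eq_ext_prod[abs_def])
qed (use mixed_formsD[OF assms(1)] mixed_formsD[OF assms(2)] in
    \<open>simp_all add: wedge_eq_ext_prod alternating_ext_prod pullback_ext_prod\<close>)

lemma mixed_forms_ext_d:
  assumes "\<alpha> \<in> mixed_forms A"
  shows "ext_d A \<alpha> \<in> mixed_forms A"
proof (rule mixed_formsI)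
  fix c x assume "c \<notin> A \<or> x \<notin> chart_image c"
  then show "ext_d A \<alpha> c x = 0" by (rule ext_d_outside)
next
  fix c assume c: "c \<in> A"
  show "smooth_coeffs (chart_image c) (ext_d A \<alpha> c)"
    by (subst smooth_coeffs_cong[OF open_chart_image[OF c] ext_d_eq_local_d[OF c]])
      (simp_all add: smooth_coeffs_local_d[OF open_chart_image[OF c] mixed_formsD(2)[OF assms c]])
next
  fix c x assume c: "c \<in> A" and x: "x \<in> chart_image c"
  show "alternating (ext_d A \<alpha> c x)"
    unfolding ext_d_eq_local_d[OF c x]
    by (rule alternating_local_d[OF open_chart_image[OF c] mixed_formsD(2)[OF assms c] mixed_formsD(3)[OF assms c] x])
next
  fix c c' x assume c: "c \<in> A" "c' \<in> A" "x \<in> overlap c c'" "x \<in> chart_image c" "transition c c' x \<in> chart_image c'"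
  show "ext_d A \<alpha> c x = pullback (frechet_derivative (transition c c') (at x)) (ext_d A \<alpha> c' (transition c c' x))"
    unfolding ext_d_eq_local_d[OF c(1,4)] ext_d_eq_local_d[OF c(2,5)]
    by (rule pullback_local_d[OF open_overlap[OF c(1,2)] open_chart_image[OF c(2)] transition_subset[OF c(1)]
        smooth_transition[OF c(1,2)] mixed_formsD(2)[OF assms c(2)] mixed_formsD(3)[OF assms c(2)] c(3)
        mixed_formsD(4)[OF assms c(1,2)]])
qed

section \<open>The Poisson bivector\<close>

lemma \<omega>_mixed: "\<omega> \<in> mixed_forms A" and \<omega>_homogeneous: "homogeneous 2 \<omega>" and d_\<omega>: "ext_d A \<omega> = 0"
  using symplectic_form by (auto simp: symplectic_form_def forms_iff)

text \<open>The Hamiltonian vector of the covector \<open>u\<^sup>*\<close>. The matrix of this map in the standard basis has the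
components of \<open>\<pi>\<close> as entries (\<open>poisson_bivector_ham\<close>), so \<open>\<Lambda>\<close> is the contraction with it.\<close>

definition ham :: "('a, 'b) chart \<Rightarrow> 'b \<Rightarrow> 'b \<Rightarrow> 'b"
  where "ham c x u = ham_vector \<omega> c x (\<lambda>v. v \<bullet> u)"

lemma \<omega>_ham:
  assumes "c \<in> A" "x \<in> chart_image c"
  shows "\<omega> c x [ham c x u, v] = - (v \<bullet> u)"
  unfolding ham_def
  by (rule ham_vector[OF symplectic_form assms]) (simp add: linear_iff inner_add_left)

lemma \<omega>_linear: "linear (\<lambda>v. \<omega> c x [v, w])" "linear (\<lambda>v. \<omega> c x [w, v])"
  using alternating_linear[OF mixed_forms_alternating[OF \<omega>_mixed]]
    alternating_linear[OF alternating_interior_prod[OF mixed_forms_alternating[OF \<omega>_mixed]]]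
  by (simp_all add: interior_prod_def)

lemma \<omega>_swap: "\<omega> c x [u, v] = - \<omega> c x [v, u]"
  by (rule alternating_swap[OF mixed_forms_alternating[OF \<omega>_mixed]])

lemma \<omega>_eqI:
  assumes "c \<in> A" "x \<in> chart_image c" "\<And>v. \<omega> c x [u, v] = \<omega> c x [w, v]"
  shows "u = w"
proof (rule ccontr)
  assume "u \<noteq> w"
  then obtain v where "\<omega> c x [u - w, v] \<noteq> 0"
    using symplectic_form assms(1,2) by (force simp: symplectic_form_def)
  then show False using assms(3)[of v] linear_diff[OF \<omega>_linear(1)] by simp
qed

lemma skew_map_ham:
  assumes c: "c \<in> A" "x \<in> chart_image c"
  shows "skew_map (ham c x)"
proof -
  have "linear (ham c x)"
    by (rule linearI; rule \<omega>_eqI[OF c])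
      (simp_all add: linear_add[OF \<omega>_linear(1)] linear_scale[OF \<omega>_linear(1)] \<omega>_ham[OF c] inner_add_right)
  moreover have "ham c x u \<bullet> v = - (ham c x v \<bullet> u)" for u v
  proof -
    have "ham c x u \<bullet> v = - \<omega> c x [ham c x v, ham c x u]" by (simp only: \<omega>_ham[OF c] minus_minus)
    also have "\<dots> = \<omega> c x [ham c x u, ham c x v]" by (rule \<omega>_swap[symmetric])
    also have "\<dots> = - (ham c x v \<bullet> u)" by (rule \<omega>_ham[OF c])
    finally show ?thesis .
  qed
  ultimately show ?thesis unfolding skew_map_def by blast
qed

lemma poisson_bivector_ham:
  assumes c: "c \<in> A" "x \<in> chart_image c"
  shows "poisson_bivector \<omega> c x (\<lambda>v. v \<bullet> e) (\<lambda>v. v \<bullet> e') = ham c x e \<bullet> e'"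
proof -
  have "ham c x e \<bullet> e' = - (ham c x e' \<bullet> e)" using skew_map_ham[OF c] unfolding skew_map_def by blast
  then show ?thesis
    unfolding poisson_bivector_def ham_def[symmetric] \<omega>_ham[OF c] by (rule sym)
qed

lemma lefschetz_Lambda_eq:
  assumes c: "c \<in> A" "x \<in> chart_image c" and a: "alternating (\<alpha> c x)"
  shows "lefschetz_Lambda \<omega> \<alpha> c x = bivector_contraction (ham c x) (\<alpha> c x)"
proof
  fix vs
  have l: "linear (\<lambda>v. \<alpha> c x (e # v # vs))" for e
    using alternating_linear[OF alternating_interior_prod[OF a]] by (simp add: interior_prod_def)
  have "lefschetz_Lambda \<omega> \<alpha> c x vs =
      1 / 2 * (\<Sum>e\<in>Basis. \<Sum>e'\<in>Basis. (ham c x e \<bullet> e') *\<^sub>R \<alpha> c x (e # e' # vs))"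
    by (simp add: lefschetz_Lambda_def poisson_bivector_ham[OF c])
  also have "\<dots> = bivector_contraction (ham c x) (\<alpha> c x) vs"
    by (simp only: sum_Basis_linear[OF l]) (simp add: bivector_contraction_def fun_apply sum_fun_apply interior_prod_def)
  finally show "lefschetz_Lambda \<omega> \<alpha> c x vs = bivector_contraction (ham c x) (\<alpha> c x) vs" .
qed

lemma lefschetz_Lambda_outside: "\<alpha> c x = 0 \<Longrightarrow> lefschetz_Lambda \<omega> \<alpha> c x = 0"
  by (simp add: lefschetz_Lambda_def fun_eq_iff fun_apply)

text \<open>Up to sign, the components of \<open>\<pi>\<close> form the inverse of the matrix of \<open>\<omega>\<close>.\<close>

lemma smooth_ham:
  assumes c: "c \<in> A" and e: "e \<in> Basis" "e' \<in> Basis"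
  shows "smooth_on (chart_image c) (\<lambda>x. ham c x e \<bullet> e')"
proof -
  have "smooth_on (chart_image c) (\<lambda>x. - (ham c x e \<bullet> e'))"
  proof (rule smooth_on_inverse_matrix[where p = "\<lambda>x e e'. - (ham c x e \<bullet> e')" and w = "\<lambda>x e e'. \<omega> c x [e, e']",
      OF open_chart_image[OF c] finite_Basis])
    fix x i j :: 'b assume x: "x \<in> chart_image c" and ij: "i \<in> Basis" "j \<in> Basis"
    have "(\<Sum>k\<in>Basis. (ham c x i \<bullet> k) *\<^sub>R \<omega> c x [k, j]) = - (j \<bullet> i)"
      by (simp only: sum_Basis_linear[OF \<omega>_linear(1)] \<omega>_ham[OF c x])
    then show "(\<Sum>k\<in>Basis. - (ham c x i \<bullet> k) * \<omega> c x [k, j]) = (if i = j then 1 else 0)"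
      using ij by (simp add: sum_negf inner_Basis)
    have "(\<Sum>k\<in>Basis. (ham c x j \<bullet> k) *\<^sub>R \<omega> c x [i, k]) = \<omega> c x [i, ham c x j]"
      by (simp only: sum_Basis_linear[OF \<omega>_linear(2)])
    also have "\<dots> = - \<omega> c x [ham c x j, i]" by (rule \<omega>_swap)
    also have "\<dots> = i \<bullet> j" by (simp only: \<omega>_ham[OF c x] minus_minus)
    finally have "(\<Sum>k\<in>Basis. (ham c x j \<bullet> k) *\<^sub>R \<omega> c x [i, k]) = i \<bullet> j" .
    moreover have "- (ham c x k \<bullet> j) = ham c x j \<bullet> k" for k
      using skew_map_ham[OF c x] unfolding skew_map_def by (metis minus_minus)
    ultimately show "(\<Sum>k\<in>Basis. \<omega> c x [i, k] * - (ham c x k \<bullet> j)) = (if i = j then 1 else 0)"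
      using ij by (simp add: inner_Basis mult.commute)
  next
    show "smooth_on (chart_image c) (\<lambda>x. \<omega> c x [i, j])" for i j
      using mixed_formsD(2)[OF \<omega>_mixed c] by (simp add: smooth_coeffs_def)
  qed (use e in auto)
  from smooth_on_minus[OF open_chart_image[OF c] this] show ?thesis by simp
qed

text \<open>Both sides have the same contraction with \<open>\<omega>\<close>, because \<open>\<omega>\<close> is compatible with the transition map, and
\<open>\<omega>\<close> is nondegenerate.\<close>

lemma ham_transition:
  assumes c: "c \<in> A" "c' \<in> A" "x \<in> overlap c c'"
  shows "ham c' (transition c c' x) u =
    frechet_derivative (transition c c') (at x) (ham c x (adjoint (frechet_derivative (transition c c') (at x)) u))"
proof -
  let ?T = "frechet_derivative (transition c c') (at x)" and ?y = "transition c c' x"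
  have x: "x \<in> chart_image c" by (rule subsetD[OF overlap_subset c(3)])
  have y: "?y \<in> chart_image c'" by (rule subsetD[OF transition_subset[OF c(1)] imageI[OF c(3)]])
  show ?thesis
  proof (rule \<omega>_eqI[OF c(2) y])
    fix v
    obtain w where w: "v = ?T w" using surj_transition[OF c] by (metis surjD)
    have "\<omega> c' ?y [?T (ham c x (adjoint ?T u)), ?T w] = \<omega> c x [ham c x (adjoint ?T u), w]"
      using mixed_formsD(4)[OF \<omega>_mixed c] by (simp add: pullback_def)
    then show "\<omega> c' ?y [ham c' ?y u, v] = \<omega> c' ?y [?T (ham c x (adjoint ?T u)), v]"
      unfolding w \<omega>_ham[OF c(2) y] \<omega>_ham[OF c(1) x] adjoint_works[OF linear_transition[OF c]] by simp
  qed
qed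

lemma mixed_forms_Lambda:
  assumes a: "\<alpha> \<in> mixed_forms A"
  shows "lefschetz_Lambda \<omega> \<alpha> \<in> mixed_forms A"
proof (rule mixed_formsI)
  fix c x assume "c \<notin> A \<or> x \<notin> chart_image c"
  then show "lefschetz_Lambda \<omega> \<alpha> c x = 0" by (intro lefschetz_Lambda_outside mixed_formsD(1)[OF a])
next
  fix c assume c: "c \<in> A"
  show "smooth_coeffs (chart_image c) (lefschetz_Lambda \<omega> \<alpha> c)"
    unfolding smooth_coeffs_def
  proof
    fix vs
    note S = open_chart_image[OF c]
    have "smooth_on (chart_image c) (\<lambda>x. 1 / 2 * (\<Sum>e\<in>Basis. \<Sum>e'\<in>Basis. (ham c x e \<bullet> e') * \<alpha> c x (e # e' # vs)))"
      using mixed_formsD(2)[OF a c]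
      by (intro smooth_on_cmult[OF S] smooth_on_sum[OF S] smooth_on_mult[OF S] smooth_ham[OF c])
        (auto simp: smooth_coeffs_def)
    moreover have "lefschetz_Lambda \<omega> \<alpha> c x vs =
      1 / 2 * (\<Sum>e\<in>Basis. \<Sum>e'\<in>Basis. (ham c x e \<bullet> e') * \<alpha> c x (e # e' # vs))" if "x \<in> chart_image c" for x
      by (simp add: lefschetz_Lambda_def poisson_bivector_ham[OF c that])
    ultimately show "smooth_on (chart_image c) (\<lambda>x. lefschetz_Lambda \<omega> \<alpha> c x vs)"
      by (subst smooth_on_cong[OF S]) auto
  qed
next
  fix c x assume "c \<in> A" "x \<in> chart_image c"
  then show "alternating (lefschetz_Lambda \<omega> \<alpha> c x)"
    using mixed_forms_alternating[OF a] by (simp add: lefschetz_Lambda_eq alternating_bivector_contraction)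
next
  fix c c' x assume c: "c \<in> A" "c' \<in> A" "x \<in> overlap c c'" "x \<in> chart_image c" "transition c c' x \<in> chart_image c'"
  have "linear (ham c x)" using skew_map_ham[OF c(1,4)] unfolding skew_map_def by blast
  note bivector_contraction_pullback[OF linear_transition[OF c(1-3)] this mixed_forms_alternating[OF a] ham_transition[OF c(1-3)]]
  then show "lefschetz_Lambda \<omega> \<alpha> c x =
      pullback (frechet_derivative (transition c c') (at x)) (lefschetz_Lambda \<omega> \<alpha> c' (transition c c' x))"
    unfolding lefschetz_Lambda_eq[OF c(1,4) mixed_forms_alternating[OF a]]
      lefschetz_Lambda_eq[OF c(2,5) mixed_forms_alternating[OF a]] mixed_formsD(4)[OF a c(1-3)] .
qed

end

section \<open>The Lefschetz operators\<close>

text \<open>If the arguments are distinct, one of them is in the span of the others.\<close>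

lemma alternating_vanishes_above_dim:
  fixes a :: "'b::euclidean_space list \<Rightarrow> real"
  assumes a: "alternating a" and len: "length vs > DIM('b)"
  shows "a vs = 0"
proof (cases "distinct vs")
  case False
  then obtain i j where "i < j" "j < length vs" "vs ! i = vs ! j"
    by (metis distinct_conv_nth linorder_neqE_nat)
  then show ?thesis using a unfolding alternating_def alternating_form_def by blast
next
  case True
  then have "card (set vs) > DIM('b)" using len by (simp add: distinct_card)
  then have "dependent (set vs)" by (simp add: dependent_biggerset)
  then obtain v where v: "v \<in> set vs" "v \<in> span (set vs - {v})" by (auto simp: dependent_def)
  then obtain i where i: "i < length vs" "vs ! i = v" by (auto simp: in_set_conv_nth)
  have lin: "linear (\<lambda>u. a (vs[i := u]))" using a i unfolding alternating_def alternating_form_def by blast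
  have "a (vs[i := u]) = 0" if u: "u \<in> set vs - {v}" for u
  proof -
    obtain j where j: "j < length vs" "vs ! j = u" "j \<noteq> i" using u i by (auto simp: in_set_conv_nth)
    then have "min i j < max i j" "max i j < length (vs[i := u])" "vs[i := u] ! min i j = vs[i := u] ! max i j"
      using i by (auto simp: min_def max_def nth_list_update)
    then show ?thesis using a unfolding alternating_def alternating_form_def by blast
  qed
  then have "a (vs[i := v]) = 0"
    using linear_eq_0_on_span[OF lin, of "set vs - {v}" v] v(2) by blast
  then show ?thesis using i by (metis list_update_id)
qed

text \<open>Multiplication by a function of the degree. The sign \<open>(- 1)\<^sup>k\<close> of the Leibniz rule, the operator \<open>n - k\<close> and
the projection to a degree are of this form.\<close>

definition reweight :: "(nat \<Rightarrow> real) \<Rightarrow> ('a, 'b) form \<Rightarrow> ('a, 'b) form"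
  where "reweight f \<alpha> = (\<lambda>c x vs. f (length vs) * \<alpha> c x vs)"

lemma form_add_apply: "(\<alpha> + \<beta>) c x = \<alpha> c x + (\<beta> c x :: 'b list \<Rightarrow> real)" for \<alpha> \<beta> :: "('a, 'b) form"
  by (simp add: fun_apply)

lemma form_diff_apply: "(\<alpha> - \<beta>) c x = \<alpha> c x - (\<beta> c x :: 'b list \<Rightarrow> real)" for \<alpha> \<beta> :: "('a, 'b) form"
  by (simp add: fun_apply)

lemma form_scaleR_apply: "(r *\<^sub>R \<alpha>) c x = r *\<^sub>R (\<alpha> c x :: 'b list \<Rightarrow> real)" for \<alpha> :: "('a, 'b) form"
  by (simp add: fun_apply)

lemma form_eqI: "(\<And>c x. \<alpha> c x = \<beta> c x) \<Longrightarrow> \<alpha> = (\<beta> :: ('a, 'b) form)"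
  by (simp add: fun_eq_iff)

lemma wedge_add_left: "wedge (\<alpha> + \<beta>) \<gamma> = wedge \<alpha> \<gamma> + wedge \<beta> \<gamma>"
  and wedge_add_right: "wedge \<gamma> (\<alpha> + \<beta>) = wedge \<gamma> \<alpha> + wedge \<gamma> \<beta>"
  and wedge_scaleR_left: "wedge (r *\<^sub>R \<alpha>) \<gamma> = r *\<^sub>R wedge \<alpha> \<gamma>"
  and wedge_scaleR_right: "wedge \<gamma> (r *\<^sub>R \<alpha>) = r *\<^sub>R wedge \<gamma> \<alpha>"
  and wedge_assoc: "wedge (wedge \<alpha> \<beta>) \<gamma> = wedge \<alpha> (wedge \<beta> \<gamma>)"
  by (rule form_eqI; simp only: wedge_eq_ext_prod form_add_apply form_scaleR_apply ext_prod_add_left ext_prod_add_right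
      ext_prod_scaleR_left ext_prod_scaleR_right ext_prod_assoc)+

lemma bilinear_wedge: "bilinear wedge"
  by (auto simp: bilinear_def intro!: linearI wedge_add_left wedge_add_right wedge_scaleR_left wedge_scaleR_right)

lemmas wedge_zero_left = bilinear_lzero[OF bilinear_wedge]
  and wedge_zero_right = bilinear_rzero[OF bilinear_wedge]
  and wedge_minus_left = bilinear_lneg[OF bilinear_wedge]
  and wedge_minus_right = bilinear_rneg[OF bilinear_wedge]
  and wedge_diff_right = bilinear_rsub[OF bilinear_wedge]

lemma linear_lefschetz_L: "linear (lefschetz_L \<omega>)"
  unfolding lefschetz_L_def[abs_def] by (rule bilinear_wedge[unfolded bilinear_def, THEN conjunct1, rule_format])

lemma linear_lefschetz_Lambda: "linear (lefschetz_Lambda \<omega>)"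
  by (rule linearI)
    (auto simp: lefschetz_Lambda_def fun_eq_iff fun_apply sum.distrib distrib_left sum_distrib_left mult_ac)

context symplectic_atlas
begin

abbreviation d where "d \<equiv> ext_d A"
abbreviation L where "L \<equiv> lefschetz_L \<omega>"
abbreviation \<Lambda> where "\<Lambda> \<equiv> lefschetz_Lambda \<omega>"
abbreviation \<delta> where "\<delta> \<equiv> koszul_delta A \<omega>"
abbreviation T where "T \<equiv> mixed_forms A"

lemma mixed_forms_reweight:
  assumes "\<alpha> \<in> T"
  shows "reweight f \<alpha> \<in> T"
proof (rule mixed_formsI)
  fix c x assume "c \<notin> A \<or> x \<notin> chart_image c"
  from mixed_formsD(1)[OF assms this] show "reweight f \<alpha> c x = 0"
    by (simp add: reweight_def fun_eq_iff fun_apply)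
next
  fix c assume c: "c \<in> A"
  show "smooth_coeffs (chart_image c) (reweight f \<alpha> c)"
    using mixed_formsD(2)[OF assms c] by (simp add: smooth_coeffs_def reweight_def smooth_on_cmult[OF open_chart_image[OF c]])
next
  fix c x assume c: "c \<in> A" "x \<in> chart_image c"
  have "alternating_form k (reweight f \<alpha> c x)" for k
  proof -
    have "alternating_form k (reweight f \<alpha> c x) = alternating_form k (f k *\<^sub>R \<alpha> c x)"
      by (auto simp: alternating_form_def reweight_def fun_apply)
    then show ?thesis
      using alternating_scaleR[OF mixed_formsD(3)[OF assms c]] by (simp add: alternating_def)
  qed
  then show "alternating (reweight f \<alpha> c x)" by (simp add: alternating_def)
next
  fix c c' x assume "c \<in> A" "c' \<in> A" "x \<in> overlap c c'"
  from mixed_formsD(4)[OF assms this]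
  show "reweight f \<alpha> c x = pullback (frechet_derivative (transition c c') (at x)) (reweight f \<alpha> c' (transition c c' x))"
    by (simp add: reweight_def pullback_def)
qed

lemma mixed_forms_L: "\<alpha> \<in> T \<Longrightarrow> L \<alpha> \<in> T"
  unfolding lefschetz_L_def by (rule mixed_forms_wedge[OF \<omega>_mixed])

lemma mixed_forms_\<delta>: "\<alpha> \<in> T \<Longrightarrow> \<delta> \<alpha> \<in> T"
  unfolding koszul_delta_def by (intro mixed_forms_diff mixed_forms_Lambda mixed_forms_ext_d)

lemma d_eqI:
  assumes "\<And>c x. c \<in> A \<Longrightarrow> x \<in> chart_image c \<Longrightarrow> local_d (\<alpha> c) x = \<beta> c x"
    and "\<And>c x. c \<notin> A \<or> x \<notin> chart_image c \<Longrightarrow> \<beta> c x = 0"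
  shows "d \<alpha> = \<beta>"
proof (rule form_eqI)
  fix c x show "d \<alpha> c x = \<beta> c x"
    using assms ext_d_eq_local_d ext_d_outside by metis
qed

lemma d_add: "\<alpha> \<in> T \<Longrightarrow> \<beta> \<in> T \<Longrightarrow> d (\<alpha> + \<beta>) = d \<alpha> + d \<beta>"
proof (rule d_eqI)
  fix c x assume ab: "\<alpha> \<in> T" "\<beta> \<in> T" and c: "c \<in> A" "x \<in> chart_image c"
  show "local_d ((\<alpha> + \<beta>) c) x = (d \<alpha> + d \<beta>) c x"
    using local_d_linear(1)[OF open_chart_image[OF c(1)] mixed_formsD(2)[OF ab(1) c(1)] mixed_formsD(2)[OF ab(2) c(1)] c(2)]
    unfolding form_add_apply ext_d_eq_local_d[OF c] by (simp add: plus_fun_def)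
qed (simp only: form_add_apply ext_d_outside add_0_left)

lemma d_scaleR: "\<alpha> \<in> T \<Longrightarrow> d (r *\<^sub>R \<alpha>) = r *\<^sub>R d \<alpha>"
proof (rule d_eqI)
  fix c x assume a: "\<alpha> \<in> T" and c: "c \<in> A" "x \<in> chart_image c"
  show "local_d ((r *\<^sub>R \<alpha>) c) x = (r *\<^sub>R d \<alpha>) c x"
    using local_d_linear(3)[OF open_chart_image[OF c(1)] mixed_formsD(2)[OF a c(1)] smooth_coeffs_zero c(2)]
    unfolding form_scaleR_apply ext_d_eq_local_d[OF c] by (simp add: scaleR_fun_def)
qed (simp only: form_scaleR_apply ext_d_outside scaleR_zero_right)

lemma d_d: "\<alpha> \<in> T \<Longrightarrow> d (d \<alpha>) = 0"
proof (rule d_eqI)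
  fix c x assume a: "\<alpha> \<in> T" and c: "c \<in> A" "x \<in> chart_image c"
  have "local_d (d \<alpha> c) x = local_d (local_d (\<alpha> c)) x"
    by (rule local_d_cong[OF open_chart_image[OF c(1)] c(2)]) (rule ext_d_eq_local_d[OF c(1)])
  then show "local_d (d \<alpha> c) x = 0 c x"
    using local_d_local_d[OF open_chart_image[OF c(1)] mixed_formsD(2)[OF a c(1)] c(2)] by (simp add: fun_apply)
qed (simp add: fun_apply)

lemma d_wedge:
  assumes ab: "\<alpha> \<in> T" "\<beta> \<in> T"
  shows "d (wedge \<alpha> \<beta>) = wedge (d \<alpha>) \<beta> + wedge (reweight (\<lambda>k. (- 1) ^ k) \<alpha>) (d \<beta>)"
proof (rule d_eqI)
  fix c x assume c: "c \<in> A" "x \<in> chart_image c"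
  have gs: "reweight (\<lambda>k. (- 1) ^ k) \<alpha> c x = grade_sign (\<alpha> c x)" by (simp add: reweight_def grade_sign_def)
  show "local_d (wedge \<alpha> \<beta> c) x = (wedge (d \<alpha>) \<beta> + wedge (reweight (\<lambda>k. (- 1) ^ k) \<alpha>) (d \<beta>)) c x"
    using local_d_ext_prod[OF open_chart_image[OF c(1)] mixed_formsD(2)[OF ab(1) c(1)] mixed_formsD(2)[OF ab(2) c(1)] c(2)]
    unfolding form_add_apply wedge_eq_ext_prod gs ext_d_eq_local_d[OF c] by (simp add: wedge_eq_ext_prod[abs_def])
next
  fix c x assume c: "c \<notin> A \<or> x \<notin> chart_image c"
  show "(wedge (d \<alpha>) \<beta> + wedge (reweight (\<lambda>k. (- 1) ^ k) \<alpha>) (d \<beta>)) c x = 0"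
    unfolding form_add_apply wedge_eq_ext_prod by (simp add: ext_d_outside[OF c])
qed

lemma reweight_homogeneous: "homogeneous k \<alpha> \<Longrightarrow> reweight f \<alpha> = f k *\<^sub>R \<alpha>"
proof (rule form_eqI)
  fix c x assume "homogeneous k \<alpha>"
  then have "has_grade k (\<alpha> c x)" unfolding homogeneous_def by blast
  then show "reweight f \<alpha> c x = (f k *\<^sub>R \<alpha>) c x"
    unfolding form_scaleR_apply by (auto simp: has_grade_def reweight_def fun_eq_iff fun_apply)
qed

text \<open>The Leibniz rule, with \<open>\<omega>\<close> closed and of even degree.\<close>

lemma d_L: "\<alpha> \<in> T \<Longrightarrow> d (L \<alpha>) = L (d \<alpha>)"
  unfolding lefschetz_L_def d_wedge[OF \<omega>_mixed] d_\<omega>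
  by (simp add: wedge_zero_left reweight_homogeneous[OF \<omega>_homogeneous])

definition H :: "('a, 'b) form \<Rightarrow> ('a, 'b) form"
  where "H = reweight (\<lambda>k. real DIM('b) / 2 - real k)"

lemma \<Lambda>_L:
  assumes "\<alpha> \<in> T"
  shows "\<Lambda> (L \<alpha>) = L (\<Lambda> \<alpha>) + H \<alpha>"
proof (rule form_eqI)
  fix c x
  show "\<Lambda> (L \<alpha>) c x = (L (\<Lambda> \<alpha>) + H \<alpha>) c x"
  proof (cases "c \<in> A \<and> x \<in> chart_image c")
    case True
    then have c: "c \<in> A" "x \<in> chart_image c" by auto
    note alt = mixed_forms_alternating[OF assms, of c x] mixed_forms_alternating[OF \<omega>_mixed, of c x]
    have "\<Lambda> (L \<alpha>) c x = bivector_contraction (ham c x) (\<omega> c x \<odot> \<alpha> c x)"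
      by (subst lefschetz_Lambda_eq[OF c mixed_forms_alternating[OF mixed_forms_L[OF assms]]])
        (simp add: lefschetz_L_def wedge_eq_ext_prod)
    also have "\<dots> = \<omega> c x \<odot> bivector_contraction (ham c x) (\<alpha> c x) + (\<lambda>vs. (real DIM('b) / 2 - real (length vs)) * \<alpha> c x vs)"
      by (rule bivector_contraction_symplectic[OF skew_map_ham[OF c] alt _ \<omega>_ham[OF c]])
        (use \<omega>_homogeneous in \<open>unfold homogeneous_def, blast\<close>)
    also have "\<dots> = (L (\<Lambda> \<alpha>) + H \<alpha>) c x"
      unfolding form_add_apply lefschetz_L_def wedge_eq_ext_prod lefschetz_Lambda_eq[of c x \<alpha>, OF c alt(1)] H_def reweight_def ..
    finally show ?thesis .
  next
    case False
    then have c: "c \<notin> A \<or> x \<notin> chart_image c" by simp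
    have "\<Lambda> (L \<alpha>) c x = 0"
      by (rule lefschetz_Lambda_outside) (simp add: lefschetz_L_def wedge_eq_ext_prod mixed_formsD(1)[OF assms c])
    moreover have "L (\<Lambda> \<alpha>) c x = 0"
      by (simp add: lefschetz_L_def wedge_eq_ext_prod lefschetz_Lambda_outside mixed_formsD(1)[OF assms c])
    moreover have "H \<alpha> c x = 0"
      by (simp add: H_def reweight_def mixed_formsD(1)[OF assms c] fun_eq_iff fun_apply)
    ultimately show ?thesis by (simp add: form_add_apply)
  qed
qed

lemma mixed_forms_H: "\<alpha> \<in> T \<Longrightarrow> H \<alpha> \<in> T"
  unfolding H_def by (rule mixed_forms_reweight)

lemma linear_H: "linear H"
  by (rule linearI) (auto simp: H_def reweight_def fun_eq_iff fun_apply algebra_simps)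

lemma d_H: "\<alpha> \<in> T \<Longrightarrow> d (H \<alpha>) = H (d \<alpha>) + d \<alpha>"
proof (rule d_eqI)
  fix c x assume a: "\<alpha> \<in> T" and c: "c \<in> A" "x \<in> chart_image c"
  let ?n = "real DIM('b) / 2"
  show "local_d (H \<alpha> c) x = (H (d \<alpha>) + d \<alpha>) c x"
  proof
    fix vs :: "'b list"
    have "frechet_derivative (\<lambda>y. H \<alpha> c y (omit i vs)) (at x) v =
        (?n - real (length vs - 1)) * frechet_derivative (\<lambda>y. \<alpha> c y (omit i vs)) (at x) v" if "i < length vs" for i v
    proof -
      have "length (omit i vs) = length vs - 1" using that by (auto simp: omit_def)
      then show ?thesis unfolding H_def reweight_def
        using frechet_derivative_scaleR[OF smooth_coeffs_differentiable[OF mixed_formsD(2)[OF a c(1)] c(2)]] by simp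
    qed
    then have "local_d (H \<alpha> c) x vs = (?n - real (length vs - 1)) * local_d (\<alpha> c) x vs"
      unfolding local_d_def by (simp add: sum_distrib_left mult_ac)
    also have "\<dots> = (?n - real (length vs) + 1) * local_d (\<alpha> c) x vs"
      by (cases vs) auto
    finally show "local_d (H \<alpha> c) x vs = (H (d \<alpha>) + d \<alpha>) c x vs"
      unfolding form_add_apply H_def reweight_def ext_d_eq_local_d[OF c] by (simp add: fun_apply algebra_simps)
  qed
next
  fix c x assume c: "c \<notin> A \<or> x \<notin> chart_image c"
  show "(H (d \<alpha>) + d \<alpha>) c x = 0"
    unfolding form_add_apply H_def reweight_def ext_d_outside[OF c] by (simp add: fun_eq_iff fun_apply)
qed

lemma \<Lambda>_H: "\<Lambda> (H \<alpha>) = H (\<Lambda> \<alpha>) - 2 *\<^sub>R \<Lambda> \<alpha>"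
  unfolding lefschetz_Lambda_def H_def reweight_def
  by (auto simp: fun_eq_iff fun_apply sum_distrib_left sum_subtractf[symmetric] algebra_simps intro!: sum.cong)

section \<open>The commutator of \<open>\<Lambda>\<close> and \<open>\<delta>\<close>\<close>

text \<open>The iterated commutators \<open>(ad \<Lambda>)\<^sup>m d\<close>; the first one is \<open>\<delta>\<close>.\<close>

primrec ad_\<Lambda> :: "nat \<Rightarrow> ('a, 'b) form \<Rightarrow> ('a, 'b) form"
  where
    "ad_\<Lambda> 0 \<alpha> = d \<alpha>"
  | "ad_\<Lambda> (Suc m) \<alpha> = \<Lambda> (ad_\<Lambda> m \<alpha>) - ad_\<Lambda> m (\<Lambda> \<alpha>)"

lemma ad_\<Lambda>_1: "ad_\<Lambda> 1 \<alpha> = \<delta> \<alpha>"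
  by (simp add: koszul_delta_def)

lemma mixed_forms_ad_\<Lambda>: "\<alpha> \<in> T \<Longrightarrow> ad_\<Lambda> m \<alpha> \<in> T"
  by (induction m arbitrary: \<alpha>) (auto intro: mixed_forms_ext_d mixed_forms_diff mixed_forms_Lambda)

lemma ad_\<Lambda>_add: "\<alpha> \<in> T \<Longrightarrow> \<beta> \<in> T \<Longrightarrow> ad_\<Lambda> m (\<alpha> + \<beta>) = ad_\<Lambda> m \<alpha> + ad_\<Lambda> m \<beta>"
  by (induction m arbitrary: \<alpha> \<beta>)
    (simp_all add: d_add linear_add[OF linear_lefschetz_Lambda] mixed_forms_Lambda)

lemma ad_\<Lambda>_scaleR: "\<alpha> \<in> T \<Longrightarrow> ad_\<Lambda> m (r *\<^sub>R \<alpha>) = r *\<^sub>R ad_\<Lambda> m \<alpha>"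
  by (induction m arbitrary: \<alpha>)
    (simp_all add: d_scaleR linear_scale[OF linear_lefschetz_Lambda] mixed_forms_Lambda scaleR_diff_right)

lemma ad_\<Lambda>_diff: "\<alpha> \<in> T \<Longrightarrow> \<beta> \<in> T \<Longrightarrow> ad_\<Lambda> m (\<alpha> - \<beta>) = ad_\<Lambda> m \<alpha> - ad_\<Lambda> m \<beta>"
  using ad_\<Lambda>_add[of \<alpha> "(- 1) *\<^sub>R \<beta>"] ad_\<Lambda>_scaleR[of \<beta> m "- 1"] mixed_forms_scaleR[of \<beta> "- 1"] by simp

lemma vector_identities:
  fixes p q s t h y :: "'v::real_vector"
  shows "(p + r *\<^sub>R q) + 2 *\<^sub>R q - ((s + 2 *\<^sub>R t) + r *\<^sub>R t) = (p - s) + (r + 2) *\<^sub>R (q - t)"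
    and "(p + k *\<^sub>R q) - (h + r *\<^sub>R y) - ((s - h) + k *\<^sub>R t) = (p - s) + k *\<^sub>R (q - t) - r *\<^sub>R y"
    and "(p + k *\<^sub>R y) - r *\<^sub>R y = p + (k - r) *\<^sub>R y"
  by (simp_all add: algebra_simps)

lemma H_ad_\<Lambda>: "\<alpha> \<in> T \<Longrightarrow> H (ad_\<Lambda> m \<alpha>) = ad_\<Lambda> m (H \<alpha>) + (2 * real m - 1) *\<^sub>R ad_\<Lambda> m \<alpha>"
proof (induction m arbitrary: \<alpha>)
  case 0
  then show ?case by (simp add: d_H)
next
  case (Suc m)
  let ?D = "ad_\<Lambda> m" and ?r = "2 * real m - 1"
  have "H (ad_\<Lambda> (Suc m) \<alpha>) = H (\<Lambda> (?D \<alpha>)) - H (?D (\<Lambda> \<alpha>))"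
    by (simp add: linear_diff[OF linear_H])
  also have "H (\<Lambda> (?D \<alpha>)) = \<Lambda> (H (?D \<alpha>)) + 2 *\<^sub>R \<Lambda> (?D \<alpha>)" by (simp add: \<Lambda>_H)
  also have "H (?D \<alpha>) = ?D (H \<alpha>) + ?r *\<^sub>R ?D \<alpha>" by (rule Suc.IH[OF Suc.prems])
  also have "H (?D (\<Lambda> \<alpha>)) = ?D (H (\<Lambda> \<alpha>)) + ?r *\<^sub>R ?D (\<Lambda> \<alpha>)"
    by (rule Suc.IH[OF mixed_forms_Lambda[OF Suc.prems]])
  also have "H (\<Lambda> \<alpha>) = \<Lambda> (H \<alpha>) + 2 *\<^sub>R \<Lambda> \<alpha>" by (simp add: \<Lambda>_H)
  also have "?D (\<Lambda> (H \<alpha>) + 2 *\<^sub>R \<Lambda> \<alpha>) = ?D (\<Lambda> (H \<alpha>)) + 2 *\<^sub>R ?D (\<Lambda> \<alpha>)"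
    using Suc.prems by (simp add: ad_\<Lambda>_add ad_\<Lambda>_scaleR mixed_forms_Lambda mixed_forms_H mixed_forms_scaleR)
  finally have "H (ad_\<Lambda> (Suc m) \<alpha>) = (\<Lambda> (?D (H \<alpha>)) - ?D (\<Lambda> (H \<alpha>))) + (?r + 2) *\<^sub>R (\<Lambda> (?D \<alpha>) - ?D (\<Lambda> \<alpha>))"
    unfolding linear_add[OF linear_lefschetz_Lambda] linear_scale[OF linear_lefschetz_Lambda] vector_identities(1) .
  moreover have "?r + 2 = 2 * real (Suc m) - 1" by simp
  ultimately show ?case unfolding ad_\<Lambda>.simps by metis
qed

text \<open>Moving \<open>L\<close> past one more \<open>\<Lambda>\<close> adds \<open>- [H, (ad \<Lambda>)\<^sup>m d] = (1 - 2m) (ad \<Lambda>)\<^sup>m d\<close>, so the coefficient \<open>c\<^sub>m\<close> satisfies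
\<open>c\<^sub>m\<^sub>+\<^sub>1 = c\<^sub>m + 1 - 2m\<close> with \<open>c\<^sub>0 = 0\<close>, that is \<open>c\<^sub>m = m (2 - m)\<close>.\<close>

lemma L_ad_\<Lambda>:
  "\<alpha> \<in> T \<Longrightarrow> L (ad_\<Lambda> m \<alpha>) = ad_\<Lambda> m (L \<alpha>) + (real m * (2 - real m)) *\<^sub>R ad_\<Lambda> (m - 1) \<alpha>"
proof (induction m arbitrary: \<alpha>)
  case 0
  then show ?case by (simp add: d_L)
next
  case (Suc m)
  let ?D = "ad_\<Lambda> m" and ?D' = "ad_\<Lambda> (m - 1)" and ?c = "real m * (2 - real m)"
  note \<Lambda>lin = linear_add[OF linear_lefschetz_Lambda] linear_scale[OF linear_lefschetz_Lambda]
  have "L (ad_\<Lambda> (Suc m) \<alpha>) = L (\<Lambda> (?D \<alpha>)) - L (?D (\<Lambda> \<alpha>))"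
    by (simp add: linear_diff[OF linear_lefschetz_L])
  also have "L (\<Lambda> (?D \<alpha>)) = \<Lambda> (L (?D \<alpha>)) - H (?D \<alpha>)"
    by (simp add: \<Lambda>_L[OF mixed_forms_ad_\<Lambda>[OF Suc.prems]])
  also have "L (?D \<alpha>) = ?D (L \<alpha>) + ?c *\<^sub>R ?D' \<alpha>" by (rule Suc.IH[OF Suc.prems])
  also have "H (?D \<alpha>) = ?D (H \<alpha>) + (2 * real m - 1) *\<^sub>R ?D \<alpha>" by (rule H_ad_\<Lambda>[OF Suc.prems])
  also have "L (?D (\<Lambda> \<alpha>)) = ?D (L (\<Lambda> \<alpha>)) + ?c *\<^sub>R ?D' (\<Lambda> \<alpha>)"
    by (rule Suc.IH[OF mixed_forms_Lambda[OF Suc.prems]])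
  also have "L (\<Lambda> \<alpha>) = \<Lambda> (L \<alpha>) - H \<alpha>" by (simp add: \<Lambda>_L[OF Suc.prems])
  also have "?D (\<Lambda> (L \<alpha>) - H \<alpha>) = ?D (\<Lambda> (L \<alpha>)) - ?D (H \<alpha>)"
    using Suc.prems by (simp add: ad_\<Lambda>_diff mixed_forms_Lambda mixed_forms_H mixed_forms_L)
  finally have "L (ad_\<Lambda> (Suc m) \<alpha>) = ad_\<Lambda> (Suc m) (L \<alpha>) +
      ?c *\<^sub>R (\<Lambda> (?D' \<alpha>) - ?D' (\<Lambda> \<alpha>)) - (2 * real m - 1) *\<^sub>R ?D \<alpha>"
    unfolding \<Lambda>lin vector_identities(2) ad_\<Lambda>.simps .
  also have "?c *\<^sub>R (\<Lambda> (?D' \<alpha>) - ?D' (\<Lambda> \<alpha>)) = ?c *\<^sub>R ?D \<alpha>"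
    by (cases m) simp_all
  also have "ad_\<Lambda> (Suc m) (L \<alpha>) + ?c *\<^sub>R ?D \<alpha> - (2 * real m - 1) *\<^sub>R ?D \<alpha> =
      ad_\<Lambda> (Suc m) (L \<alpha>) + (?c - (2 * real m - 1)) *\<^sub>R ?D \<alpha>"
    by (rule vector_identities(3))
  also have "?c - (2 * real m - 1) = real (Suc m) * (2 - real (Suc m))" by (simp add: algebra_simps)
  finally show ?case by (simp only: diff_Suc_1)
qed

text \<open>The operator \<open>d\<close> raises the degree by \<open>1\<close> and each \<open>\<Lambda>\<close> lowers it by \<open>2\<close>. The bound \<open>K\<close> is an integer since it
decreases by \<open>2\<close> with every \<open>\<Lambda>\<close> that is applied to \<open>\<alpha>\<close>.\<close>

lemma ad_\<Lambda>_vanishes: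
  assumes "\<And>c x vs. int (length vs) \<ge> K \<Longrightarrow> \<alpha> c x vs = 0"
    and "int (length vs) + 2 * int m \<ge> K + 1"
  shows "ad_\<Lambda> m \<alpha> c x vs = 0"
  using assms
proof (induction m arbitrary: \<alpha> vs K)
  case 0
  have "\<alpha> c y (omit i vs) = 0" if "i < length vs" for i y
    using 0 that by (intro 0(1)) (auto simp: omit_def)
  then show ?case by (simp add: ext_d_def)
next
  case (Suc m)
  have "ad_\<Lambda> m \<alpha> c x (e # e' # vs) = 0" for e e'
    using Suc.prems by (intro Suc.IH[where K = K]) auto
  moreover have "ad_\<Lambda> m (\<Lambda> \<alpha>) c x vs = 0"
    using Suc.prems by (intro Suc.IH[where K = "K - 2"]) (auto simp: lefschetz_Lambda_def)
  ultimately show ?case by (simp add: fun_apply lefschetz_Lambda_def)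
qed

text \<open>Descending induction: \<open>(ad \<Lambda>)\<^sup>m d\<close> vanishes for large \<open>m\<close> by degree, and if it vanishes for \<open>m + 1 \<ge> 3\<close>, then
also for \<open>m\<close>, because its commutator with \<open>L\<close> is a nonzero multiple of \<open>(ad \<Lambda>)\<^sup>m d\<close> (\<open>L_ad_\<Lambda>\<close>).\<close>

lemma ad_\<Lambda>_2:
  assumes "\<alpha> \<in> T"
  shows "ad_\<Lambda> 2 \<alpha> = 0"
proof -
  have top: "ad_\<Lambda> (DIM('b) + 1) \<alpha> = 0" if "\<alpha> \<in> T" for \<alpha>
  proof (rule form_eqI, rule ext)
    fix c x and vs :: "'b list"
    have "ad_\<Lambda> (DIM('b) + 1) \<alpha> c x vs = 0"
      using alternating_vanishes_above_dim[OF mixed_forms_alternating[OF that]]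
      by (intro ad_\<Lambda>_vanishes[where K = "int DIM('b) + 1"]) auto
    then show "ad_\<Lambda> (DIM('b) + 1) \<alpha> c x vs = 0 c x vs" by (simp add: fun_apply)
  qed
  have down: "ad_\<Lambda> m \<alpha> = 0" if m: "m \<ge> 2" and z: "\<And>\<beta>. \<beta> \<in> T \<Longrightarrow> ad_\<Lambda> (Suc m) \<beta> = 0" and a: "\<alpha> \<in> T" for m \<alpha>
  proof -
    have "L 0 = 0 + (real (Suc m) * (2 - real (Suc m))) *\<^sub>R ad_\<Lambda> m \<alpha>"
      using L_ad_\<Lambda>[OF a, of "Suc m"] unfolding z[OF a] z[OF mixed_forms_L[OF a]] diff_Suc_1 .
    then have "(real (Suc m) * (2 - real (Suc m))) *\<^sub>R ad_\<Lambda> m \<alpha> = 0"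
      by (simp only: linear_0[OF linear_lefschetz_L] add_0_left)
    moreover have "real (Suc m) * (2 - real (Suc m)) \<noteq> 0" using m by simp
    ultimately show ?thesis unfolding scaleR_eq_0_iff by blast
  qed
  have "2 \<le> DIM('b) + 1" using DIM_positive[where 'a = 'b] by linarith
  then have "\<forall>\<alpha>\<in>T. ad_\<Lambda> 2 \<alpha> = 0"
  proof (induction rule: inc_induct)
    case base
    then show ?case using top by blast
  next
    case (step m)
    then show ?case using down by blast
  qed
  with assms show ?thesis by blast
qed

lemma \<Lambda>_\<delta>: "\<alpha> \<in> T \<Longrightarrow> \<Lambda> (\<delta> \<alpha>) = \<delta> (\<Lambda> \<alpha>)"
  using ad_\<Lambda>_2[of \<alpha>] ad_\<Lambda>_1 by (simp add: numeral_2_eq_2)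

lemma L_\<delta>: "\<alpha> \<in> T \<Longrightarrow> L (\<delta> \<alpha>) = \<delta> (L \<alpha>) + d \<alpha>"
  using L_ad_\<Lambda>[of \<alpha> 1] ad_\<Lambda>_1 by simp

lemmas \<delta>_add = ad_\<Lambda>_add[of _ _ 1, unfolded ad_\<Lambda>_1]
  and \<delta>_scaleR = ad_\<Lambda>_scaleR[of _ 1, unfolded ad_\<Lambda>_1]
  and \<delta>_diff = ad_\<Lambda>_diff[of _ _ 1, unfolded ad_\<Lambda>_1]

text \<open>As \<open>\<Lambda>\<close> commutes and \<open>d\<close> anticommutes with \<open>\<delta>\<close>, one has \<open>\<delta> \<delta> = \<Lambda> d \<delta> - d \<Lambda> \<delta> = - \<delta> (\<Lambda> d - d \<Lambda>) = - \<delta> \<delta>\<close>.\<close>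

lemma \<delta>_\<delta>:
  assumes a: "\<alpha> \<in> T"
  shows "\<delta> (\<delta> \<alpha>) = 0"
proof -
  note m = mixed_forms_ext_d[OF a] mixed_forms_Lambda[OF a] mixed_forms_\<delta>[OF a]
  have d\<delta>: "d (\<delta> \<beta>) = - \<delta> (d \<beta>)" if "\<beta> \<in> T" for \<beta>
    using that d_add[of "\<Lambda> (d \<beta>)" "(- 1) *\<^sub>R d (\<Lambda> \<beta>)"] d_scaleR[of "d (\<Lambda> \<beta>)" "- 1"]
      d_d[of "\<Lambda> \<beta>"] d_d[of \<beta>] mixed_forms_minus
    by (simp add: koszul_delta_def mixed_forms_Lambda mixed_forms_ext_d linear_0[OF linear_lefschetz_Lambda])
  have "\<delta> (\<delta> \<alpha>) = \<Lambda> (d (\<delta> \<alpha>)) - d (\<Lambda> (\<delta> \<alpha>))" by (simp only: koszul_delta_def)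
  also have "\<dots> = - (\<Lambda> (\<delta> (d \<alpha>))) - d (\<delta> (\<Lambda> \<alpha>))"
    by (simp only: d\<delta>[OF a] \<Lambda>_\<delta>[OF a] linear_neg[OF linear_lefschetz_Lambda])
  also have "\<dots> = - (\<delta> (\<Lambda> (d \<alpha>)) - \<delta> (d (\<Lambda> \<alpha>)))"
    by (simp add: \<Lambda>_\<delta>[OF m(1)] d\<delta>[OF m(2)])
  also have "\<delta> (\<Lambda> (d \<alpha>)) - \<delta> (d (\<Lambda> \<alpha>)) = \<delta> (\<Lambda> (d \<alpha>) - d (\<Lambda> \<alpha>))"
    by (rule \<delta>_diff[symmetric]) (intro mixed_forms_Lambda mixed_forms_ext_d a)+
  also have "\<Lambda> (d \<alpha>) - d (\<Lambda> \<alpha>) = \<delta> \<alpha>" by (simp only: koszul_delta_def)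
  finally have "\<delta> (\<delta> \<alpha>) + \<delta> (\<delta> \<alpha>) = 0" by simp
  then have "2 *\<^sub>R \<delta> (\<delta> \<alpha>) = 0" by (simp only: scaleR_2)
  then show ?thesis by simp
qed

end

section \<open>Signed sums over one or two entries of a list\<close>

text \<open>The sum over \<open>i\<close> of \<open>(- 1)\<^sup>i \<Phi>(f\<^sub>i, fs without f\<^sub>i)\<close>, and for \<open>pair_sum\<close> the sum over \<open>i < j\<close> of
\<open>(- 1)\<^sup>i\<^sup>+\<^sup>j\<^sup>-\<^sup>1 \<Phi>(f\<^sub>i, f\<^sub>j, fs without f\<^sub>i and f\<^sub>j)\<close>, with positions counted from \<open>0\<close>. The recursive form matches
that of the antisymmetrized products, and these are the shuffle sums with first block of length \<open>1\<close>
and \<open>2\<close>.\<close>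

primrec contr_sum :: "('x \<Rightarrow> 'x list \<Rightarrow> 'v::real_vector) \<Rightarrow> 'x list \<Rightarrow> 'v"
  where
    "contr_sum \<Phi> [] = 0"
  | "contr_sum \<Phi> (f # fs) = \<Phi> f fs - contr_sum (\<lambda>g r. \<Phi> g (f # r)) fs"

primrec pair_sum :: "('x \<Rightarrow> 'x \<Rightarrow> 'x list \<Rightarrow> 'v::real_vector) \<Rightarrow> 'x list \<Rightarrow> 'v"
  where
    "pair_sum \<Phi> [] = 0"
  | "pair_sum \<Phi> (f # fs) = contr_sum (\<Phi> f) fs + pair_sum (\<lambda>g h r. \<Phi> g h (f # r)) fs"

lemma shuffle_sum_1_eq_contr_sum:
  "length fs = Suc m \<Longrightarrow> shuffle_sum (Suc 0) m G fs = contr_sum (\<lambda>g r. G [g] r) fs"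
proof (induction fs arbitrary: m G)
  case (Cons f fs)
  show ?case
  proof (cases m)
    case 0
    then show ?thesis using Cons.prems by (simp add: shuffle_sum_0_right)
  next
    case (Suc q)
    then have "length fs = Suc (0 + q)" using Cons.prems by simp
    from shuffle_sum_Cons[OF this, of G f] show ?thesis
      using Cons.IH[of q] Suc Cons.prems by (simp add: shuffle_sum_0_left)
  qed
qed simp

lemma shuffle_sum_2_eq_pair_sum:
  "length fs = Suc (Suc m) \<Longrightarrow> shuffle_sum (Suc (Suc 0)) m G fs = pair_sum (\<lambda>g h r. G [g, h] r) fs"
proof (induction fs arbitrary: m G)
  case (Cons f fs)
  show ?case
  proof (cases m)
    case 0
    then obtain g where "fs = [g]" using Cons.prems by (auto simp: length_Suc_conv)
    then show ?thesis using 0 by (simp add: shuffle_sum_0_right)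
  next
    case (Suc q)
    then have "length fs = Suc (Suc 0 + q)" using Cons.prems by simp
    from shuffle_sum_Cons[OF this, of G f] show ?thesis
      using Cons.IH[of q] shuffle_sum_1_eq_contr_sum[of fs "Suc q"] Suc Cons.prems by simp
  qed
qed simp

text \<open>The operators \<open>d\<close> and \<open>\<delta>\<close> are additive on the subspace of forms only, so the argument tracks membership in
a subspace \<open>V\<close> along with the equation.\<close>

lemma contr_sum_transfer:
  assumes "subspace V" "\<And>x y. x \<in> V \<Longrightarrow> y \<in> V \<Longrightarrow> h (x - y) = h x - h y" "h 0 = 0"
    and "set fs \<subseteq> F"
    and "\<And>g r. g \<in> F \<Longrightarrow> set r \<subseteq> F \<Longrightarrow> Suc (length r) = length fs \<Longrightarrow> \<Phi> g r \<in> V \<and> h (\<Phi> g r) = \<Psi> g r"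
  shows "contr_sum \<Phi> fs \<in> V \<and> h (contr_sum \<Phi> fs) = contr_sum \<Psi> fs"
  using assms(4,5)
proof (induction fs arbitrary: \<Phi> \<Psi>)
  case Nil
  then show ?case using assms(1,3) by (simp add: subspace_0)
next
  case (Cons f fs)
  have "contr_sum (\<lambda>g r. \<Phi> g (f # r)) fs \<in> V \<and> h (contr_sum (\<lambda>g r. \<Phi> g (f # r)) fs) = contr_sum (\<lambda>g r. \<Psi> g (f # r)) fs"
    using Cons.prems by (intro Cons.IH) auto
  moreover have "\<Phi> f fs \<in> V \<and> h (\<Phi> f fs) = \<Psi> f fs"
    using Cons.prems by auto
  ultimately show ?case using assms(1,2) by (simp add: subspace_diff)
qed

lemma pair_sum_transfer:
  assumes V: "subspace V" and h: "\<And>x y. x \<in> V \<Longrightarrow> y \<in> V \<Longrightarrow> h (x - y) = h x - h y" "h 0 = 0"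
    "\<And>x y. x \<in> V \<Longrightarrow> y \<in> V \<Longrightarrow> h (x + y) = h x + h y"
    and "set fs \<subseteq> F"
    and "\<And>g g' r. g \<in> F \<Longrightarrow> g' \<in> F \<Longrightarrow> set r \<subseteq> F \<Longrightarrow> Suc (Suc (length r)) = length fs \<Longrightarrow>
      \<Phi> g g' r \<in> V \<and> h (\<Phi> g g' r) = \<Psi> g g' r"
  shows "pair_sum \<Phi> fs \<in> V \<and> h (pair_sum \<Phi> fs) = pair_sum \<Psi> fs"
  using assms(5,6)
proof (induction fs arbitrary: \<Phi> \<Psi>)
  case Nil
  then show ?case using assms(1,3) by (simp add: subspace_0)
next
  case (Cons f fs)
  have "pair_sum (\<lambda>g g' r. \<Phi> g g' (f # r)) fs \<in> V \<and>
      h (pair_sum (\<lambda>g g' r. \<Phi> g g' (f # r)) fs) = pair_sum (\<lambda>g g' r. \<Psi> g g' (f # r)) fs"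
    using Cons.prems by (intro Cons.IH) auto
  moreover have "contr_sum (\<Phi> f) fs \<in> V \<and> h (contr_sum (\<Phi> f) fs) = contr_sum (\<Psi> f) fs"
    using Cons.prems by (intro contr_sum_transfer[OF V h(1,2), where F = F]) auto
  ultimately show ?case using V h(3) by (simp add: subspace_add)
qed

lemma contr_sum_cong:
  assumes "set fs \<subseteq> F" "\<And>g r. g \<in> F \<Longrightarrow> set r \<subseteq> F \<Longrightarrow> Suc (length r) = length fs \<Longrightarrow> \<Phi> g r = \<Psi> g r"
  shows "contr_sum \<Phi> fs = contr_sum \<Psi> fs"
  using contr_sum_transfer[of UNIV "\<lambda>x. x" fs F \<Phi> \<Psi>] assms by simp

lemma pair_sum_cong:
  assumes "set fs \<subseteq> F" "\<And>g g' r. g \<in> F \<Longrightarrow> g' \<in> F \<Longrightarrow> set r \<subseteq> F \<Longrightarrow> Suc (Suc (length r)) = length fs \<Longrightarrow> \<Phi> g g' r = \<Psi> g g' r"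
  shows "pair_sum \<Phi> fs = pair_sum \<Psi> fs"
  using pair_sum_transfer[of UNIV "\<lambda>x. x" fs F \<Phi> \<Psi>] assms by simp

lemma contr_sum_linear: "linear h \<Longrightarrow> h (contr_sum \<Phi> fs) = contr_sum (\<lambda>g r. h (\<Phi> g r)) fs"
  using contr_sum_transfer[of UNIV h fs UNIV \<Phi> "\<lambda>g r. h (\<Phi> g r)"] by (simp add: linear_diff linear_0)

lemma pair_sum_linear: "linear h \<Longrightarrow> h (pair_sum \<Phi> fs) = pair_sum (\<lambda>g g' r. h (\<Phi> g g' r)) fs"
  using pair_sum_transfer[of UNIV h fs UNIV \<Phi> "\<lambda>g g' r. h (\<Phi> g g' r)"] by (simp add: linear_diff linear_0 linear_add)

lemma contr_sum_add: "contr_sum (\<lambda>g r. \<Phi> g r + \<Psi> g r) fs = contr_sum \<Phi> fs + contr_sum \<Psi> fs"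
  by (induction fs arbitrary: \<Phi> \<Psi>) (simp_all add: algebra_simps)

lemma pair_sum_add: "pair_sum (\<lambda>g g' r. \<Phi> g g' r + \<Psi> g g' r) fs = pair_sum \<Phi> fs + pair_sum \<Psi> fs"
  by (induction fs arbitrary: \<Phi> \<Psi>) (simp_all add: contr_sum_add algebra_simps)

lemma contr_sum_diff: "contr_sum (\<lambda>g r. \<Phi> g r - \<Psi> g r) fs = contr_sum \<Phi> fs - contr_sum \<Psi> fs"
  by (induction fs arbitrary: \<Phi> \<Psi>) (simp_all add: algebra_simps)

lemma pair_sum_diff: "pair_sum (\<lambda>g g' r. \<Phi> g g' r - \<Psi> g g' r) fs = pair_sum \<Phi> fs - pair_sum \<Psi> fs"
  by (induction fs arbitrary: \<Phi> \<Psi>) (simp_all add: contr_sum_diff algebra_simps)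

lemma linear_wedge: "linear (wedge \<alpha>)"
  by (rule bilinear_wedge[unfolded bilinear_def, THEN conjunct1, rule_format])

context symplectic_atlas
begin

section \<open>Products with functions and one-forms\<close>

abbreviation F0 where "F0 \<equiv> forms A 0"

lemma subspace_mixed_forms: "subspace T"
  by (simp add: subspace_def mixed_forms_zero mixed_forms_add mixed_forms_scaleR)

lemma F0_T: "f \<in> F0 \<Longrightarrow> f \<in> T" and F0_grade: "f \<in> F0 \<Longrightarrow> has_grade 0 (f c x)"
  unfolding forms_iff homogeneous_def by blast+

lemma d_F0: "f \<in> F0 \<Longrightarrow> d f \<in> forms A 1"
proof -
  assume f: "f \<in> F0"
  have "has_grade 1 (d f c x)" for c x
  proof (cases "c \<in> A \<and> x \<in> chart_image c")
    case True
    then show ?thesis using has_grade_local_d[of 0 "f c", OF F0_grade[OF f]] by (simp add: ext_d_eq_local_d)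
  next
    case False
    then show ?thesis using ext_d_outside[of c A x f] by (simp add: has_grade_def fun_apply)
  qed
  then show ?thesis using mixed_forms_ext_d[OF F0_T[OF f]] by (simp add: forms_iff homogeneous_def)
qed

lemma forms1_T: "\<theta> \<in> forms A 1 \<Longrightarrow> \<theta> \<in> T" and forms1_grade: "\<theta> \<in> forms A 1 \<Longrightarrow> has_grade 1 (\<theta> c x)"
  unfolding forms_iff homogeneous_def by blast+

lemma wedge_F0_apply: "f \<in> F0 \<Longrightarrow> wedge f \<alpha> c x = f c x [] *\<^sub>R \<alpha> c x"
  by (simp add: wedge_eq_ext_prod ext_prod_scalar_left[OF F0_grade])

lemma wedge_F0_commute: "f \<in> F0 \<Longrightarrow> wedge \<theta> (wedge f \<alpha>) = wedge f (wedge \<theta> \<alpha>)"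
  by (rule form_eqI) (simp add: wedge_F0_apply wedge_eq_ext_prod[of \<theta>] ext_prod_scaleR_right)

lemma wedge_forms1_anticommute:
  assumes "\<theta> \<in> forms A 1" "\<eta> \<in> forms A 1"
  shows "wedge \<theta> (wedge \<eta> \<alpha>) = - wedge \<eta> (wedge \<theta> \<alpha>)"
proof -
  have "wedge \<theta> \<eta> = - wedge \<eta> \<theta>"
  proof (rule form_eqI)
    fix c x show "wedge \<theta> \<eta> c x = (- wedge \<eta> \<theta>) c x"
      using covector_ext_prod_commute[OF forms1_grade[OF assms(1)] forms1_grade[OF assms(2)]]
      by (simp add: wedge_eq_ext_prod fun_apply)
  qed
  then show ?thesis by (metis wedge_assoc wedge_minus_left)
qed

text \<open>The unit of the wedge product. As a form it is zero outside of the coordinate domains.\<close>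

definition one_form :: "('a, 'b) form"
  where "one_form = (\<lambda>c x vs. if c \<in> A \<and> x \<in> chart_image c \<and> vs = [] then 1 else 0)"

lemma one_form_F0: "one_form \<in> F0"
proof -
  have "one_form \<in> T"
  proof (rule mixed_formsI)
    fix c assume c: "c \<in> A"
    show "smooth_coeffs (chart_image c) (one_form c)"
      unfolding smooth_coeffs_def
    proof
      fix vs
      have "smooth_on (chart_image c) (\<lambda>x. one_form c x vs) = smooth_on (chart_image c) (\<lambda>x. if vs = [] then 1 else 0 :: real)"
        by (rule smooth_on_cong[OF open_chart_image[OF c]]) (simp add: one_form_def c)
      then show "smooth_on (chart_image c) (\<lambda>x. one_form c x vs)" by (simp add: smooth_on_const)
    qed
  next
    fix c x
    show "alternating (one_form c x)"
      by (auto simp: alternating_def alternating_form_def one_form_def intro!: linearI)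
  qed (auto simp: one_form_def pullback_def fun_eq_iff fun_apply)
  then show ?thesis by (auto simp: forms_iff homogeneous_def has_grade_def one_form_def)
qed

lemma wedge_one_form: "\<alpha> \<in> T \<Longrightarrow> wedge \<alpha> one_form = \<alpha>"
proof (rule form_eqI)
  fix c x assume a: "\<alpha> \<in> T"
  show "wedge \<alpha> one_form c x = \<alpha> c x"
    using mixed_formsD(1)[OF a, of c x]
    by (simp add: wedge_eq_ext_prod ext_prod_scalar_right[OF F0_grade[OF one_form_F0]])
      (auto simp: one_form_def)
qed

section \<open>Antisymmetrized products\<close>

definition d_prod :: "('a, 'b) form list \<Rightarrow> ('a, 'b) form"
  where "d_prod fs = foldr (\<lambda>f \<alpha>. wedge (d f) \<alpha>) fs one_form"

text \<open>The sum of \<open>(- 1)\<^sup>i f\<^sub>i df\<^sub>0 \<and> \<dots> \<and> df\<^sub>k\<^sub>-\<^sub>1\<close> with \<open>df\<^sub>i\<close> omitted, that is \<open>k Alt(m\<^sub>k)\<close>, by recursion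
(\<open>sum_omit_eq_alt_sum\<close>). Moving \<open>f\<^sub>i\<close> past \<open>df\<^sub>0\<close> costs no sign; the minus sign comes from the index shift.\<close>

primrec alt_sum :: "('a, 'b) form list \<Rightarrow> ('a, 'b) form"
  where
    "alt_sum [] = 0"
  | "alt_sum (f # fs) = wedge f (d_prod fs) - wedge (d f) (alt_sum fs)"

declare alt_sum.simps [simp del]

lemma d_prod_simps [simp]: "d_prod [] = one_form" "d_prod (f # fs) = wedge (d f) (d_prod fs)"
  by (simp_all add: d_prod_def)

lemma d_prod_T: "set fs \<subseteq> F0 \<Longrightarrow> d_prod fs \<in> T"
  by (induction fs) (auto intro: mixed_forms_wedge mixed_forms_ext_d F0_T one_form_F0)

lemma alt_sum_T: "set fs \<subseteq> F0 \<Longrightarrow> alt_sum fs \<in> T"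
  by (induction fs) (auto simp: alt_sum.simps intro: mixed_forms_zero mixed_forms_diff mixed_forms_wedge mixed_forms_ext_d d_prod_T F0_T)

lemma foldl_wedge:
  assumes "\<alpha> \<in> T" "set fs \<subseteq> F0"
  shows "foldl wedge \<alpha> (map d fs) = wedge \<alpha> (d_prod fs)"
  using assms
proof (induction fs arbitrary: \<alpha>)
  case Nil
  then show ?case by (simp add: wedge_one_form)
next
  case (Cons f fs)
  then show ?case by (simp add: mixed_forms_wedge mixed_forms_ext_d F0_T wedge_assoc)
qed

lemma set_omit: "set (omit i xs) \<subseteq> set xs"
  using set_take_subset[of i xs] set_drop_subset[of "Suc i" xs] by (auto simp: omit_def)

lemma sum_omit_eq_alt_sum:
  assumes "set fs \<subseteq> F0"
  shows "(\<Sum>i<length fs. (- 1) ^ i *\<^sub>R wedge (fs ! i) (d_prod (omit i fs))) = alt_sum fs"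
  using assms
proof (induction fs)
  case (Cons f fs)
  have t: "(- 1) ^ Suc i *\<^sub>R wedge ((f # fs) ! Suc i) (d_prod (omit (Suc i) (f # fs))) =
      - wedge (d f) ((- 1) ^ i *\<^sub>R wedge (fs ! i) (d_prod (omit i fs)))" if "i < length fs" for i
  proof -
    have "fs ! i \<in> F0" using Cons.prems that by auto
    from wedge_F0_commute[OF this] show ?thesis by (simp add: omit_def wedge_scaleR_right)
  qed
  have "(\<Sum>i<length (f # fs). (- 1) ^ i *\<^sub>R wedge ((f # fs) ! i) (d_prod (omit i (f # fs)))) =
      wedge f (d_prod fs) + (\<Sum>i<length fs. - wedge (d f) ((- 1) ^ i *\<^sub>R wedge (fs ! i) (d_prod (omit i fs))))"
    unfolding list.size add_0_right add_Suc_right sum.lessThan_Suc_shift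
    using t by (simp add: omit_def)
  also have "\<dots> = alt_sum (f # fs)"
    using Cons linear_sum[OF linear_wedge, of "d f" "\<lambda>i. (- 1) ^ i *\<^sub>R wedge (fs ! i) (d_prod (omit i fs))" "{..<length fs}"]
    by (simp add: sum_negf alt_sum.simps)
  finally show ?case .
qed (simp add: alt_sum.simps)

lemma alt_m_eq_alt_sum:
  assumes "set fs \<subseteq> F0"
  shows "alt_m A fs = (1 / real (length fs)) *\<^sub>R alt_sum fs"
proof -
  have "foldl wedge (fs ! i) (map d (omit i fs)) = wedge (fs ! i) (d_prod (omit i fs))" if "i < length fs" for i
    using assms that set_omit[of i fs] by (intro foldl_wedge F0_T) auto
  then show ?thesis unfolding alt_m_def sum_omit_eq_alt_sum[OF assms, symmetric] by simp
qed

lemma d_wedge_F0: "f \<in> F0 \<Longrightarrow> \<alpha> \<in> T \<Longrightarrow> d (wedge f \<alpha>) = wedge (d f) \<alpha> + wedge f (d \<alpha>)"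
  using reweight_homogeneous[of 0 f "\<lambda>k. (- 1) ^ k"] by (simp add: d_wedge F0_T forms_iff)

lemma d_wedge_d: "f \<in> F0 \<Longrightarrow> \<alpha> \<in> T \<Longrightarrow> d (wedge (d f) \<alpha>) = - wedge (d f) (d \<alpha>)"
  using d_F0[of f] reweight_homogeneous[of 1 "d f" "\<lambda>k. (- 1) ^ k"]
  by (simp add: d_wedge F0_T forms_iff d_d wedge_zero_left wedge_minus_left)

lemma d_zero: "d 0 = 0"
  using d_scaleR[OF mixed_forms_zero, of 0] by simp

lemma d_diff: "\<alpha> \<in> T \<Longrightarrow> \<beta> \<in> T \<Longrightarrow> d (\<alpha> - \<beta>) = d \<alpha> - d \<beta>"
  using ad_\<Lambda>_diff[of \<alpha> \<beta> 0] by simp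

lemma d_one_form: "d one_form = 0"
proof (rule d_eqI)
  fix c x assume c: "c \<in> A" "x \<in> chart_image c"
  have "local_d (one_form c) x = local_d (\<lambda>y vs. if vs = [] then 1 else 0) x"
    by (rule local_d_cong[OF open_chart_image[OF c(1)] c(2)]) (auto simp: one_form_def c fun_eq_iff)
  then show "local_d (one_form c) x = 0 c x" by (simp add: local_d_def fun_eq_iff fun_apply)
qed (simp add: fun_apply)

lemma d_d_prod: "set fs \<subseteq> F0 \<Longrightarrow> d (d_prod fs) = 0"
  by (induction fs) (simp_all add: d_one_form d_wedge_d d_prod_T wedge_zero_right)

lemma d_alt_sum: "set fs \<subseteq> F0 \<Longrightarrow> d (alt_sum fs) = real (length fs) *\<^sub>R d_prod fs"
proof (induction fs)
  case (Cons f fs)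
  then have fs: "f \<in> F0" "set fs \<subseteq> F0" by auto
  have "d (alt_sum (f # fs)) = d (wedge f (d_prod fs)) - d (wedge (d f) (alt_sum fs))"
    unfolding alt_sum.simps using fs by (intro d_diff mixed_forms_wedge mixed_forms_ext_d d_prod_T alt_sum_T F0_T)
  also have "\<dots> = wedge (d f) (d_prod fs) + wedge (d f) (real (length fs) *\<^sub>R d_prod fs)"
    unfolding d_wedge_F0[OF fs(1) d_prod_T[OF fs(2)]] d_wedge_d[OF fs(1) alt_sum_T[OF fs(2)]] d_d_prod[OF fs(2)]
      Cons.IH[OF fs(2)] wedge_zero_right by simp
  also have "\<dots> = wedge (d f) ((1 + real (length fs)) *\<^sub>R d_prod fs)"
    unfolding scaleR_add_left wedge_add_right scaleR_one ..
  finally show ?case unfolding wedge_scaleR_right d_prod_simps by simp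
qed (simp add: alt_sum.simps d_zero)

section \<open>Contraction with Hamiltonian vector fields\<close>

text \<open>Contraction with the vector field \<open>X\<close> such that \<open>\<iota>\<^sub>X \<omega> = - \<theta>\<close>.\<close>

definition ham_contraction :: "('a, 'b) form \<Rightarrow> ('a, 'b) form \<Rightarrow> ('a, 'b) form"
  where "ham_contraction \<theta> \<alpha> = (\<lambda>c x. interior_prod (\<Sum>e\<in>Basis. \<theta> c x [e] *\<^sub>R ham c x e) (\<alpha> c x))"

definition poisson_bracket :: "('a, 'b) form \<Rightarrow> ('a, 'b) form \<Rightarrow> ('a, 'b) form"
  where "poisson_bracket f g = \<Lambda> (wedge (d f) (d g))"

lemma \<Lambda>_wedge_forms1:
  assumes t: "\<theta> \<in> forms A 1" and a: "\<alpha> \<in> T"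
  shows "\<Lambda> (wedge \<theta> \<alpha>) = wedge \<theta> (\<Lambda> \<alpha>) + ham_contraction \<theta> \<alpha>"
proof (rule form_eqI)
  fix c x
  note alt = mixed_forms_alternating[OF a, of c x] mixed_forms_alternating[OF forms1_T[OF t], of c x]
  show "\<Lambda> (wedge \<theta> \<alpha>) c x = (wedge \<theta> (\<Lambda> \<alpha>) + ham_contraction \<theta> \<alpha>) c x"
  proof (cases "c \<in> A \<and> x \<in> chart_image c")
    case True
    then have c: "c \<in> A" "x \<in> chart_image c" by auto
    have "\<Lambda> (wedge \<theta> \<alpha>) c x = bivector_contraction (ham c x) (\<theta> c x \<odot> \<alpha> c x)"
      by (subst lefschetz_Lambda_eq[OF c mixed_forms_alternating[OF mixed_forms_wedge[OF forms1_T[OF t] a]]])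
        (simp add: wedge_eq_ext_prod)
    also have "\<dots> = \<theta> c x \<odot> bivector_contraction (ham c x) (\<alpha> c x) +
        interior_prod (\<Sum>e\<in>Basis. \<theta> c x [e] *\<^sub>R ham c x e) (\<alpha> c x)"
      by (rule bivector_contraction_covector[OF skew_map_ham[OF c] alt forms1_grade[OF t]])
    finally show ?thesis
      unfolding form_add_apply wedge_eq_ext_prod lefschetz_Lambda_eq[of c x \<alpha>, OF c alt(1)] ham_contraction_def .
  next
    case False
    then have z: "\<alpha> c x = 0" using mixed_formsD(1)[OF a] by blast
    then show ?thesis
      unfolding form_add_apply ham_contraction_def wedge_eq_ext_prod
      by (simp add: lefschetz_Lambda_outside wedge_eq_ext_prod)
  qed
qed

lemma \<Lambda>_wedge_F0: "f \<in> F0 \<Longrightarrow> \<Lambda> (wedge f \<alpha>) = wedge f (\<Lambda> \<alpha>)"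
proof (rule form_eqI)
  fix c x assume f: "f \<in> F0"
  show "\<Lambda> (wedge f \<alpha>) c x = wedge f (\<Lambda> \<alpha>) c x"
    unfolding wedge_F0_apply[OF f] lefschetz_Lambda_def
    by (simp add: fun_eq_iff fun_apply wedge_F0_apply[OF f] sum_distrib_left mult_ac)
qed

lemma ham_contraction_wedge_F0: "f \<in> F0 \<Longrightarrow> ham_contraction \<theta> (wedge f \<alpha>) = wedge f (ham_contraction \<theta> \<alpha>)"
  by (rule form_eqI) (simp add: ham_contraction_def wedge_F0_apply)

lemma linear_ham_contraction: "linear (ham_contraction \<theta>)"
  by (rule linearI; rule form_eqI)
    (simp_all only: ham_contraction_def form_add_apply form_scaleR_apply interior_prod_linear)

lemma ham_contraction_wedge_forms1:
  assumes "\<eta> \<in> forms A 1"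
  shows "ham_contraction \<theta> (wedge \<eta> \<alpha>) = wedge (ham_contraction \<theta> \<eta>) \<alpha> - wedge \<eta> (ham_contraction \<theta> \<alpha>)"
proof (rule form_eqI)
  fix c x
  note g = forms1_grade[OF assms, of c x]
  let ?v = "\<Sum>e\<in>Basis. \<theta> c x [e] *\<^sub>R ham c x e"
  have g0: "has_grade 0 (interior_prod ?v (\<eta> c x))" using g has_grade_interior_prod[of 0 "\<eta> c x" ?v] by simp
  show "ham_contraction \<theta> (wedge \<eta> \<alpha>) c x = (wedge (ham_contraction \<theta> \<eta>) \<alpha> - wedge \<eta> (ham_contraction \<theta> \<alpha>)) c x"
    unfolding form_diff_apply wedge_eq_ext_prod ham_contraction_def interior_prod_covector_ext_prod[OF g]
      ext_prod_scalar_left[OF g0] by (simp add: interior_prod_def)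
qed

lemma \<Lambda>_forms1: "\<theta> \<in> forms A 1 \<Longrightarrow> \<Lambda> \<theta> = 0" and \<Lambda>_F0: "f \<in> F0 \<Longrightarrow> \<Lambda> f = 0"
proof -
  have z: "\<alpha> c x (e # e' # vs) = 0" if "\<alpha> \<in> forms A 1 \<or> \<alpha> \<in> F0" for \<alpha> c x e e' and vs :: "'b list"
    using that forms1_grade[of \<alpha> c x] F0_grade[of \<alpha> c x] by (auto simp: has_grade_def)
  have "\<Lambda> \<alpha> = 0" if "\<alpha> \<in> forms A 1 \<or> \<alpha> \<in> F0" for \<alpha>
    by (rule form_eqI, rule ext) (simp add: lefschetz_Lambda_def z[OF that] fun_apply)
  then show "\<theta> \<in> forms A 1 \<Longrightarrow> \<Lambda> \<theta> = 0" "f \<in> F0 \<Longrightarrow> \<Lambda> f = 0" by blast+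
qed

lemma homogeneous_\<Lambda>:
  assumes "homogeneous (Suc (Suc k)) \<alpha>"
  shows "homogeneous k (\<Lambda> \<alpha>)"
  unfolding homogeneous_def has_grade_def
proof (intro allI impI)
  fix c x and vs :: "'b list" assume "length vs \<noteq> k"
  then have "\<alpha> c x (e # e' # vs) = 0" for e e'
    using assms[unfolded homogeneous_def has_grade_def, rule_format, of "e # e' # vs" c x] by simp
  then show "\<Lambda> \<alpha> c x vs = 0" by (simp add: lefschetz_Lambda_def)
qed

lemma has_grade_ext_prod:
  fixes a b :: "'v list \<Rightarrow> real"
  assumes "has_grade j a" "has_grade k b"
  shows "has_grade (j + k) (a \<odot> b)"
  unfolding has_grade_def
proof (intro allI impI)
  fix vs :: "'v list" assume l: "length vs \<noteq> j + k"
  show "(a \<odot> b) vs = 0"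
    unfolding ext_prod_def shuffle_sum_def
  proof (intro sum.neutral ballI)
    fix p \<sigma> assume "p \<in> {..length vs}"
    then have "length (take p (permute_list \<sigma> vs)) \<noteq> j \<or> length (drop p (permute_list \<sigma> vs)) \<noteq> k"
      using l by auto
    then have "a (take p (permute_list \<sigma> vs)) = 0 \<or> b (drop p (permute_list \<sigma> vs)) = 0"
      using assms unfolding has_grade_def by blast
    then show "real_of_int (sign \<sigma>) *\<^sub>R (a (take p (permute_list \<sigma> vs)) * b (drop p (permute_list \<sigma> vs))) = 0"
      by auto
  qed
qed

lemma homogeneous_wedge: "homogeneous j \<alpha> \<Longrightarrow> homogeneous k \<beta> \<Longrightarrow> homogeneous (j + k) (wedge \<alpha> \<beta>)"
  unfolding homogeneous_def wedge_eq_ext_prod using has_grade_ext_prod by blast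

lemma poisson_bracket_F0: "f \<in> F0 \<Longrightarrow> g \<in> F0 \<Longrightarrow> poisson_bracket f g \<in> F0"
  unfolding poisson_bracket_def
  using d_F0[of f] d_F0[of g] homogeneous_wedge[of 1 "d f" 1 "d g"] homogeneous_\<Lambda>[of 0 "wedge (d f) (d g)"]
  by (simp add: forms_iff mixed_forms_Lambda mixed_forms_wedge)

lemma poisson_bracket_eq: "f \<in> F0 \<Longrightarrow> g \<in> F0 \<Longrightarrow> ham_contraction (d f) (d g) = poisson_bracket f g"
  unfolding poisson_bracket_def
  using \<Lambda>_wedge_forms1[OF d_F0 forms1_T[OF d_F0]] \<Lambda>_forms1[OF d_F0] by (simp add: wedge_zero_right)

lemma contr_sum_wedge:
  assumes "g \<in> F0" "set fs \<subseteq> F0"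
  shows "contr_sum (\<lambda>f r. wedge (poisson_bracket g f) (wedge \<eta> (\<phi> r))) fs =
    wedge \<eta> (contr_sum (\<lambda>f r. wedge (poisson_bracket g f) (\<phi> r)) fs)"
  unfolding contr_sum_linear[OF linear_wedge]
  by (rule contr_sum_cong[OF assms(2)]) (rule wedge_F0_commute[OF poisson_bracket_F0[OF assms(1)], symmetric])

lemma pair_sum_wedge:
  assumes "set fs \<subseteq> F0"
  shows "pair_sum (\<lambda>f g r. wedge (poisson_bracket f g) (wedge \<eta> (\<phi> r))) fs =
    wedge \<eta> (pair_sum (\<lambda>f g r. wedge (poisson_bracket f g) (\<phi> r)) fs)"
  unfolding pair_sum_linear[OF linear_wedge]
  by (rule pair_sum_cong[OF assms]) (rule wedge_F0_commute[OF poisson_bracket_F0, symmetric])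

text \<open>The contraction is an antiderivation that maps \<open>df\<close> to \<open>{g, f}\<close>.\<close>

lemma ham_contraction_d_prod:
  assumes g: "g \<in> F0" and "set fs \<subseteq> F0"
  shows "ham_contraction (d g) (d_prod fs) = contr_sum (\<lambda>f r. wedge (poisson_bracket g f) (d_prod r)) fs"
  using assms(2)
proof (induction fs)
  case Nil
  have "ham_contraction (d g) one_form = 0"
    unfolding ham_contraction_def by (auto simp: fun_eq_iff fun_apply one_form_def interior_prod_def)
  then show ?case by simp
next
  case (Cons f fs)
  then have fs: "f \<in> F0" "set fs \<subseteq> F0" by auto
  show ?case
    unfolding d_prod_simps ham_contraction_wedge_forms1[OF d_F0[OF fs(1)]] poisson_bracket_eq[OF g fs(1)]
      Cons.IH[OF fs(2)] contr_sum.simps contr_sum_wedge[OF g fs(2)] ..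
qed

text \<open>The minus sign relative to \<open>ham_contraction_d_prod\<close> is explained by two arguments \<open>g\<^sub>1, g\<^sub>2\<close>: the
antisymmetrized product is \<open>g\<^sub>1 dg\<^sub>2 - g\<^sub>2 dg\<^sub>1\<close>, and in its contraction \<open>g\<^sub>1 {g, g\<^sub>2} - g\<^sub>2 {g, g\<^sub>1}\<close> the term with
the first argument contracted carries the minus sign.\<close>

lemma ham_contraction_alt_sum:
  assumes g: "g \<in> F0" and "set fs \<subseteq> F0"
  shows "ham_contraction (d g) (alt_sum fs) = - contr_sum (\<lambda>f r. wedge (poisson_bracket g f) (alt_sum r)) fs"
  using assms(2)
proof (induction fs)
  case Nil
  show ?case unfolding alt_sum.simps contr_sum.simps linear_0[OF linear_ham_contraction] by (rule minus_zero[symmetric])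
next
  case (Cons f fs)
  let ?C = "\<lambda>\<phi>. contr_sum (\<lambda>f r. wedge (poisson_bracket g f) (\<phi> r)) fs"
  have fs: "f \<in> F0" "set fs \<subseteq> F0" using Cons.prems by auto
  have "ham_contraction (d g) (alt_sum (f # fs)) =
      wedge f (?C d_prod) - (wedge (poisson_bracket g f) (alt_sum fs) - wedge (d f) (- ?C alt_sum))"
    unfolding alt_sum.simps linear_diff[OF linear_ham_contraction] ham_contraction_wedge_F0[OF fs(1)]
      ham_contraction_wedge_forms1[OF d_F0[OF fs(1)]] ham_contraction_d_prod[OF g fs(2)]
      poisson_bracket_eq[OF g fs(1)] Cons.IH[OF fs(2)] ..
  also have "\<dots> = - (wedge (poisson_bracket g f) (alt_sum fs) - (wedge f (?C d_prod) - wedge (d f) (?C alt_sum)))"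
    unfolding wedge_minus_right by simp
  also have "wedge f (?C d_prod) - wedge (d f) (?C alt_sum) =
      contr_sum (\<lambda>h r. wedge (poisson_bracket g h) (alt_sum (f # r))) fs"
    unfolding alt_sum.simps wedge_diff_right contr_sum_diff contr_sum_wedge[OF g fs(2)] ..
  finally show ?case by (simp only: contr_sum.simps)
qed

lemma \<Lambda>_d_prod:
  assumes "set fs \<subseteq> F0"
  shows "\<Lambda> (d_prod fs) = pair_sum (\<lambda>f g r. wedge (poisson_bracket f g) (d_prod r)) fs"
  using assms
proof (induction fs)
  case Nil
  then show ?case by (simp add: \<Lambda>_F0 one_form_F0)
next
  case (Cons f fs)
  have fs: "f \<in> F0" "set fs \<subseteq> F0" using Cons.prems by auto
  show ?case
    unfolding d_prod_simps \<Lambda>_wedge_forms1[OF d_F0[OF fs(1)] d_prod_T[OF fs(2)]] Cons.IH[OF fs(2)]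
      ham_contraction_d_prod[OF fs] pair_sum.simps pair_sum_wedge[OF fs(2)] by (rule add.commute)
qed

lemma \<Lambda>_alt_sum:
  assumes "set fs \<subseteq> F0"
  shows "\<Lambda> (alt_sum fs) = pair_sum (\<lambda>f g r. wedge (poisson_bracket f g) (alt_sum r)) fs"
  using assms
proof (induction fs)
  case Nil
  show ?case unfolding alt_sum.simps pair_sum.simps linear_0[OF linear_lefschetz_Lambda] ..
next
  case (Cons f fs)
  have fs: "f \<in> F0" "set fs \<subseteq> F0" using Cons.prems by auto
  have arrange: "p - (q + - t) = t + (p - q)" for p q t :: "'v::real_vector" by simp
  show ?case
    unfolding alt_sum.simps linear_diff[OF linear_lefschetz_Lambda] \<Lambda>_wedge_F0[OF fs(1)] \<Lambda>_d_prod[OF fs(2)]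
      \<Lambda>_wedge_forms1[OF d_F0[OF fs(1)] alt_sum_T[OF fs(2)]] Cons.IH[OF fs(2)] ham_contraction_alt_sum[OF fs]
      pair_sum.simps wedge_diff_right pair_sum_diff pair_sum_wedge[OF fs(2)] by (rule arrange)
qed

text \<open>Let \<open>a\<close> be the antisymmetrized product of \<open>N\<close> functions and \<open>R = \<Lambda>D\<close>. As \<open>da = N D\<close>, the first term of
\<open>\<delta>a = \<Lambda>da - d\<Lambda>a\<close> is \<open>N R\<close>. In the second one, \<open>d\<close> acts on the pair sum of \<open>{f, g} a(r)\<close>, and since
\<open>d a(r) = (N - 2) D(r)\<close> the result is \<open>Q + (N - 2) R\<close>, where \<open>Q\<close> is the pair sum of \<open>d{f, g} \<and> a(r)\<close>.
What remains is \<open>R + (R - Q)\<close>, and \<open>R - Q\<close> is the pair sum of \<open>a({f, g}, r)\<close> by the recursion for \<open>a\<close>.\<close>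

lemma \<delta>_alt_sum:
  assumes "set fs \<subseteq> F0"
  shows "\<delta> (alt_sum fs) = \<Lambda> (d_prod fs) + pair_sum (\<lambda>f g r. alt_sum (poisson_bracket f g # r)) fs"
proof -
  let ?R = "pair_sum (\<lambda>f g r. wedge (poisson_bracket f g) (d_prod r)) fs"
  let ?Q = "pair_sum (\<lambda>f g r. wedge (d (poisson_bracket f g)) (alt_sum r)) fs"
  let ?N = "real (length fs)"
  have "d (\<Lambda> (alt_sum fs)) =
      pair_sum (\<lambda>f g r. wedge (d (poisson_bracket f g)) (alt_sum r) + (?N - 2) *\<^sub>R wedge (poisson_bracket f g) (d_prod r)) fs"
    unfolding \<Lambda>_alt_sum[OF assms]
  proof (rule pair_sum_transfer[where h = d, THEN conjunct2, OF subspace_mixed_forms d_diff d_zero d_add assms])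
    fix f g r assume r: "f \<in> F0" "g \<in> F0" "set r \<subseteq> F0" "Suc (Suc (length r)) = length fs"
    then have "real (length r) = ?N - 2" by linarith
    then show "wedge (poisson_bracket f g) (alt_sum r) \<in> T \<and>
        d (wedge (poisson_bracket f g) (alt_sum r)) =
        wedge (d (poisson_bracket f g)) (alt_sum r) + (?N - 2) *\<^sub>R wedge (poisson_bracket f g) (d_prod r)"
      using r by (simp add: d_wedge_F0 poisson_bracket_F0 F0_T alt_sum_T mixed_forms_wedge d_alt_sum wedge_scaleR_right)
  qed
  also have "\<dots> = ?Q + (?N - 2) *\<^sub>R ?R"
    by (simp only: pair_sum_add pair_sum_linear[OF linear_scaleR[of "?N - 2"], symmetric])
  finally have 1: "\<delta> (alt_sum fs) = ?N *\<^sub>R ?R - (?Q + (?N - 2) *\<^sub>R ?R)"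
    unfolding koszul_delta_def d_alt_sum[OF assms] linear_scale[OF linear_lefschetz_Lambda] \<Lambda>_d_prod[OF assms] by simp
  have 2: "pair_sum (\<lambda>f g r. alt_sum (poisson_bracket f g # r)) fs = ?R - ?Q"
    by (simp only: alt_sum.simps pair_sum_diff)
  have "n *\<^sub>R p - (q + (n - 2) *\<^sub>R p) = p + (p - q)" for n p and q :: "'v::real_vector"
    by (simp add: algebra_simps scaleR_2)
  then show ?thesis unfolding 1 2 \<Lambda>_d_prod[OF assms] .
qed

end

section \<open>Symmetries of the antisymmetrized product\<close>

text \<open>A transposition of two positions at distance \<open>m\<close> is a product of \<open>2m - 1\<close> adjacent ones, and every
permutation is a product of transpositions.\<close>

lemma adjacent_swap_imp_sign:
  fixes \<Phi> :: "'x list \<Rightarrow> 'v::real_vector"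
  assumes adj: "\<And>us a b vs. set us \<union> {a, b} \<union> set vs \<subseteq> F \<Longrightarrow> \<Phi> (us @ a # b # vs) = - \<Phi> (us @ b # a # vs)"
    and xs: "set xs \<subseteq> F" and \<sigma>: "\<sigma> permutes {..<length xs}"
  shows "\<Phi> (permute_list \<sigma> xs) = real_of_int (sign \<sigma>) *\<^sub>R \<Phi> xs"
proof -
  have far: "\<Phi> (us @ a # ws @ b # vs) = - \<Phi> (us @ b # ws @ a # vs)"
    if "set us \<union> {a, b} \<union> set ws \<union> set vs \<subseteq> F" for us a b ws vs
    using that
  proof (induction ws arbitrary: us)
    case Nil
    then show ?case using adj[of us a b vs] by simp
  next
    case (Cons w ws)
    have "\<Phi> (us @ a # (w # ws) @ b # vs) = - \<Phi> (us @ w # a # ws @ b # vs)"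
      using Cons.prems adj[of us a w "ws @ b # vs"] by simp
    also have "\<Phi> (us @ w # a # ws @ b # vs) = - \<Phi> (us @ w # b # ws @ a # vs)"
      using Cons.IH[of "us @ [w]"] Cons.prems by simp
    also have "\<Phi> (us @ w # b # ws @ a # vs) = - \<Phi> (us @ b # (w # ws) @ a # vs)"
      using Cons.prems adj[of us w b "ws @ a # vs"] by simp
    finally show ?case by simp
  qed
  have transp: "\<Phi> (permute_list (Transposition.transpose i j) ys) = - \<Phi> ys"
    if "set ys \<subseteq> F" "i < j" "j < length ys" for i j ys
  proof -
    define us where "us = take i ys"
    define ws where "ws = take (j - Suc i) (drop (Suc i) ys)"
    define vs where "vs = drop (Suc j) ys"
    have "drop i ys = ys ! i # drop (Suc i) ys" using that by (simp add: Cons_nth_drop_Suc)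
    moreover have "drop (Suc i) ys = ws @ drop j ys"
      using that unfolding ws_def by (metis append_take_drop_id drop_drop Suc_leI le_add_diff_inverse2)
    moreover have "drop j ys = ys ! j # vs" using that unfolding vs_def by (simp add: Cons_nth_drop_Suc)
    ultimately have ys: "ys = us @ ys ! i # ws @ ys ! j # vs"
      using append_take_drop_id[of i ys] unfolding us_def by simp
    have li: "length us = i" "length ws = j - Suc i" using that by (auto simp: us_def ws_def)
    have t: "permute_list (Transposition.transpose i j) ys = us @ ys ! j # ws @ ys ! i # vs"
    proof (rule nth_equalityI)
      show "length (permute_list (Transposition.transpose i j) ys) = length (us @ ys ! j # ws @ ys ! i # vs)"
        using ys by (metis length_permute_list length_append length_Cons)
      fix k assume "k < length (permute_list (Transposition.transpose i j) ys)"
      then have k: "k < length ys" by simp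
      have nth: "ys ! k = (us @ ys ! i # ws @ ys ! j # vs) ! k" using ys by simp
      have tp: "Transposition.transpose i j permutes {..<length ys}" using that by (intro permutes_swap_id) auto
      show "permute_list (Transposition.transpose i j) ys ! k = (us @ ys ! j # ws @ ys ! i # vs) ! k"
        unfolding permute_list_nth[OF tp k]
      proof -
        consider "k = i" | "k = j" | "k < i" | "i < k" "k < j" | "j < k" using linorder_cases by metis
        then show "ys ! Transposition.transpose i j k = (us @ ys ! j # ws @ ys ! i # vs) ! k"
        proof cases
          case 1
          then show ?thesis using li by (simp add: nth_append)
        next
          case 2
          then show ?thesis using li that by (simp add: nth_append nth_Cons')
        next
          case 3
          then show ?thesis using nth li that by (simp add: nth_append Transposition.transpose_def)
        next
          case 4
          then have "k - Suc i < j - Suc i" by linarith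
          then show ?thesis using nth li that 4 by (simp add: nth_append nth_Cons' Transposition.transpose_def)
        next
          case 5
          then have "\<not> k - Suc i < j - Suc i" using that by linarith
          then show ?thesis using nth li that 5 by (simp add: nth_append nth_Cons' Transposition.transpose_def)
        qed
      qed
    qed
    have "set us \<union> {ys ! j, ys ! i} \<union> set ws \<union> set vs \<subseteq> F"
      using that ys by (metis (no_types, lifting) Un_insert_left Un_insert_right insert_commute list.simps(15)
          set_append sup_assoc sup_bot.left_neutral)
    from far[OF this] show ?thesis unfolding t using ys by simp
  qed
  show ?thesis
    using finite_lessThan \<sigma>
  proof (induction rule: permutes_rev_induct)
    case id
    show ?case by (simp only: permute_list_id sign_id of_int_1 scaleR_one)
  next
    case (swap a b p)
    have tp: "Transposition.transpose a b permutes {..<length xs}" using swap by (intro permutes_swap_id) auto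
    have len: "length (permute_list p xs) = length xs" by simp
    have setp: "set (permute_list p xs) \<subseteq> F" using swap xs by simp
    have "\<Phi> (permute_list (Transposition.transpose a b) (permute_list p xs)) = - \<Phi> (permute_list p xs)"
    proof (cases "a < b")
      case True
      then show ?thesis using transp[OF setp True] swap len by simp
    next
      case False
      then have "b < a" using swap by simp
      then show ?thesis using transp[OF setp \<open>b < a\<close>] swap len by (simp add: transpose_commute)
    qed
    moreover have "permute_list (p \<circ> Transposition.transpose a b) xs = permute_list (Transposition.transpose a b) (permute_list p xs)"
      by (rule permute_list_compose[OF tp])
    moreover have "sign (p \<circ> Transposition.transpose a b) = - sign p"
      using swap permutes_imp_permutation[of "{..<length xs}" p] permutation_swap_id[of a b]
      by (simp add: sign_compose sign_swap_id)
    ultimately have "\<Phi> (permute_list (p \<circ> Transposition.transpose a b) xs) =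
        real_of_int (sign (p \<circ> Transposition.transpose a b)) *\<^sub>R \<Phi> xs"
      using swap.IH by simp
    then show ?case .
  qed
qed

context symplectic_atlas
begin

lemma d_linear_combination: "f \<in> F0 \<Longrightarrow> g \<in> F0 \<Longrightarrow> d (r *\<^sub>R f + s *\<^sub>R g) = r *\<^sub>R d f + s *\<^sub>R d g"
  by (simp only: d_add d_scaleR mixed_forms_scaleR F0_T)

lemma d_prod_linear:
  "set fs \<subseteq> F0 \<Longrightarrow> i < length fs \<Longrightarrow> f \<in> F0 \<Longrightarrow> g \<in> F0 \<Longrightarrow>
    d_prod (fs[i := r *\<^sub>R f + s *\<^sub>R g]) = r *\<^sub>R d_prod (fs[i := f]) + s *\<^sub>R d_prod (fs[i := g])"
proof (induction fs arbitrary: i)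
  case (Cons h hs)
  show ?case
  proof (cases i)
    case 0
    show ?thesis
      unfolding 0 list_update.simps nat.case d_prod_simps d_linear_combination[OF Cons.prems(3,4)]
        wedge_add_left wedge_scaleR_left ..
  next
    case (Suc j)
    then have IH: "d_prod (hs[j := r *\<^sub>R f + s *\<^sub>R g]) = r *\<^sub>R d_prod (hs[j := f]) + s *\<^sub>R d_prod (hs[j := g])"
      using Cons.prems by (intro Cons.IH) auto
    show ?thesis
      unfolding Suc list_update.simps nat.case d_prod_simps IH wedge_add_right wedge_scaleR_right ..
  qed
qed simp

lemma alt_sum_linear:
  "set fs \<subseteq> F0 \<Longrightarrow> i < length fs \<Longrightarrow> f \<in> F0 \<Longrightarrow> g \<in> F0 \<Longrightarrow>
    alt_sum (fs[i := r *\<^sub>R f + s *\<^sub>R g]) = r *\<^sub>R alt_sum (fs[i := f]) + s *\<^sub>R alt_sum (fs[i := g])"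
proof (induction fs arbitrary: i)
  case (Cons h hs)
  have arrange: "(r *\<^sub>R p + s *\<^sub>R q) - (r *\<^sub>R t + s *\<^sub>R u) = r *\<^sub>R (p - t) + s *\<^sub>R (q - u)" for p q t u :: "'v::real_vector"
    by (simp add: algebra_simps)
  show ?case
  proof (cases i)
    case 0
    show ?thesis
      unfolding 0 list_update.simps nat.case alt_sum.simps d_linear_combination[OF Cons.prems(3,4)]
        wedge_add_left wedge_scaleR_left by (rule arrange)
  next
    case (Suc j)
    then have IH: "alt_sum (hs[j := r *\<^sub>R f + s *\<^sub>R g]) = r *\<^sub>R alt_sum (hs[j := f]) + s *\<^sub>R alt_sum (hs[j := g])"
      using Cons.prems by (intro Cons.IH) auto
    have D: "d_prod (hs[j := r *\<^sub>R f + s *\<^sub>R g]) = r *\<^sub>R d_prod (hs[j := f]) + s *\<^sub>R d_prod (hs[j := g])"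
      using Cons.prems Suc by (intro d_prod_linear) auto
    show ?thesis
      unfolding Suc list_update.simps nat.case alt_sum.simps IH D wedge_add_right wedge_scaleR_right by (rule arrange)
  qed
qed simp

lemma d_prod_swap:
  assumes "set us \<union> {f, g} \<union> set vs \<subseteq> F0"
  shows "d_prod (us @ f # g # vs) = - d_prod (us @ g # f # vs)"
  using assms
proof (induction us)
  case Nil
  then show ?case
    using wedge_forms1_anticommute[OF d_F0 d_F0, of f g "d_prod vs"] by simp
next
  case (Cons u us)
  then have IH: "d_prod (us @ f # g # vs) = - d_prod (us @ g # f # vs)" by simp
  show ?case unfolding append_Cons d_prod_simps IH wedge_minus_right ..
qed

lemma alt_sum_swap:
  assumes "set us \<union> {f, g} \<union> set vs \<subseteq> F0"
  shows "alt_sum (us @ f # g # vs) = - alt_sum (us @ g # f # vs)"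
  using assms
proof (induction us)
  case Nil
  then have fg: "f \<in> F0" "g \<in> F0" by auto
  have arrange: "p - (q - - t) = - (q - (p - t))" for p q t :: "'v::real_vector" by simp
  show ?case
    unfolding append_Nil alt_sum.simps d_prod_simps wedge_diff_right wedge_F0_commute[OF fg(1)] wedge_F0_commute[OF fg(2)]
      wedge_forms1_anticommute[OF d_F0[OF fg(1)] d_F0[OF fg(2)]] by (rule arrange)
next
  case (Cons u us)
  then have IH: "alt_sum (us @ f # g # vs) = - alt_sum (us @ g # f # vs)" by simp
  have D: "d_prod (us @ f # g # vs) = - d_prod (us @ g # f # vs)" using Cons.prems by (intro d_prod_swap) auto
  have arrange: "- p - - q = - (p - q)" for p q :: "'v::real_vector" by simp
  show ?case unfolding append_Cons alt_sum.simps IH D wedge_minus_right by (rule arrange)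
qed

lemma alt_sum_zero: "0 \<in> set fs \<Longrightarrow> d_prod fs = 0 \<and> alt_sum fs = 0"
proof (induction fs)
  case (Cons f fs)
  have z: "0 - 0 = (0::'v::real_vector)" by simp
  show ?case
  proof (cases "f = 0")
    case True
    show ?thesis unfolding True alt_sum.simps d_prod_simps d_zero wedge_zero_left z by (intro conjI refl)
  next
    case False
    then have "0 \<in> set fs" using Cons.prems by (metis set_ConsD)
    then have IH: "d_prod fs = 0" "alt_sum fs = 0" using Cons.IH by blast+
    show ?thesis unfolding alt_sum.simps d_prod_simps IH wedge_zero_right z by (intro conjI refl)
  qed
qed simp

lemma homogeneous_zero: "homogeneous k 0"
  by (simp add: homogeneous_def has_grade_def fun_apply)

lemma homogeneous_diff: "homogeneous k \<alpha> \<Longrightarrow> homogeneous k \<beta> \<Longrightarrow> homogeneous k (\<alpha> - \<beta>)"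
  and homogeneous_add: "homogeneous k \<alpha> \<Longrightarrow> homogeneous k \<beta> \<Longrightarrow> homogeneous k (\<alpha> + \<beta>)"
  and homogeneous_scaleR: "homogeneous k \<alpha> \<Longrightarrow> homogeneous k (r *\<^sub>R \<alpha>)"
  unfolding homogeneous_def has_grade_def by (simp_all add: fun_apply)

lemma homogeneous_sum: "(\<And>i. i \<in> I \<Longrightarrow> homogeneous k (f i)) \<Longrightarrow> homogeneous k (\<Sum>i\<in>I. f i)"
  by (induction I rule: infinite_finite_induct) (auto intro: homogeneous_zero homogeneous_add)

lemma homogeneous_F0: "f \<in> F0 \<Longrightarrow> homogeneous 0 f" and homogeneous_d_F0: "f \<in> F0 \<Longrightarrow> homogeneous 1 (d f)"
  using d_F0[of f] unfolding forms_iff by blast+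

lemma homogeneous_d_prod: "set fs \<subseteq> F0 \<Longrightarrow> homogeneous (length fs) (d_prod fs)"
proof (induction fs)
  case Nil
  then show ?case using homogeneous_F0[OF one_form_F0] by simp
next
  case (Cons f fs)
  then show ?case using homogeneous_wedge[of 1 "d f" "length fs" "d_prod fs"] homogeneous_d_F0[of f] by simp
qed

lemma homogeneous_alt_sum: "set fs \<subseteq> F0 \<Longrightarrow> homogeneous (length fs - 1) (alt_sum fs)"
proof (induction fs)
  case Nil
  show ?case unfolding alt_sum.simps by (rule homogeneous_zero)
next
  case (Cons f fs)
  then have fs: "f \<in> F0" "set fs \<subseteq> F0" by auto
  have "homogeneous (length fs) (wedge f (d_prod fs))"
    using homogeneous_wedge[OF homogeneous_F0[OF fs(1)] homogeneous_d_prod[OF fs(2)]] by simp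
  moreover have "homogeneous (length fs) (wedge (d f) (alt_sum fs))"
  proof (cases fs)
    case Nil
    then show ?thesis by (simp only: alt_sum.simps wedge_zero_right homogeneous_zero)
  next
    case (Cons a list)
    then show ?thesis
      using homogeneous_wedge[OF homogeneous_d_F0[OF fs(1)] Cons.IH[OF fs(2)]] by simp
  qed
  ultimately show ?case unfolding alt_sum.simps by (simp only: homogeneous_diff list.size add_Suc_right add_0_right diff_Suc_1)
qed

section \<open>The operator \<open>\<Sum>\<^sub>j c\<^sub>k\<^sub>,\<^sub>j L\<^sup>j \<Lambda>\<^sup>j\<close>\<close>

definition L\<Lambda> :: "nat \<Rightarrow> ('a, 'b) form \<Rightarrow> ('a, 'b) form"
  where "L\<Lambda> j \<alpha> = (L ^^ j) ((\<Lambda> ^^ j) \<alpha>)"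

lemma linear_funpow: "linear h \<Longrightarrow> linear (h ^^ j)" for h :: "'v::real_vector \<Rightarrow> 'v"
  by (induction j) (simp_all add: linear_compose linear_id[unfolded id_def] id_def)

lemmas linear_L_pow = linear_funpow[OF linear_lefschetz_L]
  and linear_\<Lambda>_pow = linear_funpow[OF linear_lefschetz_Lambda]

lemma linear_L\<Lambda>: "linear (L\<Lambda> j)"
  using linear_compose[OF linear_\<Lambda>_pow linear_L_pow] by (simp add: L\<Lambda>_def[abs_def] comp_def)

lemma mixed_forms_L_pow: "\<alpha> \<in> T \<Longrightarrow> (L ^^ j) \<alpha> \<in> T"
  by (induction j) (simp_all add: mixed_forms_L)

lemma mixed_forms_\<Lambda>_pow: "\<alpha> \<in> T \<Longrightarrow> (\<Lambda> ^^ j) \<alpha> \<in> T"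
  by (induction j) (simp_all add: mixed_forms_Lambda)

lemma mixed_forms_L\<Lambda>: "\<alpha> \<in> T \<Longrightarrow> L\<Lambda> j \<alpha> \<in> T"
  unfolding L\<Lambda>_def by (intro mixed_forms_L_pow mixed_forms_\<Lambda>_pow)

lemma d_L_pow: "\<alpha> \<in> T \<Longrightarrow> d ((L ^^ j) \<alpha>) = (L ^^ j) (d \<alpha>)"
  by (induction j) (simp_all add: d_L mixed_forms_L_pow)

lemma \<delta>_\<Lambda>_pow: "\<alpha> \<in> T \<Longrightarrow> \<delta> ((\<Lambda> ^^ j) \<alpha>) = (\<Lambda> ^^ j) (\<delta> \<alpha>)"
  by (induction j) (simp_all add: \<Lambda>_\<delta>[symmetric] mixed_forms_\<Lambda>_pow)

lemma \<delta>_L_pow: "\<alpha> \<in> T \<Longrightarrow> \<delta> ((L ^^ j) \<alpha>) = (L ^^ j) (\<delta> \<alpha>) - real j *\<^sub>R (L ^^ (j - 1)) (d \<alpha>)"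
proof (induction j)
  case (Suc j)
  have arrange: "p - r *\<^sub>R q - q = p - (r + 1) *\<^sub>R q" for p q :: "'v::real_vector" and r
    by (simp add: algebra_simps)
  have eq: "real j *\<^sub>R L ((L ^^ (j - 1)) (d \<alpha>)) = real j *\<^sub>R (L ^^ j) (d \<alpha>)"
    by (cases j) simp_all
  have "\<delta> ((L ^^ Suc j) \<alpha>) = L (\<delta> ((L ^^ j) \<alpha>)) - d ((L ^^ j) \<alpha>)"
    unfolding L_\<delta>[OF mixed_forms_L_pow[OF Suc.prems]] by simp
  also have "\<dots> = (L ^^ Suc j) (\<delta> \<alpha>) - real j *\<^sub>R (L ^^ j) (d \<alpha>) - (L ^^ j) (d \<alpha>)"
    unfolding Suc.IH[OF Suc.prems] d_L_pow[OF Suc.prems] linear_diff[OF linear_lefschetz_L]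
      linear_scale[OF linear_lefschetz_L] eq by simp
  also have "\<dots> = (L ^^ Suc j) (\<delta> \<alpha>) - (real j + 1) *\<^sub>R (L ^^ j) (d \<alpha>)"
    by (rule arrange)
  finally show ?case by (simp add: add.commute)
qed simp

lemma d_\<Lambda>_pow: "\<alpha> \<in> T \<Longrightarrow> d ((\<Lambda> ^^ j) \<alpha>) = (\<Lambda> ^^ j) (d \<alpha>) - real j *\<^sub>R (\<Lambda> ^^ (j - 1)) (\<delta> \<alpha>)"
proof (induction j)
  case (Suc j)
  have arrange: "p - r *\<^sub>R q - q = p - (r + 1) *\<^sub>R q" for p q :: "'v::real_vector" and r
    by (simp add: algebra_simps)
  have eq: "real j *\<^sub>R \<Lambda> ((\<Lambda> ^^ (j - 1)) (\<delta> \<alpha>)) = real j *\<^sub>R (\<Lambda> ^^ j) (\<delta> \<alpha>)"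
    by (cases j) simp_all
  have "d ((\<Lambda> ^^ Suc j) \<alpha>) = \<Lambda> (d ((\<Lambda> ^^ j) \<alpha>)) - \<delta> ((\<Lambda> ^^ j) \<alpha>)"
    by (simp add: koszul_delta_def)
  also have "\<dots> = (\<Lambda> ^^ Suc j) (d \<alpha>) - real j *\<^sub>R (\<Lambda> ^^ j) (\<delta> \<alpha>) - (\<Lambda> ^^ j) (\<delta> \<alpha>)"
    unfolding Suc.IH[OF Suc.prems] \<delta>_\<Lambda>_pow[OF Suc.prems] linear_diff[OF linear_lefschetz_Lambda]
      linear_scale[OF linear_lefschetz_Lambda] eq by simp
  also have "\<dots> = (\<Lambda> ^^ Suc j) (d \<alpha>) - (real j + 1) *\<^sub>R (\<Lambda> ^^ j) (\<delta> \<alpha>)"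
    by (rule arrange)
  finally show ?case by (simp add: add.commute)
qed simp

text \<open>From \<open>[L, \<delta>] = d\<close> and \<open>[L, d] = 0\<close> one has \<open>\<delta> L\<^sup>j = L\<^sup>j \<delta> - j L\<^sup>j\<^sup>-\<^sup>1 d\<close>, and from \<open>[\<Lambda>, d] = \<delta>\<close> and \<open>[\<Lambda>, \<delta>] = 0\<close> that
\<open>d \<Lambda>\<^sup>j = \<Lambda>\<^sup>j d - j \<Lambda>\<^sup>j\<^sup>-\<^sup>1 \<delta>\<close>. The square arises because both are applied.\<close>

lemma \<delta>_L\<Lambda>_Suc:
  assumes a: "\<alpha> \<in> T"
  shows "\<delta> (L\<Lambda> (Suc j) \<alpha>) = L\<Lambda> (Suc j) (\<delta> \<alpha>) - real (Suc j) *\<^sub>R L\<Lambda> j (\<Lambda> (d \<alpha>))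
    + (real (Suc j))\<^sup>2 *\<^sub>R L\<Lambda> j (\<delta> \<alpha>)"
proof -
  have arrange: "p - r *\<^sub>R (q - r *\<^sub>R t) = p - r *\<^sub>R q + r\<^sup>2 *\<^sub>R t" for p q t :: "'v::real_vector" and r
    by (simp add: algebra_simps power2_eq_square)
  have "\<delta> (L\<Lambda> (Suc j) \<alpha>) = (L ^^ Suc j) ((\<Lambda> ^^ Suc j) (\<delta> \<alpha>)) -
      real (Suc j) *\<^sub>R (L ^^ j) ((\<Lambda> ^^ Suc j) (d \<alpha>) - real (Suc j) *\<^sub>R (\<Lambda> ^^ j) (\<delta> \<alpha>))"
    unfolding L\<Lambda>_def \<delta>_L_pow[OF mixed_forms_\<Lambda>_pow[OF a]] \<delta>_\<Lambda>_pow[OF a] d_\<Lambda>_pow[OF a] diff_Suc_1 ..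
  also have "\<dots> = (L ^^ Suc j) ((\<Lambda> ^^ Suc j) (\<delta> \<alpha>)) - real (Suc j) *\<^sub>R (L ^^ j) ((\<Lambda> ^^ Suc j) (d \<alpha>)) +
      (real (Suc j))\<^sup>2 *\<^sub>R (L ^^ j) ((\<Lambda> ^^ j) (\<delta> \<alpha>))"
    unfolding linear_diff[OF linear_L_pow] linear_scale[OF linear_L_pow] by (rule arrange)
  also have "(\<Lambda> ^^ Suc j) (d \<alpha>) = (\<Lambda> ^^ j) (\<Lambda> (d \<alpha>))" by (simp add: funpow_swap1)
  finally show ?thesis unfolding L\<Lambda>_def .
qed

lemma \<Lambda>_pow_vanishes: "homogeneous k \<alpha> \<Longrightarrow> k < 2 * j \<Longrightarrow> (\<Lambda> ^^ j) \<alpha> = 0"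
proof (induction j arbitrary: k \<alpha>)
  case (Suc j)
  have swap: "(\<Lambda> ^^ Suc j) \<alpha> = (\<Lambda> ^^ j) (\<Lambda> \<alpha>)" by (simp add: funpow_swap1)
  show ?case
  proof (cases "k < 2")
    case True
    have "\<alpha> c x (e # e' # vs) = 0" for c x e e' and vs :: "'b list"
      using Suc.prems(1)[unfolded homogeneous_def has_grade_def, rule_format, of "e # e' # vs" c x] True by simp
    then have "\<Lambda> \<alpha> = 0" by (intro form_eqI ext) (simp add: lefschetz_Lambda_def fun_apply)
    then show ?thesis unfolding swap by (simp only: linear_0[OF linear_\<Lambda>_pow])
  next
    case False
    then obtain m where "k = Suc (Suc m)" by (metis less_2_cases_iff not0_implies_Suc)
    then show ?thesis unfolding swap using Suc homogeneous_\<Lambda>[of m \<alpha>] by (intro Suc.IH[of m]) auto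
  qed
qed simp

lemma homogeneous_\<delta>:
  assumes "homogeneous (Suc k) \<alpha>"
  shows "homogeneous k (\<delta> \<alpha>)"
proof -
  have d: "homogeneous (Suc j) (d \<beta>)" if "homogeneous j \<beta>" for j \<beta>
    unfolding homogeneous_def
  proof (intro allI)
    fix c x
    show "has_grade (Suc j) (d \<beta> c x)"
    proof (cases "c \<in> A \<and> x \<in> chart_image c")
      case True
      have "has_grade j (\<beta> c y)" for y using that unfolding homogeneous_def by blast
      from has_grade_local_d[OF this] show ?thesis using True by (simp add: ext_d_eq_local_d)
    next
      case False
      then show ?thesis using ext_d_outside[of c A x \<beta>] by (simp add: has_grade_def fun_apply)
    qed
  qed
  have "homogeneous k (d (\<Lambda> \<alpha>))"
  proof (cases k)
    case 0
    then have "\<Lambda> \<alpha> = 0" using \<Lambda>_pow_vanishes[OF assms, of 1] by simp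
    then show ?thesis by (simp add: d_zero homogeneous_zero)
  next
    case (Suc m)
    then show ?thesis using d[OF homogeneous_\<Lambda>[of m \<alpha>]] assms by simp
  qed
  then show ?thesis unfolding koszul_delta_def by (intro homogeneous_diff homogeneous_\<Lambda> d assms)
qed

definition lefschetz_coeff :: "nat \<Rightarrow> nat \<Rightarrow> real"
  where "lefschetz_coeff k j = fact (k - j - 1) / (fact (k - 1) * fact j)"

text \<open>Summing to \<open>k - 1\<close> rather than to \<open>(k - 1) / 2\<close> adds only terms that vanish on \<open>(k - 1)\<close>-forms, by degree, and
makes the summation ranges for \<open>k\<close> and \<open>k - 1\<close> differ by one term.\<close>

definition lefschetz_poly :: "nat \<Rightarrow> ('a, 'b) form \<Rightarrow> ('a, 'b) form"
  where "lefschetz_poly k \<alpha> = (\<Sum>j<k. lefschetz_coeff k j *\<^sub>R L\<Lambda> j \<alpha>)"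

lemma linear_lefschetz_poly: "linear (lefschetz_poly k)"
  unfolding lefschetz_poly_def[abs_def]
  by (intro linear_compose_sum ballI linear_compose_scale_right linear_L\<Lambda>)

lemma mixed_forms_lefschetz_poly: "\<alpha> \<in> T \<Longrightarrow> lefschetz_poly k \<alpha> \<in> T"
  unfolding lefschetz_poly_def by (intro mixed_forms_sum mixed_forms_scaleR mixed_forms_L\<Lambda>)

lemma lefschetz_coeff_recursion:
  assumes "j < m"
  shows "lefschetz_coeff (Suc m) j = real (Suc j) * real (m - j) * lefschetz_coeff (Suc m) (Suc j)"
    and "real (Suc j) * lefschetz_coeff (Suc m) (Suc j) = lefschetz_coeff m j / real m"
proof -
  obtain i where i: "m = Suc (j + i)" using assms less_iff_Suc_add by auto
  have 1: "lefschetz_coeff (Suc m) j = (real (Suc i) * fact i) / (fact m * fact j)"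
    and 2: "lefschetz_coeff (Suc m) (Suc j) = fact i / (fact m * (real (Suc j) * fact j))"
    and 3: "lefschetz_coeff m j = fact i / (fact (j + i) * fact j)"
    and 4: "fact m = real m * fact (j + i)" and 5: "real (m - j) = real (Suc i)"
    by (simp_all add: i lefschetz_coeff_def)
  show "lefschetz_coeff (Suc m) j = real (Suc j) * real (m - j) * lefschetz_coeff (Suc m) (Suc j)"
    unfolding 1 2 5 by (simp del: of_nat_Suc)
  show "real (Suc j) * lefschetz_coeff (Suc m) (Suc j) = lefschetz_coeff m j / real m"
    unfolding 2 3 4 by (simp del: of_nat_Suc)
qed

lemma \<delta>_sum: "finite I \<Longrightarrow> (\<And>i. i \<in> I \<Longrightarrow> f i \<in> T) \<Longrightarrow> \<delta> (\<Sum>i\<in>I. f i) = (\<Sum>i\<in>I. \<delta> (f i))"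
proof (induction rule: finite_induct)
  case empty
  have "\<delta> 0 = 0" using \<delta>_scaleR[OF mixed_forms_zero, of 0] by simp
  then show ?case by (simp only: sum.empty)
next
  case (insert i I)
  have "\<delta> (f i + (\<Sum>i\<in>I. f i)) = \<delta> (f i) + \<delta> (\<Sum>i\<in>I. f i)"
    using insert by (intro \<delta>_add mixed_forms_sum) auto
  moreover have "\<delta> (\<Sum>i\<in>I. f i) = (\<Sum>i\<in>I. \<delta> (f i))" using insert by blast
  ultimately show ?case unfolding sum.insert[OF insert(1,2)] by argo
qed

text \<open>With \<open>\<delta>a = W = R + S\<close> and \<open>\<Lambda>da = (m + 1) R\<close>, moving \<open>\<delta>\<close> to the right and collecting the coefficient of \<open>L\<^sup>j \<Lambda>\<^sup>j\<close>
gives \<open>(c\<^sub>j + (j + 1)\<^sup>2 c\<^sub>j\<^sub>+\<^sub>1) W - (j + 1) (m + 1) c\<^sub>j\<^sub>+\<^sub>1 R\<close>, where \<open>c\<^sub>j\<close> stands for \<open>lefschetz_coeff (m + 1) j\<close>. By the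
recursion \<open>c\<^sub>j = (j + 1) (m - j) c\<^sub>j\<^sub>+\<^sub>1\<close> the first factor equals \<open>(j + 1) (m + 1) c\<^sub>j\<^sub>+\<^sub>1\<close>, so that \<open>R\<close> cancels.\<close>

lemma \<delta>_lefschetz_poly_alt_sum:
  assumes fs: "set fs \<subseteq> F0" "length fs = Suc m" "m \<ge> 1"
  shows "\<delta> (lefschetz_poly (Suc m) (alt_sum fs)) =
    (real (Suc m) / real m) *\<^sub>R lefschetz_poly m (pair_sum (\<lambda>f g r. alt_sum (poisson_bracket f g # r)) fs)"
proof -
  let ?x = "alt_sum fs" and ?D = "d_prod fs" and ?N = "real (Suc m)" and ?c = "lefschetz_coeff (Suc m)"
  define R where "R = \<Lambda> ?D"
  define S where "S = pair_sum (\<lambda>f g r. alt_sum (poisson_bracket f g # r)) fs"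
  define W where "W = R + S"
  have x: "?x \<in> T" by (rule alt_sum_T[OF fs(1)])
  have \<delta>x: "\<delta> ?x = W" unfolding W_def R_def S_def by (rule \<delta>_alt_sum[OF fs(1)])
  have dx: "\<Lambda> (d ?x) = ?N *\<^sub>R R"
    unfolding d_alt_sum[OF fs(1)] fs(2) R_def by (rule linear_scale[OF linear_lefschetz_Lambda])
  obtain m' where m': "m = Suc m'" using fs(3) by (metis Suc_le_D One_nat_def)
  \<comment> \<open>\<open>W\<close> has degree \<open>m - 1\<close>, which is less than \<open>2m\<close>.\<close>
  have top: "L\<Lambda> m W = 0"
  proof -
    have "homogeneous (Suc m') ?x" using homogeneous_alt_sum[OF fs(1)] fs(2) m' by simp
    from homogeneous_\<delta>[OF this] have "homogeneous m' W" unfolding \<delta>x .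
    then have "(\<Lambda> ^^ m) W = 0" by (rule \<Lambda>_pow_vanishes) (simp add: m')
    then show ?thesis unfolding L\<Lambda>_def by (simp only: linear_0[OF linear_L_pow])
  qed
  have step: "?c (Suc j) *\<^sub>R \<delta> (L\<Lambda> (Suc j) ?x) = ?c (Suc j) *\<^sub>R L\<Lambda> (Suc j) W -
      (?c (Suc j) * real (Suc j) * ?N) *\<^sub>R L\<Lambda> j R + (?c (Suc j) * (real (Suc j))\<^sup>2) *\<^sub>R L\<Lambda> j W" for j
    unfolding \<delta>_L\<Lambda>_Suc[OF x] \<delta>x dx linear_scale[OF linear_L\<Lambda>]
    by (simp only: scaleR_add_right scaleR_diff_right scaleR_scaleR mult.assoc)
  have arrange: "a *\<^sub>R (p + q) - (b *\<^sub>R p) + e *\<^sub>R (p + q) = b *\<^sub>R q" if "a + e = b" for p q :: "'v::real_vector" and a b e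
    unfolding that[symmetric] by (simp add: algebra_simps)
  have "\<delta> (lefschetz_poly (Suc m) ?x) = (\<Sum>j<Suc m. ?c j *\<^sub>R \<delta> (L\<Lambda> j ?x))"
    unfolding lefschetz_poly_def
    by (rule trans[OF \<delta>_sum sum.cong[OF refl \<delta>_scaleR]])
      (simp_all only: finite_lessThan mixed_forms_scaleR mixed_forms_L\<Lambda> x)
  also have "\<dots> = ?c 0 *\<^sub>R L\<Lambda> 0 W + (\<Sum>j<m. ?c (Suc j) *\<^sub>R L\<Lambda> (Suc j) W -
      (?c (Suc j) * real (Suc j) * ?N) *\<^sub>R L\<Lambda> j R + (?c (Suc j) * (real (Suc j))\<^sup>2) *\<^sub>R L\<Lambda> j W)"
  proof -
    have "\<delta> (L\<Lambda> 0 ?x) = L\<Lambda> 0 W" unfolding L\<Lambda>_def by (simp add: \<delta>x)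
    then show ?thesis unfolding sum.lessThan_Suc_shift step by simp
  qed
  also have "\<dots> = (?c 0 *\<^sub>R L\<Lambda> 0 W + (\<Sum>j<m. ?c (Suc j) *\<^sub>R L\<Lambda> (Suc j) W)) -
      (\<Sum>j<m. (?c (Suc j) * real (Suc j) * ?N) *\<^sub>R L\<Lambda> j R) + (\<Sum>j<m. (?c (Suc j) * (real (Suc j))\<^sup>2) *\<^sub>R L\<Lambda> j W)"
  proof -
    have "a + (b - p + q) = a + b - p + q" for a b p q :: "'v::real_vector" by simp
    then show ?thesis unfolding sum.distrib sum_subtractf .
  qed
  also have "?c 0 *\<^sub>R L\<Lambda> 0 W + (\<Sum>j<m. ?c (Suc j) *\<^sub>R L\<Lambda> (Suc j) W) = (\<Sum>j<m. ?c j *\<^sub>R L\<Lambda> j W)"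
    unfolding sum.lessThan_Suc_shift[symmetric, of "\<lambda>j. ?c j *\<^sub>R L\<Lambda> j W"] sum.lessThan_Suc top by simp
  also have "(\<Sum>j<m. ?c j *\<^sub>R L\<Lambda> j W) - (\<Sum>j<m. (?c (Suc j) * real (Suc j) * ?N) *\<^sub>R L\<Lambda> j R) +
      (\<Sum>j<m. (?c (Suc j) * (real (Suc j))\<^sup>2) *\<^sub>R L\<Lambda> j W) =
      (\<Sum>j<m. ?c j *\<^sub>R L\<Lambda> j W - (?c (Suc j) * real (Suc j) * ?N) *\<^sub>R L\<Lambda> j R + (?c (Suc j) * (real (Suc j))\<^sup>2) *\<^sub>R L\<Lambda> j W)"
    unfolding sum.distrib sum_subtractf ..
  also have "\<dots> = (\<Sum>j<m. (?N / real m * lefschetz_coeff m j) *\<^sub>R L\<Lambda> j S)"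
  proof (rule sum.cong, rule refl)
    fix j assume "j \<in> {..<m}"
    then have j: "j < m" by simp
    have "real (m - j) = real m - real j" using j by simp
    then have "?c j + ?c (Suc j) * (real (Suc j))\<^sup>2 = ?c (Suc j) * real (Suc j) * ?N"
      unfolding lefschetz_coeff_recursion(1)[OF j] by (simp add: algebra_simps power2_eq_square)
    moreover have "?c (Suc j) * real (Suc j) * ?N = ?N / real m * lefschetz_coeff m j"
      using lefschetz_coeff_recursion(2)[OF j] by (simp add: mult.commute)
    ultimately show "?c j *\<^sub>R L\<Lambda> j W - (?c (Suc j) * real (Suc j) * ?N) *\<^sub>R L\<Lambda> j R +
        (?c (Suc j) * (real (Suc j))\<^sup>2) *\<^sub>R L\<Lambda> j W = (?N / real m * lefschetz_coeff m j) *\<^sub>R L\<Lambda> j S"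
      unfolding W_def linear_add[OF linear_L\<Lambda>] by (metis arrange)
  qed
  also have "\<dots> = (?N / real m) *\<^sub>R lefschetz_poly m S"
    unfolding lefschetz_poly_def scaleR_sum_right scaleR_scaleR ..
  finally show ?thesis unfolding S_def .
qed

end

section \<open>The higher brackets of functions\<close>

lemma koszul_sign_even:
  assumes "\<And>d. d \<in> set ds \<Longrightarrow> d = 0" "\<sigma> permutes {..<length ds}"
  shows "koszul_sign \<sigma> ds = 1"
  unfolding koszul_sign_def
proof (rule prod.neutral, safe)
  fix r s assume "r < s" "s < length ds"
  then have "\<sigma> r < length ds" using permutes_in_image[OF assms(2), of r] by simp
  then have "ds ! \<sigma> r = 0" using assms(1) by simp
  then show "(if odd (ds ! \<sigma> r) \<and> odd (ds ! \<sigma> s) then - 1 else 1) = (1::int)" by simp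
qed

lemma koszul_sign_id: "koszul_sign id ds = 1"
  unfolding koszul_sign_def by (rule prod.neutral) auto

lemma permutes_lessThan_1: "\<sigma> permutes {..<Suc 0} \<Longrightarrow> \<sigma> = id"
  using permutes_doubleton_iff[of \<sigma> 0 0] by (simp add: lessThan_Suc)

lemma sum_list_all_zero: "(\<forall>e\<in>set ds. e = 0) \<Longrightarrow> sum_list ds = (0 :: int)"
  by (induction ds) auto

context symplectic_atlas
begin

lemma homogeneous_L: "homogeneous k \<alpha> \<Longrightarrow> homogeneous (k + 2) (L \<alpha>)"
  unfolding lefschetz_L_def using homogeneous_wedge[OF \<omega>_homogeneous, of k \<alpha>] by (simp add: add.commute)

lemma homogeneous_L_pow: "homogeneous k \<alpha> \<Longrightarrow> homogeneous (k + 2 * j) ((L ^^ j) \<alpha>)"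
proof (induction j)
  case (Suc j)
  then show ?case using homogeneous_L[of "k + 2 * j" "(L ^^ j) \<alpha>"] by simp
qed simp

lemma homogeneous_\<Lambda>_pow: "homogeneous (k + 2 * j) \<alpha> \<Longrightarrow> homogeneous k ((\<Lambda> ^^ j) \<alpha>)"
proof (induction j arbitrary: \<alpha>)
  case (Suc j)
  then show ?case using homogeneous_\<Lambda>[of "k + 2 * j" \<alpha>] by (simp add: funpow_swap1)
qed simp

lemma homogeneous_L\<Lambda>:
  assumes "homogeneous k \<alpha>"
  shows "homogeneous k (L\<Lambda> j \<alpha>)"
proof (cases "2 * j \<le> k")
  case True
  then obtain r where "k = r + 2 * j" by (metis add.commute le_add_diff_inverse)
  then show ?thesis using assms unfolding L\<Lambda>_def by (simp add: homogeneous_L_pow homogeneous_\<Lambda>_pow)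
next
  case False
  then have "(\<Lambda> ^^ j) \<alpha> = 0" by (intro \<Lambda>_pow_vanishes[OF assms]) simp
  then show ?thesis unfolding L\<Lambda>_def by (simp only: linear_0[OF linear_L_pow] homogeneous_zero)
qed

lemma forms_above_dim:
  assumes "\<alpha> \<in> forms A k" "k > DIM('b)"
  shows "\<alpha> = 0"
proof (intro form_eqI ext)
  fix c x and vs :: "'b list"
  have "\<alpha> \<in> T" "has_grade k (\<alpha> c x)" using assms(1) unfolding forms_iff homogeneous_def by blast+
  then show "\<alpha> c x vs = 0 c x vs"
    using alternating_vanishes_above_dim[OF mixed_forms_alternating, of \<alpha> A vs c x] assms(2)
    by (cases "length vs = k") (auto simp: has_grade_def fun_apply)
qed

lemma zero_forms: "0 \<in> forms A k"
  using mixed_forms_zero homogeneous_zero by (simp add: forms_iff)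

text \<open>The operation \<open>l\<^sub>k\<close> as a function of \<open>f\<^sub>i = \<delta>\<alpha>\<^sub>i\<close>, on which alone it depends.\<close>

definition bracket :: "('a, 'b) form list \<Rightarrow> ('a, 'b) form"
  where "bracket fs = (- 1) ^ length fs *\<^sub>R lefschetz_poly (length fs) ((1 / real (length fs)) *\<^sub>R alt_sum fs)"

lemma bracket_forms: "set fs \<subseteq> F0 \<Longrightarrow> bracket fs \<in> forms A (length fs - 1)"
  unfolding forms_iff bracket_def lefschetz_poly_def
  by (intro conjI mixed_forms_scaleR mixed_forms_sum mixed_forms_L\<Lambda> alt_sum_T homogeneous_scaleR homogeneous_sum
      homogeneous_L\<Lambda> homogeneous_alt_sum)

lemma symp_higher_bracket_eq_bracket:
  assumes fs: "set (map \<delta> \<alpha>s) \<subseteq> F0"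
  shows "symp_higher_bracket A \<omega> \<alpha>s = bracket (map \<delta> \<alpha>s)"
proof (cases "\<alpha>s = []")
  case True
  show ?thesis
    unfolding True symp_higher_bracket_def bracket_def alt_m_def Let_def lefschetz_poly_def
    by (simp add: linear_0[OF linear_lefschetz_Lambda])
next
  case False
  let ?k = "length \<alpha>s" and ?x = "(1 / real (length \<alpha>s)) *\<^sub>R alt_sum (map \<delta> \<alpha>s)"
  have x: "homogeneous (?k - 1) ?x"
    using homogeneous_scaleR[OF homogeneous_alt_sum[OF fs]] by simp
  have "(\<Sum>j = 0..(?k - 1) div 2. lefschetz_coeff ?k j *\<^sub>R L\<Lambda> j ?x) = (\<Sum>j<?k. lefschetz_coeff ?k j *\<^sub>R L\<Lambda> j ?x)"
  proof (rule sum.mono_neutral_left)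
    show "{0..(?k - 1) div 2} \<subseteq> {..<?k}" using False by (cases \<alpha>s) auto
    \<comment> \<open>The additional terms apply \<open>\<Lambda>\<close> more often than the degree allows.\<close>
    show "\<forall>j\<in>{..<?k} - {0..(?k - 1) div 2}. lefschetz_coeff ?k j *\<^sub>R L\<Lambda> j ?x = 0"
    proof
      fix j assume "j \<in> {..<?k} - {0..(?k - 1) div 2}"
      then have "?k - 1 < 2 * j" by auto
      from \<Lambda>_pow_vanishes[OF x this] have "L\<Lambda> j ?x = 0"
        unfolding L\<Lambda>_def by (simp only: linear_0[OF linear_L_pow])
      then show "lefschetz_coeff ?k j *\<^sub>R L\<Lambda> j ?x = 0" by (simp only: scaleR_zero_right)
    qed
  qed simp
  then show ?thesis
    unfolding symp_higher_bracket_def bracket_def Let_def lefschetz_poly_def alt_m_eq_alt_sum[OF fs] length_map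
    by (simp only: L\<Lambda>_def lefschetz_coeff_def)
qed

lemma bracket_zero: "0 \<in> set fs \<Longrightarrow> bracket fs = 0"
  unfolding bracket_def using alt_sum_zero[of fs] linear_0[OF linear_lefschetz_poly] by simp

lemma bracket_linear:
  assumes "set fs \<subseteq> F0" "i < length fs" "f \<in> F0" "g \<in> F0"
  shows "bracket (fs[i := r *\<^sub>R f + s *\<^sub>R g]) = r *\<^sub>R bracket (fs[i := f]) + s *\<^sub>R bracket (fs[i := g])"
proof -
  have arrange: "a *\<^sub>R (b *\<^sub>R (r *\<^sub>R p + s *\<^sub>R q)) = r *\<^sub>R a *\<^sub>R b *\<^sub>R p + s *\<^sub>R a *\<^sub>R b *\<^sub>R q" for a b and p q :: "'v::real_vector"
    by (simp add: algebra_simps)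
  show ?thesis
    unfolding bracket_def alt_sum_linear[OF assms] length_list_update linear_add[OF linear_lefschetz_poly]
      linear_scale[OF linear_lefschetz_poly] by (rule arrange)
qed

lemma bracket_permute:
  assumes "set fs \<subseteq> F0" "\<sigma> permutes {..<length fs}"
  shows "bracket (permute_list \<sigma> fs) = real_of_int (sign \<sigma>) *\<^sub>R bracket fs"
proof -
  have "alt_sum (permute_list \<sigma> fs) = real_of_int (sign \<sigma>) *\<^sub>R alt_sum fs"
    by (rule adjacent_swap_imp_sign[where \<Phi> = alt_sum and F = F0, OF alt_sum_swap assms])
  then show ?thesis
    unfolding bracket_def length_permute_list
    by (simp only: linear_scale[OF linear_lefschetz_poly] scaleR_left_commute)
qed

text \<open>The relation between \<open>l\<^sub>1\<close>, \<open>l\<^sub>2\<close>, \<open>l\<^sub>k\<^sub>-\<^sub>1\<close> and \<open>l\<^sub>k\<close>. The factor \<open>k / (k - 1)\<close> of \<open>\<delta>_lefschetz_poly_alt_sum\<close> is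
absorbed by the normalizations \<open>1 / k\<close> and \<open>1 / (k - 1)\<close> of \<open>Alt(m\<^sub>k)\<close> and \<open>Alt(m\<^sub>k\<^sub>-\<^sub>1)\<close>, and the minus sign comes
from the signs \<open>(- 1)\<^sup>k\<close>.\<close>

lemma \<delta>_bracket:
  assumes fs: "set fs \<subseteq> F0" "length fs \<ge> 2"
  shows "\<delta> (bracket fs) = - pair_sum (\<lambda>f g r. bracket (poisson_bracket f g # r)) fs"
proof -
  obtain m where m: "length fs = Suc m" "m \<ge> 1" using fs(2) by (cases "length fs") auto
  let ?S = "pair_sum (\<lambda>f g r. alt_sum (poisson_bracket f g # r)) fs"
  have "bracket fs = ((- 1) ^ Suc m * (1 / real (Suc m))) *\<^sub>R lefschetz_poly (Suc m) (alt_sum fs)"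
    unfolding bracket_def m linear_scale[OF linear_lefschetz_poly] scaleR_scaleR ..
  then have "\<delta> (bracket fs) = ((- 1) ^ Suc m * (1 / real (Suc m))) *\<^sub>R \<delta> (lefschetz_poly (Suc m) (alt_sum fs))"
    by (simp only: \<delta>_scaleR mixed_forms_lefschetz_poly alt_sum_T fs(1))
  also have "\<dots> = ((- 1) ^ Suc m * (1 / real m)) *\<^sub>R lefschetz_poly m ?S"
    unfolding \<delta>_lefschetz_poly_alt_sum[OF fs(1) m] by (simp del: of_nat_Suc)
  also have "lefschetz_poly m ?S = pair_sum (\<lambda>f g r. lefschetz_poly m (alt_sum (poisson_bracket f g # r))) fs"
    by (rule pair_sum_linear[OF linear_lefschetz_poly])
  also have "((- 1) ^ Suc m * (1 / real m)) *\<^sub>R \<dots> =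
      pair_sum (\<lambda>f g r. ((- 1) ^ Suc m * (1 / real m)) *\<^sub>R lefschetz_poly m (alt_sum (poisson_bracket f g # r))) fs"
    by (rule pair_sum_linear[of "(*\<^sub>R) ((- 1) ^ Suc m * (1 / real m))", OF linear_scaleR])
  also have "\<dots> = pair_sum (\<lambda>f g r. - bracket (poisson_bracket f g # r)) fs"
  proof (rule pair_sum_cong[OF fs(1)])
    fix g g' and r :: "('a, 'b) form list" assume "Suc (Suc (length r)) = length fs"
    then have "length (poisson_bracket g g' # r) = m" using m by simp
    then show "((- 1) ^ Suc m * (1 / real m)) *\<^sub>R lefschetz_poly m (alt_sum (poisson_bracket g g' # r)) =
        - bracket (poisson_bracket g g' # r)"
      unfolding bracket_def linear_scale[OF linear_lefschetz_poly] by simp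
  qed
  also have "\<dots> = - pair_sum (\<lambda>f g r. bracket (poisson_bracket f g # r)) fs"
    by (rule pair_sum_linear[of uminus, symmetric]) (simp add: linear_iff)
  finally show ?thesis .
qed

lemma bracket_1: "f \<in> F0 \<Longrightarrow> bracket [f] = - f"
  unfolding bracket_def lefschetz_poly_def alt_sum.simps
  by (simp add: L\<Lambda>_def lefschetz_coeff_def wedge_zero_right wedge_one_form F0_T)

text \<open>The map \<open>\<delta>\<close> takes \<open>l\<^sub>2\<close> to the Poisson bracket of the functions, so that iterated operations are iterated
brackets of functions.\<close>

lemma \<delta>_bracket_2:
  assumes "f \<in> F0" "g \<in> F0"
  shows "\<delta> (bracket [f, g]) = poisson_bracket f g"
proof -
  have "\<delta> (bracket [f, g]) = - bracket [poisson_bracket f g]"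
    using \<delta>_bracket[of "[f, g]"] assms by simp
  then show ?thesis using bracket_1[OF poisson_bracket_F0[OF assms]] by simp
qed

section \<open>The \<open>L\<^sub>\<infinity>\<close>-algebra\<close>

text \<open>It vanishes on all homogeneous elements of nonzero degree, and there \<open>l\<^sub>k\<close> for \<open>k \<ge> 2\<close> vanishes too. So \<open>l\<^sub>k\<close>
is a function of the potentials of its arguments on the whole graded space (\<open>l_eq_bracket\<close>).\<close>

definition potential :: "('a, 'b) form \<Rightarrow> ('a, 'b) form"
  where "potential \<alpha> = \<delta> (degree_part 1 \<alpha>)"

lemma degree_part_eq_reweight: "degree_part k \<alpha> = reweight (\<lambda>j. if j = k then 1 else 0) \<alpha>"
  by (auto simp: degree_part_def reweight_def fun_eq_iff)

lemma mixed_forms_degree_part: "\<alpha> \<in> T \<Longrightarrow> degree_part k \<alpha> \<in> T"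
  unfolding degree_part_eq_reweight by (rule mixed_forms_reweight)

lemma degree_part_homogeneous: "homogeneous j \<alpha> \<Longrightarrow> degree_part k \<alpha> = (if j = k then \<alpha> else 0)"
  unfolding degree_part_eq_reweight by (simp add: reweight_homogeneous)

lemma degree_part_forms: "\<alpha> \<in> T \<Longrightarrow> degree_part k \<alpha> \<in> forms A k"
  unfolding forms_iff homogeneous_def has_grade_def
  by (simp add: mixed_forms_degree_part) (simp add: degree_part_def)

lemma linear_degree_part: "linear (degree_part k)"
  by (rule linearI) (auto simp: degree_part_def fun_eq_iff fun_apply)

lemma \<delta>_forms: "\<alpha> \<in> forms A (Suc k) \<Longrightarrow> \<delta> \<alpha> \<in> forms A k"
  unfolding forms_iff using mixed_forms_\<delta> homogeneous_\<delta> by blast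

lemma potential_F0: "\<alpha> \<in> T \<Longrightarrow> potential \<alpha> \<in> F0"
  unfolding potential_def using \<delta>_forms[of _ 0] degree_part_forms[of \<alpha> 1] by simp

lemma potential_linear: "\<alpha> \<in> T \<Longrightarrow> \<beta> \<in> T \<Longrightarrow> potential (r *\<^sub>R \<alpha> + s *\<^sub>R \<beta>) = r *\<^sub>R potential \<alpha> + s *\<^sub>R potential \<beta>"
  unfolding potential_def linear_add[OF linear_degree_part] linear_scale[OF linear_degree_part]
  by (simp only: \<delta>_add \<delta>_scaleR mixed_forms_degree_part mixed_forms_scaleR)

lemma \<delta>_zero: "\<delta> 0 = 0"
  using \<delta>_scaleR[OF mixed_forms_zero, of 0] by simp

lemma potential_homogeneous: "homogeneous j \<alpha> \<Longrightarrow> potential \<alpha> = (if j = 1 then \<delta> \<alpha> else 0)"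
  unfolding potential_def by (simp add: degree_part_homogeneous \<delta>_zero)

end

locale symplectic_atlas_dim = symplectic_atlas X A \<omega>
  for X :: "'a topology" and A :: "('a, 'b::euclidean_space) chart set" and \<omega> +
  fixes n :: nat
  assumes dim: "DIM('b) = 2 * n"
begin

abbreviation V where "V \<equiv> symp_grading A n"
abbreviation l where "l \<equiv> symp_ops A \<omega> n"

lemma n_pos: "n \<ge> 1"
  using DIM_positive[where 'a = 'b] dim by linarith

lemma l_1: "l 1 [\<alpha>] = \<delta> (\<alpha> - degree_part 1 \<alpha>)"
  by (simp add: symp_ops_def)

text \<open>For \<open>k > 2n + 1\<close>, where \<open>l\<^sub>k = 0\<close>, the bracket is a form of degree above the dimension.\<close>

lemma l_eq_bracket:
  assumes "2 \<le> k" "length xs = k" "set xs \<subseteq> T"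
  shows "l k xs = bracket (map potential xs)"
proof -
  have F: "set (map potential xs) \<subseteq> F0" using assms(3) potential_F0 by auto
  have p: "map \<delta> (map (degree_part 1) xs) = map potential xs" by (simp add: potential_def)
  show ?thesis
  proof (cases "k \<le> 2 * n + 1")
    case True
    then have "l k xs = symp_higher_bracket A \<omega> (map (degree_part 1) xs)"
      using assms(1) by (simp add: symp_ops_def)
    also have "\<dots> = bracket (map potential xs)"
      using symp_higher_bracket_eq_bracket[of "map (degree_part 1) xs"] F unfolding p by blast
    finally show ?thesis .
  next
    case False
    then have "bracket (map potential xs) = 0"
      using assms(2) dim by (intro forms_above_dim[OF bracket_forms[OF F]]) simp
    then show ?thesis using False assms(1) by (simp add: symp_ops_def)
  qed
qed

lemma V_cases:
  assumes "x \<in> V e"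
  obtains "x = 0" | m where "1 \<le> m" "m \<le> 2 * n" "e = 1 - int m" "x \<in> forms A m"
proof (cases "- int (2 * n) < e \<and> e \<le> 0")
  case True
  then show ?thesis using assms by (intro that(2)[of "nat (1 - e)"]) (auto simp: symp_grading_def)
next
  case False
  then show ?thesis using assms by (intro that(1)) (auto simp: symp_grading_def)
qed

lemma V_I: "1 \<le> m \<Longrightarrow> m \<le> 2 * n \<Longrightarrow> x \<in> forms A m \<Longrightarrow> x \<in> V (1 - int m)"
  by (simp add: symp_grading_def)

lemma V_T: "x \<in> V e \<Longrightarrow> x \<in> T"
  by (erule V_cases) (auto simp: mixed_forms_zero forms_iff)

lemma V_0: "V 0 = forms A 1"
  using n_pos by (simp add: symp_grading_def)

lemma V_minus_1: "V (- 1) = forms A 2"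
  using n_pos by (simp add: symp_grading_def)

lemma subspace_forms: "subspace (forms A k)"
  unfolding subspace_def
  by (auto simp: forms_iff mixed_forms_zero mixed_forms_add mixed_forms_scaleR homogeneous_zero homogeneous_add homogeneous_scaleR)

lemma subspace_V: "subspace (V e)"
  by (simp add: symp_grading_def subspace_forms subspace_single_0)

lemma total_space_T: "total_space V \<subseteq> T"
  unfolding total_space_def by (rule span_minimal) (auto simp: V_T subspace_mixed_forms)

lemma homogeneous_list_T: "homogeneous_list V ds xs \<Longrightarrow> set xs \<subseteq> T"
  unfolding homogeneous_list_def list_all2_conv_all_nth by (metis V_T in_set_conv_nth subsetI)

lemma potential_V:
  assumes "x \<in> V e" "e \<noteq> 0"
  shows "potential x = 0"
  using assms(1)
proof (cases rule: V_cases)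
  case 1
  show ?thesis unfolding 1 by (simp add: potential_homogeneous[OF homogeneous_zero, of 0])
next
  case (2 m)
  then show ?thesis using assms(2) potential_homogeneous[of m x] by (simp add: forms_iff)
qed

text \<open>For arguments of degree \<open>0\<close> the Koszul signs are trivial and the degrees are as required. In the second
case all brackets vanish.\<close>

lemma homogeneous_list_cases:
  assumes "homogeneous_list V ds xs"
  shows "(\<forall>e\<in>set ds. e = 0) \<or> 0 \<in> set (map potential xs)"
proof (rule disjCI)
  assume "0 \<notin> set (map potential xs)"
  then show "\<forall>e\<in>set ds. e = 0"
    using assms potential_V unfolding homogeneous_list_def list_all2_conv_all_nth
    by (metis in_set_conv_nth image_eqI list.set_map)
qed

lemma l_1_V:
  assumes "x \<in> V e"
  shows "l 1 [x] \<in> V (e + 1)" "potential (l 1 [x]) = 0" "l 1 [l 1 [x]] = 0"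
proof -
  have z: "l 1 [0] = 0" unfolding l_1 by (simp add: linear_0[OF linear_degree_part] \<delta>_zero)
  have pz: "potential 0 = 0" by (simp add: potential_homogeneous[OF homogeneous_zero, of 0])
  have "l 1 [x] \<in> V (e + 1) \<and> potential (l 1 [x]) = 0 \<and> l 1 [l 1 [x]] = 0"
    using assms
  proof (cases rule: V_cases)
    case 1
    show ?thesis unfolding 1 z by (simp add: pz subspace_0[OF subspace_V])
  next
    case (2 m)
    have hx: "homogeneous m x" "x \<in> T" using 2 by (simp_all add: forms_iff)
    show ?thesis
    proof (cases "m = 1")
      case True
      then have "l 1 [x] = 0" unfolding l_1 degree_part_homogeneous[OF hx(1)] by (simp add: \<delta>_zero)
      then show ?thesis using z by (simp add: pz subspace_0[OF subspace_V])
    next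
      case False
      then obtain j where j: "m = Suc (Suc j)" using 2 by (cases m; cases "m - 1") auto
      have lx: "l 1 [x] = \<delta> x" unfolding l_1 degree_part_homogeneous[OF hx(1)] using False by simp
      have f: "\<delta> x \<in> forms A (Suc j)" using \<delta>_forms 2 j by simp
      then have h: "homogeneous (Suc j) (\<delta> x)" by (simp add: forms_iff)
      have "\<delta> x \<in> V (e + 1)" using V_I[OF _ _ f] 2 j by simp
      moreover have "potential (\<delta> x) = 0"
        unfolding potential_homogeneous[OF h] by (simp add: \<delta>_\<delta> hx)
      moreover have "l 1 [\<delta> x] = 0"
        unfolding l_1 degree_part_homogeneous[OF h] by (simp add: \<delta>_\<delta> hx \<delta>_zero)
      ultimately show ?thesis unfolding lx by simp
    qed
  qed
  then show "l 1 [x] \<in> V (e + 1)" "potential (l 1 [x]) = 0" "l 1 [l 1 [x]] = 0" by simp_all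
qed

lemma multilinear_l:
  assumes "k \<ge> 1"
  shows "multilinear_on (total_space V) k (l k)"
  unfolding multilinear_on_def
proof (intro allI impI, elim conjE)
  fix xs :: "('a, 'b) form list" and i x y and a b :: real
  assume len: "length xs = k" and xs: "set xs \<subseteq> total_space V" and i: "i < k"
    and x: "x \<in> total_space V" and y: "y \<in> total_space V"
  have T: "set xs \<subseteq> T" "x \<in> T" "y \<in> T" using xs x y total_space_T by auto
  show "l k (xs[i := a *\<^sub>R x + b *\<^sub>R y]) = a *\<^sub>R l k (xs[i := x]) + b *\<^sub>R l k (xs[i := y])"
  proof (cases "k = 1")
    case True
    then obtain z where z: "xs = [z]" "i = 0" using len i by (auto simp: length_Suc_conv)
    have arrange: "(a *\<^sub>R p + b *\<^sub>R q) - (a *\<^sub>R s + b *\<^sub>R t) = a *\<^sub>R (p - s) + b *\<^sub>R (q - t)" for p q s t :: "'v::real_vector"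
      by (simp add: algebra_simps)
    have "\<delta> ((a *\<^sub>R x + b *\<^sub>R y) - degree_part 1 (a *\<^sub>R x + b *\<^sub>R y)) =
        a *\<^sub>R \<delta> (x - degree_part 1 x) + b *\<^sub>R \<delta> (y - degree_part 1 y)"
      unfolding linear_add[OF linear_degree_part] linear_scale[OF linear_degree_part] arrange
      by (simp only: \<delta>_add \<delta>_scaleR mixed_forms_scaleR mixed_forms_diff mixed_forms_degree_part T)
    then show ?thesis unfolding True z by (simp only: list_update.simps nat.case l_1)
  next
    case False
    then have k: "2 \<le> k" using assms by simp
    have sub: "set (xs[i := w]) \<subseteq> T" if "w \<in> T" for w
      using T(1) that set_update_subset_insert[of xs i w] by auto
    have w: "a *\<^sub>R x + b *\<^sub>R y \<in> T" using T by (intro mixed_forms_add mixed_forms_scaleR)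
    have F: "set (map potential xs) \<subseteq> F0" using T(1) potential_F0 by auto
    have e: "l k (xs[i := w]) = bracket ((map potential xs)[i := potential w])" if "w \<in> T" for w
      using l_eq_bracket[OF k _ sub[OF that]] len by (simp add: map_update)
    show ?thesis
      unfolding e[OF w] e[OF T(2)] e[OF T(3)] potential_linear[OF T(2,3)]
      using len i by (intro bracket_linear F potential_F0 T) simp
  qed
qed

lemma graded_skew_symmetric_l:
  assumes "k \<ge> 1"
  shows "graded_skew_symmetric V k (l k)"
  unfolding graded_skew_symmetric_def
proof (intro allI impI, elim conjE)
  fix ds and xs :: "('a, 'b) form list" and \<sigma>
  assume len: "length xs = k" and h: "homogeneous_list V ds xs" and \<sigma>: "\<sigma> permutes {..<k}"
  have lds: "length ds = k" using h len by (simp add: homogeneous_list_def list_all2_lengthD)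
  show "l k (permute_list \<sigma> xs) = real_of_int (sign \<sigma> * koszul_sign \<sigma> ds) *\<^sub>R l k xs"
  proof (cases "k = 1")
    case True
    then have "\<sigma> = id" using \<sigma> permutes_lessThan_1 by simp
    then show ?thesis by (simp only: permute_list_id sign_id koszul_sign_id mult_1 of_int_1 scaleR_one)
  next
    case False
    then have k: "2 \<le> k" using assms by simp
    have T: "set xs \<subseteq> T" by (rule homogeneous_list_T[OF h])
    have T': "set (permute_list \<sigma> xs) \<subseteq> T" using T \<sigma> len by simp
    have F: "set (map potential xs) \<subseteq> F0" using T potential_F0 by auto
    have "l k (permute_list \<sigma> xs) = bracket (permute_list \<sigma> (map potential xs))"
      using l_eq_bracket[OF k _ T'] \<sigma> len by (simp add: permute_list_map)
    also have "\<dots> = real_of_int (sign \<sigma>) *\<^sub>R bracket (map potential xs)"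
      using F \<sigma> len by (intro bracket_permute) auto
    also have "\<dots> = real_of_int (sign \<sigma> * koszul_sign \<sigma> ds) *\<^sub>R bracket (map potential xs)"
    proof (cases "0 \<in> set (map potential xs)")
      case True
      then show ?thesis by (simp add: bracket_zero)
    next
      case False
      then have "koszul_sign \<sigma> ds = 1"
        using homogeneous_list_cases[OF h] \<sigma> lds by (intro koszul_sign_even) auto
      then show ?thesis by simp
    qed
    finally show ?thesis using l_eq_bracket[OF k len T] by simp
  qed
qed

lemma l_degree:
  assumes k: "k \<ge> 1" and len: "length xs = k" and h: "homogeneous_list V ds xs"
  shows "l k xs \<in> V (sum_list ds + 2 - int k)"
proof (cases "k = 1")
  case True
  then obtain x where x: "xs = [x]" using len by (auto simp: length_Suc_conv)
  then obtain e where e: "ds = [e]" "x \<in> V e" using h by (auto simp: homogeneous_list_def list_all2_Cons2)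
  show ?thesis unfolding True x e(1) using l_1_V(1)[OF e(2)] by (simp add: add.commute)
next
  case False
  then have k2: "2 \<le> k" using k by simp
  have T: "set xs \<subseteq> T" by (rule homogeneous_list_T[OF h])
  have F: "set (map potential xs) \<subseteq> F0" using T potential_F0 by auto
  note eq = l_eq_bracket[OF k2 len T]
  show ?thesis
  proof (cases "0 \<in> set (map potential xs)")
    case True
    then show ?thesis unfolding eq by (simp add: bracket_zero subspace_0[OF subspace_V])
  next
    case False
    then have "sum_list ds = 0" using homogeneous_list_cases[OF h] sum_list_all_zero by blast
    moreover have "bracket (map potential xs) \<in> V (2 - int k)"
    proof (cases "k \<le> 2 * n + 1")
      case True
      have "bracket (map potential xs) \<in> forms A (k - 1)" using bracket_forms[OF F] len by simp
      from V_I[OF _ _ this] show ?thesis using True k2 by (simp add: of_nat_diff)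
    next
      case False
      then have "bracket (map potential xs) = 0"
        using len dim by (intro forms_above_dim[OF bracket_forms[OF F]]) simp
      then show ?thesis by (simp add: subspace_0[OF subspace_V])
    qed
    ultimately show ?thesis unfolding eq by simp
  qed
qed

lemma graded_vector_space_V: "graded_vector_space V"
  unfolding graded_vector_space_def
proof (intro conjI allI impI ballI subspace_V, elim conjE)
  fix D and x :: "int \<Rightarrow> ('a, 'b) form" and e
  assume D: "finite D" and x: "\<forall>d\<in>D. x d \<in> V d" and s: "(\<Sum>d\<in>D. x d) = 0" and e: "e \<in> D"
  show "x e = 0"
  proof (intro form_eqI ext)
    fix c y and vs :: "'b list"
    have other: "x d c y vs = 0" if d: "d \<in> D" "d \<noteq> 1 - int (length vs)" for d
    proof -
      have "x d \<in> V d" using x d by blast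
      then show ?thesis
      proof (cases rule: V_cases)
        case 1
        then show ?thesis by (simp add: fun_apply)
      next
        case (2 m)
        then have "has_grade m (x d c y)" unfolding forms_iff homogeneous_def by blast
        then show ?thesis using d 2 by (auto simp: has_grade_def)
      qed
    qed
    show "x e c y vs = 0 c y vs"
    proof (cases "e = 1 - int (length vs)")
      case False
      then show ?thesis using other[OF e] by (simp add: fun_apply)
    next
      case True
      have "(\<Sum>d\<in>D. x d) c y vs = (\<Sum>d\<in>D. x d c y vs)" by (simp only: sum_fun_apply)
      also have "\<dots> = x e c y vs + (\<Sum>d\<in>D - {e}. x d c y vs)" by (rule sum.remove[OF D e])
      also have "(\<Sum>d\<in>D - {e}. x d c y vs) = 0" using other True by (intro sum.neutral) auto
      finally show ?thesis unfolding s by simp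
    qed
  qed
qed

lemma l_inner:
  assumes "i \<ge> 2" "set ys \<subseteq> T" "length ys = i"
  shows "l i ys \<in> forms A (i - 1)"
proof -
  have "set (map potential ys) \<subseteq> F0" using assms(2) potential_F0 by auto
  then show ?thesis using l_eq_bracket[OF assms(1,3,2)] bracket_forms assms(3) by fastforce
qed

lemma poisson_bracket_zero: "poisson_bracket 0 f = 0" "poisson_bracket f 0 = 0"
  unfolding poisson_bracket_def by (simp_all only: d_zero wedge_zero_left wedge_zero_right linear_0[OF linear_lefschetz_Lambda])

text \<open>The terms of the relation are \<open>t i\<close>, up to sign. Only those with \<open>i = 2\<close> and \<open>i = N\<close> are different from
zero, and for \<open>N \<ge> 3\<close> their sum is zero by \<open>\<delta>_bracket\<close>.\<close>

lemma jacobi_l: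
  assumes N: "N \<ge> 1" and len: "length xs = N" and h: "homogeneous_list V ds xs"
  shows "(\<Sum>i = 1..N. let j = N + 1 - i in
      (- 1) ^ (i * (j + 1)) *\<^sub>R
      (\<Sum>\<sigma> \<in> unshuffles i (N - i).
         of_int (sign \<sigma> * koszul_sign \<sigma> ds) *\<^sub>R
         l j (l i (take i (permute_list \<sigma> xs)) # drop i (permute_list \<sigma> xs)))) = 0"
proof -
  have T: "set xs \<subseteq> T" by (rule homogeneous_list_T[OF h])
  have F: "set (map potential xs) \<subseteq> F0" using T potential_F0 by auto
  have lds: "length ds = N" using h len by (simp add: homogeneous_list_def list_all2_lengthD)
  have perm: "\<sigma> permutes {..<N}" if "\<sigma> \<in> unshuffles i (N - i)" "i \<le> N" for \<sigma> i
    using that by (simp add: unshuffles_def)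
  have Vnth: "\<exists>e. x \<in> V e" if "x \<in> set xs" for x
    using h that unfolding homogeneous_list_def list_all2_conv_all_nth by (auto simp: in_set_conv_nth)
  have setp: "set (permute_list \<sigma> xs) = set xs" if "\<sigma> permutes {..<N}" for \<sigma>
    using that len by simp
  define t where "t i = (\<Sum>\<sigma> \<in> unshuffles i (N - i). real_of_int (sign \<sigma> * koszul_sign \<sigma> ds) *\<^sub>R
      l (N + 1 - i) (l i (take i (permute_list \<sigma> xs)) # drop i (permute_list \<sigma> xs)))" for i
  have goal: "(\<Sum>i = 1..N. (- 1) ^ (i * (N + 1 - i + 1)) *\<^sub>R t i) = 0 \<Longrightarrow> ?thesis"
    unfolding t_def Let_def .
  have tI: "t i = 0" if "i \<le> N" and "\<And>\<sigma>. \<sigma> permutes {..<N} \<Longrightarrow>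
      l (N + 1 - i) (l i (take i (permute_list \<sigma> xs)) # drop i (permute_list \<sigma> xs)) = 0" for i
    unfolding t_def using that perm by (intro sum.neutral ballI) (simp only: scaleR_zero_right)
  \<comment> \<open>For \<open>i = 1\<close> the first argument of the outer operation has potential \<open>\<delta>\<delta>x = 0\<close>.\<close>
  have t1: "t 1 = 0"
  proof (rule tI)
    show "1 \<le> N" by (rule N)
    fix \<sigma> assume \<sigma>: "\<sigma> permutes {..<N}"
    obtain x ys where p: "permute_list \<sigma> xs = x # ys"
      using len N by (cases "permute_list \<sigma> xs") (auto dest: arg_cong[of _ _ length])
    have x: "x \<in> set xs" "set ys \<subseteq> set xs" using setp[OF \<sigma>] p by auto
    obtain e where e: "x \<in> V e" using Vnth x by blast
    have "length (x # ys) = N" unfolding p[symmetric] using len by simp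
    then have ly: "length ys = N - 1" by simp
    show "l (N + 1 - 1) (l 1 (take 1 (permute_list \<sigma> xs)) # drop 1 (permute_list \<sigma> xs)) = 0"
    proof (cases "N = 1")
      case True
      then show ?thesis using p ly l_1_V(3)[OF e] by simp
    next
      case False
      have "set (l 1 [x] # ys) \<subseteq> T" using V_T[OF l_1_V(1)[OF e]] x T by auto
      then have "l N (l 1 [x] # ys) = bracket (map potential (l 1 [x] # ys))"
        using False N ly by (intro l_eq_bracket) auto
      then show ?thesis using p l_1_V(2)[OF e] by (simp add: bracket_zero)
    qed
  qed
  have inner: "set (take i (permute_list \<sigma> xs)) \<subseteq> T" "set (drop i (permute_list \<sigma> xs)) \<subseteq> T"
    if "\<sigma> permutes {..<N}" for i \<sigma>
    using setp[OF that] T set_take_subset[of i "permute_list \<sigma> xs"] set_drop_subset[of i "permute_list \<sigma> xs"] by auto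
  \<comment> \<open>For \<open>2 < i < N\<close> the inner operation has values of form degree \<open>i - 1 > 1\<close>, whose potential is \<open>0\<close>.\<close>
  have tmid: "t i = 0" if i: "2 < i" "i < N" for i
  proof (rule tI)
    show "i \<le> N" using i by simp
    fix \<sigma> assume \<sigma>: "\<sigma> permutes {..<N}"
    let ?y = "l i (take i (permute_list \<sigma> xs))"
    have y: "?y \<in> forms A (i - 1)" using i len by (intro l_inner inner[OF \<sigma>]) auto
    have p: "potential ?y = 0" using potential_homogeneous[of "i - 1" ?y] y i by (simp add: forms_iff)
    have "l (N + 1 - i) (?y # drop i (permute_list \<sigma> xs)) = bracket (map potential (?y # drop i (permute_list \<sigma> xs)))"
      using i len y inner(2)[OF \<sigma>] by (intro l_eq_bracket) (auto simp: forms_iff)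
    then show "l (N + 1 - i) (?y # drop i (permute_list \<sigma> xs)) = 0"
      using p by (simp add: bracket_zero)
  qed
  \<comment> \<open>For \<open>N = 2\<close> the inner value is a one-form, and \<open>l\<^sub>1\<close> is zero on \<open>L\<^sub>0\<close>.\<close>
  have l1_inner: "l 1 [l N xs] = (if N = 2 then 0 else \<delta> (l N xs))" if "N \<ge> 2"
  proof -
    have y: "homogeneous (N - 1) (l N xs)" using l_inner[OF that T len] by (simp add: forms_iff)
    show ?thesis unfolding l_1 degree_part_homogeneous[OF y] using that by (auto simp: \<delta>_zero)
  qed
  have tN: "t N = l 1 [l N xs]"
    unfolding t_def
    using len by (simp add: unshuffles_0_right)
      (simp only: sign_id[unfolded id_def] sign_id koszul_sign_id[unfolded id_def] koszul_sign_id permute_list_ident permute_list_id take_all order_refl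
        drop_all mult_1 of_int_1 scaleR_one)
  consider "N = 1" | "N = 2" | "N \<ge> 3" using N by linarith
  then show ?thesis
  proof cases
    case 1
    show ?thesis by (rule goal) (simp add: 1 t1[unfolded One_nat_def])
  next
    case 2
    have "{1..2::nat} = {1, 2}" by auto
    then show ?thesis using t1 tN l1_inner by (intro goal) (simp add: 2)
  next
    case 3
    let ?m = "N - 2"
    let ?Y = "\<lambda>\<sigma>. l (N + 1 - 2) (l 2 (take 2 (permute_list \<sigma> xs)) # drop 2 (permute_list \<sigma> xs))"
    let ?G = "\<lambda>u v. bracket (poisson_bracket (u ! 0) (u ! 1) # v)"
    have Y: "?Y \<sigma> = ?G (take 2 (permute_list \<sigma> (map potential xs))) (drop 2 (permute_list \<sigma> (map potential xs)))"
      if \<sigma>: "\<sigma> permutes {..<N}" for \<sigma>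
    proof -
      obtain a b ys where p: "permute_list \<sigma> xs = a # b # ys"
        using 3 len by (metis (no_types, opaque_lifting) One_nat_def Suc_1 Suc_le_length_iff length_permute_list numeral_3_eq_3)
      have ab: "a \<in> T" "b \<in> T" "set ys \<subseteq> T" using setp[OF \<sigma>] p T by auto
      have ly: "Suc (Suc (length ys)) = N" using p len by (metis length_Cons length_permute_list)
      have l2: "l 2 [a, b] = bracket [potential a, potential b]"
        using l_eq_bracket[of 2 "[a, b]"] ab by simp
      have f1: "l 2 [a, b] \<in> forms A 1" using l_inner[of 2 "[a, b]"] ab by simp
      then have "potential (l 2 [a, b]) = \<delta> (l 2 [a, b])"
        using potential_homogeneous[of 1 "l 2 [a, b]"] by (simp add: forms_iff)
      then have pot: "potential (l 2 [a, b]) = poisson_bracket (potential a) (potential b)"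
        unfolding l2 using \<delta>_bracket_2 potential_F0 ab by simp
      have "?Y \<sigma> = l (N + 1 - 2) (l 2 [a, b] # ys)" unfolding p by simp
      also have "\<dots> = bracket (map potential (l 2 [a, b] # ys))"
        using 3 ly ab f1 by (intro l_eq_bracket) (auto simp: forms_iff)
      also have "\<dots> = bracket (poisson_bracket (potential a) (potential b) # map potential ys)"
        unfolding list.map pot ..
      finally show ?thesis using \<sigma> len p by (simp add: permute_list_map)
    qed
    \<comment> \<open>If some potential is zero, the Koszul sign may be nontrivial, but then the term is zero.\<close>
    have summand: "real_of_int (sign \<sigma> * koszul_sign \<sigma> ds) *\<^sub>R ?Y \<sigma> =
        real_of_int (sign \<sigma>) *\<^sub>R ?G (take 2 (permute_list \<sigma> (map potential xs))) (drop 2 (permute_list \<sigma> (map potential xs)))"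
      if s: "\<sigma> \<in> unshuffles 2 ?m" for \<sigma>
    proof -
      have \<sigma>: "\<sigma> permutes {..<N}" using perm[OF s] 3 by simp
      show ?thesis
      proof (cases "0 \<in> set (map potential xs)")
        case False
        then have "koszul_sign \<sigma> ds = 1"
          using homogeneous_list_cases[OF h] \<sigma> lds by (intro koszul_sign_even) auto
        then show ?thesis unfolding Y[OF \<sigma>] by simp
      next
        case True
        obtain f g fs where p: "permute_list \<sigma> (map potential xs) = f # g # fs"
          using 3 len by (metis (no_types, opaque_lifting) One_nat_def Suc_1 Suc_le_length_iff length_map length_permute_list numeral_3_eq_3)
        have "0 \<in> set (f # g # fs)" using True \<sigma> len by (simp flip: p)
        then have "0 \<in> set (poisson_bracket f g # fs)"
          using poisson_bracket_zero by auto
        then have "bracket (poisson_bracket f g # fs) = 0" by (rule bracket_zero)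
        then show ?thesis unfolding Y[OF \<sigma>] p by simp
      qed
    qed
    have "t 2 = shuffle_sum 2 ?m ?G (map potential xs)"
      unfolding t_def shuffle_sum_def by (rule sum.cong[OF refl summand])
    also have "\<dots> = pair_sum (\<lambda>f g r. bracket (poisson_bracket f g # r)) (map potential xs)"
      using shuffle_sum_2_eq_pair_sum[of "map potential xs" ?m ?G] 3 len by (simp add: numeral_2_eq_2)
    also have "\<dots> = - \<delta> (l N xs)"
      using \<delta>_bracket[OF F] l_eq_bracket[OF _ len T] 3 len by simp
    finally have t2: "t 2 = - \<delta> (l N xs)" .
    have tN': "t N = \<delta> (l N xs)" using tN l1_inner 3 by simp
    show ?thesis
    proof (rule goal)
      have "(\<Sum>i = 1..N. (- 1) ^ (i * (N + 1 - i + 1)) *\<^sub>R t i) = (\<Sum>i\<in>{2, N}. (- 1) ^ (i * (N + 1 - i + 1)) *\<^sub>R t i)"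
      proof (rule sum.mono_neutral_right)
        show "\<forall>i\<in>{1..N} - {2, N}. (- 1) ^ (i * (N + 1 - i + 1)) *\<^sub>R t i = 0"
        proof
          fix i assume "i \<in> {1..N} - {2, N}"
          then have "i = 1 \<or> 2 < i \<and> i < N" by auto
          then have "t i = 0" using t1 tmid by blast
          then show "(- 1) ^ (i * (N + 1 - i + 1)) *\<^sub>R t i = 0" by (simp only: scaleR_zero_right)
        qed
      qed (use 3 in auto)
      \<comment> \<open>The exponent \<open>i (j + 1)\<close> is even for \<open>i = 2\<close>, and for \<open>i = N\<close> as \<open>j = 1\<close>.\<close>
      also have "\<dots> = t 2 + t N" using 3 by simp
      also have "\<dots> = 0" unfolding t2 tN' by (rule left_minus)
      finally show "(\<Sum>i = 1..N. (- 1) ^ (i * (N + 1 - i + 1)) *\<^sub>R t i) = 0" .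
    qed
  qed
qed

lemma grounded_l: "grounded_L_infinity_algebra V l"
  unfolding grounded_L_infinity_algebra_def L_infinity_algebra_def
proof (intro conjI allI impI graded_vector_space_V multilinear_l graded_skew_symmetric_l)
  fix k :: nat and ds and xs :: "('a, 'b) form list"
  assume "1 \<le> k" "length xs = k \<and> homogeneous_list V ds xs"
  then show "l k xs \<in> V (sum_list ds + 2 - int k)" by (intro l_degree) auto
next
  fix N :: nat and ds and xs :: "('a, 'b) form list"
  assume "1 \<le> N" "length xs = N \<and> homogeneous_list V ds xs"
  then show "(\<Sum>i = 1..N. let j = N + 1 - i in
      (- 1) ^ (i * (j + 1)) *\<^sub>R
      (\<Sum>\<sigma> \<in> unshuffles i (N - i).
         of_int (sign \<sigma> * koszul_sign \<sigma> ds) *\<^sub>R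
         l j (l i (take i (permute_list \<sigma> xs)) # drop i (permute_list \<sigma> xs)))) = 0"
    by (intro jacobi_l) auto
next
  fix e :: int assume "0 < e"
  then show "V e = {0}" by (simp add: symp_grading_def)
next
  fix k :: nat and ds and xs :: "('a, 'b) form list"
  assume k: "1 < k" and a: "length xs = k \<and> homogeneous_list V ds xs \<and> sum_list ds \<noteq> 0"
  then have "0 \<in> set (map potential xs)" using homogeneous_list_cases[of ds xs] sum_list_all_zero by blast
  then show "l k xs = 0"
    using a k l_eq_bracket[of k xs] homogeneous_list_T[of ds xs] by (simp add: bracket_zero)
next
  fix k :: nat and ds and xs :: "('a, 'b) form list"
  assume k: "1 < k" and a: "length xs = k \<and> homogeneous_list V ds xs \<and> (\<exists>\<alpha>\<in>V (- 1). xs ! 0 = l 1 [\<alpha>])"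
  then have "potential (xs ! 0) = 0" using l_1_V(2) by auto
  moreover have "xs ! 0 \<in> set xs" using a k by (intro nth_mem) simp
  ultimately have "0 \<in> set (map potential xs)" by (metis image_eqI list.set_map)
  then show "l k xs = 0"
    using a k l_eq_bracket[of k xs] homogeneous_list_T[of ds xs] by (simp add: bracket_zero)
qed auto

end

context symplectic_atlas
begin

section \<open>One-forms modulo \<open>\<delta>\<Omega>\<^sup>2\<close>\<close>

lemma wedge_F0_right: "f \<in> F0 \<Longrightarrow> \<theta> \<in> T \<Longrightarrow> wedge \<theta> f = wedge f \<theta>"
  using wedge_F0_commute[of f \<theta> one_form] by (simp add: wedge_one_form F0_T)

lemma wedge_F0_forms: "f \<in> F0 \<Longrightarrow> \<theta> \<in> forms A k \<Longrightarrow> wedge f \<theta> \<in> forms A k"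
  using homogeneous_wedge[of 0 f k \<theta>] by (simp add: forms_iff mixed_forms_wedge)

lemma forms_add: "\<alpha> \<in> forms A k \<Longrightarrow> \<beta> \<in> forms A k \<Longrightarrow> \<alpha> + \<beta> \<in> forms A k"
  and forms_scaleR: "\<alpha> \<in> forms A k \<Longrightarrow> r *\<^sub>R \<alpha> \<in> forms A k"
  by (simp_all add: forms_iff mixed_forms_add mixed_forms_scaleR homogeneous_add homogeneous_scaleR)

lemma forms_minus: "\<alpha> \<in> forms A k \<Longrightarrow> - \<alpha> \<in> forms A k"
  using forms_scaleR[of \<alpha> k "- 1"] by simp

text \<open>This is \<open>\<delta>(f dg) = {f, g}\<close>. It identifies the bracket on classes with the Poisson bracket after applying \<open>\<delta>\<close>.\<close>

lemma \<delta>_wedge_d: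
  assumes "f \<in> F0" "g \<in> F0"
  shows "\<delta> (wedge f (d g)) = poisson_bracket f g"
proof -
  have "\<Lambda> (wedge f (d g)) = 0"
    by (rule \<Lambda>_forms1[OF wedge_F0_forms[OF assms(1) d_F0[OF assms(2)]]])
  moreover have "d (wedge f (d g)) = wedge (d f) (d g)"
    unfolding d_wedge_F0[OF assms(1) forms1_T[OF d_F0[OF assms(2)]]] d_d[OF F0_T[OF assms(2)]] wedge_zero_right
    by (rule add_0_right)
  ultimately show ?thesis unfolding koszul_delta_def poisson_bracket_def by (simp add: d_zero)
qed

definition \<delta>_exact :: "('a, 'b) form set"
  where "\<delta>_exact = \<delta> ` forms A 2"

lemma subspace_\<delta>_exact: "subspace \<delta>_exact"
  unfolding subspace_def
proof (intro conjI ballI allI)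
  show "0 \<in> \<delta>_exact" unfolding \<delta>_exact_def using \<delta>_zero zero_forms[of 2] by (metis image_eqI)
next
  fix x y assume "x \<in> \<delta>_exact" "y \<in> \<delta>_exact"
  then obtain a b where ab: "a \<in> forms A 2" "b \<in> forms A 2" "x = \<delta> a" "y = \<delta> b" unfolding \<delta>_exact_def by blast
  then have "x + y = \<delta> (a + b)" by (simp only: \<delta>_add forms_iff)
  then show "x + y \<in> \<delta>_exact" unfolding \<delta>_exact_def using forms_add[OF ab(1,2)] by blast
next
  fix c x assume "x \<in> \<delta>_exact"
  then obtain a where a: "a \<in> forms A 2" "x = \<delta> a" unfolding \<delta>_exact_def by blast
  then have "c *\<^sub>R x = \<delta> (c *\<^sub>R a)" by (simp only: \<delta>_scaleR forms_iff)
  then show "c *\<^sub>R x \<in> \<delta>_exact" unfolding \<delta>_exact_def using forms_scaleR[OF a(1)] by blast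
qed

lemmas \<delta>_exact_add = subspace_add[OF subspace_\<delta>_exact]
  and \<delta>_exact_diff = subspace_diff[OF subspace_\<delta>_exact]
  and \<delta>_exact_scaleR = subspace_scale[OF subspace_\<delta>_exact]
  and \<delta>_exact_minus = subspace_neg[OF subspace_\<delta>_exact]
  and \<delta>_exact_zero = subspace_0[OF subspace_\<delta>_exact]

lemma \<delta>_\<delta>_exact: "x \<in> \<delta>_exact \<Longrightarrow> \<delta> x = 0"
  unfolding \<delta>_exact_def by (auto simp: forms_iff \<delta>_\<delta>)

text \<open>Evaluate \<open>[L, \<delta>] = d\<close> on the function \<open>f\<close>, where \<open>\<delta>f = 0\<close>: this gives \<open>df = - \<delta>(f \<omega>)\<close>.\<close>

lemma d_F0_\<delta>_exact:
  assumes f: "f \<in> F0"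
  shows "d f \<in> \<delta>_exact"
proof -
  have "\<delta> f = 0" unfolding koszul_delta_def \<Lambda>_F0[OF f] \<Lambda>_forms1[OF d_F0[OF f]] by (simp add: d_zero)
  then have "0 = \<delta> (L f) + d f" using L_\<delta>[OF F0_T[OF f]] by (simp add: linear_0[OF linear_lefschetz_L])
  then have "d f = - \<delta> (L f)" by (metis add.commute add_eq_0_iff)
  moreover have "L f \<in> forms A 2"
    using homogeneous_L[OF homogeneous_F0[OF f]] mixed_forms_L[OF F0_T[OF f]] by (simp add: forms_iff numeral_2_eq_2)
  ultimately show ?thesis using \<delta>_exact_minus unfolding \<delta>_exact_def by auto
qed

lemma bracket_2:
  assumes f: "f \<in> F0" and g: "g \<in> F0"
  shows "bracket [f, g] = (1 / 2) *\<^sub>R (wedge f (d g) - wedge g (d f))"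
proof -
  let ?x = "wedge f (d g) - wedge g (d f)"
  have a: "alt_sum [f, g] = ?x"
    unfolding alt_sum.simps d_prod_simps wedge_zero_right wedge_one_form[OF F0_T[OF g]]
      wedge_one_form[OF forms1_T[OF d_F0[OF g]]] diff_zero wedge_F0_right[OF g forms1_T[OF d_F0[OF f]]] ..
  have "\<Lambda> ((1 / 2) *\<^sub>R alt_sum [f, g]) = 0"
    using homogeneous_alt_sum[of "[f, g]"] alt_sum_T[of "[f, g]"] f g
    by (intro \<Lambda>_forms1 forms_scaleR) (simp add: forms_iff)
  then have "L\<Lambda> (Suc 0) ((1 / 2) *\<^sub>R alt_sum [f, g]) = 0"
    unfolding L\<Lambda>_def by (simp add: linear_0[OF linear_lefschetz_L])
  moreover have "L\<Lambda> 0 ((1 / 2) *\<^sub>R alt_sum [f, g]) = (1 / 2) *\<^sub>R alt_sum [f, g]" unfolding L\<Lambda>_def by simp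
  moreover have "bracket [f, g] = lefschetz_coeff 2 0 *\<^sub>R L\<Lambda> 0 ((1 / 2) *\<^sub>R alt_sum [f, g]) +
      lefschetz_coeff 2 (Suc 0) *\<^sub>R L\<Lambda> (Suc 0) ((1 / 2) *\<^sub>R alt_sum [f, g])"
    unfolding bracket_def lefschetz_poly_def by (simp add: numeral_2_eq_2)
  moreover have "lefschetz_coeff 2 0 = 1" by (simp add: lefschetz_coeff_def)
  ultimately show ?thesis unfolding a by (simp only: scaleR_one scaleR_zero_right add_0_right)
qed

lemma product_rule_\<delta>_exact:
  assumes f: "f \<in> F0" and g: "g \<in> F0"
  shows "wedge f (d g) + wedge g (d f) \<in> \<delta>_exact"
proof -
  have "d (wedge f g) = wedge g (d f) + wedge f (d g)"
    unfolding d_wedge_F0[OF f F0_T[OF g]] wedge_F0_right[OF g forms1_T[OF d_F0[OF f]]] ..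
  then show ?thesis using d_F0_\<delta>_exact[OF wedge_F0_forms[OF f g]] by (simp add: add.commute)
qed

text \<open>The bracket is \<open>(f dg - g df) / 2\<close>, and \<open>f dg + g df = d(f g)\<close> is \<open>\<delta>\<close>-exact.\<close>

lemma bracket_2_mod_\<delta>_exact:
  assumes f: "f \<in> F0" and g: "g \<in> F0"
  shows "bracket [f, g] - wedge f (d g) \<in> \<delta>_exact" "bracket [f, g] + wedge g (d f) \<in> \<delta>_exact"
proof -
  have 1: "(1 / 2) *\<^sub>R (p - q) - p = (- 1 / 2) *\<^sub>R (p + q)" and 2: "(1 / 2) *\<^sub>R (p - q) + q = (1 / 2) *\<^sub>R (p + q)"
    for p q :: "'v::real_vector"
  proof -
    have h: "p = (1 / 2) *\<^sub>R p + (1 / 2) *\<^sub>R p" for p :: 'v by (simp flip: scaleR_add_left)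
    have "(1 / 2) *\<^sub>R (p - q) - p = (1 / 2) *\<^sub>R (p - q) - ((1 / 2) *\<^sub>R p + (1 / 2) *\<^sub>R p)" by (subst h[of p]) simp
    then show "(1 / 2) *\<^sub>R (p - q) - p = (- 1 / 2) *\<^sub>R (p + q)" by (simp add: algebra_simps)
    have "(1 / 2) *\<^sub>R (p - q) + q = (1 / 2) *\<^sub>R (p - q) + ((1 / 2) *\<^sub>R q + (1 / 2) *\<^sub>R q)" by (subst h[of q]) simp
    then show "(1 / 2) *\<^sub>R (p - q) + q = (1 / 2) *\<^sub>R (p + q)" by (simp add: algebra_simps)
  qed
  show "bracket [f, g] - wedge f (d g) \<in> \<delta>_exact" "bracket [f, g] + wedge g (d f) \<in> \<delta>_exact"
    unfolding bracket_2[OF f g] 1 2 by (intro \<delta>_exact_scaleR product_rule_\<delta>_exact f g)+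
qed

lemma poisson_bracket_swap: "f \<in> F0 \<Longrightarrow> g \<in> F0 \<Longrightarrow> poisson_bracket f g = - poisson_bracket g f"
proof -
  assume fg: "f \<in> F0" "g \<in> F0"
  have "wedge (d f) (d g) = - wedge (d g) (d f)"
    using wedge_forms1_anticommute[OF d_F0[OF fg(1)] d_F0[OF fg(2)], of one_form]
    by (simp only: wedge_one_form forms1_T d_F0 fg)
  then show ?thesis unfolding poisson_bracket_def by (simp only: linear_neg[OF linear_lefschetz_Lambda])
qed

text \<open>The relation \<open>\<delta>_bracket\<close> of arity three says that a signed sum of the brackets of \<open>{f, g}\<close> with \<open>h\<close> is
\<open>\<delta>\<close>-exact, and modulo \<open>\<delta>\<close>-exact forms the bracket of \<open>{f, g}\<close> with \<open>h\<close> is \<open>- h d{f, g}\<close>.\<close>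

lemma jacobi_mod_\<delta>_exact:
  assumes fgh: "f \<in> F0" "g \<in> F0" "h \<in> F0"
  shows "wedge f (d (poisson_bracket g h)) + wedge g (d (poisson_bracket h f)) + wedge h (d (poisson_bracket f g)) \<in> \<delta>_exact"
proof -
  let ?b1 = "bracket [poisson_bracket f g, h]" and ?b2 = "bracket [poisson_bracket f h, g]"
    and ?b3 = "bracket [poisson_bracket g h, f]"
  have "\<delta> (bracket [f, g, h]) = - (?b1 - (?b2 - 0) + (?b3 - 0 + 0))"
    using \<delta>_bracket[of "[f, g, h]"] fgh by simp
  moreover have "bracket [f, g, h] \<in> forms A 2" using bracket_forms[of "[f, g, h]"] fgh by (simp add: numeral_2_eq_2)
  ultimately have "- (?b1 - (?b2 - 0) + (?b3 - 0 + 0)) \<in> \<delta>_exact" unfolding \<delta>_exact_def by (metis image_eqI)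
  then have e: "?b1 - ?b2 + ?b3 \<in> \<delta>_exact" using \<delta>_exact_minus by (metis minus_minus diff_zero add_0_right)
  have e1: "?b1 + wedge h (d (poisson_bracket f g)) \<in> \<delta>_exact"
    and e2: "?b2 + wedge g (d (poisson_bracket f h)) \<in> \<delta>_exact"
    and e3: "?b3 + wedge f (d (poisson_bracket g h)) \<in> \<delta>_exact"
    by (intro bracket_2_mod_\<delta>_exact(2) poisson_bracket_F0 fgh)+
  have "d (poisson_bracket h f) = d ((- 1) *\<^sub>R poisson_bracket f h)"
    using poisson_bracket_swap[OF fgh(3,1)] by simp
  also have "\<dots> = (- 1) *\<^sub>R d (poisson_bracket f h)"
    by (rule d_scaleR[OF F0_T[OF poisson_bracket_F0[OF fgh(1,3)]]])
  finally have s: "wedge g (d (poisson_bracket h f)) = - wedge g (d (poisson_bracket f h))"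
    by (simp add: wedge_minus_right)
  have arrange: "p + - q + r = (b3 + p) - (b2 + q) + (b1 + r) - (b1 - b2 + b3)" for p q r b1 b2 b3 :: "'v::real_vector"
    by (simp add: algebra_simps)
  show ?thesis
    unfolding s arrange[of _ _ _ ?b3 ?b2 ?b1]
    by (intro \<delta>_exact_add \<delta>_exact_diff e e1 e2 e3)
qed

section \<open>The Lie algebra of classes of one-forms\<close>

abbreviation cls where "cls \<equiv> delta_class A \<omega>"

definition class_bracket :: "('a, 'b) form \<Rightarrow> ('a, 'b) form \<Rightarrow> ('a, 'b) form"
  where "class_bracket \<alpha> \<beta> = wedge (\<delta> \<alpha>) (d (\<delta> \<beta>))"

lemma cls_eq: "\<alpha> \<in> forms A 1 \<Longrightarrow> cls \<alpha> = {\<beta> \<in> forms A 1. \<alpha> - \<beta> \<in> \<delta>_exact}"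
  by (auto simp: delta_class_def delta_rel_def \<delta>_exact_def)

lemma cls_self: "\<alpha> \<in> forms A 1 \<Longrightarrow> \<alpha> \<in> cls \<alpha>"
  by (simp add: cls_eq \<delta>_exact_zero)

lemma cls_eqI:
  assumes ab: "\<alpha> \<in> forms A 1" "\<beta> \<in> forms A 1" and e: "\<alpha> - \<beta> \<in> \<delta>_exact"
  shows "cls \<alpha> = cls \<beta>"
proof -
  have "\<alpha> - \<gamma> \<in> \<delta>_exact \<longleftrightarrow> \<beta> - \<gamma> \<in> \<delta>_exact" for \<gamma>
  proof
    assume "\<alpha> - \<gamma> \<in> \<delta>_exact"
    from \<delta>_exact_diff[OF this e] show "\<beta> - \<gamma> \<in> \<delta>_exact" by (simp only: diff_diff_eq2 diff_add_eq diff_diff_eq add_diff_cancel_left' diff_add_cancel) (simp add: algebra_simps)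
  next
    assume "\<beta> - \<gamma> \<in> \<delta>_exact"
    from \<delta>_exact_add[OF e this] show "\<alpha> - \<gamma> \<in> \<delta>_exact" by simp
  qed
  then show ?thesis unfolding cls_eq[OF ab(1)] cls_eq[OF ab(2)] by blast
qed

text \<open>The operations on classes are unions over all representatives; if the term under the union does not
depend on the representative, one representative suffices.\<close>

lemma UN_cls:
  assumes "\<alpha> \<in> forms A 1" "\<And>\<alpha>'. \<alpha>' \<in> forms A 1 \<Longrightarrow> \<alpha> - \<alpha>' \<in> \<delta>_exact \<Longrightarrow> F \<alpha>' = F \<alpha>"
  shows "(\<Union>\<alpha>'\<in>cls \<alpha>. F \<alpha>') = F \<alpha>"
  using assms(2) cls_self[OF assms(1)] unfolding cls_eq[OF assms(1)] by blast

lemma carrier_eq: "lie_carrier (symp_lie A \<omega>) = cls ` forms A 1"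
  by (auto simp: symp_lie_def quotient_def delta_class_def)

lemma lie_zero_eq: "lie_zero (symp_lie A \<omega>) = cls 0"
  by (simp add: symp_lie_def)

lemma lie_add_cls:
  assumes ab: "\<alpha> \<in> forms A 1" "\<beta> \<in> forms A 1"
  shows "lie_add (symp_lie A \<omega>) (cls \<alpha>) (cls \<beta>) = cls (\<alpha> + \<beta>)"
proof -
  have c: "cls (\<alpha>' + \<beta>') = cls (\<alpha> + \<beta>)"
    if "\<alpha>' \<in> forms A 1" "\<beta>' \<in> forms A 1" "\<alpha> - \<alpha>' \<in> \<delta>_exact" "\<beta> - \<beta>' \<in> \<delta>_exact" for \<alpha>' \<beta>'
  proof (rule cls_eqI[symmetric])
    have "(\<alpha> + \<beta>) - (\<alpha>' + \<beta>') = (\<alpha> - \<alpha>') + (\<beta> - \<beta>')" by (rule add_diff_add)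
    then show "(\<alpha> + \<beta>) - (\<alpha>' + \<beta>') \<in> \<delta>_exact" using \<delta>_exact_add[OF that(3,4)] by (simp only:)
  qed (intro forms_add that ab)+
  have in1: "(\<Union>\<beta>'\<in>cls \<beta>. cls (\<alpha>' + \<beta>')) = cls (\<alpha> + \<beta>)" if a': "\<alpha>' \<in> forms A 1" "\<alpha> - \<alpha>' \<in> \<delta>_exact" for \<alpha>'
  proof -
    have z: "\<beta> - \<beta> \<in> \<delta>_exact" by (simp add: \<delta>_exact_zero)
    show ?thesis
      using UN_cls[OF ab(2), of "\<lambda>\<beta>'. cls (\<alpha>' + \<beta>')"] c[OF a'(1) _ a'(2)] c[OF a'(1) ab(2) a'(2) z] by metis
  qed
  have z: "\<alpha> - \<alpha> \<in> \<delta>_exact" by (simp add: \<delta>_exact_zero)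
  have "(\<Union>\<alpha>'\<in>cls \<alpha>. \<Union>\<beta>'\<in>cls \<beta>. cls (\<alpha>' + \<beta>')) = (\<Union>\<beta>'\<in>cls \<beta>. cls (\<alpha> + \<beta>'))"
    by (rule UN_cls[OF ab(1)]) (simp only: in1 z ab)
  then show ?thesis unfolding in1[OF ab(1) z] by (simp add: symp_lie_def)
qed

lemma lie_scale_cls:
  assumes a: "\<alpha> \<in> forms A 1"
  shows "lie_scale (symp_lie A \<omega>) r (cls \<alpha>) = cls (r *\<^sub>R \<alpha>)"
proof -
  have "(\<Union>\<alpha>'\<in>cls \<alpha>. cls (r *\<^sub>R \<alpha>')) = cls (r *\<^sub>R \<alpha>)"
  proof (rule UN_cls[OF a])
    fix \<alpha>' assume a': "\<alpha>' \<in> forms A 1" "\<alpha> - \<alpha>' \<in> \<delta>_exact"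
    have "r *\<^sub>R \<alpha> - r *\<^sub>R \<alpha>' \<in> \<delta>_exact"
      using \<delta>_exact_scaleR[OF a'(2), of r] by (simp only: scaleR_diff_right)
    then show "cls (r *\<^sub>R \<alpha>') = cls (r *\<^sub>R \<alpha>)" by (intro cls_eqI[symmetric] forms_scaleR a a')
  qed
  then show ?thesis by (simp add: symp_lie_def)
qed

lemma \<delta>_F0: "\<alpha> \<in> forms A 1 \<Longrightarrow> \<delta> \<alpha> \<in> F0"
  using \<delta>_forms[of \<alpha> 0] by simp

lemma class_bracket_forms: "\<alpha> \<in> forms A 1 \<Longrightarrow> \<beta> \<in> forms A 1 \<Longrightarrow> class_bracket \<alpha> \<beta> \<in> forms A 1"
  unfolding class_bracket_def by (intro wedge_F0_forms \<delta>_F0 d_F0)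

lemma \<delta>_eq_if_exact_diff: "\<alpha> \<in> forms A 1 \<Longrightarrow> \<alpha>' \<in> forms A 1 \<Longrightarrow> \<alpha> - \<alpha>' \<in> \<delta>_exact \<Longrightarrow> \<delta> \<alpha>' = \<delta> \<alpha>"
  using \<delta>_\<delta>_exact[of "\<alpha> - \<alpha>'"] \<delta>_diff[of \<alpha> \<alpha>'] forms1_T by simp

lemma lie_bracket_cls:
  assumes ab: "\<alpha> \<in> forms A 1" "\<beta> \<in> forms A 1"
  shows "lie_bracket (symp_lie A \<omega>) (cls \<alpha>) (cls \<beta>) = cls (class_bracket \<alpha> \<beta>)"
proof -
  have "(\<Union>\<beta>'\<in>cls \<beta>. cls (wedge (\<delta> \<alpha>') (d (\<delta> \<beta>')))) = cls (wedge (\<delta> \<alpha>') (d (\<delta> \<beta>)))" for \<alpha>'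
    by (rule UN_cls[OF ab(2)]) (simp only: \<delta>_eq_if_exact_diff[OF ab(2)])
  moreover have "(\<Union>\<alpha>'\<in>cls \<alpha>. cls (wedge (\<delta> \<alpha>') (d (\<delta> \<beta>)))) = cls (wedge (\<delta> \<alpha>) (d (\<delta> \<beta>)))"
    by (rule UN_cls[OF ab(1)]) (simp only: \<delta>_eq_if_exact_diff[OF ab(1)])
  ultimately show ?thesis by (simp add: symp_lie_def class_bracket_def)
qed

lemma class_bracket_linear:
  assumes "\<alpha> \<in> forms A 1" "\<beta> \<in> forms A 1"
  shows "class_bracket (r *\<^sub>R \<alpha> + s *\<^sub>R \<beta>) \<gamma> = r *\<^sub>R class_bracket \<alpha> \<gamma> + s *\<^sub>R class_bracket \<beta> \<gamma>"
    and "class_bracket \<gamma> (r *\<^sub>R \<alpha> + s *\<^sub>R \<beta>) = r *\<^sub>R class_bracket \<gamma> \<alpha> + s *\<^sub>R class_bracket \<gamma> \<beta>"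
proof -
  have "\<delta> (r *\<^sub>R \<alpha> + s *\<^sub>R \<beta>) = r *\<^sub>R \<delta> \<alpha> + s *\<^sub>R \<delta> \<beta>"
    using assms forms1_T by (simp only: \<delta>_add \<delta>_scaleR mixed_forms_scaleR)
  then show "class_bracket (r *\<^sub>R \<alpha> + s *\<^sub>R \<beta>) \<gamma> = r *\<^sub>R class_bracket \<alpha> \<gamma> + s *\<^sub>R class_bracket \<beta> \<gamma>"
    "class_bracket \<gamma> (r *\<^sub>R \<alpha> + s *\<^sub>R \<beta>) = r *\<^sub>R class_bracket \<gamma> \<alpha> + s *\<^sub>R class_bracket \<gamma> \<beta>"
    unfolding class_bracket_def
    by (simp_all only: wedge_add_left wedge_add_right wedge_scaleR_left wedge_scaleR_right
        d_linear_combination \<delta>_F0 assms)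
qed

lemma class_bracket_self: "\<alpha> \<in> forms A 1 \<Longrightarrow> class_bracket \<alpha> \<alpha> \<in> \<delta>_exact"
proof -
  assume a: "\<alpha> \<in> forms A 1"
  have h: "(1 / 2) *\<^sub>R (p + p) = p" for p :: "'v::real_vector" by simp
  from \<delta>_exact_scaleR[OF product_rule_\<delta>_exact[OF \<delta>_F0[OF a] \<delta>_F0[OF a]], of "1 / 2"]
  show ?thesis unfolding h class_bracket_def .
qed

lemma class_bracket_jacobi:
  assumes "\<alpha> \<in> forms A 1" "\<beta> \<in> forms A 1" "\<gamma> \<in> forms A 1"
  shows "class_bracket \<alpha> (class_bracket \<beta> \<gamma>) + class_bracket \<beta> (class_bracket \<gamma> \<alpha>) +
    class_bracket \<gamma> (class_bracket \<alpha> \<beta>) \<in> \<delta>_exact"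
  using jacobi_mod_\<delta>_exact[OF \<delta>_F0[OF assms(1)] \<delta>_F0[OF assms(2)] \<delta>_F0[OF assms(3)]]
  unfolding class_bracket_def by (simp only: \<delta>_wedge_d \<delta>_F0 assms)

lemma cls_\<delta>_exact: "\<alpha> \<in> forms A 1 \<Longrightarrow> \<alpha> \<in> \<delta>_exact \<Longrightarrow> cls \<alpha> = cls 0"
  by (rule cls_eqI) (simp_all add: zero_forms)

lemma real_lie_algebra_symp_lie: "real_lie_algebra (symp_lie A \<omega>)"
proof -
  note closed = zero_forms forms_add forms_scaleR class_bracket_forms
  have inv: "\<exists>y\<in>forms A 1. cls (y + x) = cls 0" if "x \<in> forms A 1" for x
    using that by (intro bexI[of _ "- x"]) (simp_all add: forms_minus)
  show ?thesis
    unfolding real_lie_algebra_def Let_def carrier_eq lie_zero_eq ball_simps bex_simps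
  proof (intro conjI ballI allI)
    show "\<exists>y\<in>forms A 1. lie_add (symp_lie A \<omega>) (cls y) (cls x) = cls 0" if "x \<in> forms A 1" for x
      using inv[OF that] that by (simp add: lie_add_cls cong: bex_cong)
  next
    fix x assume "x \<in> forms A 1"
    then show "lie_bracket (symp_lie A \<omega>) (cls x) (cls x) = cls 0"
      by (simp only: lie_bracket_cls class_bracket_self cls_\<delta>_exact class_bracket_forms)
  next
    fix x y w assume "x \<in> forms A 1" "y \<in> forms A 1" "w \<in> forms A 1"
    then show "lie_add (symp_lie A \<omega>) (lie_add (symp_lie A \<omega>)
        (lie_bracket (symp_lie A \<omega>) (cls x) (lie_bracket (symp_lie A \<omega>) (cls y) (cls w)))
        (lie_bracket (symp_lie A \<omega>) (cls y) (lie_bracket (symp_lie A \<omega>) (cls w) (cls x))))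
        (lie_bracket (symp_lie A \<omega>) (cls w) (lie_bracket (symp_lie A \<omega>) (cls x) (cls y))) = cls 0"
      by (simp only: lie_bracket_cls lie_add_cls class_bracket_jacobi cls_\<delta>_exact closed)
  qed (simp_all only: lie_add_cls lie_scale_cls lie_bracket_cls class_bracket_linear closed imageI
      add_ac add_0_left add_0_right scaleR_add_left scaleR_add_right scaleR_scaleR scaleR_one)
qed

end

context symplectic_atlas_dim
begin

lemma L_infinity_morphism_cls: "L_infinity_morphism_to_lie V l (symp_lie A \<omega>) cls"
  unfolding L_infinity_morphism_to_lie_def V_0 V_minus_1 carrier_eq lie_zero_eq
proof (intro conjI ballI allI grounded_l real_lie_algebra_symp_lie imageI)
  fix a b :: real and x y assume "x \<in> forms A 1" "y \<in> forms A 1"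
  then show "cls (a *\<^sub>R x + b *\<^sub>R y) = lie_add (symp_lie A \<omega>) (lie_scale (symp_lie A \<omega>) a (cls x)) (lie_scale (symp_lie A \<omega>) b (cls y))"
    by (simp only: lie_scale_cls lie_add_cls forms_scaleR)
next
  fix \<alpha> assume a: "\<alpha> \<in> forms A 2"
  then have h: "homogeneous 2 \<alpha>" by (simp add: forms_iff)
  have "l 1 [\<alpha>] = \<delta> \<alpha>" unfolding l_1 degree_part_homogeneous[OF h] by simp
  moreover have "\<delta> \<alpha> \<in> forms A 1" using \<delta>_forms[of \<alpha> 1] a by (simp add: numeral_2_eq_2)
  moreover have "\<delta> \<alpha> \<in> \<delta>_exact" unfolding \<delta>_exact_def using a by blast
  ultimately show "cls (l 1 [\<alpha>]) = cls 0" by (simp only: cls_\<delta>_exact)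
next
  fix x y assume xy: "x \<in> forms A 1" "y \<in> forms A 1"
  have p: "potential z = \<delta> z" if "z \<in> forms A 1" for z
    using potential_homogeneous[of 1 z] that by (simp add: forms_iff)
  have l2: "l 2 [x, y] = bracket [\<delta> x, \<delta> y]"
    using l_eq_bracket[of 2 "[x, y]"] xy p forms1_T by simp
  have "cls (l 2 [x, y]) = cls (class_bracket x y)"
  proof (rule cls_eqI)
    show "l 2 [x, y] \<in> forms A 1" using l_inner[of 2 "[x, y]"] xy forms1_T by simp
    show "l 2 [x, y] - class_bracket x y \<in> \<delta>_exact"
      unfolding l2 class_bracket_def by (rule bracket_2_mod_\<delta>_exact(1)[OF \<delta>_F0[OF xy(1)] \<delta>_F0[OF xy(2)]])
  qed (rule class_bracket_forms[OF xy])
  then show "cls (l 2 [x, y]) = lie_bracket (symp_lie A \<omega>) (cls x) (cls y)"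
    by (simp only: lie_bracket_cls xy)
qed

end

theorem theorem4p7:
  fixes X :: "'a topology"
    and A :: "('a, 'b::euclidean_space) chart set"
    and \<omega> :: "('a, 'b) form"
    and n :: nat
  assumes "symplectic_manifold X A \<omega>"
    and "DIM('b) = 2 * n"
  shows "grounded_L_infinity_algebra (symp_grading A n) (symp_ops A \<omega> n) \<and>
    L_infinity_morphism_to_lie (symp_grading A n) (symp_ops A \<omega> n) (symp_lie A \<omega>)
      (delta_class A \<omega>)"
proof -
  interpret symplectic_atlas_dim X A \<omega> n
    by unfold_locales (rule assms)+
  show ?thesis using grounded_l L_infinity_morphism_cls by blast
qed

end
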